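(* Let $n,m\in\mathbb{N}$, let $\mathcal{V}_{ns}$ be the universal nonsignalling vector space with unit $e$ and generators $\{P(a,b|x,y):x,y\in[n],a,b\in[m]\}$, and let $D_{ns}, D_{qc}, D_{qa}, D_{q(k)}$ ($k\in\mathbb{N}$) be the cones in $\mathcal{V}_{ns}$ defined in the context. Let $\varphi:\mathcal{V}_{ns}\to\mathbb{C}$ be a unital linear functional (i.e. $\varphi(e)=1$) and put $p(a,b|x,y):=\varphi(P(a,b|x,y))$ for all $a,b\in[m]$, $x,y\in[n]$. Writing $\varphi(D)\ge0$ to mean $\varphi(z)\ge0$ for all $z\in D$, the following hold: (1) $p\in C_q(n,m)$ if and only if $\varphi(D_{q(k)})\ge0$ for some $k\in\mathbb{N}$. (2) $p\in C_{qa}(n,m)$ if and only if $\varphi(D_{qa})\ge0$. (3) $p\in C_{qc}(n,m)$ if and only if $\varphi(D_{qc})\ge0$. (4) $p\in C_{ns}(n,m)$ if and only if $\varphi(D_{ns})\ge0$.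
   Context: Notation: $[n]=\{1,\dots,n\}$; $M_{r,s}$ is the space of complex $r\times s$ matrices, $M_r=M_{r,r}$; $J_2$ is the $2\times2$ all-ones matrix; $a\oplus b$ is the diagonal $2\times 2$ matrix with entries $a,b$. Correlations. A correlation with $n$ inputs and $m$ outputs is a tuple $p=\{p(a,b|x,y)\}_{a,b\in[m],x,y\in[n]}$ of nonnegative reals with $\sum_{a,b}p(a,b|x,y)=1$ for all $x,y$. It is nonsignalling ($p\in C_{ns}(n,m)$) if $\sum_dp(a,d|x,w)$ does not depend on $w$ and $\sum_cp(c,b|z,y)$ does not depend on $z$. It is quantum commuting ($p\in C_{qc}(n,m)$) if there are a Hilbert space $H$, C*-algebras $\mathcal{A},\mathcal{B}\subseteq B(H)$ commuting with each other elementwise, projection-valued measures $\{E_{x,a}\}_{a=1}^m\subseteq\mathcal{A}$ and $\{F_{y,b}\}_{b=1}^m\subseteq\mathcal{B}$ for $x,y\in[n]$, and a state $\phi$ on $\mathcal{A}\mathcal{B}$ with $p(a,b|x,y)=\phi(E_{x,a}F_{y,b})$. It is quantum ($p\in C_q(n,m)$) if moreover $H$ can be taken finite-dimensional. $C_{qa}(n,m)=\overline{C_q(n,m)}$. The space $\mathcal{V}_{ns}$. $\mathcal{V}_{ns}$ is the quotient of the complex vector space with basis $e,\{P(a,b|x,y)\}_{a,b\in[m],x,y\in[n]}$ by the subspace generated by the nonsignalling relations $\mathcal R$: $\sum_{a,b}P(a,b|x,y)=e$ for all $x,y$; $\sum_bP(a,b|x,y)=\sum_bP(a,b|x,z)$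 and $\sum_bP(b,a|y,x)=\sum_bP(b,a|z,x)$ for all $a\in[m]$, $x,y,z\in[n]$. The involution fixes $e$ and each $P(a,b|x,y)$. Enumerate the generators $P(a,b|x,y)$ as $p_1,\dots,p_N$, $N=n^2m^2$, and write $p^\perp=e-p$. The cone $E$. $\widetilde{E}=\{r_0e+\sum_{i=1}^Nt_ip_i+\sum_{i=1}^Ns_ip_i^\perp:r_0,t_i,s_i\ge0\}$, $E=\{x\in\mathcal V_{ns}:x=x^*,\ x+\epsilon e\in\widetilde{E}\ \forall\epsilon>0\}$. $D_r^{\max}=\{\alpha^*\operatorname{diag}(s_1,\dots,s_j)\alpha:j\in\mathbb{N},\alpha\in M_{j,r},s_i\in E\}$ and $E_r^{\max}=\{x\in M_r(\mathcal{V}_{ns})_h:x+\epsilon I_r\otimes e\in D_r^{\max}\ \forall\epsilon>0\}$, where $M_r(\mathcal V_{ns})_h$ denotes hermitian elements. The matrix ordering $\mathcal{E}^{\mathrm{proj}}$. For a matrix ordering $\mathcal{C}=\{\mathcal{C}_r\}$ on $\mathcal{V}_{ns}$ (cones $\mathcal{C}_r\subseteq M_r(\mathcal{V}_{ns})_h$ with $\alpha^*\mathcal{C}_r\alpha\subseteq\mathcal{C}_s$ for $\alpha\in M_{r,s}$) and $p$ with $p,p^\perp\in\mathcal{C}_1$, let $x\in\mathcal{C}(p)_r$ iff for every $\epsilon>0$ there is $t>0$ with $x\otimes J_2+\epsilon I_r\otimes(p\oplus p^\perp)+tI_r\otimes(p^\perp\oplus p)\in\mathcal{C}_{2r}$.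 Extend $p_1,\dots,p_N$ to a sequence by $p_j=p_i$ when $j\equiv i\pmod N$. Let $\mathcal{E}^0=E^{\max}$, $\mathcal{E}^{j+1}=\mathcal{E}^j(p_{j+1})$, and let $x\in\mathcal{E}^{\mathrm{proj}}_r$ iff for every $\epsilon>0$ there is $j$ with $x+\epsilon I_r\otimes e\in\mathcal{E}^j_r$. The cone $E^{\mathrm{proj}(k)}$. For a cone $C\subseteq M_k(\mathcal{V}_{ns})_h$, let $C[p]$ be the set of $x\in M_k(\mathcal{V}_{ns})_h$ such that for every $\epsilon>0$ there is $t>0$ with $(\alpha+\beta)^*x(\alpha+\beta)+(\epsilon\alpha^*\alpha+t\beta^*\beta)\otimes p+(\epsilon\beta^*\beta+t\alpha^*\alpha)\otimes p^\perp\in C$ for all $\alpha,\beta\in M_k$. Let $E^0=E_k^{\max}$, $E^j=E^{j-1}[p_j]$ for $j\geq 1$ (with periodic indexing of the $p_j$), and let $E^{\mathrm{proj}(k)}$ be the set of $x\in M_k(\mathcal{V}_{ns})_h$ such that for every $\epsilon>0$ there is $j$ with $x+\epsilon I_k\otimes e\in E^j$. The four families of cones in $\mathcal{V}_{ns}$: $D_{ns}=E$; $D_{qc}=\mathcal{E}^{\mathrm{proj}}_1$; $D_{q(k)}=(E^{\mathrm{proj}(k)})_1$, the first cone of any operator system structure on $\mathcal{V}_{ns}$ whose $k$-th cone is $E^{\mathrm{proj}(k)}$ (it is uniquely determined), e.g. $D_{q(k)}=\{x\in(\mathcal{V}_{ns})_h:\alpha^*x\alpha\in E^{\mathrm{proj}(k)}\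 \forall\alpha\in M_{1,k}\}$; and $D_{qa}=\bigcap_{k=1}^\infty D_{q(k)}$. *)

theory Defs
  imports
    "HOL-Analysis.Analysis"
    "HOL-Library.Function_Algebras"
    "Jordan_Normal_Form.Matrix"
begin

section \<open>Complex function spaces\<close>

definition fscale :: "complex \<Rightarrow> ('a \<Rightarrow> complex) \<Rightarrow> 'a \<Rightarrow> complex" where
  "fscale c f = (\<lambda>i. c * f i)"

global_interpretation fun_vs: vector_space fscale
  by unfold_locales (auto simp: fscale_def fun_eq_iff algebra_simps)


section \<open>Complex Hilbert spaces and operators\<close>

text \<open>
  A Hilbert space is a complex linear subspace \<open>H\<close> of the functions from an index type \<open>'u\<close> to the
  complex numbers, together with an arbitrary complete inner product on \<open>H\<close> (which need not be
  related to the coordinates). Since every complex vector space embeds linearly into such a function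
  space once \<open>'u\<close> is large enough, every Hilbert space arises in this way, up to isomorphism,
  for some \<open>'u\<close>. The inner product is linear in its first argument; its values off \<open>H\<close> are
  irrelevant.
\<close>

definition hnorm :: "('h \<Rightarrow> 'h \<Rightarrow> complex) \<Rightarrow> 'h \<Rightarrow> real" where
  "hnorm ip v = sqrt (Re (ip v v))"

locale hilbert_space =
  fixes H :: "('u \<Rightarrow> complex) set"
    and ip :: "('u \<Rightarrow> complex) \<Rightarrow> ('u \<Rightarrow> complex) \<Rightarrow> complex"
  assumes subspace: "fun_vs.subspace H"
    and ip_add: "\<lbrakk>u \<in> H; v \<in> H; w \<in> H\<rbrakk> \<Longrightarrow> ip (u + v) w = ip u w + ip v w"
    and ip_scale: "\<lbrakk>u \<in> H; v \<in> H\<rbrakk> \<Longrightarrow> ip (fscale c u) v = c * ip u v"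
    and ip_cnj: "\<lbrakk>u \<in> H; v \<in> H\<rbrakk> \<Longrightarrow> ip v u = cnj (ip u v)"
    and ip_pos: "\<lbrakk>u \<in> H; u \<noteq> 0\<rbrakk> \<Longrightarrow> 0 < Re (ip u u)"
    and complete:
      "\<lbrakk>\<And>i. s i \<in> H; \<And>\<epsilon>. 0 < \<epsilon> \<Longrightarrow> \<exists>M. \<forall>i\<ge>M. \<forall>j\<ge>M. hnorm ip (s i - s j) < \<epsilon>\<rbrakk>
        \<Longrightarrow> \<exists>l\<in>H. (\<lambda>i. hnorm ip (s i - l)) \<longlonglongrightarrow> 0"

definition finite_dim :: "('u \<Rightarrow> complex) set \<Rightarrow> bool" where
  "finite_dim H \<longleftrightarrow> (\<exists>B. finite B \<and> H = fun_vs.span B)"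

type_synonym 'u op = "('u \<Rightarrow> complex) \<Rightarrow> 'u \<Rightarrow> complex"

text \<open>
  Operators on \<open>H\<close> are represented by functions that vanish off \<open>H\<close>, so that equality of operators is
  equality of functions, and sum and product are \<open>+\<close> and \<open>\<circ>\<close>.
\<close>

definition bounded_ops ::
    "('u \<Rightarrow> complex) set \<Rightarrow> (('u \<Rightarrow> complex) \<Rightarrow> ('u \<Rightarrow> complex) \<Rightarrow> complex) \<Rightarrow> 'u op set" where
  "bounded_ops H ip = {T.
     (\<forall>v\<in>H. T v \<in> H) \<and> (\<forall>v. v \<notin> H \<longrightarrow> T v = 0) \<and>
     (\<forall>u\<in>H. \<forall>v\<in>H. T (u + v) = T u + T v) \<and>
     (\<forall>c. \<forall>v\<in>H. T (fscale c v) = fscale c (T v)) \<and>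
     (\<exists>K. \<forall>v\<in>H. hnorm ip (T v) \<le> K * hnorm ip v)}"

definition op_id :: "('u \<Rightarrow> complex) set \<Rightarrow> 'u op" where
  "op_id H = (\<lambda>v. if v \<in> H then v else 0)"

definition op_scale :: "complex \<Rightarrow> 'u op \<Rightarrow> 'u op" where
  "op_scale c T = (\<lambda>v. fscale c (T v))"

text \<open>\<open>is_adjoint H ip S T\<close>: the operator \<open>S\<close> is the adjoint of \<open>T\<close>.\<close>

definition is_adjoint ::
    "('u \<Rightarrow> complex) set \<Rightarrow> (('u \<Rightarrow> complex) \<Rightarrow> ('u \<Rightarrow> complex) \<Rightarrow> complex) \<Rightarrow>
     'u op \<Rightarrow> 'u op \<Rightarrow> bool" where
  "is_adjoint H ip S T \<longleftrightarrow> (\<forall>u\<in>H. \<forall>v\<in>H. ip (T u) v = ip u (S v))"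

definition cstar_algebra ::
    "('u \<Rightarrow> complex) set \<Rightarrow> (('u \<Rightarrow> complex) \<Rightarrow> ('u \<Rightarrow> complex) \<Rightarrow> complex) \<Rightarrow>
     'u op set \<Rightarrow> bool" where
  "cstar_algebra H ip A \<longleftrightarrow>
     A \<subseteq> bounded_ops H ip \<and> 0 \<in> A \<and>
     (\<forall>S\<in>A. \<forall>T\<in>A. S + T \<in> A \<and> S \<circ> T \<in> A) \<and>
     (\<forall>c. \<forall>T\<in>A. op_scale c T \<in> A) \<and>
     (\<forall>T\<in>A. \<exists>S\<in>A. is_adjoint H ip S T) \<and>
     (\<forall>T\<in>bounded_ops H ip.
        (\<forall>\<epsilon>>0. \<exists>S\<in>A. \<forall>v\<in>H. hnorm ip (T v - S v) \<le> \<epsilon> * hnorm ip v) \<longrightarrow> T \<in> A)"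

definition cstar_generated ::
    "('u \<Rightarrow> complex) set \<Rightarrow> (('u \<Rightarrow> complex) \<Rightarrow> ('u \<Rightarrow> complex) \<Rightarrow> complex) \<Rightarrow>
     'u op set \<Rightarrow> 'u op set" where
  "cstar_generated H ip G = \<Inter>{A. cstar_algebra H ip A \<and> G \<subseteq> A}"

text \<open>States are only used on C*-algebras that contain the identity of \<open>H\<close>.\<close>

definition state_on ::
    "('u \<Rightarrow> complex) set \<Rightarrow> (('u \<Rightarrow> complex) \<Rightarrow> ('u \<Rightarrow> complex) \<Rightarrow> complex) \<Rightarrow>
     'u op set \<Rightarrow> ('u op \<Rightarrow> complex) \<Rightarrow> bool" where
  "state_on H ip A \<phi> \<longleftrightarrow>
     (\<forall>S\<in>A. \<forall>T\<in>A. \<phi> (S + T) = \<phi> S + \<phi> T) \<and>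
     (\<forall>c. \<forall>T\<in>A. \<phi> (op_scale c T) = c * \<phi> T) \<and>
     (\<forall>S\<in>A. \<forall>T\<in>A. is_adjoint H ip S T \<longrightarrow> \<phi> (S \<circ> T) \<in> \<real>\<^sub>\<ge>\<^sub>0) \<and>
     \<phi> (op_id H) = 1"

definition pvm ::
    "('u \<Rightarrow> complex) set \<Rightarrow> (('u \<Rightarrow> complex) \<Rightarrow> ('u \<Rightarrow> complex) \<Rightarrow> complex) \<Rightarrow>
     ('o::finite \<Rightarrow> 'u op) \<Rightarrow> bool" where
  "pvm H ip E \<longleftrightarrow>
     (\<forall>a. E a \<in> bounded_ops H ip \<and> E a \<circ> E a = E a \<and> is_adjoint H ip (E a) (E a)) \<and>
     (\<Sum>a\<in>UNIV. E a) = op_id H"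


section \<open>Correlations\<close>

text \<open>
  The inputs form a finite type \<open>'i\<close> and the outputs a finite type \<open>'o\<close>; \<open>p a b x y\<close> is
  \<open>p(a,b|x,y)\<close>, a nonnegative real regarded as a complex number.
\<close>

type_synonym ('i, 'o) corr = "'o \<Rightarrow> 'o \<Rightarrow> 'i \<Rightarrow> 'i \<Rightarrow> complex"

definition correlation :: "('i::finite, 'o::finite) corr \<Rightarrow> bool" where
  "correlation p \<longleftrightarrow>
     (\<forall>a b x y. p a b x y \<in> \<real>\<^sub>\<ge>\<^sub>0) \<and> (\<forall>x y. (\<Sum>a\<in>UNIV. \<Sum>b\<in>UNIV. p a b x y) = 1)"

definition C_ns :: "('i::finite, 'o::finite) corr set" where
  "C_ns = {p. correlation p \<and>
     (\<forall>a x w w'. (\<Sum>d\<in>UNIV. p a d x w) = (\<Sum>d\<in>UNIV. p a d x w')) \<and>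
     (\<forall>b y z z'. (\<Sum>c\<in>UNIV. p c b z y) = (\<Sum>c\<in>UNIV. p c b z' y))}"

definition commuting_model ::
    "('u \<Rightarrow> complex) set \<Rightarrow> (('u \<Rightarrow> complex) \<Rightarrow> ('u \<Rightarrow> complex) \<Rightarrow> complex) \<Rightarrow>
     ('i::finite, 'o::finite) corr \<Rightarrow> bool" where
  "commuting_model H ip p \<longleftrightarrow> hilbert_space H ip \<and>
     (\<exists>A B E F \<phi>.
        cstar_algebra H ip A \<and> cstar_algebra H ip B \<and>
        (\<forall>S\<in>A. \<forall>T\<in>B. S \<circ> T = T \<circ> S) \<and>
        (\<forall>x. pvm H ip (E x) \<and> (\<forall>a. E x a \<in> A)) \<and>
        (\<forall>y. pvm H ip (F y) \<and> (\<forall>b. F y b \<in> B)) \<and>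
        state_on H ip (cstar_generated H ip (A \<union> B)) \<phi> \<and>
        (\<forall>a b x y. p a b x y = \<phi> (E x a \<circ> F y b)))"

text \<open>
  HOL cannot quantify existentially over types, so the index type \<open>'u\<close> of the Hilbert spaces is a
  parameter of the following sets. It has to be infinite to leave room for Hilbert spaces of every
  finite dimension and for infinite-dimensional ones.
\<close>

definition C_qc :: "'u itself \<Rightarrow> ('i::finite, 'o::finite) corr set" where
  "C_qc _ = {p. correlation p \<and> (\<exists>(H :: ('u \<Rightarrow> complex) set) ip. commuting_model H ip p)}"

definition C_q :: "'u itself \<Rightarrow> ('i::finite, 'o::finite) corr set" where
  "C_q _ = {p. correlation p \<and>
     (\<exists>(H :: ('u \<Rightarrow> complex) set) ip. finite_dim H \<and> commuting_model H ip p)}"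

definition C_qa :: "'u itself \<Rightarrow> ('i::finite, 'o::finite) corr set" where
  "C_qa U = closure (C_q U)"


section \<open>The universal nonsignalling vector space\<close>

text \<open>
  The free complex vector space on \<open>e\<close> and the symbols \<open>P(a,b|x,y)\<close> consists of the complex functions
  on the finite index type \<open>('o \<times> 'o \<times> 'i \<times> 'i) option\<close>, where \<open>None\<close> stands for \<open>e\<close>.
\<close>

type_synonym ('i, 'o) free_ns = "('o \<times> 'o \<times> 'i \<times> 'i) option \<Rightarrow> complex"

definition basis_fun :: "'a \<Rightarrow> 'a \<Rightarrow> complex" where
  "basis_fun i = (\<lambda>j. if j = i then 1 else 0)"

definition free_P :: "'o \<Rightarrow> 'o \<Rightarrow> 'i \<Rightarrow> 'i \<Rightarrow> ('i, 'o) free_ns" where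
  "free_P a b x y = basis_fun (Some (a, b, x, y))"

definition ns_relations :: "('i::finite, 'o::finite) free_ns set" where
  "ns_relations =
     {(\<Sum>a\<in>UNIV. \<Sum>b\<in>UNIV. free_P a b x y) - basis_fun None | x y. True} \<union>
     {(\<Sum>b\<in>UNIV. free_P a b x y) - (\<Sum>b\<in>UNIV. free_P a b x z) | a x y z. True} \<union>
     {(\<Sum>b\<in>UNIV. free_P b a y x) - (\<Sum>b\<in>UNIV. free_P b a z x) | a x y z. True}"

definition ns_equiv :: "('i::finite, 'o::finite) free_ns \<Rightarrow> ('i, 'o) free_ns \<Rightarrow> bool" where
  "ns_equiv u v \<longleftrightarrow> u - v \<in> fun_vs.span ns_relations"

lemma equivp_ns_equiv:
  "equivp (ns_equiv :: ('a::finite, 'b::finite) free_ns \<Rightarrow> ('a, 'b) free_ns \<Rightarrow> bool)"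
proof (rule equivpI)
  show "reflp (ns_equiv :: ('a, 'b) free_ns \<Rightarrow> _)"
    by (rule reflpI) (simp add: ns_equiv_def fun_vs.span_zero)
  show "symp (ns_equiv :: ('a, 'b) free_ns \<Rightarrow> _)"
  proof (rule sympI)
    fix u v :: "('a, 'b) free_ns"
    assume "ns_equiv u v"
    then have "- (u - v) \<in> fun_vs.span ns_relations"
      unfolding ns_equiv_def by (rule fun_vs.span_neg)
    then show "ns_equiv v u" by (simp add: ns_equiv_def)
  qed
  show "transp (ns_equiv :: ('a, 'b) free_ns \<Rightarrow> _)"
  proof (rule transpI)
    fix u v w :: "('a, 'b) free_ns"
    assume "ns_equiv u v" "ns_equiv v w"
    then have "(u - v) + (v - w) \<in> fun_vs.span ns_relations"
      unfolding ns_equiv_def by (rule fun_vs.span_add)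
    then show "ns_equiv u w" by (simp add: ns_equiv_def)
  qed
qed

lemma cnj_span_ns_relations:
  fixes u :: "('a::finite, 'b::finite) free_ns"
  assumes "u \<in> fun_vs.span ns_relations"
  shows "(\<lambda>i. cnj (u i)) \<in> fun_vs.span ns_relations"
  using assms
proof (induction rule: fun_vs.span_induct_alt)
  case base
  have "(\<lambda>i. cnj (0 i)) = (0 :: ('a, 'b) free_ns)" by (simp add: fun_eq_iff)
  then show ?case by (simp only: fun_vs.span_zero)
next
  case (step c x y)
  have sum_app: "(\<Sum>k\<in>S. h k) i = (\<Sum>k\<in>S. h k i)"
    for h :: "'k \<Rightarrow> ('a, 'b) free_ns" and S i
    by (induction S rule: infinite_finite_induct) simp_all
  have cnj_P: "cnj (free_P a b w z i) = free_P a b w z i" for a b :: 'b and w z :: 'a and i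
    by (simp add: free_P_def basis_fun_def)
  have cnj_e: "cnj (basis_fun None i) = basis_fun None i" for i :: "('b \<times> 'b \<times> 'a \<times> 'a) option"
    by (simp add: basis_fun_def)
  have cnj_x: "cnj (x i) = x i" for i
    using step(1) unfolding ns_relations_def
    by (elim UnE CollectE exE conjE) (simp_all add: sum_app cnj_P cnj_e)
  have eq: "(\<lambda>i. cnj ((fscale c x + y) i)) = fscale (cnj c) x + (\<lambda>i. cnj (y i))"
    by (simp add: fun_eq_iff fscale_def cnj_x)
  show ?case
    unfolding eq
    by (intro fun_vs.span_add fun_vs.span_scale fun_vs.span_base step)
qed

quotient_type ('i, 'o) vns = "('i::finite, 'o::finite) free_ns" / ns_equiv
  by (rule equivp_ns_equiv)

instantiation vns :: (finite, finite) real_vector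
begin

lift_definition zero_vns :: "('a, 'b) vns" is 0 .

lift_definition plus_vns :: "('a, 'b) vns \<Rightarrow> ('a, 'b) vns \<Rightarrow> ('a, 'b) vns" is "(+)"
  unfolding ns_equiv_def add_diff_add by (rule fun_vs.span_add)

lift_definition uminus_vns :: "('a, 'b) vns \<Rightarrow> ('a, 'b) vns" is uminus
  unfolding ns_equiv_def minus_diff_minus by (rule fun_vs.span_neg)

lift_definition minus_vns :: "('a, 'b) vns \<Rightarrow> ('a, 'b) vns \<Rightarrow> ('a, 'b) vns" is "(-)"
  proof -
  fix u v w z :: "('a, 'b) free_ns"
  assume "ns_equiv u v" "ns_equiv w z"
  then have "(u - v) - (w - z) \<in> fun_vs.span ns_relations"
    unfolding ns_equiv_def by (rule fun_vs.span_diff)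
  then show "ns_equiv (u - w) (v - z)" by (simp add: ns_equiv_def algebra_simps)
qed

lift_definition scaleR_vns :: "real \<Rightarrow> ('a, 'b) vns \<Rightarrow> ('a, 'b) vns" is "\<lambda>r. fscale (of_real r)"
  unfolding ns_equiv_def fun_vs.scale_right_diff_distrib[symmetric] by (rule fun_vs.span_scale)

instance
proof
  have eq: "ns_equiv u v" if "u = v" for u v :: "('x::finite, 'y::finite) free_ns"
    using that by (simp add: ns_equiv_def fun_vs.span_zero)
  fix x y z :: "('a, 'b) vns" and r s :: real
  show "x + y + z = x + (y + z)" by transfer (rule eq, simp add: add.assoc)
  show "x + y = y + x" by transfer (rule eq, simp add: add.commute)
  show "0 + x = x" by transfer (rule eq, simp)
  show "- x + x = 0" by transfer (rule eq, simp)
  show "x - y = x + - y" by transfer (rule eq, simp)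
  show "r *\<^sub>R (x + y) = r *\<^sub>R x + r *\<^sub>R y"
    by transfer (rule eq, simp add: fun_vs.scale_right_distrib)
  show "(r + s) *\<^sub>R x = r *\<^sub>R x + s *\<^sub>R x"
    by transfer (rule eq, simp add: fun_vs.scale_left_distrib)
  show "r *\<^sub>R s *\<^sub>R x = (r * s) *\<^sub>R x" by transfer (rule eq, simp)
  show "1 *\<^sub>R x = x" by transfer (rule eq, simp)
qed

end

lift_definition vscale :: "complex \<Rightarrow> ('i::finite, 'o::finite) vns \<Rightarrow> ('i, 'o) vns" is fscale
  unfolding ns_equiv_def fun_vs.scale_right_diff_distrib[symmetric] by (rule fun_vs.span_scale)

global_interpretation vns: vector_space vscale
proof
  have eq: "ns_equiv u v" if "u = v" for u v :: "('x::finite, 'y::finite) free_ns"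
    using that by (simp add: ns_equiv_def fun_vs.span_zero)
  fix x y :: "('a, 'b) vns" and c d :: complex
  show "vscale c (x + y) = vscale c x + vscale c y"
    by transfer (rule eq, simp add: fun_vs.scale_right_distrib)
  show "vscale (c + d) x = vscale c x + vscale d x"
    by transfer (rule eq, simp add: fun_vs.scale_left_distrib)
  show "vscale c (vscale d x) = vscale (c * d) x" by transfer (rule eq, simp)
  show "vscale 1 x = x" by transfer (rule eq, simp)
qed

lift_definition vstar :: "('i::finite, 'o::finite) vns \<Rightarrow> ('i, 'o) vns" is "\<lambda>u i. cnj (u i)"
proof -
  fix u v :: "('i, 'o) free_ns"
  assume "ns_equiv u v"
  from cnj_span_ns_relations[OF this[unfolded ns_equiv_def]]
  show "ns_equiv (\<lambda>i. cnj (u i)) (\<lambda>i. cnj (v i))"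
    by (simp add: ns_equiv_def fun_diff_def)
qed

lift_definition vunit :: "('i::finite, 'o::finite) vns" is "basis_fun None" .

lift_definition vP :: "'o \<Rightarrow> 'o \<Rightarrow> 'i \<Rightarrow> 'i \<Rightarrow> ('i::finite, 'o::finite) vns" is free_P .

definition perp :: "('i::finite, 'o::finite) vns \<Rightarrow> ('i, 'o) vns" where
  "perp p = vunit - p"


section \<open>Matrices over the nonsignalling space\<close>

definition herm :: "nat \<Rightarrow> ('i::finite, 'o::finite) vns mat set" where
  "herm r = {x \<in> carrier_mat r r. \<forall>i<r. \<forall>j<r. x $$ (i, j) = vstar (x $$ (j, i))}"

text \<open>\<open>compress \<alpha> x\<close> is \<open>\<alpha>\<^sup>* x \<alpha>\<close>.\<close>

definition compress ::
    "complex mat \<Rightarrow> ('i::finite, 'o::finite) vns mat \<Rightarrow> ('i, 'o) vns mat" where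
  "compress \<alpha> x = Matrix.mat (dim_col \<alpha>) (dim_col \<alpha>) (\<lambda>(i, j).
     \<Sum>k<dim_row \<alpha>. \<Sum>l<dim_row \<alpha>. vscale (cnj (\<alpha> $$ (k, i)) * \<alpha> $$ (l, j)) (x $$ (k, l)))"

definition adj_mult :: "complex mat \<Rightarrow> complex mat" where
  "adj_mult \<alpha> = map_mat cnj (transpose_mat \<alpha>) * \<alpha>"

text \<open>Kronecker products; one of the two factors has complex entries.\<close>

definition kron :: "('a \<Rightarrow> 'b \<Rightarrow> 'c) \<Rightarrow> 'a mat \<Rightarrow> 'b mat \<Rightarrow> 'c mat" where
  "kron f A B = Matrix.mat (dim_row A * dim_row B) (dim_col A * dim_col B) (\<lambda>(i, j).
     f (A $$ (i div dim_row B, j div dim_col B)) (B $$ (i mod dim_row B, j mod dim_col B)))"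

abbreviation tensor_left ::
    "complex mat \<Rightarrow> ('i::finite, 'o::finite) vns mat \<Rightarrow> ('i, 'o) vns mat" where
  "tensor_left A x \<equiv> kron vscale A x"

abbreviation tensor_right ::
    "('i::finite, 'o::finite) vns mat \<Rightarrow> complex mat \<Rightarrow> ('i, 'o) vns mat" where
  "tensor_right x A \<equiv> kron (\<lambda>v c. vscale c v) x A"

definition tensor_elem ::
    "complex mat \<Rightarrow> ('i::finite, 'o::finite) vns \<Rightarrow> ('i, 'o) vns mat" where
  "tensor_elem A v = map_mat (\<lambda>c. vscale c v) A"

definition real_id :: "real \<Rightarrow> nat \<Rightarrow> complex mat" where
  "real_id \<epsilon> r = complex_of_real \<epsilon> \<cdot>\<^sub>m 1\<^sub>m r"

definition J2 :: "complex mat" where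
  "J2 = Matrix.mat 2 2 (\<lambda>_. 1)"

definition dsum ::
    "('i::finite, 'o::finite) vns \<Rightarrow> ('i, 'o) vns \<Rightarrow> ('i, 'o) vns mat" where
  "dsum v w = mat_diag 2 (\<lambda>i. if i = 0 then v else w)"

definition mat1 :: "('i::finite, 'o::finite) vns \<Rightarrow> ('i, 'o) vns mat" where
  "mat1 v = Matrix.mat 1 1 (\<lambda>_. v)"


section \<open>The cones\<close>

definition Etilde :: "('i::finite, 'o::finite) vns set" where
  "Etilde =
     {r *\<^sub>R vunit +
      (\<Sum>(a, b, x, y)\<in>UNIV. t (a, b, x, y) *\<^sub>R vP a b x y) +
      (\<Sum>(a, b, x, y)\<in>UNIV. s (a, b, x, y) *\<^sub>R perp (vP a b x y)) | r t s.
      0 \<le> r \<and> (\<forall>q. 0 \<le> t q) \<and> (\<forall>q. 0 \<le> s q)}"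

definition E_cone :: "('i::finite, 'o::finite) vns set" where
  "E_cone = {x. vstar x = x \<and> (\<forall>\<epsilon>>0. x + \<epsilon> *\<^sub>R vunit \<in> Etilde)}"

definition Dmax :: "nat \<Rightarrow> ('i::finite, 'o::finite) vns mat set" where
  "Dmax r = {compress \<alpha> (mat_diag j s) | \<alpha> j s. \<alpha> \<in> carrier_mat j r \<and> (\<forall>i<j. s i \<in> E_cone)}"

definition Emax :: "nat \<Rightarrow> ('i::finite, 'o::finite) vns mat set" where
  "Emax r = {x \<in> herm r. \<forall>\<epsilon>>0. x + tensor_elem (real_id \<epsilon> r) vunit \<in> Dmax r}"

text \<open>The matrix ordering \<open>\<C>(p)\<close>.\<close>

definition proj_ord ::
    "(nat \<Rightarrow> ('i::finite, 'o::finite) vns mat set) \<Rightarrow> ('i, 'o) vns \<Rightarrow>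
     nat \<Rightarrow> ('i, 'o) vns mat set" where
  "proj_ord C p r = {x \<in> herm r. \<forall>\<epsilon>>0. \<exists>t>0.
     tensor_right x J2 + tensor_left (real_id \<epsilon> r) (dsum p (perp p))
       + tensor_left (real_id t r) (dsum (perp p) p) \<in> C (2 * r)}"

text \<open>The cone \<open>C[p]\<close> in the hermitian \<open>k \<times> k\<close> matrices.\<close>

definition proj_cone ::
    "nat \<Rightarrow> ('i::finite, 'o::finite) vns mat set \<Rightarrow> ('i, 'o) vns \<Rightarrow> ('i, 'o) vns mat set" where
  "proj_cone k C p = {x \<in> herm k. \<forall>\<epsilon>>0. \<exists>t>0.
     \<forall>\<alpha>\<in>carrier_mat k k. \<forall>\<beta>\<in>carrier_mat k k.
       compress (\<alpha> + \<beta>) x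
         + tensor_elem (complex_of_real \<epsilon> \<cdot>\<^sub>m adj_mult \<alpha> + complex_of_real t \<cdot>\<^sub>m adj_mult \<beta>) p
         + tensor_elem (complex_of_real \<epsilon> \<cdot>\<^sub>m adj_mult \<beta> + complex_of_real t \<cdot>\<^sub>m adj_mult \<alpha>) (perp p)
       \<in> C}"

text \<open>
  An enumeration of the generators is given by a bijection \<open>g\<close> from \<open>{..<N}\<close>, so that
  \<open>periodic_gen g j\<close> is \<open>p\<^bsub>j+1\<^esub>\<close> in the periodically extended sequence \<open>p\<^sub>1, p\<^sub>2, \<dots>\<close>.
\<close>

definition generator_enum :: "(nat \<Rightarrow> 'o::finite \<times> 'o \<times> 'i::finite \<times> 'i) \<Rightarrow> bool" where
  "generator_enum g \<longleftrightarrow> bij_betw g {..<CARD('o \<times> 'o \<times> 'i \<times> 'i)} UNIV"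

definition periodic_gen ::
    "(nat \<Rightarrow> 'o \<times> 'o \<times> 'i \<times> 'i) \<Rightarrow> nat \<Rightarrow> ('i::finite, 'o::finite) vns" where
  "periodic_gen g j = (case g (j mod CARD('o \<times> 'o \<times> 'i \<times> 'i)) of (a, b, x, y) \<Rightarrow> vP a b x y)"

primrec E_seq ::
    "(nat \<Rightarrow> 'o \<times> 'o \<times> 'i \<times> 'i) \<Rightarrow> nat \<Rightarrow> nat \<Rightarrow> ('i::finite, 'o::finite) vns mat set" where
  "E_seq g 0 = Emax"
| "E_seq g (Suc j) = proj_ord (E_seq g j) (periodic_gen g j)"

definition E_proj ::
    "(nat \<Rightarrow> 'o \<times> 'o \<times> 'i \<times> 'i) \<Rightarrow> nat \<Rightarrow> ('i::finite, 'o::finite) vns mat set" where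
  "E_proj g r = {x \<in> herm r. \<forall>\<epsilon>>0. \<exists>j. x + tensor_elem (real_id \<epsilon> r) vunit \<in> E_seq g j r}"

primrec Ek_seq ::
    "(nat \<Rightarrow> 'o \<times> 'o \<times> 'i \<times> 'i) \<Rightarrow> nat \<Rightarrow> nat \<Rightarrow> ('i::finite, 'o::finite) vns mat set" where
  "Ek_seq g k 0 = Emax k"
| "Ek_seq g k (Suc j) = proj_cone k (Ek_seq g k j) (periodic_gen g j)"

definition Ek_proj ::
    "(nat \<Rightarrow> 'o \<times> 'o \<times> 'i \<times> 'i) \<Rightarrow> nat \<Rightarrow> ('i::finite, 'o::finite) vns mat set" where
  "Ek_proj g k = {x \<in> herm k. \<forall>\<epsilon>>0. \<exists>j. x + tensor_elem (real_id \<epsilon> k) vunit \<in> Ek_seq g k j}"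

definition D_ns :: "('i::finite, 'o::finite) vns set" where
  "D_ns = E_cone"

definition D_qc :: "(nat \<Rightarrow> 'o \<times> 'o \<times> 'i \<times> 'i) \<Rightarrow> ('i::finite, 'o::finite) vns set" where
  "D_qc g = {x. mat1 x \<in> E_proj g 1}"

definition D_q ::
    "(nat \<Rightarrow> 'o \<times> 'o \<times> 'i \<times> 'i) \<Rightarrow> nat \<Rightarrow> ('i::finite, 'o::finite) vns set" where
  "D_q g k = {x. vstar x = x \<and> (\<forall>\<alpha>\<in>carrier_mat 1 k. compress \<alpha> (mat1 x) \<in> Ek_proj g k)}"

definition D_qa :: "(nat \<Rightarrow> 'o \<times> 'o \<times> 'i \<times> 'i) \<Rightarrow> ('i::finite, 'o::finite) vns set" where
  "D_qa g = (\<Inter>k\<in>{1..}. D_q g k)"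

definition nonneg_on :: "('v \<Rightarrow> complex) \<Rightarrow> 'v set \<Rightarrow> bool" where
  "nonneg_on \<phi> D \<longleftrightarrow> (\<forall>z\<in>D. \<phi> z \<in> \<real>\<^sub>\<ge>\<^sub>0)"

end

theory Submission
  imports Defs
begin

text \<open>A functional on the nonsignalling space is written as a hermitian family of linear functionals F i j, a kernel. It
pairs with a matrix X as ev r F X = sum of F i j (X i j), and frm contracts a kernel with coefficient vectors.
Nonnegativity on one matrix cone is nonnegativity of such a pairing, so each cone of the theorem is matched with a
class of kernels.

Soundness. In a commuting model with projections P q and state \<phi>, the kernel \<phi>(a_i* T a_j) is nonnegative on
E_max. Suppose x lies in the next stage along p. Replacing each a_i by the pair P a_i, (1 - P) a_i makes the penalty
term t (perp p, p) vanish and leaves the \<epsilon>-term bounded, so the kernel is nonnegative at x as well. Hence it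
is nonnegative on all stages (ev_proj_step, D_qc_sound). In finite dimension the operators are spanned by some k of
them, and compressions of size k suffice (operators_finite_span, D_q_sound).

Completeness for commuting models. A kernel that is nonnegative on a matrix ordering closed under proj_ord C p
extends, by a separation argument, to a kernel on twice as many indices that is nonnegative on the same ordering and
in which each old vector is a sum of one vector killed by perp p and one killed by p (riesz). Running through all
generators infinitely often gives a kernel on the natural numbers in which every vector splits along every generator
(datum_exists). In its reproducing kernel Hilbert space each generator acts as an idempotent contraction, hence as an
orthogonal projection, and the nonsignalling relations make the marginal projections commute (datum_in_C_qc,
commuting_model_of_projections).

Completeness for a fixed size k. Doubling the indices is not allowed here; only compressions back to size k are
tested. A matrix outside E^proj(k) is negative on a normalised compression of a state whose halves are killed
(dilated_separation); this uses compactness, with the penalty t tending to infinity. On the closure R of the exposed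
states every state is such a compression of another state in R (R_Dil). Among the states of R that are negative on the
given matrix, one of maximal rank has no room to grow: its dilation spans the same space, so it already splits along
every generator (splitting_state). This yields a model of dimension at most k. Direct sums of models give convexity,
compactness of the models of size k gives closedness of their convex hull, and separating hyperplanes turn this into
the statements on C_q and C_qa (D_q_nonneg_split, D_qa_nonneg_split).\<close>

type_synonym ('i, 'o) lab = "'o \<times> 'o \<times> 'i \<times> 'i"
type_synonym ('i, 'o) fam = "nat => nat => ('i, 'o) vns => complex"
abbreviation (input) "smat t \<equiv> map_mat ((*\<^sub>R) t)"
abbreviation Rnn :: "complex set" where "Rnn \<equiv> \<real>\<^sub>\<ge>\<^sub>0"
abbreviation (input) "cof \<equiv> complex_of_real"
abbreviation (input) "dmat r \<equiv> Matrix.mat (2 * r) (2 * r)"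

section \<open>The nonsignalling space\<close>

lemma ns_equiv_refl: "u = v ==> ns_equiv u v" by (simp add: ns_equiv_def fun_vs.span_zero)

lemma vscale_of_real: "vscale (cof r) x = r *\<^sub>R x" by transfer (rule ns_equiv_refl, simp)

lemma vstar_add: "vstar (x + y) = vstar x + vstar y" by transfer (rule ns_equiv_refl, simp add: fun_eq_iff)

lemma vstar_vscale: "vstar (vscale c x) = vscale (cnj c) (vstar x)" by transfer (rule ns_equiv_refl, simp add: fun_eq_iff fscale_def)

lemma vstar_vstar [simp]: "vstar (vstar x) = x" by transfer (rule ns_equiv_refl, simp)

lemma vstar_vunit [simp]: "vstar vunit = vunit" by transfer (rule ns_equiv_refl, simp add: fun_eq_iff basis_fun_def)

lemma vstar_vP [simp]: "vstar (vP a b x y) = vP a b x y" by transfer (rule ns_equiv_refl, simp add: fun_eq_iff basis_fun_def free_P_def)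

lemma vstar_zero [simp]: "vstar 0 = 0" by transfer (rule ns_equiv_refl, simp add: fun_eq_iff)

lemma vstar_diff: "vstar (x - y) = vstar x - vstar y" by transfer (rule ns_equiv_refl, simp add: fun_eq_iff)

lemma vstar_minus: "vstar (- x) = - vstar x" using vstar_diff[of 0 x] by simp

lemma vstar_scaleR: "vstar (r *\<^sub>R x) = r *\<^sub>R vstar x" using vstar_vscale[of "of_real r" x] by (simp add: vscale_of_real)

lemma vstar_sum: "vstar (SUM i:I. f i) = (SUM i:I. vstar (f i))" by (induction I rule: infinite_finite_induct) (simp_all add: vstar_add)

lemma vstar_perp [simp]: "vstar p = p ==> vstar (perp p) = perp p" by (simp add: perp_def vstar_diff)

definition gen :: "(('i, 'o) lab) option => ('i::finite, 'o::finite) vns" where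
 "gen q = (case q of None => vunit | Some (a, b, x, y) => vP a b x y)"

abbreviation (input) "prj t \<equiv> gen (Some t)"

lemma gen_simps [simp]: "gen None = vunit" "gen (Some (a, b, x, y)) = vP a b x y" by (simp_all add: gen_def)

lemma vstar_gen [simp]: "vstar (gen q) = gen q" by (cases q) auto

lemma gen_abs: "gen q = abs_vns (basis_fun q)" by (cases q) (auto simp: vunit_def vP_def free_P_def)

lemma abs_vns_sum: "abs_vns (SUM i:I. f i) = (SUM i:I. abs_vns (f i))" by (induction I rule: infinite_finite_induct)
  (simp_all only: sum.infinite sum.empty sum.insert zero_vns_def plus_vns.abs_eq[symmetric] not_False_eq_True)

lemma sum_fun_apply: "(SUM k:S. h k) i = (SUM k:S. h k i :: 'b::comm_monoid_add)" by (induction S rule: infinite_finite_induct) simp_all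

lemma vns_expand: "x = (SUM q:UNIV. vscale (rep_vns x q) (gen q))"
proof -
 have "rep_vns x = (SUM q:UNIV. fscale (rep_vns x q) (basis_fun q))"
  by (auto simp: fun_eq_iff sum_fun_apply fscale_def basis_fun_def if_distrib cong: if_cong)
 then have "abs_vns (rep_vns x) = (SUM q:UNIV. abs_vns (fscale (rep_vns x q) (basis_fun q)))" by (metis (no_types, lifting) abs_vns_sum sum.cong)
 moreover have "abs_vns (rep_vns x) = x" using Quotient3_vns by (rule Quotient3_abs_rep)
 ultimately show ?thesis by (simp add: vscale.abs_eq[symmetric] gen_abs)
qed

definition clin :: "(('i::finite, 'o::finite) vns => complex) => bool" where
 "clin f \<longleftrightarrow> (ALL x y. f (x + y) = f x + f y) & (ALL c x. f (vscale c x) = c * f x)"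

lemma clinD:
 assumes "clin f"
 shows "f (x + y) = f x + f y" "f (vscale c x) = c * f x" "f 0 = 0" "f (- x) = - f x"
  "f (x - y) = f x - f y" "f (r *\<^sub>R x) = of_real r * f x"
  "f (SUM i:I. h i) = (SUM i:I. f (h i))" "f (perp x) = f vunit - f x"
proof -
 show a: "f (x + y) = f x + f y" and s: "f (vscale c x) = c * f x" for x y c using assms by (auto simp: clin_def)
 show z: "f 0 = 0" using s[of 0 0] by simp
 show m: "f (- x) = - f x" for x using a[of x "-x"] z by (simp add: eq_neg_iff_add_eq_0 add.commute)
 show d: "f (x - y) = f x - f y" for x y using a[of x "-y"] m by simp
 show "f (r *\<^sub>R x) = of_real r * f x" using s[of "of_real r" x] by (simp add: vscale_of_real)
 show "f (SUM i:I. h i) = (SUM i:I. f (h i))" by (induction I rule: infinite_finite_induct) (simp_all add: a z)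
 show "f (perp x) = f vunit - f x" by (simp add: perp_def d)
qed

lemma clin_expand: "clin f ==> f x = (SUM q:UNIV. rep_vns x q * f (gen q))" using arg_cong[OF vns_expand[of x], of f] by (simp add: clinD)

lemma clin_cong: "clin f ==> clin h ==> (!!q. f (gen q) = h (gen q)) ==> f = h" by (rule HOL.ext) (metis (no_types, lifting) clin_expand sum.cong)

lemma clin_zero [simp]: "clin (%_. 0)" by (simp add: clin_def)
lemma clin_add: "clin f ==> clin h ==> clin (%x. f x + h x)" by (simp add: clin_def algebra_simps)
lemma clin_cmult: "clin f ==> clin (%x. c * f x)" by (simp add: clin_def algebra_simps)
lemma clin_sum: "(!!i. i \<in> I ==> clin (f i)) ==> clin (%x. SUM i:I. f i x)" by (induction I rule: infinite_finite_induct) (simp_all add: clin_add)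

definition ns_rel :: "(((('i::finite, 'o::finite) lab) option) => complex) => bool" where
 "ns_rel t \<longleftrightarrow>
  (ALL x y. (SUM a:UNIV. SUM b:UNIV. t (Some (a, b, x, y))) = t None) &
  (ALL a x y z. (SUM b:UNIV. t (Some (a, b, x, y))) = (SUM b:UNIV. t (Some (a, b, x, z)))) &
  (ALL a x y z. (SUM b:UNIV. t (Some (b, a, y, x))) = (SUM b:UNIV. t (Some (b, a, z, x))))"

text \<open>Prescribing values on the generators that respect the nonsignalling relations defines a linear functional on the
quotient.\<close>
definition ns_ext :: "(((('i::finite, 'o::finite) lab) option) => complex) => ('i, 'o) vns => complex" where
 "ns_ext t x = (SUM q:UNIV. rep_vns x q * t q)"

lemma free_eval_basis:
 fixes q :: "(('i::finite, 'o::finite) lab) option"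
 shows "(SUM r:UNIV. basis_fun q r * t r) = (t q :: complex)" by (simp add: basis_fun_def if_distrib[where f = "%c. c * _"] cong: if_cong)

lemma ns_ext:
 fixes t :: "((('i::finite, 'o::finite) lab) option) => complex"
 assumes "ns_rel t"
 shows "clin (ns_ext t)" "ns_ext t (gen q) = t q"
proof -
 define T where "T u = (SUM q:UNIV. u q * t q)" for u
 have Ta: "T (u + v) = T u + T v" and Tm: "T (u - v) = T u - T v" and Ts: "T (fscale c u) = c * T u" for u v c
  by (simp_all add: T_def fscale_def algebra_simps sum.distrib sum_subtractf sum_distrib_left)
 have Tsum: "T (SUM i:I. h i) = (SUM i:I. T (h i))" for I :: "'o set" and h
 proof -
  have "T 0 = 0" by (simp add: T_def)
  then show ?thesis by (induction I rule: infinite_finite_induct) (simp_all only: Ta sum.infinite sum.empty sum.insert not_False_eq_True)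
 qed
 have Tb: "T (basis_fun q) = t q" for q unfolding T_def by (rule free_eval_basis)
 have Tspan: "T u = 0" if "u \<in> fun_vs.span ns_relations" for u using that
 proof (induction rule: fun_vs.span_induct_alt)
  case base show ?case by (simp add: T_def)
 next
  case (step c x y)
  have "T x = 0" using step(1) assms unfolding ns_relations_def free_P_def ns_rel_def by (auto simp: Tm Tsum Tb)
  then show ?case using step by (simp only: Ta Ts) simp
 qed
 have Teq: "T u = T v" if "ns_equiv u v" for u v using Tspan[of "u - v"] that by (simp add: ns_equiv_def Tm)
 have e: "ns_ext t (abs_vns u) = T u" for u
 proof -
  have "ns_equiv (rep_vns (abs_vns u)) u" by (rule Quotient3_rep_abs[OF Quotient3_vns]) (simp add: ns_equiv_refl)
  then show ?thesis using Teq by (simp add: ns_ext_def T_def)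
 qed
 have ab: "x = abs_vns (rep_vns x)" for x :: "('i, 'o) vns" using Quotient3_abs_rep[OF Quotient3_vns] by metis
 have "ns_ext t (x + y) = ns_ext t x + ns_ext t y" for x y
  by (subst ab[of x], subst ab[of y]) (simp only: plus_vns.abs_eq e Ta, simp add: T_def ns_ext_def)
 moreover have "ns_ext t (vscale c x) = c * ns_ext t x" for x c by (subst ab[of x]) (simp only: vscale.abs_eq e Ts, simp add: T_def ns_ext_def)
 ultimately show "clin (ns_ext t)" by (simp add: clin_def)
 show "ns_ext t (gen q) = t q" by (simp add: gen_abs e Tb)
qed

lemma vns_relations:
 fixes x y z :: "'i::finite" and a b :: "'o::finite"
 shows "(SUM a:UNIV. SUM b:UNIV. vP a b x y) = (vunit :: ('i, 'o) vns)"
  "(SUM b:UNIV. vP a b x y) = (SUM b:UNIV. vP a b x z :: ('i, 'o) vns)"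
  "(SUM b:UNIV. vP b a y x) = (SUM b:UNIV. vP b a z x :: ('i, 'o) vns)"
proof -
 have P: "vP a b x y = abs_vns (free_P a b x y)" for a b :: 'o and x y :: 'i by (simp add: vP_def)
 have I: "abs_vns u = abs_vns v" if "u - v \<in> ns_relations" for u v :: "('i,'o) free_ns"
  using that by (intro Quotient3_rel_abs[OF Quotient3_vns]) (simp add: ns_equiv_def fun_vs.span_base)
 show "(SUM a:UNIV. SUM b:UNIV. vP a b x y) = (vunit :: ('i, 'o) vns)" unfolding P vunit_def abs_vns_sum[symmetric]
  by (rule I) (simp add: ns_relations_def, blast)
 show "(SUM b:UNIV. vP a b x y) = (SUM b:UNIV. vP a b x z :: ('i, 'o) vns)" unfolding P abs_vns_sum[symmetric]
  by (rule I) (unfold ns_relations_def, blast)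
 show "(SUM b:UNIV. vP b a y x) = (SUM b:UNIV. vP b a z x :: ('i, 'o) vns)" unfolding P abs_vns_sum[symmetric]
  by (rule I) (unfold ns_relations_def, blast)
qed

section \<open>Cones\<close>

instantiation "fun" :: (type, real_vector) real_vector
begin
definition scaleR_fun :: "real => ('a => 'b) => 'a => 'b" where
 "scaleR_fun r f = (%x. r *\<^sub>R f x)"
instance by standard (auto simp: scaleR_fun_def fun_eq_iff algebra_simps)
end

text \<open>The Hahn-Banach argument in the form needed here: by Zorn's lemma the cone is contained in a maximal cone M without -
u. Maximality makes M total, and then L x, the infimum of all t with t u - x in M, is linear in x.\<close>
lemma state_exists:
 fixes C :: "'a::real_vector set"
 assumes add: "!!x y. x \<in> C ==> y \<in> C ==> x + y \<in> C"
  and scale: "!!t x. 0 <= t ==> x \<in> C ==> t *\<^sub>R x \<in> C"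
  and unit: "!!x. EX t>=0. x + t *\<^sub>R u \<in> C"
  and nu: "- u ~: C"
 shows "EX L. linear L & (ALL x:C. 0 <= L x) & L u = (1::real)"
proof -
 define \<S> where "\<S> = {K. C <= K & (ALL x:K. ALL y:K. x + y \<in> K) & (ALL t>=0. ALL x:K. t *\<^sub>R x \<in> K) & - u ~: K}"
 have SI: "K \<in> \<S>" if "C <= K" "!!x y. x \<in> K ==> y \<in> K ==> x + y \<in> K"
  "!!t x. 0 <= t ==> x \<in> K ==> t *\<^sub>R x \<in> K" "- u ~: K" for K unfolding \<S>_def using that by blast
 have SD: "C <= K" "- u ~: K" "!!x y. x \<in> K ==> y \<in> K ==> x + y \<in> K"
  "!!t x. 0 <= t ==> x \<in> K ==> t *\<^sub>R x \<in> K" if "K \<in> \<S>" for K using that unfolding \<S>_def by blast+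
 have "EX M:\<S>. ALL X:\<S>. M <= X --> X = M"
 proof (rule subset_Zorn_nonempty)
  have "C \<in> \<S>" using assms by (intro SI) auto
  then show "\<S> ~= {}" by blast
 next
  fix \<C> assume ne: "\<C> ~= {}" and ch: "subset.chain \<S> \<C>"
  have sub: "K \<in> \<S>" if "K \<in> \<C>" for K using ch that unfolding subset_chain_def by blast
  have lin: "A <= B \<or> B <= A" if "A \<in> \<C>" "B \<in> \<C>" for A B using ch that unfolding subset_chain_def by blast
  show "\<Union>\<C> \<in> \<S>"
  proof (rule SI)
   obtain K where "K \<in> \<C>" using ne by blast
   with SD(1)[OF sub] show "C <= \<Union>\<C>" by blast
   show "- u ~: \<Union>\<C>" using SD(2)[OF sub] by blast
  next
   fix t :: real and x assume t: "0 <= t" and "x \<in> \<Union>\<C>"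
   then obtain K where K: "K \<in> \<C>" "x \<in> K" by blast
   with SD(4)[OF sub t] show "t *\<^sub>R x \<in> \<Union>\<C>" by blast
  next
   fix x y assume "x \<in> \<Union>\<C>" "y \<in> \<Union>\<C>"
   then obtain A B where AB: "x \<in> A" "y \<in> B" "A \<in> \<C>" "B \<in> \<C>" by blast
   with lin[of A B] obtain D where D: "x \<in> D" "y \<in> D" "D \<in> \<C>" by blast
   from SD(3)[OF sub[OF D(3)] D(1,2)] D(3) show "x + y \<in> \<Union>\<C>" by blast
  qed
 qed
 then obtain M where M: "M \<in> \<S>" and max: "!!X. X \<in> \<S> ==> M <= X ==> X = M" by blast
 note Ma = SD(3)[OF M] and Mu = SD(2)[OF M] and CM = SD(1)[OF M]
 have Ms: "t *\<^sub>R x \<in> M" if "x \<in> M" "t >= 0" for x t using SD(4)[OF M] that by blast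
 have zero: "0 \<in> M"
 proof -
  obtain t where "0 + t *\<^sub>R u \<in> C" using unit by blast
  then have "t *\<^sub>R u \<in> M" using CM by auto
  then have "0 *\<^sub>R (t *\<^sub>R u) \<in> M" using Ms by fastforce
  then show ?thesis by simp
 qed
 have key: "EX m:M. EX s>0. - u = m + s *\<^sub>R x" if "x ~: M" for x
 proof -
  define K where "K = {m + s *\<^sub>R x | m s. m \<in> M & s >= 0}"
  have KI: "m + s *\<^sub>R x \<in> K" if "m \<in> M" "s >= 0" for m s using that unfolding K_def by blast
  have MK: "M <= K" using KI[of _ 0] by auto
  have "x \<in> K" using KI[OF zero, of 1] by simp
  then have "K ~= M" using that by blast
  then have "K ~: \<S>" using max MK by blast
  moreover have "x' + y' \<in> K" if xK: "x' \<in> K" and yK: "y' \<in> K" for x' y'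
  proof -
   obtain m s where "x' = m + s *\<^sub>R x" "m \<in> M" "s >= 0" using xK unfolding K_def by blast
   moreover obtain m' s' where "y' = m' + s' *\<^sub>R x" "m' \<in> M" "s' >= 0" using yK unfolding K_def by blast
   ultimately have "x' + y' = (m + m') + (s + s') *\<^sub>R x" "(m + m') + (s + s') *\<^sub>R x \<in> K"
    by (simp add: scaleR_left_distrib, intro KI Ma) auto
   then show ?thesis by metis
  qed
  moreover have "t *\<^sub>R x' \<in> K" if x': "x' \<in> K" and t: "t >= 0" for x' t
  proof -
   obtain m s where "x' = m + s *\<^sub>R x" "m \<in> M" "s >= 0" using x' unfolding K_def by blast
   then have "t *\<^sub>R x' = t *\<^sub>R m + (t * s) *\<^sub>R x" "t *\<^sub>R m + (t * s) *\<^sub>R x \<in> K"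
    using t by (simp add: scaleR_right_distrib, intro KI Ms) auto
   then show ?thesis by metis
  qed
  moreover have "C <= K" using MK CM by (rule subset_trans[rotated])
  ultimately have "- u \<in> K" using SI[of K] by blast
  then obtain m s where ms: "- u = m + s *\<^sub>R x" "m \<in> M" "s >= 0" unfolding K_def by blast
  then have "s ~= 0" using Mu by auto
  then show ?thesis using ms by (intro bexI[of _ m] exI[of _ s]) auto
 qed
 have total: "x \<in> M \<or> - x \<in> M" for x
 proof (rule ccontr)
  assume "\<not> (x \<in> M \<or> - x \<in> M)"
  then obtain m s m' s' where 1: "m \<in> M" "s > 0" "- u = m + s *\<^sub>R x" and 2: "m' \<in> M" "s' > 0" "- u = m' + s' *\<^sub>R (- x)"
   using key[of x] key[of "-x"] by blast
  have "s' *\<^sub>R (- u) + s *\<^sub>R (- u) = s' *\<^sub>R (m + s *\<^sub>R x) + s *\<^sub>R (m' + s' *\<^sub>R (- x))"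
   using 1(3) 2(3) by (intro arg_cong2[of _ _ _ _ "(+)"] arg_cong2[of _ _ _ _ "scaleR"]) auto
  then have eq: "(s' + s) *\<^sub>R (- u) = s' *\<^sub>R m + s *\<^sub>R m'"
   by (simp add: scaleR_left_distrib scaleR_right_distrib scaleR_right_diff_distrib mult.commute)
  have "s' *\<^sub>R m + s *\<^sub>R m' \<in> M" using 1(1,2) 2(1,2) by (intro Ma Ms) auto
  then have "(1 / (s' + s)) *\<^sub>R ((s' + s) *\<^sub>R (- u)) \<in> M" unfolding eq by (rule Ms) (use 1(2) 2(2) in simp)
  moreover have "(1 / (s' + s)) *\<^sub>R ((s' + s) *\<^sub>R (- u)) = - u" using 1(2) 2(2) by simp
  ultimately show False using Mu by metis
 qed
 then have uM: "u \<in> M" using Mu by blast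
 have sgn: "t >= 0" if "t *\<^sub>R u \<in> M" for t
 proof (rule ccontr)
  assume "\<not> t >= 0"
  then have "(1 / (- t)) *\<^sub>R (t *\<^sub>R u) \<in> M" by (intro Ms that) auto
  then show False using \<open>\<not> t >= 0\<close> Mu by simp
 qed
 define T where "T x = {t. t *\<^sub>R u - x \<in> M}" for x
 define L where "L x = Inf (T x)" for x
 have low: "t <= t'" if "x - t *\<^sub>R u \<in> M" "t' \<in> T x" for x t t'
  using Ma[OF that(1), of "t' *\<^sub>R u - x"] sgn[of "t' - t"] that(2) by (simp add: T_def algebra_simps)
 have ne: "T x ~= {}" and bb: "bdd_below (T x)" for x
 proof -
  obtain s where "- x + s *\<^sub>R u \<in> M" using unit CM by blast
  then have "s \<in> T x" by (simp add: T_def algebra_simps)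
  then show "T x ~= {}" by blast
  obtain s where "x + s *\<^sub>R u \<in> M" using unit CM by blast
  then show "bdd_below (T x)" using low[of x "- s"] by (intro bdd_belowI[of _ "- s"]) simp
 qed
 have upI: "L x <= t" if "t *\<^sub>R u - x \<in> M" for x t unfolding L_def by (rule cInf_lower[OF _ bb]) (use that in "simp add: T_def")
 have loI: "t <= L x" if "x - t *\<^sub>R u \<in> M" for x t unfolding L_def by (rule cInf_greatest[OF ne low[OF that]])
 have up: "(L x + e) *\<^sub>R u - x \<in> M" if e: "e > 0" for x e
 proof -
  obtain t where t: "t \<in> T x" "t < L x + e" using e ne cInf_lessD[of "T x" "L x + e"] by (auto simp: L_def)
  have "(t *\<^sub>R u - x) + (L x + e - t) *\<^sub>R u \<in> M" using t uM by (intro Ma Ms) (auto simp: T_def)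
  then show ?thesis by (simp add: algebra_simps)
 qed
 have lo: "x - (L x - e) *\<^sub>R u \<in> M" if e: "e > 0" for x e
 proof -
  have "(L x - e) *\<^sub>R u - x ~: M" using e upI[of "L x - e" x] by auto
  then show ?thesis using total[of "(L x - e) *\<^sub>R u - x"] by simp
 qed
 have Ladd: "L (x + y) = L x + L y" for x y
 proof (rule antisym; rule field_le_epsilon)
  fix e :: real assume "e > 0"
  then have e: "e / 2 > 0" by simp
  have "(L x + e/2) *\<^sub>R u - x + ((L y + e/2) *\<^sub>R u - y) = (L x + e/2 + (L y + e/2)) *\<^sub>R u - (x + y)"
   unfolding scaleR_left_distrib by simp
  with Ma[OF up[OF e, of x] up[OF e, of y]] have "(L x + e/2 + (L y + e/2)) *\<^sub>R u - (x + y) \<in> M" by (simp only:)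
  from upI[OF this] show "L (x + y) <= L x + L y + e" by linarith
  have "x - (L x - e/2) *\<^sub>R u + (y - (L y - e/2) *\<^sub>R u) = x + y - (L x - e/2 + (L y - e/2)) *\<^sub>R u"
   unfolding scaleR_left_distrib by simp
  with Ma[OF lo[OF e, of x] lo[OF e, of y]] have "x + y - (L x - e/2 + (L y - e/2)) *\<^sub>R u \<in> M" by (simp only:)
  from loI[OF this] show "L x + L y <= L (x + y) + e" by linarith
 qed
 have Lpos: "L (c *\<^sub>R x) = c * L x" if c: "c > 0" for c x
 proof (rule antisym; rule field_le_epsilon)
  fix e :: real assume "e > 0"
  then have e: "e / c > 0" using c by simp
  have "c *\<^sub>R ((L x + e/c) *\<^sub>R u - x) \<in> M" "c *\<^sub>R (x - (L x - e/c) *\<^sub>R u) \<in> M"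
   using up[OF e] lo[OF e] c by (auto intro!: Ms)
  then have "(c * L x + e) *\<^sub>R u - c *\<^sub>R x \<in> M" "c *\<^sub>R x - (c * L x - e) *\<^sub>R u \<in> M"
   using c by (simp_all add: scaleR_diff_right distrib_left right_diff_distrib)
  from upI[OF this(1)] loI[OF this(2)] show "L (c *\<^sub>R x) <= c * L x + e" "c * L x <= L (c *\<^sub>R x) + e" by simp_all
 qed
 have L0: "L 0 = 0" using Ladd[of 0 0] by simp
 have Lneg: "L (- x) = - L x" for x using Ladd[of x "-x"] L0 by simp
 have Lscale: "L (c *\<^sub>R x) = c * L x" for c x
 proof (cases "c > 0")
  case False
  then show ?thesis using Lpos[of "-c" x] Lneg[of "c *\<^sub>R x"] L0 by (cases "c = 0") auto
 qed (rule Lpos)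
 have "linear L" by (rule linearI) (simp_all add: Ladd Lscale)
 moreover have "0 <= L x" if "x \<in> C" for x using loI[of x 0] CM that by auto
 moreover have "L u = 1" using upI[of 1 u] loI[of u 1] zero by simp
 ultimately show ?thesis by blast
qed

section \<open>Matrices over the nonsignalling space\<close>

definition unit_mat :: "real => nat => ('i::finite, 'o::finite) vns mat" where
 "unit_mat eps r = tensor_elem (real_id eps r) vunit"

lemma unit_mat_carrier [simp]: "unit_mat eps r \<in> carrier_mat r r"
 "dim_row (unit_mat eps r) = r" "dim_col (unit_mat eps r) = r" by (simp_all add: unit_mat_def tensor_elem_def real_id_def)

lemma unit_mat_index [simp]:
 "i < r ==> j < r ==> unit_mat eps r $$ (i, j) = (if i = j then eps *\<^sub>R vunit else 0)"
 by (simp add: unit_mat_def tensor_elem_def real_id_def vscale_of_real)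

lemma hermD:
 assumes "X \<in> herm r"
 shows "X \<in> carrier_mat r r" "dim_row X = r" "dim_col X = r"
  "i < r ==> j < r ==> vstar (X $$ (j, i)) = X $$ (i, j)"
proof -
 have c: "X \<in> carrier_mat r r" and h: "!!i j. i < r ==> j < r ==> X $$ (i, j) = vstar (X $$ (j, i))" using assms unfolding herm_def by blast+
 show "X \<in> carrier_mat r r" "dim_row X = r" "dim_col X = r" using c by auto
 show "i < r ==> j < r ==> vstar (X $$ (j, i)) = X $$ (i, j)" using h[of i j] by simp
qed

lemma hermI:
 assumes "dim_row X = r" "dim_col X = r" "!!i j. i < r ==> j < r ==> X $$ (i, j) = vstar (X $$ (j, i))"
 shows "X \<in> herm r"
proof -
 have "X \<in> carrier_mat r r" using assms(1,2) by auto
 then show ?thesis unfolding herm_def using assms(3) by blast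
qed

lemma herm_add:
 assumes "X \<in> herm r" "Y \<in> herm r"
 shows "X + Y \<in> herm r" by (rule hermI) (simp_all add: hermD[OF assms(1)] hermD[OF assms(2)] vstar_add)

lemma herm_unit [simp]: "unit_mat eps r \<in> herm r" by (rule hermI) (simp_all add: vstar_scaleR)

lemma compress_carrier [simp]: "dim_row (compress alpha X) = dim_col alpha" "dim_col (compress alpha X) = dim_col alpha"
 by (simp_all add: compress_def)

lemma compress_index:
 "alpha \<in> carrier_mat s r ==> i < r ==> j < r ==> compress alpha X $$ (i, j) =
  (SUM k<s. SUM l<s. vscale (cnj (alpha $$ (k, i)) * alpha $$ (l, j)) (X $$ (k, l)))" by (simp add: compress_def)

lemma compress_herm:
 assumes X: "X \<in> herm s" and a: "alpha \<in> carrier_mat s r"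
 shows "compress alpha X \<in> herm r"
proof (rule hermI)
 fix i j assume ij: "i < r" "j < r"
 show "compress alpha X $$ (i, j) = vstar (compress alpha X $$ (j, i))"
  unfolding compress_index[OF a ij] compress_index[OF a ij(2,1)] vstar_sum vstar_vscale
  by (subst sum.swap, intro sum.cong refl) (simp add: hermD(4)[OF X] mult.commute)
qed (use a in auto)

lemma compress_add:
 assumes "X \<in> carrier_mat s s" "Y \<in> carrier_mat s s" and a: "alpha \<in> carrier_mat s r"
 shows "compress alpha (X + Y) = compress alpha X + compress alpha Y"
 by (rule eq_matI) (use assms in "simp_all add: compress_index[OF a] vns.scale_right_distrib sum.distrib")

lemma sum_swap4:
 "(SUM m:A. SUM n:B. SUM k:D. SUM l:E. f m n k l) = (SUM k:D. SUM l:E. SUM m:A. SUM n:B. f m n k l)"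
proof -
 have "(SUM m:A. SUM n:B. SUM k:D. SUM l:E. f m n k l) = (SUM m:A. SUM k:D. SUM n:B. SUM l:E. f m n k l)" by (rule sum.cong[OF refl], rule sum.swap)
 also have "... = (SUM k:D. SUM m:A. SUM n:B. SUM l:E. f m n k l)" by (rule sum.swap)
 also have "... = (SUM k:D. SUM m:A. SUM l:E. SUM n:B. f m n k l)" by (rule sum.cong[OF refl], rule sum.cong[OF refl], rule sum.swap)
 also have "... = (SUM k:D. SUM l:E. SUM m:A. SUM n:B. f m n k l)" by (rule sum.cong[OF refl], rule sum.swap)
 finally show ?thesis .
qed

lemma compress_compress:
 assumes a: "alpha \<in> carrier_mat r s" and b: "beta \<in> carrier_mat s t"
 shows "compress beta (compress alpha X) = compress (alpha * beta) X"
proof (rule eq_matI)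
 have ab: "alpha * beta \<in> carrier_mat r t" using a b by simp
 fix i j assume "i < dim_row (compress (alpha * beta) X)" "j < dim_col (compress (alpha * beta) X)"
 then have ij: "i < t" "j < t" using b by auto
 have ent: "(alpha * beta) $$ (k, i) = (SUM m<s. alpha $$ (k, m) * beta $$ (m, i))" if "k < r" "i < t" for k i
  using that a b by (simp add: scalar_prod_def lessThan_atLeast0)
 have prod: "cnj ((alpha * beta) $$ (k, i)) * (alpha * beta) $$ (l, j) =
   (SUM m<s. SUM n<s. cnj (beta $$ (m, i)) * beta $$ (n, j) * (cnj (alpha $$ (k, m)) * alpha $$ (l, n)))" if "k < r" "l < r" for k l
  by (simp only: ent[OF that(1) ij(1)] ent[OF that(2) ij(2)] cnj_sum sum_product complex_cnj_mult) (intro sum.cong refl, simp only: ac_simps)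
 have "compress beta (compress alpha X) $$ (i, j) =
  (SUM m<s. SUM n<s. SUM k<r. SUM l<r. vscale (cnj (beta $$ (m, i)) * beta $$ (n, j) * (cnj (alpha $$ (k, m)) * alpha $$ (l, n))) (X $$ (k, l)))"
  unfolding compress_index[OF b ij] by (intro sum.cong refl) (simp add: compress_index[OF a] vns.scale_sum_right)
 also have "... = (SUM k<r. SUM l<r. SUM m<s. SUM n<s.
   vscale (cnj (beta $$ (m, i)) * beta $$ (n, j) * (cnj (alpha $$ (k, m)) * alpha $$ (l, n))) (X $$ (k, l)))" by (rule sum_swap4)
 also have "... = compress (alpha * beta) X $$ (i, j)" unfolding compress_index[OF ab ij]
  by (intro sum.cong refl) (simp only: prod lessThan_iff vns.scale_sum_left)
 finally show "compress beta (compress alpha X) $$ (i, j) = compress (alpha * beta) X $$ (i, j)" .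
qed (use a b in auto)

lemma sum_lessThan_double:
 fixes s :: nat
 shows "(SUM k<2 * s. g k) = (SUM k<s. g (2 * k) + g (2 * k + 1) :: 'b::comm_monoid_add)" by (induction s) (simp_all add: add.assoc)

lemma sum_delta2:
 fixes X :: "'b::comm_monoid_add"
 assumes "finite A" "finite B"
 shows "(SUM k:A. SUM l:B. if k = a then if l = b then X else 0 else 0) = (if a \<in> A & b \<in> B then X else 0)"
proof -
 have "(SUM k:A. SUM l:B. if k = a then if l = b then X else 0 else 0) = (SUM k:A. if k = a then (if b \<in> B then X else 0) else 0)"
  by (intro sum.cong refl) (use assms in simp)
 then show ?thesis using assms by simp
qed

lemma sum_scaled_delta:
 fixes r :: nat
 assumes "a < r"
 shows "(SUM i<r. cnj (if a = i then of_real c else 0) * (if b = i then of_real c else 0)) = (if a = b then cof (c * c) else 0)"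
proof -
 have "(SUM i<r. cnj (if a = i then of_real c else 0) * (if b = i then of_real c else 0)) = (SUM i<r. if i = a then (if a = b then cof (c * c) else 0) else 0)"
  by (intro sum.cong refl) auto
 also have "... = (if a = b then cof (c * c) else 0)" using assms by (subst sum.delta) auto
 finally show ?thesis .
qed

lemma mat1_index [simp]: "mat1 v $$ (0, 0) = v" "dim_row (mat1 v) = 1" "dim_col (mat1 v) = 1"
 "mat1 v \<in> carrier_mat 1 1" by (simp_all add: mat1_def)

text \<open>Entrywise comparison of matrices of even size, where each index i is the entry i mod 2 of the block i div 2.\<close>
lemma eq_mat_double:
 assumes "dim_row X = 2 * r" "dim_col X = 2 * r" "dim_row Y = 2 * r" "dim_col Y = 2 * r"
  and "!!i j. i < 2 * r ==> j < 2 * r ==> i div 2 < r ==> j div 2 < r ==> X $$ (i, j) = Y $$ (i, j)"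
 shows "X = Y" by (rule eq_matI) (use assms in auto)

section \<open>Matrix orderings\<close>

locale mord =
 fixes C :: "nat => ('i::finite, 'o::finite) vns mat set"
 assumes sub: "X \<in> C r ==> X \<in> herm r"
  and add: "X \<in> C r ==> Y \<in> C r ==> X + Y \<in> C r"
  and comp: "X \<in> C s ==> alpha \<in> carrier_mat s r ==> compress alpha X \<in> C r"
  and pos: "mat1 (vP a b x y) \<in> C 1"
  and pos': "mat1 (perp (vP a b x y)) \<in> C 1"
begin

lemma posv_add:
 assumes "mat1 v \<in> C 1" "mat1 w \<in> C 1"
 shows "mat1 (v + w) \<in> C 1"
proof -
 have "mat1 (v + w) = mat1 v + mat1 w" by (rule eq_matI) (auto simp: mat1_def)
 then show ?thesis using add[OF assms] by simp
qed

lemma rank_one: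
 assumes "mat1 v \<in> C 1"
 shows "Matrix.mat r r (%(a, b). vscale (cnj (rho a) * rho b) v) \<in> C r"
proof -
 have "compress (Matrix.mat 1 r (%(_, b). rho b)) (mat1 v) \<in> C r" by (rule comp[OF assms]) simp
 moreover have "compress (Matrix.mat 1 r (%(_, b). rho b)) (mat1 v) = Matrix.mat r r (%(a, b). vscale (cnj (rho a) * rho b) v)"
  by (rule eq_matI) (simp_all add: compress_def)
 ultimately show ?thesis by simp
qed

lemma psd:
 assumes v: "mat1 v \<in> C 1" and "finite I"
 shows "Matrix.mat r r (%(a, b). vscale (SUM i:I. cnj (rho i a) * rho i b) v) \<in> C r" using \<open>finite I\<close>
proof (induction I)
 case empty
 have "Matrix.mat r r (%(a, b). vscale (SUM i:{}. cnj (rho i a) * rho i b) v) = Matrix.mat r r (%(a, b). vscale (cnj 0 * 0) v)" by (rule eq_matI) auto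
 then show ?case using rank_one[OF v, of r "%_. 0"] by (simp only:)
next
 case (insert i I)
 have eq: "Matrix.mat r r (%(a, b). vscale (SUM i:insert i I. cnj (rho i a) * rho i b) v)
  = Matrix.mat r r (%(a, b). vscale (cnj (rho i a) * rho i b) v) + Matrix.mat r r (%(a, b). vscale (SUM i:I. cnj (rho i a) * rho i b) v)"
  by (rule eq_matI) (use insert in "simp_all add: vns.scale_left_distrib")
 show ?case unfolding eq by (rule add[OF rank_one[OF v] insert.IH])
qed

lemma posv_unit: "mat1 vunit \<in> C 1"
proof -
 have "mat1 (vP a b x y + perp (vP a b x y)) \<in> C 1" for a b x y by (rule posv_add[OF pos pos'])
 then show ?thesis by (simp add: perp_def)
qed

lemma posv_gen: "mat1 (gen q) \<in> C 1"
proof (cases q)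
 case (Some t)
 then show ?thesis using pos by (cases t) simp
qed (use posv_unit in simp)

lemma zero: "Matrix.mat r r (%_. 0) \<in> C r"
proof -
 have "Matrix.mat r r (%(a, b). vscale (cnj 0 * 0) vunit) = Matrix.mat r r (%_. 0 :: ('i, 'o) vns)" by (rule eq_matI) auto
 then show ?thesis using rank_one[OF posv_unit, of r "%_. 0"] by (simp only:)
qed

lemma posv_perp_gen: "mat1 (perp (gen q)) \<in> C 1"
proof (cases q)
 case None
 then show ?thesis using zero[of 1] by (simp add: perp_def mat1_def)
next
 case (Some t)
 then show ?thesis using pos' by (cases t) simp
qed

lemma scale:
 assumes X: "X \<in> C r" and t: "t >= 0"
 shows "smat t X \<in> C r"
proof -
 let ?a = "Matrix.mat r r (%(i, j). if i = j then of_real (sqrt t) else 0)"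
 have "compress ?a X \<in> C r" using X by (rule comp) simp
 moreover have "compress ?a X = smat t X"
 proof (rule eq_matI)
  note D = hermD[OF sub[OF X]]
  fix i j assume "i < dim_row (smat t X)" "j < dim_col (smat t X)"
  then have ij: "i < r" "j < r" using D by auto
  have "compress ?a X $$ (i, j) = (SUM k<r. SUM l<r. if k = i then if l = j then vscale (of_real t) (X $$ (i, j)) else 0 else 0)"
   using t ij by (subst compress_index[of _ r r]) (auto intro!: sum.cong simp flip: of_real_mult)
  also have "... = vscale (of_real t) (X $$ (i, j))" using ij by (subst sum_delta2) auto
  finally show "compress ?a X $$ (i, j) = smat t X $$ (i, j)" using ij D by (simp add: vscale_of_real)
 qed (use hermD[OF sub[OF X]] in auto)
 ultimately show ?thesis by simp
qed

text \<open>The rank-one squares of the vectors e_i + (A i j / 2) e_j, over all i and j, sum to A plus a nonnegative diagonal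
matrix.\<close>
lemma dd:
 assumes A: "!!a b. a < r ==> b < r ==> A b a = cnj (A a b)" and v: "mat1 v \<in> C 1"
 shows "EX c>=0. ALL c'>=c. Matrix.mat r r (%(a, b). vscale (A a b + (if a = b then cof c' else 0)) v) \<in> C r"
proof -
 define s where "s a = (SUM i<r. (cmod (A i a))\<^sup>2 / 4)" for a
 define c where "c = real r + (SUM a<r. s a)"
 have s0: "s a >= 0" for a by (auto simp: s_def intro: sum_nonneg)
 define rho where "rho = (%(i, j) a. (if a = i then 1 else 0) + (if a = j then A i j / 2 else 0))"
 have sumr: "(SUM q:{..<r} \<times> {..<r}. cnj (rho q a) * rho q b) = A a b + (if a = b then of_real (real r + s a) else 0)"
  if ab: "a < r" "b < r" for a b
 proof -
  have "(SUM q:{..<r} \<times> {..<r}. cnj (rho q a) * rho q b) = (SUM i<r. SUM j<r. cnj (rho (i, j) a) * rho (i, j) b)"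
   by (simp add: sum.cartesian_product case_prod_unfold)
  also have "... = (SUM i<r. SUM j<r. (if i = a then if a = b then 1 else 0 else 0)
    + (if i = a then if j = b then A a b / 2 else 0 else 0)
    + (if i = b then if j = a then cnj (A b a) / 2 else 0 else 0)
    + (if j = a then if a = b then cnj (A i a) * A i a / 4 else 0 else 0))" by (intro sum.cong refl) (auto simp: rho_def algebra_simps)
  also have "... = (SUM i<r. SUM j<r. if i = a then if a = b then 1 else 0 else 0)
    + (SUM i<r. SUM j<r. if i = a then if j = b then A a b / 2 else 0 else 0)
    + (SUM i<r. SUM j<r. if i = b then if j = a then cnj (A b a) / 2 else 0 else 0)
    + (SUM i<r. SUM j<r. if j = a then if a = b then cnj (A i a) * A i a / 4 else 0 else 0)" by (simp add: sum.distrib)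
  also have "(SUM i<r. SUM j<r. if i = a then if a = b then 1 else 0 else 0) = (if a = b then cof (real r) else 0)" by (subst sum.swap) (use ab in simp)
  also have "(SUM i<r. SUM j<r. if i = a then if j = b then A a b / 2 else 0 else 0) = A a b / 2" using ab by (subst sum_delta2) auto
  also have "(SUM i<r. SUM j<r. if i = b then if j = a then cnj (A b a) / 2 else 0 else 0) = A a b / 2" using ab A[OF ab] by (subst sum_delta2) auto
  also have "(SUM i<r. SUM j<r. if j = a then if a = b then cnj (A i a) * A i a / 4 else 0 else 0) = (if a = b then of_real (s a) else 0)"
   using ab by (simp add: s_def complex_norm_square[unfolded of_real_power] mult.commute)
  finally show ?thesis by simp
 qed
 have "Matrix.mat r r (%(a, b). vscale (A a b + (if a = b then cof c' else 0)) v) \<in> C r" if c': "c' >= c" for c'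
 proof -
  define z where "z a = c' - (real r + s a)" for a
  define tau where "tau i a = (if a = i then cof (sqrt (z a)) else 0)" for i a :: nat
  have le: "0 <= z a" if "a < r" for a using c' member_le_sum[of a "{..<r}" s] that s0 by (simp add: c_def z_def)
  have t: "(SUM i<r. cnj (tau i a) * tau i b) = (if a = b then of_real (z a) else 0)" if ab: "a < r" "b < r" for a b
  proof -
   have sq: "cof (sqrt (z a)) * cof (sqrt (z a)) = of_real (z a)" if "a < r" for a
    using le[OF that] by (metis of_real_mult real_sqrt_mult_self abs_of_nonneg)
   have "(SUM i<r. cnj (tau i a) * tau i b) = (SUM i<r. if i = a then (if a = b then of_real (z a) else 0) else 0)"
    by (intro sum.cong refl) (use ab in "auto simp: tau_def sq")
   also have "... = (if a = b then of_real (z a) else 0)" using ab by (subst sum.delta) auto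
   finally show ?thesis .
  qed
  have eq: "Matrix.mat r r (%(a, b). vscale (A a b + (if a = b then cof c' else 0)) v)
   = Matrix.mat r r (%(a, b). vscale (SUM q:{..<r} \<times> {..<r}. cnj (rho q a) * rho q b) v)
   + Matrix.mat r r (%(a, b). vscale (SUM i<r. cnj (tau i a) * tau i b) v)" by (rule eq_matI) (auto simp: sumr t z_def vns.scale_left_distrib[symmetric])
  show ?thesis unfolding eq by (intro add psd[OF v]) auto
 qed
 moreover have "c >= 0" using s0 by (simp add: c_def sum_nonneg)
 ultimately show ?thesis by blast
qed

lemma dom:
 assumes "mat1 v \<in> C 1"
 shows "EX c>0. Matrix.mat r r (%(a, b). vscale ((if a = b then cof c else 0) - (SUM k<s. cnj (alpha k a) * alpha k b)) v) \<in> C r"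
proof -
 obtain c where "c >= 0" and c: "ALL c'>=c. Matrix.mat r r (%(a, b). vscale (- (SUM k<s. cnj (alpha k a) * alpha k b) + (if a = b then cof c' else 0)) v) \<in> C r"
  using dd[OF _ assms, of r "%a b. - (SUM k<s. cnj (alpha k a) * alpha k b)"] by (auto simp: mult.commute)
 show ?thesis using c[rule_format, of "c + 1"] \<open>c >= 0\<close> by (intro exI[of _ "c + 1"]) (simp add: add.commute)
qed

lemma sum_mat:
 assumes "finite I" "!!i. i \<in> I ==> Matrix.mat r r (X i) \<in> C r"
 shows "Matrix.mat r r (%q. SUM i:I. X i q) \<in> C r" using assms
proof (induction I)
 case empty show ?case using zero by simp
next
 case (insert i I)
 have "Matrix.mat r r (%q. SUM i:insert i I. X i q) = Matrix.mat r r (X i) + Matrix.mat r r (%q. SUM i:I. X i q)"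
  by (rule eq_matI) (use insert in simp_all)
 then show ?case using add[OF insert.prems[of i] insert.IH] insert by auto
qed

lemma unit_mem:
 assumes "eps >= 0"
 shows "unit_mat eps r \<in> C r"
proof -
 have "Matrix.mat r r (%(a, b). vscale (SUM i<r. cnj (if a = i then of_real (sqrt eps) else 0) * (if b = i then of_real (sqrt eps) else 0)) vunit) \<in> C r"
  by (rule psd[OF posv_unit]) simp
 moreover have "Matrix.mat r r (%(a, b). vscale (SUM i<r. cnj (if a = i then of_real (sqrt eps) else 0) * (if b = i then of_real (sqrt eps) else 0)) vunit) = (unit_mat eps r :: ('i, 'o) vns mat)"
  using assms by (intro eq_matI) (simp_all add: sum_scaled_delta vscale_of_real del: of_real_mult)
 ultimately show ?thesis by (simp only:)
qed

text \<open>X is a sum of generators with hermitian coefficient matrices A q; dd applies to each of them, and every generator lies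
below the unit.\<close>
lemma order_unit:
 assumes X: "X \<in> herm r"
 shows "EX c>=0. ALL c'>=c. X + unit_mat c' r \<in> C r"
proof -
 define A where "A q a b = (rep_vns (X $$ (a, b)) q + cnj (rep_vns (X $$ (b, a)) q)) / 2" for q a b
 have X_eq: "X $$ (a, b) = (SUM q:UNIV. vscale (A q a b) (gen q))" if "a < r" "b < r" for a b
 proof -
  have 1: "X $$ (a, b) = (SUM q:UNIV. vscale (cnj (rep_vns (X $$ (b, a)) q)) (gen q))"
   using arg_cong[OF vns_expand[of "X $$ (b, a)"], of vstar] hermD(4)[OF X that] by (simp add: vstar_sum vstar_vscale)
  have "(2::real) *\<^sub>R X $$ (a, b) = X $$ (a, b) + X $$ (a, b)" by (rule scaleR_2)
  also have "... = (SUM q:UNIV. vscale (rep_vns (X $$ (a, b)) q) (gen q)) + (SUM q:UNIV. vscale (cnj (rep_vns (X $$ (b, a)) q)) (gen q))"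
   using 1 vns_expand[of "X $$ (a, b)"] by argo
  also have "... = (SUM q:UNIV. vscale (2 * A q a b) (gen q))"
  proof -
   have "2 * A q a b = rep_vns (X $$ (a, b)) q + cnj (rep_vns (X $$ (b, a)) q)" for q by (simp add: A_def)
   then show ?thesis by (simp only: sum.distrib[symmetric] vns.scale_left_distrib[symmetric])
  qed
  also have "... = vscale 2 (SUM q:UNIV. vscale (A q a b) (gen q))" by (simp add: vns.scale_sum_right)
  also have "... = 2 *\<^sub>R (SUM q:UNIV. vscale (A q a b) (gen q))" using vscale_of_real[of 2] by simp
  finally show ?thesis by simp
 qed
 have "EX c>=0. ALL c'>=c. Matrix.mat r r (%(a, b). vscale (A q a b + (if a = b then cof c' else 0)) (gen q)) \<in> C r" for q
  by (rule dd[OF _ posv_gen]) (simp add: A_def)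
 then have "ALL q. EX c. c >= 0 & (ALL c'>=c. Matrix.mat r r (%(a, b). vscale (A q a b + (if a = b then cof c' else 0)) (gen q)) \<in> C r)" by blast
 from choice[OF this] obtain c where c0: "!!q. c q >= 0" and c: "!!q. Matrix.mat r r (%(a, b). vscale (A q a b + (if a = b then cof (c q) else 0)) (gen q)) \<in> C r"
  by blast
 have X1: "X + unit_mat (SUM q:UNIV. c q) r \<in> C r"
 proof -
  have "Matrix.mat r r (%(a, b). vscale (SUM i<r. cnj (if a = i then of_real (sqrt (c q)) else 0) * (if b = i then of_real (sqrt (c q)) else 0)) (perp (gen q))) \<in> C r" for q
   by (rule psd[OF posv_perp_gen]) simp
  moreover have "Matrix.mat r r (%(a, b). vscale (SUM i<r. cnj (if a = i then of_real (sqrt (c q)) else 0) * (if b = i then of_real (sqrt (c q)) else 0)) (perp (gen q)))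
   = Matrix.mat r r (%(a, b). vscale (if a = b then cof (c q) else 0) (perp (gen q)))" for q
   using c0[of q] by (intro eq_matI) (simp_all add: sum_scaled_delta del: of_real_mult)
  ultimately have 2: "Matrix.mat r r (%(a, b). vscale (if a = b then cof (c q) else 0) (perp (gen q))) \<in> C r" for q by (simp only:)
  have "X + unit_mat (SUM q:UNIV. c q) r =
   Matrix.mat r r (%p. SUM q:UNIV. case p of (a, b) => vscale (A q a b + (if a = b then cof (c q) else 0)) (gen q))
   + Matrix.mat r r (%p. SUM q:UNIV. case p of (a, b) => vscale (if a = b then cof (c q) else 0) (perp (gen q)))"
  proof (rule eq_matI)
   fix i j assume "i < dim_row (Matrix.mat r r (%p. SUM q:UNIV. case p of (a, b) => vscale (A q a b + (if a = b then cof (c q) else 0)) (gen q)) + Matrix.mat r r (%p. SUM q:UNIV. case p of (a, b) => vscale (if a = b then cof (c q) else 0) (perp (gen q))))"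
    "j < dim_col (Matrix.mat r r (%p. SUM q:UNIV. case p of (a, b) => vscale (A q a b + (if a = b then cof (c q) else 0)) (gen q)) + Matrix.mat r r (%p. SUM q:UNIV. case p of (a, b) => vscale (if a = b then cof (c q) else 0) (perp (gen q))))"
   then have ij: "i < r" "j < r" by auto
   have e: "vscale (if i = j then cof (c q) else 0) (gen q) + vscale (if i = j then cof (c q) else 0) (perp (gen q))
     = (if i = j then c q *\<^sub>R vunit else 0)" for q by (simp add: perp_def algebra_simps vscale_of_real)
   have "(X + unit_mat (SUM q:UNIV. c q) r) $$ (i, j) = (SUM q:UNIV. vscale (A q i j) (gen q)) + (SUM q:UNIV. if i = j then c q *\<^sub>R vunit else 0)"
    using ij hermD[OF X] by (simp add: X_eq scaleR_sum_left)
   also have "... = (SUM q:UNIV. vscale (A q i j + (if i = j then cof (c q) else 0)) (gen q))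
     + (SUM q:UNIV. vscale (if i = j then cof (c q) else 0) (perp (gen q)))"
    unfolding sum.distrib[symmetric] by (intro sum.cong refl) (simp only: vns.scale_left_distrib e[symmetric] add.assoc)
   finally show "(X + unit_mat (SUM q:UNIV. c q) r) $$ (i, j) = (Matrix.mat r r (%p. SUM q:UNIV. case p of (a, b) => vscale (A q a b + (if a = b then cof (c q) else 0)) (gen q)) + Matrix.mat r r (%p. SUM q:UNIV. case p of (a, b) => vscale (if a = b then cof (c q) else 0) (perp (gen q)))) $$ (i, j)"
    using ij by simp
  qed (use hermD[OF X] in auto)
  then show ?thesis using add[OF sum_mat sum_mat, OF finite c finite 2] by (simp only:)
 qed
 have "X + unit_mat c' r \<in> C r" if "c' >= (SUM q:UNIV. c q)" for c'
 proof -
  have "unit_mat (c' - (SUM q:UNIV. c q)) r \<in> C r" using that by (intro unit_mem) auto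
  then have "X + unit_mat (SUM q:UNIV. c q) r + unit_mat (c' - (SUM q:UNIV. c q)) r \<in> C r" by (rule add[OF X1])
  moreover have "X + unit_mat (SUM q:UNIV. c q) r + unit_mat (c' - (SUM q:UNIV. c q)) r = X + unit_mat c' r"
   by (rule eq_matI) (use hermD[OF X] in "auto simp: scaleR_left_distrib[symmetric] add.assoc")
  ultimately show ?thesis by simp
 qed
 then show ?thesis using c0 by (intro exI[of _ "SUM q:UNIV. c q"]) (auto intro: sum_nonneg)
qed

text \<open>The direct sum of two positive matrices, with its blocks interleaved to match the index convention of the doubled
matrices.\<close>
lemma interleave:
 assumes Z: "Z0 \<in> C r" "Z1 \<in> C r"
 shows "dmat r (%(i, j). if i mod 2 = j mod 2 then (if even i then Z0 else Z1) $$ (i div 2, j div 2) else 0) \<in> C (2 * r)" (is "?R \<in> _")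
proof -
 define kappa where "kappa s = Matrix.mat r (2 * r) (%(i, j). if j mod 2 = s & j div 2 = i then 1 else 0 :: complex)" for s :: nat
 have k: "kappa s \<in> carrier_mat r (2 * r)" for s by (simp add: kappa_def)
 have ent: "compress (kappa s) Z $$ (i, j) = (if i mod 2 = s & j mod 2 = s then Z $$ (i div 2, j div 2) else 0)"
  if ij: "i < 2 * r" "j < 2 * r" for s i j and Z :: "('i, 'o) vns mat"
 proof -
  have "compress (kappa s) Z $$ (i, j) = (SUM k<r. SUM l<r. if k = i div 2 then if l = j div 2 then
    (if i mod 2 = s & j mod 2 = s then Z $$ (i div 2, j div 2) else 0) else 0 else 0)"
   unfolding compress_index[OF k ij] using ij by (intro sum.cong refl) (auto simp: kappa_def)
  also have "... = (if i mod 2 = s & j mod 2 = s then Z $$ (i div 2, j div 2) else 0)" using ij by (subst sum_delta2) auto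
  finally show ?thesis .
 qed
 have "compress (kappa 0) Z0 + compress (kappa 1) Z1 \<in> C (2 * r)" by (rule add[OF comp[OF Z(1) k] comp[OF Z(2) k]])
 moreover have "compress (kappa 0) Z0 + compress (kappa 1) Z1 = ?R"
 proof (rule eq_mat_double[of _ r])
  fix i j assume ij: "i < 2 * r" "j < 2 * r"
  have c: "i mod 2 = 0 \<or> i mod 2 = 1" "j mod 2 = 0 \<or> j mod 2 = 1" by auto
  have "(compress (kappa 0) Z0 + compress (kappa 1) Z1) $$ (i, j) = compress (kappa 0) Z0 $$ (i, j) + compress (kappa 1) Z1 $$ (i, j)"
   using ij k[of 1] by (intro index_add_mat) auto
  also have "... = (if i mod 2 = j mod 2 then if i mod 2 = 0 then Z0 $$ (i div 2, j div 2) else Z1 $$ (i div 2, j div 2) else 0)"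
   unfolding ent[OF ij] using c by (elim disjE) simp_all
  also have "... = ?R $$ (i, j)" using ij by (auto simp: even_iff_mod_2_eq_zero)
  finally show "(compress (kappa 0) Z0 + compress (kappa 1) Z1) $$ (i, j) = ?R $$ (i, j)" .
 qed (use k[of 0] k[of 1] in auto)
 ultimately show ?thesis by simp
qed

lemma spread:
 assumes X: "X \<in> C r"
 shows "dmat r (%(i, j). X $$ (i div 2, j div 2)) \<in> C (2 * r)"
proof -
 define D where "D = Matrix.mat r (2 * r) (%(i, j). if j div 2 = i then 1 else 0 :: complex)"
 have k: "D \<in> carrier_mat r (2 * r)" by (simp add: D_def)
 have "compress D X = dmat r (%(i, j). X $$ (i div 2, j div 2))"
 proof (rule eq_matI)
  fix i j assume "i < dim_row (dmat r (%(i, j). X $$ (i div 2, j div 2)))"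
   "j < dim_col (dmat r (%(i, j). X $$ (i div 2, j div 2)))"
  then have ij: "i < 2 * r" "j < 2 * r" by auto
  have "compress D X $$ (i, j) = (SUM k<r. SUM l<r. if k = i div 2 then if l = j div 2 then X $$ (i div 2, j div 2) else 0 else 0)"
   unfolding compress_index[OF k ij] using ij by (intro sum.cong refl) (auto simp: D_def)
  also have "... = X $$ (i div 2, j div 2)" using ij by (subst sum_delta2) auto
  finally show "compress D X $$ (i, j) = dmat r (%(i, j). X $$ (i div 2, j div 2)) $$ (i, j)" using ij by simp
 qed (use k in auto)
 then show ?thesis using comp[OF X k] by simp
qed

end

lemma eq_iff_half: "i = j \<longleftrightarrow> i div 2 = j div 2 & i mod 2 = j mod 2" for i j :: nat by (metis div_mult_mod_eq)

lemma mod2_cases: "i mod 2 = 0 \<or> i mod 2 = (1::nat)" by auto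

lemma scaleR_vscale: "r *\<^sub>R vscale c x = vscale c (r *\<^sub>R x)" by (simp flip: vscale_of_real add: mult.commute)

text \<open>The doubled matrix that occurs in the definition of the projection ordering: x tensor J_2, with the weights \<epsilon>
and t on p and its complement in crossed order on the diagonal.\<close>
definition ymat :: "nat => ('i::finite, 'o::finite) vns => ('i, 'o) vns mat => real => real => ('i, 'o) vns mat" where
 "ymat r p X eps t = dmat r (%(i, j). X $$ (i div 2, j div 2) +
   (if i div 2 = j div 2 & i mod 2 = j mod 2
   then (if i mod 2 = 0 then eps *\<^sub>R p + t *\<^sub>R perp p else eps *\<^sub>R perp p + t *\<^sub>R p) else 0))"

lemma ymat_dims [simp]: "dim_row (ymat r p X eps t) = 2 * r" "dim_col (ymat r p X eps t) = 2 * r" by (simp_all add: ymat_def)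

lemma ymat_eq:
 assumes X: "X \<in> carrier_mat r r"
 shows "tensor_right X J2 + tensor_left (real_id eps r) (dsum p (perp p))
    + tensor_left (real_id t r) (dsum (perp p) p) = ymat r p X eps t"
proof (rule eq_matI)
 fix i j assume "i < dim_row (ymat r p X eps t)" "j < dim_col (ymat r p X eps t)"
 then have ij: "i < 2 * r" "j < 2 * r" "i div 2 < r" "j div 2 < r" "i < r * 2" "j < r * 2" by auto
 have d: "dim_row (dsum v w) = 2" "dim_col (dsum v w) = 2" for v w :: "('a, 'b) vns" by (simp_all add: dsum_def mat_diag_def)
 have dsum_ent: "dsum v w $$ (a mod 2, b mod 2) = (if a mod 2 = b mod 2 then if a mod 2 = 0 then v else w else 0)"
  for v w :: "('a, 'b) vns" and a b :: nat using mod2_cases[of a] mod2_cases[of b] by (auto simp: dsum_def mat_diag_def)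
 have rid: "real_id c r $$ (i div 2, j div 2) = (if i div 2 = j div 2 then of_real c else 0)" for c using ij by (simp add: real_id_def)
 have rd: "dim_row (real_id c r) = r" "dim_col (real_id c r) = r" for c by (simp_all add: real_id_def)
 show "(tensor_right X J2 + tensor_left (real_id eps r) (dsum p (perp p))
    + tensor_left (real_id t r) (dsum (perp p) p)) $$ (i, j) = ymat r p X eps t $$ (i, j)"
  using ij X by (simp add: kron_def J2_def d rd rid dsum_ent ymat_def vscale_of_real)
qed (use X in "auto simp: kron_def J2_def real_id_def dsum_def mat_diag_def")

lemma proj_ord_alt:
 "proj_ord C p r = {X \<in> herm r. \<forall>eps>0. EX t>0. ymat r p X eps t \<in> C (2 * r)}"
 unfolding proj_ord_def by (intro Collect_cong conj_cong refl) (simp add: ymat_eq hermD(1))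

lemma proj_ordD:
 "X \<in> proj_ord C p r ==> eps > 0 ==> EX t>0. ymat r p X eps t \<in> C (2 * r)" unfolding proj_ord_alt by blast

lemma scaleR_double: "(2 * h) *\<^sub>R v = h *\<^sub>R v + h *\<^sub>R v" "(4 * h) *\<^sub>R v = h *\<^sub>R v + h *\<^sub>R v + (h *\<^sub>R v + h *\<^sub>R v)"
 for v :: "'a::real_vector" by (simp_all flip: scaleR_left_distrib)

lemma ymat_herm:
 assumes "X \<in> herm r" "vstar p = p"
 shows "ymat r p X eps t \<in> herm (2 * r)"
proof (rule hermI)
 fix i j assume "i < 2 * r" "j < 2 * r"
 then show "ymat r p X eps t $$ (i, j) = vstar (ymat r p X eps t $$ (j, i))" using hermD(4)[OF assms(1), of "i div 2" "j div 2"] assms(2)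
  by (auto simp: ymat_def vstar_add vstar_scaleR)
qed simp_all

definition arch :: "(nat => ('i::finite, 'o::finite) vns mat set) => bool" where
 "arch C \<longleftrightarrow> (ALL r. ALL X:herm r. (\<forall>eps>0. X + unit_mat eps r \<in> C r) --> X \<in> C r)"

definition clo :: "(nat => ('i::finite, 'o::finite) vns mat set) => nat => ('i, 'o) vns mat set" where
 "clo C r = {X \<in> herm r. \<forall>eps>0. X + unit_mat eps r \<in> C r}"

lemma compress_unit_index:
 assumes a: "alpha \<in> carrier_mat s r" and ij: "i < r" "j < r"
 shows "compress alpha (unit_mat delta s) $$ (i, j) = vscale (of_real delta * (SUM k<s. cnj (alpha $$ (k, i)) * alpha $$ (k, j))) vunit"
proof -
 have "compress alpha (unit_mat delta s) $$ (i, j) =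
  (SUM k<s. SUM l<s. if l = k then vscale (of_real delta * (cnj (alpha $$ (k, i)) * alpha $$ (k, j))) vunit else 0)"
  unfolding compress_index[OF a ij] by (intro sum.cong refl) (auto simp flip: vscale_of_real simp: mult.commute)
 also have "... = (SUM k<s. vscale (of_real delta * (cnj (alpha $$ (k, i)) * alpha $$ (k, j))) vunit)" by (intro sum.cong refl) (subst sum.delta, auto)
 finally show ?thesis by (simp only: vns.scale_sum_left sum_distrib_left)
qed

context mord begin

lemma block:
 fixes c :: "nat => real"
 assumes v: "mat1 v \<in> C 1"
 shows "dmat r (%(i, j). if i div 2 = j div 2 then (c (i mod 2) * c (j mod 2)) *\<^sub>R v else 0) \<in> C (2 * r)"
proof -
 define rho where "rho k i = (if i div 2 = k then cof (c (i mod 2)) else 0)" for k i :: nat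
 have e: "(SUM k<r. cnj (rho k i) * rho k j) = (if i div 2 = j div 2 then of_real (c (i mod 2) * c (j mod 2)) else 0)"
  if ij: "i < 2 * r" for i j
 proof -
  have "(SUM k<r. cnj (rho k i) * rho k j) = (SUM k<r. if k = i div 2 then (if i div 2 = j div 2 then of_real (c (i mod 2) * c (j mod 2)) else 0) else 0)"
   by (intro sum.cong refl) (auto simp: rho_def)
  also have "... = (if i div 2 = j div 2 then of_real (c (i mod 2) * c (j mod 2)) else 0)" using ij by (subst sum.delta) auto
  finally show ?thesis .
 qed
 have "dmat r (%(i, j). vscale (SUM k<r. cnj (rho k i) * rho k j) v) \<in> C (2 * r)" by (rule psd[OF v]) simp
 also have "dmat r (%(i, j). vscale (SUM k<r. cnj (rho k i) * rho k j) v) =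
  dmat r (%(i, j). if i div 2 = j div 2 then (c (i mod 2) * c (j mod 2)) *\<^sub>R v else 0)"
  by (rule eq_matI) (auto simp: e vscale_of_real simp del: of_real_mult)
 finally show ?thesis .
qed

lemma clo_mono: "X \<in> C r ==> X \<in> clo C r" unfolding clo_def using sub add unit_mem by simp

lemma mord_clo: "mord (clo C)"
proof
 show "X \<in> herm r" if "X \<in> clo C r" for X r using that by (simp add: clo_def)
 show "mat1 (vP a b x y) \<in> clo C 1" "mat1 (perp (vP a b x y)) \<in> clo C 1" for a b x y by (intro clo_mono pos pos')+
 show "X + Y \<in> clo C r" if "X \<in> clo C r" "Y \<in> clo C r" for X Y r unfolding clo_def
 proof (intro CollectI conjI allI impI)
  have h: "X \<in> herm r" "Y \<in> herm r" using that by (auto simp: clo_def)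
  then show "X + Y \<in> herm r" by (rule herm_add)
  fix eps :: real assume "eps > 0"
  then have "X + unit_mat (eps/2) r \<in> C r" "Y + unit_mat (eps/2) r \<in> C r" using that by (auto simp: clo_def)
  then have "(X + unit_mat (eps/2) r) + (Y + unit_mat (eps/2) r) \<in> C r" by (rule add)
  also have "(X + unit_mat (eps/2) r) + (Y + unit_mat (eps/2) r) = X + Y + unit_mat eps r"
   by (rule eq_matI) (use hermD[OF h(1)] hermD[OF h(2)] in "auto simp: scaleR_left_distrib[symmetric]")
  finally show "X + Y + unit_mat eps r \<in> C r" .
 qed
 show "compress alpha X \<in> clo C r" if X: "X \<in> clo C s" and a: "alpha \<in> carrier_mat s r" for X s alpha r unfolding clo_def
 proof (intro CollectI conjI allI impI)
  have h: "X \<in> herm s" using X by (auto simp: clo_def)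
  then show "compress alpha X \<in> herm r" using a by (rule compress_herm)
  fix eps :: real assume e: "eps > 0"
  obtain c where c: "c > 0" and M: "Matrix.mat r r (%(i, j). vscale ((if i = j then cof c else 0) - (SUM k<s. cnj (alpha $$ (k, i)) * alpha $$ (k, j))) vunit) \<in> C r"
   (is "?M \<in> C r") using dom[OF posv_unit, where r = r and s = s and alpha = "%k i. alpha $$ (k, i)"] by blast
  define delta where "delta = eps / c"
  have d: "delta > 0" "delta * c = eps" using c e by (auto simp: delta_def)
  have "X + unit_mat delta s \<in> C s" using X d by (auto simp: clo_def)
  from comp[OF this a] have "compress alpha (X + unit_mat delta s) + smat delta ?M \<in> C r" by (rule add) (use d M in "auto intro: scale")
  also have "compress alpha (X + unit_mat delta s) + smat delta ?M = compress alpha X + unit_mat eps r"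
  proof (rule eq_matI)
   fix i j assume "i < dim_row (compress alpha X + unit_mat eps r)" "j < dim_col (compress alpha X + unit_mat eps r)"
   then have ij: "i < r" "j < r" by auto
   have "cof delta * cof c = of_real eps" using d by (metis of_real_mult)
   then show "(compress alpha (X + unit_mat delta s) + smat delta ?M) $$ (i, j) = (compress alpha X + unit_mat eps r) $$ (i, j)"
    using ij a hermD[OF h] by (simp add: compress_add[of _ s _ _ r] compress_unit_index[of _ s r] right_diff_distrib
      vns.scale_left_diff_distrib vns.scale_right_diff_distrib flip: vscale_of_real)
  qed (use a in auto)
  finally show "compress alpha X + unit_mat eps r \<in> C r" .
 qed
qed

lemma arch_clo: "arch (clo C)" unfolding arch_def
proof (intro allI ballI impI)
 fix r and X :: "('i, 'o) vns mat"
 assume X: "X \<in> herm r" and h: "\<forall>eps>0. X + unit_mat eps r \<in> clo C r"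
 have "X + unit_mat eps r \<in> C r" if e: "eps > 0" for eps
 proof -
  have "X + unit_mat (eps/2) r + unit_mat (eps/2) r \<in> C r" using h[rule_format, of "eps/2"] e unfolding clo_def by auto
  also have "X + unit_mat (eps/2) r + unit_mat (eps/2) r = X + unit_mat eps r"
   by (rule eq_matI) (use hermD[OF X] in "auto simp: scaleR_left_distrib[symmetric] add.assoc")
  finally show ?thesis .
 qed
 then show "X \<in> clo C r" using X by (simp add: clo_def)
qed

lemma proj_ord_mono:
 assumes X: "X \<in> C r" and p: "mat1 p \<in> C 1" "mat1 (perp p) \<in> C 1"
 shows "X \<in> proj_ord C p r" unfolding proj_ord_alt
proof (intro CollectI conjI allI impI exI[of _ 1])
 show "X \<in> herm r" using X by (rule sub)
 fix eps :: real assume e: "eps > 0"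
 let ?b = "%c v. dmat r (%(i, j). if i div 2 = j div 2 then (c (i mod 2) * c (j mod 2)) *\<^sub>R v else 0)"
 let ?c0 = "%s i. if i = 0 then sqrt s else (0::real)" and ?c1 = "%s i. if i = 0 then (0::real) else sqrt s"
 have "dmat r (%(i, j). X $$ (i div 2, j div 2)) +
   (?b (?c0 eps) p + (?b (?c1 eps) (perp p) + (?b (?c0 1) (perp p) + ?b (?c1 1) p))) \<in> C (2 * r)" by (intro add block p spread X)
 also have "dmat r (%(i, j). X $$ (i div 2, j div 2)) +
   (?b (?c0 eps) p + (?b (?c1 eps) (perp p) + (?b (?c0 1) (perp p) + ?b (?c1 1) p))) = ymat r p X eps 1"
 proof (rule eq_matI)
  fix i j assume "i < dim_row (ymat r p X eps 1)" "j < dim_col (ymat r p X eps 1)"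
  then show "(dmat r (%(i, j). X $$ (i div 2, j div 2)) +
   (?b (?c0 eps) p + (?b (?c1 eps) (perp p) + (?b (?c0 1) (perp p) + ?b (?c1 1) p)))) $$ (i, j) = ymat r p X eps 1 $$ (i, j)"
   using mod2_cases[of i] mod2_cases[of j] e by (elim disjE) (simp_all add: ymat_def)
 qed auto
 finally show "ymat r p X eps 1 \<in> C (2 * r)" .
qed auto

text \<open>Closure under compression is the only delicate point: \<alpha> may increase the \<epsilon>-term by the factor given by
its norm, and this is absorbed by choosing a smaller \<epsilon> and a larger t.\<close>
lemma mord_proj_ord:
 assumes p: "mat1 p \<in> C 1" "mat1 (perp p) \<in> C 1"
 shows "mord (proj_ord C p)"
proof
 show "X \<in> herm r" if "X \<in> proj_ord C p r" for X r using that by (simp add: proj_ord_def)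
 show "mat1 (vP a b x y) \<in> proj_ord C p 1" "mat1 (perp (vP a b x y)) \<in> proj_ord C p 1" for a b x y by (intro proj_ord_mono pos pos' p)+
 show "X + Y \<in> proj_ord C p r" if XY: "X \<in> proj_ord C p r" "Y \<in> proj_ord C p r" for X Y r unfolding proj_ord_alt
 proof (intro CollectI conjI allI impI)
  have hh: "X \<in> herm r" "Y \<in> herm r" using that by (auto simp: proj_ord_def)
  then show "X + Y \<in> herm r" by (rule herm_add)
  fix eps :: real assume e0: "eps > 0"
  define h where "h = eps / 2"
  have e: "h > 0" "eps = h + h" using e0 by (auto simp: h_def)
  then obtain t t' where t: "t > 0" "ymat r p X h t \<in> C (2 * r)" "t' > 0" "ymat r p Y h t' \<in> C (2 * r)"
   using proj_ordD[OF XY(1) e(1)] proj_ordD[OF XY(2) e(1)] by blast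
  have "ymat r p X h t + ymat r p Y h t' \<in> C (2 * r)" using t by (intro add)
  also have "ymat r p X h t + ymat r p Y h t' = ymat r p (X + Y) eps (t + t')"
  proof (rule eq_mat_double[of _ r])
   fix i j assume ij: "i < 2 * r" "j < 2 * r" "i div 2 < r" "j div 2 < r"
   then show "(ymat r p X h t + ymat r p Y h t') $$ (i, j) = ymat r p (X + Y) eps (t + t') $$ (i, j)" using hermD[OF hh(1)] hermD[OF hh(2)]
    by (simp add: ymat_def e(2) scaleR_left_distrib scaleR_double add_ac)
  qed auto
  finally show "EX t>0. ymat r p (X + Y) eps t \<in> C (2 * r)" using t by (intro exI[of _ "t + t'"]) auto
 qed
 show "compress alpha X \<in> proj_ord C p r" if X: "X \<in> proj_ord C p s" and a: "alpha \<in> carrier_mat s r" for X s alpha r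
  unfolding proj_ord_alt
 proof (intro CollectI conjI allI impI)
  have h: "X \<in> herm s" using X by (auto simp: proj_ord_def)
  then show "compress alpha X \<in> herm r" using a by (rule compress_herm)
  fix eps :: real assume e: "eps > 0"
  define S where "S i j = (SUM k<s. cnj (alpha $$ (k, i)) * alpha $$ (k, j))" for i j
  obtain c1 c2 where c1: "c1 > 0" "Matrix.mat r r (%(i, j). vscale ((if i = j then cof c1 else 0) - S i j) p) \<in> C r"
    and c2: "c2 > 0" "Matrix.mat r r (%(i, j). vscale ((if i = j then cof c2 else 0) - S i j) (perp p)) \<in> C r"
   using dom[OF p(1), where r = r and s = s and alpha = "%k i. alpha $$ (k, i)"]
    dom[OF p(2), where r = r and s = s and alpha = "%k i. alpha $$ (k, i)"] unfolding S_def by blast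
  define c where "c = c1 + c2"
  have c: "c > 0" using c1 c2 by (simp add: c_def)
  have diag: "Matrix.mat r r (%(i, j). vscale (if i = j then cof d else 0) v) \<in> C r" if "d >= 0" "mat1 v \<in> C 1" for d v
  proof -
   have "Matrix.mat r r (%(a, b). vscale (SUM i<r. cnj (if a = i then of_real (sqrt d) else 0) * (if b = i then of_real (sqrt d) else 0)) v) \<in> C r"
    by (rule psd[OF that(2)]) simp
   also have "Matrix.mat r r (%(a, b). vscale (SUM i<r. cnj (if a = i then of_real (sqrt d) else 0) * (if b = i then of_real (sqrt d) else 0)) v)
    = Matrix.mat r r (%(i, j). vscale (if i = j then cof d else 0) v)" using that(1) by (intro eq_matI) (simp_all add: sum_scaled_delta del: of_real_mult)
   finally show ?thesis .
  qed
  have Mp: "Matrix.mat r r (%(i, j). vscale ((if i = j then cof c else 0) - S i j) v) \<in> C r" (is "?M v \<in> _") if "v = p \<or> v = perp p" for v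
  proof -
   have "Matrix.mat r r (%(i, j). vscale ((if i = j then cof d else 0) - S i j) v) + Matrix.mat r r (%(i, j). vscale (if i = j then cof (c - d) else 0) v)
     = Matrix.mat r r (%(i, j). vscale ((if i = j then cof c else 0) - S i j) v)" for d by (rule eq_matI) (simp_all add: vns.scale_left_distrib[symmetric])
   then show ?thesis using add[OF c1(2) diag[of "c - c1" p]] add[OF c2(2) diag[of "c - c2" "perp p"]] c1(1) c2(1) p that by (auto simp: c_def)
  qed
  define delta where "delta = eps / c"
  have d: "delta > 0" "eps = delta * c" using c e by (auto simp: delta_def)
  obtain t where t: "t > 0" "ymat s p X delta t \<in> C (2 * s)" using proj_ordD[OF X d(1)] by blast
  define alpha2 where "alpha2 = Matrix.mat (2 * s) (2 * r) (%(i, j). if i mod 2 = j mod 2 then alpha $$ (i div 2, j div 2) else 0)"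
  have a2: "alpha2 \<in> carrier_mat (2 * s) (2 * r)" by (simp add: alpha2_def)
  let ?Z0 = "smat delta (?M p) + smat t (?M (perp p))"
  let ?Z1 = "smat delta (?M (perp p)) + smat t (?M p)"
  let ?I = "dmat r (%(i, j). if i mod 2 = j mod 2 then (if even i then ?Z0 else ?Z1) $$ (i div 2, j div 2) else 0)"
  have "compress alpha2 (ymat s p X delta t) + ?I \<in> C (2 * r)" using d t a2 Mp by (intro add comp[of _ "2 * s"] interleave scale) auto
  also have "compress alpha2 (ymat s p X delta t) + ?I = ymat r p (compress alpha X) eps (c * t)"
  proof (rule eq_mat_double[of _ r])
   fix i j assume ij: "i < 2 * r" "j < 2 * r" "i div 2 < r" "j div 2 < r"
   define D where "D = (if i mod 2 = 0 then delta *\<^sub>R p + t *\<^sub>R perp p else delta *\<^sub>R perp p + t *\<^sub>R p)"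
   let ?a = "%k i. alpha $$ (k, i div 2)"
   have "compress alpha2 (ymat s p X delta t) $$ (i, j) =
     (SUM k<s. SUM l<s. vscale (cnj (?a k i) * ?a l j) (X $$ (k, l)) + (if l = k then if i mod 2 = j mod 2 then vscale (cnj (?a k i) * ?a k j) D else 0 else 0))"
    unfolding compress_index[OF a2 ij(1,2)] sum_lessThan_double sum.distrib[symmetric]
   proof (intro sum.cong refl)
    fix k l assume kl: "k \<in> {..<s}" "l \<in> {..<s}"
    have A: "alpha2 $$ (2 * k, i) = (if i mod 2 = 0 then ?a k i else 0)" "alpha2 $$ (2 * k + 1, i) = (if i mod 2 = 1 then ?a k i else 0)"
     "alpha2 $$ (2 * l, j) = (if j mod 2 = 0 then ?a l j else 0)" "alpha2 $$ (2 * l + 1, j) = (if j mod 2 = 1 then ?a l j else 0)"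
     using kl ij(1,2) by (auto simp: alpha2_def)
    have B: "ymat s p X delta t $$ (2 * k, 2 * l) = X $$ (k, l) + (if k = l then delta *\<^sub>R p + t *\<^sub>R perp p else 0)"
     "ymat s p X delta t $$ (2 * k + 1, 2 * l) = X $$ (k, l)"
     "ymat s p X delta t $$ (2 * k, 2 * l + 1) = X $$ (k, l)"
     "ymat s p X delta t $$ (2 * k + 1, 2 * l + 1) = X $$ (k, l) + (if k = l then delta *\<^sub>R perp p + t *\<^sub>R p else 0)"
     using kl by (auto simp: ymat_def)
    show "vscale (cnj (alpha2 $$ (2 * k, i)) * alpha2 $$ (2 * l, j)) (ymat s p X delta t $$ (2 * k, 2 * l)) +
      vscale (cnj (alpha2 $$ (2 * k, i)) * alpha2 $$ (2 * l + 1, j)) (ymat s p X delta t $$ (2 * k, 2 * l + 1)) +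
      (vscale (cnj (alpha2 $$ (2 * k + 1, i)) * alpha2 $$ (2 * l, j)) (ymat s p X delta t $$ (2 * k + 1, 2 * l)) +
      vscale (cnj (alpha2 $$ (2 * k + 1, i)) * alpha2 $$ (2 * l + 1, j)) (ymat s p X delta t $$ (2 * k + 1, 2 * l + 1))) =
     vscale (cnj (?a k i) * ?a l j) (X $$ (k, l)) + (if l = k then if i mod 2 = j mod 2 then vscale (cnj (?a k i) * ?a k j) D else 0 else 0)"
     unfolding A B using mod2_cases[of i] mod2_cases[of j] by (elim disjE) (simp_all add: D_def vns.scale_right_distrib)
   qed
   also have "... = (SUM k<s. SUM l<s. vscale (cnj (?a k i) * ?a l j) (X $$ (k, l))) + (SUM k<s. if i mod 2 = j mod 2 then vscale (cnj (?a k i) * ?a k j) D else 0)"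
    unfolding sum.distrib by (intro arg_cong2[of _ _ _ _ "(+)"] refl sum.cong) (subst sum.delta, auto)
   also have "... = compress alpha X $$ (i div 2, j div 2) + (if i mod 2 = j mod 2 then vscale (S (i div 2) (j div 2)) D else 0)"
    unfolding compress_index[OF a ij(3,4)] S_def by (simp add: vns.scale_sum_left)
   finally have 1: "compress alpha2 (ymat s p X delta t) $$ (i, j) = compress alpha X $$ (i div 2, j div 2) + (if i mod 2 = j mod 2 then vscale (S (i div 2) (j div 2)) D else 0)" .
   define K where "K = (if i div 2 = j div 2 then cof c else 0) - S (i div 2) (j div 2)"
   have Z0: "?Z0 $$ (i div 2, j div 2) = vscale K (delta *\<^sub>R p + t *\<^sub>R perp p)"
    and Z1: "?Z1 $$ (i div 2, j div 2) = vscale K (delta *\<^sub>R perp p + t *\<^sub>R p)"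
    using ij(3,4) by (simp_all add: K_def vns.scale_right_distrib scaleR_vscale)
   have "?I $$ (i, j) = (if i mod 2 = j mod 2 then (if even i then ?Z0 $$ (i div 2, j div 2) else ?Z1 $$ (i div 2, j div 2)) else 0)"
    by (subst index_mat(1)[OF ij(1,2)]) simp
   then have 2: "?I $$ (i, j) = (if i mod 2 = j mod 2 then vscale K D else 0)" unfolding Z0 Z1 D_def even_iff_mod_2_eq_zero by auto
   have 3: "ymat r p (compress alpha X) eps (c * t) $$ (i, j) = compress alpha X $$ (i div 2, j div 2) + (if i div 2 = j div 2 & i mod 2 = j mod 2 then vscale (of_real c) D else 0)"
    using ij(1,2) by (simp add: ymat_def D_def d(2) scaleR_right_distrib mult.commute vscale_of_real)
   have "(compress alpha2 (ymat s p X delta t) + ?I) $$ (i, j) = compress alpha2 (ymat s p X delta t) $$ (i, j) + ?I $$ (i, j)"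
    by (rule index_add_mat) (use ij in auto)
   then show "(compress alpha2 (ymat s p X delta t) + ?I) $$ (i, j) = ymat r p (compress alpha X) eps (c * t) $$ (i, j)"
    unfolding 1 2 3 K_def by (auto simp: vns.scale_left_diff_distrib)
  qed (use a2 in auto)
  finally show "EX t>0. ymat r p (compress alpha X) eps t \<in> C (2 * r)" using c t(1) by (intro exI[of _ "c * t"]) auto
 qed
qed

text \<open>Adding \<eta> times the unit to x changes the doubled matrix by \<eta> J_2; completing the square moves this to the
diagonal, where it is absorbed in \<epsilon> and t.\<close>
lemma arch_proj_ord:
 assumes p: "mat1 p \<in> C 1" "mat1 (perp p) \<in> C 1"
 shows "arch (proj_ord C p)" unfolding arch_def
proof (intro allI ballI impI)
 fix r and X :: "('i, 'o) vns mat"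
 assume X: "X \<in> herm r" and h: "\<forall>eps>0. X + unit_mat eps r \<in> proj_ord C p r"
 have "EX t>0. ymat r p X eps t \<in> C (2 * r)" if e: "eps > 0" for eps
 proof -
  define eta where "eta = eps / 4"
  have eta: "eta > 0" "eps = (eta + eta) + (eta + eta)" "eta + eta > 0" using e by (auto simp: eta_def)
  have "X + unit_mat eta r \<in> proj_ord C p r" using h eta by blast
  then obtain t where t: "t > 0" "ymat r p (X + unit_mat eta r) (eta + eta) t \<in> C (2 * r)" using proj_ordD[OF _ eta(3)] by blast
  \<comment> \<open>Adding the square with signs (1, -1) turns eta J_2 into 2 eta times the identity, and the unit is p + perp p.\<close>
  let ?c = "%i. if i = 0 then sqrt eta else - sqrt eta"
  let ?b = "dmat r (%(i, j). if i div 2 = j div 2 then (?c (i mod 2) * ?c (j mod 2)) *\<^sub>R vunit else 0)"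
  have "ymat r p (X + unit_mat eta r) (eta + eta) t + ?b \<in> C (2 * r)" by (intro add t block posv_unit)
  also have "ymat r p (X + unit_mat eta r) (eta + eta) t + ?b = ymat r p X eps (t + (eta + eta))"
  proof (rule eq_mat_double[of _ r])
   fix i j assume ij: "i < 2 * r" "j < 2 * r" "i div 2 < r" "j div 2 < r"
   have u: "vunit = p + perp p" by (simp add: perp_def)
   show "(ymat r p (X + unit_mat eta r) (eta + eta) t + ?b) $$ (i, j) = ymat r p X eps (t + (eta + eta)) $$ (i, j)"
    using ij hermD[OF X] mod2_cases[of i] mod2_cases[of j] eta(1)
    by (elim disjE) (simp_all add: ymat_def eta(2) u scaleR_left_distrib scaleR_right_distrib scaleR_double)
  qed auto
  finally show ?thesis using t(1) eta by (intro exI[of _ "t + (eta + eta)"]) auto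
 qed
 then show "X \<in> proj_ord C p r" using X by (simp add: proj_ord_alt)
qed

end

section \<open>The cones of the theorem\<close>

lemma Etilde_alt:
 "(Etilde :: ('i::finite, 'o::finite) vns set) = {r *\<^sub>R vunit + (SUM q:UNIV. t q *\<^sub>R prj q) + (SUM q:UNIV. s q *\<^sub>R perp (prj q)) | r t s.
   0 <= r & (ALL q. 0 <= t q) & (ALL q. 0 <= s q)}"
proof -
 have 1: "(\<Sum>(a, b, x, y)\<in>UNIV. t (a, b, x, y) *\<^sub>R vP a b x y) = (SUM q:UNIV. t q *\<^sub>R (prj q :: ('i, 'o) vns))" for t :: "('i, 'o) lab => real"
  by (intro sum.cong refl) auto
 have 2: "(\<Sum>(a, b, x, y)\<in>UNIV. t (a, b, x, y) *\<^sub>R perp (vP a b x y)) = (SUM q:UNIV. t q *\<^sub>R perp (prj q :: ('i, 'o) vns))" for t :: "('i, 'o) lab => real"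
  by (intro sum.cong refl) auto
 show ?thesis unfolding Etilde_def 1 2 ..
qed

lemma Etilde_memI:
 "0 <= r ==> (!!q. 0 <= t q) ==> (!!q. 0 <= s q) ==>
  r *\<^sub>R vunit + (SUM q:UNIV. t q *\<^sub>R prj q) + (SUM q:UNIV. s q *\<^sub>R perp (prj q)) \<in> Etilde" unfolding Etilde_alt by blast

lemma vP_in_E: "vP a b x y \<in> E_cone"
proof -
 have "vP a b x y + eps *\<^sub>R vunit \<in> Etilde" if "eps > 0" for eps
  using Etilde_memI[of eps "%q. if q = (a, b, x, y) then 1 else 0" "%_. 0"] that
  by (simp add: if_distrib[of "%c. c *\<^sub>R _"] add.commute cong: if_cong)
 then show ?thesis by (simp add: E_cone_def)
qed

lemma perp_vP_in_E: "perp (vP a b x y) \<in> E_cone"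
proof -
 have "perp (vP a b x y) + eps *\<^sub>R vunit \<in> Etilde" if "eps > 0" for eps
  using Etilde_memI[of eps "%_. 0" "%q. if q = (a, b, x, y) then 1 else 0"] that
  by (simp add: if_distrib[of "%c. c *\<^sub>R _"] add.commute cong: if_cong)
 then show ?thesis by (simp add: E_cone_def)
qed

lemma E_cone_nonneg:
 assumes f: "clin f" and P: "!!a b x y. f (vP a b x y) \<in> Rnn" "!!a b x y. f (perp (vP a b x y)) \<in> Rnn"
  and u: "f vunit \<in> Rnn" and x: "x \<in> E_cone"
 shows "f x \<in> Rnn"
proof -
 have Et: "f y \<in> Rnn" if "y \<in> Etilde" for y
 proof -
  obtain r t s where y: "y = r *\<^sub>R vunit + (SUM q:UNIV. t q *\<^sub>R prj q) + (SUM q:UNIV. s q *\<^sub>R perp (prj q))"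
   and nn: "0 <= r" "!!q. 0 <= t q" "!!q. 0 <= s q" using \<open>y \<in> Etilde\<close> unfolding Etilde_alt by blast
  have g: "f (prj q) \<in> Rnn" "f (perp (prj q)) \<in> Rnn" for q using P by (cases q; simp)+
  have "f y = of_real r * f vunit + (SUM q:UNIV. of_real (t q) * f (prj q)) + (SUM q:UNIV. of_real (s q) * f (perp (prj q)))"
   unfolding y by (simp only: clinD(1,6,7)[OF f])
  then show ?thesis using nn u g by (auto simp: complex_nonneg_Reals_iff intro!: sum_nonneg add_nonneg_nonneg mult_nonneg_nonneg)
 qed
 have e: "f x + of_real eps * f vunit \<in> Rnn" if "eps > 0" for eps
  using Et[of "x + eps *\<^sub>R vunit"] x that by (auto simp: E_cone_def clinD(1,6)[OF f])
 have im: "Im (f x) = 0" using e[of 1] u by (simp add: complex_nonneg_Reals_iff)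
 have "0 <= Re (f x) + eps" if "eps > 0" for eps
 proof -
  have "eps / (Re (f vunit) + 1) > 0" using u that by (simp add: complex_nonneg_Reals_iff)
  from e[OF this] have "0 <= Re (f x) + eps / (Re (f vunit) + 1) * Re (f vunit)" using u by (simp add: complex_nonneg_Reals_iff)
  also have "eps / (Re (f vunit) + 1) * Re (f vunit) <= eps" using u that by (simp add: complex_nonneg_Reals_iff field_simps)
  finally show ?thesis by simp
 qed
 then have "0 <= Re (f x)" by (rule field_le_epsilon)
 with im show ?thesis by (simp add: complex_nonneg_Reals_iff)
qed

lemma compress_diag_index:
 assumes a: "alpha \<in> carrier_mat j r" and ij: "a < r" "b < r"
 shows "compress alpha (mat_diag j s) $$ (a, b) = (SUM k<j. vscale (cnj (alpha $$ (k, a)) * alpha $$ (k, b)) (s k))"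
proof -
 have "compress alpha (mat_diag j s) $$ (a, b) =
  (SUM k<j. SUM l<j. if l = k then vscale (cnj (alpha $$ (k, a)) * alpha $$ (k, b)) (s k) else 0)"
  unfolding compress_index[OF a ij] by (intro sum.cong refl) (auto simp: mat_diag_def)
 also have "... = (SUM k<j. vscale (cnj (alpha $$ (k, a)) * alpha $$ (k, b)) (s k))" by (intro sum.cong refl) (subst sum.delta, auto)
 finally show ?thesis .
qed

lemma sum_lessThan_add: "(SUM k<j + l. f k) = (SUM k<j. f k) + (SUM k<l. f (j + k) :: 'b::comm_monoid_add)" for j l :: nat
 by (induction l) (simp_all add: add.assoc)

text \<open>D_max is closed under addition since two diagonal matrices can be stacked into one.\<close>
lemma mord_Dmax: "mord (Dmax :: nat => ('i::finite, 'o::finite) vns mat set)"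
proof
 show "X \<in> herm r" if X: "X \<in> Dmax r" for X :: "('i, 'o) vns mat" and r
 proof -
  obtain alpha j s where X: "X = compress alpha (mat_diag j s)" "alpha \<in> carrier_mat j r" "ALL i<j. s i \<in> E_cone"
   using X unfolding Dmax_def by blast
  have "mat_diag j s \<in> herm j" by (rule hermI) (use X(3) in "auto simp: mat_diag_def E_cone_def")
  then show ?thesis unfolding X(1) using X(2) by (rule compress_herm)
 qed
 show "X + Y \<in> Dmax r" if X: "X \<in> Dmax r" and Y: "Y \<in> Dmax r" for X Y :: "('i, 'o) vns mat" and r
 proof -
  obtain alpha j s where X: "X = compress alpha (mat_diag j s)" "alpha \<in> carrier_mat j r" "ALL i<j. s i \<in> E_cone"
   using X unfolding Dmax_def by blast
  obtain beta l t where Y: "Y = compress beta (mat_diag l t)" "beta \<in> carrier_mat l r" "ALL i<l. t i \<in> E_cone"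
   using Y unfolding Dmax_def by blast
  define gamma where "gamma = Matrix.mat (j + l) r (%(i, b). if i < j then alpha $$ (i, b) else beta $$ (i - j, b))"
  define u where "u i = (if i < j then s i else t (i - j))" for i
  have g: "gamma \<in> carrier_mat (j + l) r" by (simp add: gamma_def)
  have "X + Y = compress gamma (mat_diag (j + l) u)"
  proof (rule eq_matI)
   fix a b assume "a < dim_row (compress gamma (mat_diag (j + l) u))" "b < dim_col (compress gamma (mat_diag (j + l) u))"
   then have ab: "a < r" "b < r" using g by auto
   show "(X + Y) $$ (a, b) = compress gamma (mat_diag (j + l) u) $$ (a, b)" unfolding compress_diag_index[OF g ab] sum_lessThan_add
    using ab X(2) Y(2) by (simp add: X(1) Y(1) compress_diag_index[OF X(2) ab] compress_diag_index[OF Y(2) ab] gamma_def u_def)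
  qed (use X Y g in auto)
  moreover have "ALL i<j + l. u i \<in> E_cone" using X(3) Y(3) by (auto simp: u_def)
  ultimately show ?thesis using g unfolding Dmax_def by blast
 qed
 show "compress alpha X \<in> Dmax r" if X: "X \<in> Dmax s" and a: "alpha \<in> carrier_mat s r" for X :: "('i, 'o) vns mat" and s alpha r
 proof -
  obtain beta j t where X: "X = compress beta (mat_diag j t)" "beta \<in> carrier_mat j s" "ALL i<j. t i \<in> E_cone"
   using X unfolding Dmax_def by blast
  have "compress alpha X = compress (beta * alpha) (mat_diag j t)" unfolding X(1) using X(2) a by (rule compress_compress)
  moreover have "beta * alpha \<in> carrier_mat j r" using X(2) a by simp
  ultimately show ?thesis using X(3) unfolding Dmax_def by blast
 qed
 have D: "mat1 v \<in> Dmax 1" if "v \<in> E_cone" for v :: "('i, 'o) vns"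
 proof -
  have "mat1 v = compress (1\<^sub>m 1) (mat_diag 1 (%_. v))" by (rule eq_matI) (auto simp: compress_def mat_diag_def)
  then show ?thesis using that unfolding Dmax_def by (intro CollectI exI[of _ "1\<^sub>m 1"] exI[of _ 1] exI[of _ "%_. v"]) auto
 qed
 show "mat1 (vP a b x y) \<in> Dmax 1" "mat1 (perp (vP a b x y)) \<in> Dmax 1" for a b :: 'o and x y :: 'i by (intro D vP_in_E perp_vP_in_E)+
qed

lemma Emax_clo: "Emax = clo Dmax" by (rule HOL.ext) (simp add: Emax_def clo_def unit_mat_def)

definition pgen :: "(nat => ('i, 'o) lab) => nat => ('i, 'o) lab" where
 "pgen g j = g (j mod CARD(('i, 'o) lab))"

lemma periodic_gen_eq: "periodic_gen g j = gen (Some (pgen g j))" by (simp add: periodic_gen_def pgen_def split: prod.split)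

lemma pgen_ex:
 fixes g :: "nat => ('i::finite, 'o::finite) lab"
 assumes "generator_enum g"
 shows "EX j>=n. pgen g j = q"
proof -
 let ?N = "CARD(('i, 'o) lab)"
 have "q \<in> g ` {..<?N}" using assms unfolding generator_enum_def bij_betw_def by blast
 then obtain i where i: "i < ?N" "g i = q" by blast
 have "pgen g (i + n * ?N) = q" using i by (simp add: pgen_def)
 moreover have "i + n * ?N >= n" using i(1) by (metis One_nat_def Suc_leI le_add2 le_trans mult.right_neutral mult_le_mono2 zero_less_iff_neq_zero not_less0)
 ultimately show ?thesis by blast
qed

lemma mord_E_seq: "mord (E_seq g j)" and arch_E_seq: "arch (E_seq g j)"
proof (induction j)
 case 0
 show "mord (E_seq g 0)" "arch (E_seq g 0)" by (simp_all add: Emax_clo mord.mord_clo mord.arch_clo mord_Dmax)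
next
 case (Suc j)
 interpret mord "E_seq g j" by (rule Suc)
 show "mord (E_seq g (Suc j))" "arch (E_seq g (Suc j))"
  by (auto simp: periodic_gen_eq simp del: One_nat_def intro!: mord_proj_ord arch_proj_ord posv_gen posv_perp_gen)
qed

lemma E_seq_Suc: "X \<in> E_seq g j r ==> X \<in> E_seq g (Suc j) r"
proof -
 assume X: "X \<in> E_seq g j r"
 interpret mord "E_seq g j" by (rule mord_E_seq)
 show ?thesis unfolding E_seq.simps periodic_gen_eq by (intro proj_ord_mono X posv_gen posv_perp_gen)
qed

lemma E_seq_mono: "i <= j ==> X \<in> E_seq g i r ==> X \<in> E_seq g j r"
 by (induction j rule: dec_induct) (auto intro: E_seq_Suc simp del: E_seq.simps)

lemma mord_E_union: "mord (%r. \<Union>j. E_seq g j r)"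
proof
 fix X Y and r :: nat
 show "X \<in> (\<Union>j. E_seq g j r) ==> X \<in> herm r" using mord.sub[OF mord_E_seq] by blast
 show "X + Y \<in> (\<Union>j. E_seq g j r)" if XY: "X \<in> (\<Union>j. E_seq g j r)" "Y \<in> (\<Union>j. E_seq g j r)"
 proof -
  obtain i j where "X \<in> E_seq g i r" "Y \<in> E_seq g j r" using XY by blast
  then have "X \<in> E_seq g (max i j) r" "Y \<in> E_seq g (max i j) r" by (meson E_seq_mono max.cobounded1 max.cobounded2)+
  then show ?thesis using mord.add[OF mord_E_seq] by blast
 qed
 show "compress alpha X \<in> (\<Union>j. E_seq g j r)" if "X \<in> (\<Union>j. E_seq g j s)" "alpha \<in> carrier_mat s r" for alpha s
  using that mord.comp[OF mord_E_seq, of X g _ s alpha r] by blast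
 show "mat1 (vP a b x y) \<in> (\<Union>j. E_seq g j 1)" "mat1 (perp (vP a b x y)) \<in> (\<Union>j. E_seq g j 1)" for a b x y
  by (rule UN_I[OF UNIV_I], rule mord.pos[OF mord_E_seq], rule UN_I[OF UNIV_I], rule mord.pos'[OF mord_E_seq])
qed

lemma E_proj_clo: "E_proj g = clo (%r. \<Union>j. E_seq g j r)" by (rule HOL.ext) (simp add: E_proj_def clo_def unit_mat_def)

lemma mord_E_proj: "mord (E_proj g)" unfolding E_proj_clo by (intro mord.mord_clo mord_E_union)

text \<open>The limit ordering is a fixed point: each generator occurs at arbitrarily late stages, so passing to proj_ord along it
gives nothing new.\<close>
lemma E_proj_closed:
 fixes X :: "('i::finite, 'o::finite) vns mat"
 assumes g: "generator_enum g" and X: "X \<in> proj_ord (E_proj g) (prj q) r"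
 shows "X \<in> E_proj g r"
proof -
 let ?p = "prj q :: ('i, 'o) vns"
 have h: "X \<in> herm r" using X by (simp add: proj_ord_def)
 have "EX j. X + unit_mat eps r \<in> E_seq g j r" if e: "eps > 0" for eps
 proof -
  define d where "d = eps / 4"
  have d: "d > 0" "eps = 4 * d" using e by (auto simp: d_def)
  obtain t where t: "t > 0" "ymat r ?p X d t \<in> E_proj g (2 * r)" using proj_ordD[OF X d(1)] by blast
  then obtain i where "ymat r ?p X d t + unit_mat d (2 * r) \<in> E_seq g i (2 * r)" using d(1) unfolding E_proj_def unit_mat_def by blast
  moreover obtain j where j: "j >= i" "pgen g j = q" using pgen_ex[OF g] by blast
  ultimately have Y: "ymat r ?p X d t + unit_mat d (2 * r) \<in> E_seq g j (2 * r)" by (blast intro: E_seq_mono)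
  interpret mord "E_seq g j" by (rule mord_E_seq)
  have "X + unit_mat eps r \<in> proj_ord (E_seq g j) ?p r" unfolding proj_ord_alt
  proof (intro CollectI conjI allI impI)
   show "X + unit_mat eps r \<in> herm r" using h by (intro herm_add) auto
   fix e' :: real assume e': "e' > 0"
   let ?b = "%c v. dmat r (%(i, j). if i div 2 = j div 2 then (c (i mod 2) * c (j mod 2)) *\<^sub>R v else 0)"
   let ?c0 = "%s i. if i = 0 then sqrt s else (0::real)" and ?c1 = "%s i. if i = 0 then (0::real) else sqrt s"
   \<comment> \<open>The weights (1, 2) for p and (2, 1) for perp p have the same off-diagonal product, so the squares contribute 2 c times the unit off the diagonal, as J_2 requires; the rest of the diagonal is the penalty with t = 8 c.\<close>
   let ?d0 = "%i. if i = 0 then sqrt (2 * d) else 2 * sqrt (2 * d)" and ?d1 = "%i. if i = 0 then 2 * sqrt (2 * d) else sqrt (2 * d)"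
   have "ymat r ?p X d t + unit_mat d (2 * r) + (?b ?d0 ?p + (?b ?d1 (perp ?p) + (?b (?c0 e') ?p + ?b (?c1 e') (perp ?p)))) \<in> E_seq g j (2 * r)"
    by (intro add Y block posv_gen posv_perp_gen)
   also have "ymat r ?p X d t + unit_mat d (2 * r) + (?b ?d0 ?p + (?b ?d1 (perp ?p) + (?b (?c0 e') ?p + ?b (?c1 e') (perp ?p))))
     = ymat r ?p (X + unit_mat eps r) e' (t + d + 4 * d)"
   proof (rule eq_mat_double[of _ r])
    fix i j assume ij: "i < 2 * r" "j < 2 * r" "i div 2 < r" "j div 2 < r"
    have u: "vunit = ?p + perp ?p" by (simp add: perp_def)
    have sq: "sqrt (2 * d) * sqrt (2 * d) = 2 * d" "sqrt e' * sqrt e' = e'" using d e' by simp_all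
    have sq8: "2 * sqrt (2 * d) * (2 * sqrt (2 * d)) = 4 * d + 4 * d" "sqrt (2 * d) * (2 * sqrt (2 * d)) = 4 * d" "2 * sqrt (2 * d) * sqrt (2 * d) = 4 * d"
     using sq(1) by auto
    have num: "(8 * d) *\<^sub>R v = d *\<^sub>R v + d *\<^sub>R v + (d *\<^sub>R v + d *\<^sub>R v) + (d *\<^sub>R v + d *\<^sub>R v + (d *\<^sub>R v + d *\<^sub>R v))"
     "(5 * d) *\<^sub>R v = d *\<^sub>R v + d *\<^sub>R v + (d *\<^sub>R v + d *\<^sub>R v) + d *\<^sub>R v" for v :: "('i, 'o) vns"
     by (simp_all flip: scaleR_left_distrib)
    show "(ymat r ?p X d t + unit_mat d (2 * r) + (?b ?d0 ?p + (?b ?d1 (perp ?p) + (?b (?c0 e') ?p + ?b (?c1 e') (perp ?p))))) $$ (i, j)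
     = ymat r ?p (X + unit_mat eps r) e' (t + d + 4 * d) $$ (i, j)" using ij hermD[OF h] mod2_cases[of i] mod2_cases[of j]
     by (elim disjE) (simp_all only: index_add_mat index_mat unit_mat_index unit_mat_carrier ymat_def d(2) u split if_True if_False
       eq_iff_half[of i j] refl simp_thms zero_neq_one one_neq_zero dim_row_mat dim_col_mat sq sq8 mult_zero_left mult_zero_right scaleR_zero_left scaleR_zero_right,
      auto simp: scaleR_left_distrib scaleR_right_distrib scaleR_double num add_ac)
   qed auto
   finally show "EX t>0. ymat r ?p (X + unit_mat eps r) e' t \<in> E_seq g j (2 * r)" using t(1) d(1) by (intro exI[of _ "t + d + 4 * d"]) auto
  qed
  then have "X + unit_mat eps r \<in> E_seq g (Suc j) r" using j(2) by (simp add: periodic_gen_eq)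
  then show ?thesis by blast
 qed
 then show ?thesis using h by (simp add: E_proj_def unit_mat_def)
qed

section \<open>Cones in one matrix level\<close>

definition kcone :: "nat => ('i::finite, 'o::finite) vns mat set => bool" where
 "kcone k C \<longleftrightarrow> (ALL X:C. X \<in> herm k) & (ALL X:C. ALL Y:C. X + Y \<in> C) &
   (ALL X:C. ALL alpha:carrier_mat k k. compress alpha X \<in> C) &
   (ALL q rho. Matrix.mat k k (%(a, b). vscale (cnj (rho a) * rho b) (prj q)) \<in> C) &
   (ALL q rho. Matrix.mat k k (%(a, b). vscale (cnj (rho a) * rho b) (perp (prj q))) \<in> C)"

text \<open>The largest matrix ordering with a given cone C in level k: a matrix is positive if all its compressions to size k
are. It lets cones of one fixed size be treated by the results on matrix orderings.\<close>
definition kmin :: "nat => ('i::finite, 'o::finite) vns mat set => nat => ('i, 'o) vns mat set" where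
 "kmin k C r = {Y \<in> herm r. ALL gamma:carrier_mat r k. compress gamma Y \<in> C}"

lemma mord_kcone: "mord C ==> kcone k (C k)" unfolding kcone_def
 by (auto intro: mord.sub mord.add mord.comp mord.rank_one mord.posv_gen mord.posv_perp_gen simp del: gen_simps)

lemma mord_kmin:
 assumes "kcone k C"
 shows "mord (kmin k C)"
proof
 have C: "!!X Y. X \<in> C ==> Y \<in> C ==> X + Y \<in> C"
   "!!q rho. Matrix.mat k k (%(a, b). vscale (cnj (rho a) * rho b) (prj q)) \<in> C"
   "!!q rho. Matrix.mat k k (%(a, b). vscale (cnj (rho a) * rho b) (perp (prj q))) \<in> C" using assms unfolding kcone_def by blast+
 fix X Y and r :: nat
 show "X \<in> kmin k C r ==> X \<in> herm r" by (simp add: kmin_def)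
 show "X + Y \<in> kmin k C r" if "X \<in> kmin k C r" "Y \<in> kmin k C r"
  using that unfolding kmin_def by (auto simp: herm_add compress_add[of _ r _ _ k] hermD(1) intro: C(1))
 show "compress alpha X \<in> kmin k C r" if "X \<in> kmin k C s" "alpha \<in> carrier_mat s r" for s alpha
  using that unfolding kmin_def by (auto simp: compress_herm compress_compress[of _ s r _ k])
 have m: "mat1 v \<in> herm 1" if "vstar v = v" for v :: "('a, 'b) vns" by (rule hermI) (auto simp: that)
 have c: "compress gamma (mat1 v) = Matrix.mat k k (%(a, b). vscale (cnj (gamma $$ (0, a)) * gamma $$ (0, b)) v)"
  if "gamma \<in> carrier_mat 1 k" for gamma and v :: "('a, 'b) vns" by (rule eq_matI) (use that in "auto simp: compress_index[of _ 1 k]")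
 fix a b :: 'b and x y :: 'a
 show "mat1 (vP a b x y) \<in> kmin k C 1" "mat1 (perp (vP a b x y)) \<in> kmin k C 1"
  using C(2)[of _ "(a, b, x, y)"] C(3)[of _ "(a, b, x, y)"] unfolding kmin_def by (auto simp: m c simp del: One_nat_def)
qed

lemma compress_one: "X \<in> carrier_mat k k ==> compress (1\<^sub>m k) X = X"
proof (rule eq_matI)
 assume X: "X \<in> carrier_mat k k"
 fix i j assume "i < dim_row X" "j < dim_col X"
 then have ij: "i < k" "j < k" using X by auto
 have "compress (1\<^sub>m k) X $$ (i, j) = (SUM a<k. SUM b<k. if a = i then if b = j then X $$ (i, j) else 0 else 0)"
  using ij by (subst compress_index[of _ k k]) (auto intro!: sum.cong)
 also have "... = X $$ (i, j)" using ij by (subst sum_delta2) auto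
 finally show "compress (1\<^sub>m k) X $$ (i, j) = X $$ (i, j)" .
qed auto

lemma kmin_self: "kcone k C ==> kmin k C k = C"
proof -
 assume C: "kcone k C"
 have "X \<in> C" if X: "X \<in> kmin k C k" for X
 proof -
  have h: "X \<in> herm k" and "compress (1\<^sub>m k) X \<in> C" using X unfolding kmin_def by auto
  then show ?thesis using compress_one hermD(1)[OF h] by metis
 qed
 moreover have "X \<in> kmin k C k" if X: "X \<in> C" for X using X C unfolding kmin_def kcone_def by blast
 ultimately show ?thesis by blast
qed

definition karch :: "nat => ('i::finite, 'o::finite) vns mat set => bool" where
 "karch k C \<longleftrightarrow> (ALL X:herm k. (\<forall>eps>0. X + unit_mat eps k \<in> C) --> X \<in> C)"

lemma arch_karch: "arch C ==> karch k (C k)" by (simp add: arch_def karch_def)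

lemma arch_kmin:
 assumes C: "kcone k C" and A: "karch k C"
 shows "arch (kmin k C)" unfolding arch_def
proof (intro allI ballI impI)
 fix r and X :: "('a, 'b) vns mat"
 assume X: "X \<in> herm r" and h: "\<forall>eps>0. X + unit_mat eps r \<in> kmin k C r"
 interpret M: mord "kmin k C" using C by (rule mord_kmin)
 have "compress gamma X \<in> C" if g: "gamma \<in> carrier_mat r k" for gamma
 proof -
  have "compress gamma X \<in> clo (kmin k C) k" by (rule mord.comp[OF M.mord_clo _ g]) (use X h in "simp add: clo_def")
  then have "compress gamma X \<in> herm k" "\<forall>eps>0. compress gamma X + unit_mat eps k \<in> C" unfolding clo_def kmin_self[OF C] by auto
  then show ?thesis using A unfolding karch_def by blast
 qed
 then show "X \<in> kmin k C r" using X unfolding kmin_def by blast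
qed

section \<open>Positive functionals\<close>

definition herm_fam :: "('i::finite, 'o::finite) fam => bool" where
 "herm_fam f \<longleftrightarrow> (ALL i j. clin (f i j)) & (ALL i j x. f j i (vstar x) = cnj (f i j x))"

definition ev :: "nat => ('i::finite, 'o::finite) fam => ('i, 'o) vns mat => complex" where
 "ev r f X = (SUM i<r. SUM j<r. f i j (X $$ (i, j)))"

definition frm :: "nat => ('i::finite, 'o::finite) fam => ('i, 'o) vns =>
  (nat => complex) => (nat => complex) => complex" where
 "frm k f x c d = (SUM i<k. SUM j<k. cnj (c i) * d j * f i j x)"

lemma herm_famD:
 assumes "herm_fam f"
 shows "clin (f i j)" "f j i (vstar x) = cnj (f i j x)" using assms by (auto simp: herm_fam_def)

lemma clin_frm: "herm_fam f ==> clin (%x. frm k f x c d)" unfolding frm_def by (intro clin_sum clin_cmult herm_famD(1))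

lemma frm_herm: "herm_fam f ==> frm k f (vstar x) d c = cnj (frm k f x c d)" unfolding frm_def cnj_sum complex_cnj_mult herm_famD(2)[symmetric]
 by (subst sum.swap) (simp add: mult.commute mult.left_commute)

lemma herm_fam_frm: "herm_fam f ==> herm_fam (%i j x. frm k f x (delta i) (delta j))"
 by (simp add: herm_fam_def[of "%i j x. frm k f x (delta i) (delta j)"] clin_frm frm_herm)

lemma ev_add: "herm_fam f ==> X \<in> carrier_mat r r ==> Y \<in> carrier_mat r r ==> ev r f (X + Y) = ev r f X + ev r f Y"
 by (simp add: ev_def clinD(1)[OF herm_famD(1)] sum.distrib)

lemma ev_scale: "herm_fam f ==> X \<in> carrier_mat r r ==> ev r f (smat t X) = of_real t * ev r f X"
 by (simp add: ev_def clinD(6)[OF herm_famD(1)] sum_distrib_left)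

lemma ev_unit: "herm_fam f ==> ev r f (unit_mat eps r) = of_real eps * (SUM i<r. f i i vunit)"
proof -
 assume f: "herm_fam f"
 have "ev r f (unit_mat eps r) = (SUM i<r. SUM j<r. if j = i then of_real eps * f i i vunit else 0)"
  unfolding ev_def by (intro sum.cong refl) (auto simp: clinD[OF herm_famD(1)[OF f]])
 also have "... = (SUM i<r. of_real eps * f i i vunit)" by (intro sum.cong refl) (subst sum.delta, auto)
 finally show ?thesis by (simp add: sum_distrib_left)
qed

lemma ev_real:
 assumes f: "herm_fam f" and X: "X \<in> herm r"
 shows "Im (ev r f X) = 0"
proof -
 have "cnj (ev r f X) = (SUM i<r. SUM j<r. f j i (X $$ (j, i)))" unfolding ev_def cnj_sum herm_famD(2)[OF f, symmetric]
  by (intro sum.cong refl) (simp add: hermD(4)[OF X])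
 also have "... = ev r f X" unfolding ev_def by (rule sum.swap)
 finally show ?thesis by (metis Im_complex_of_real complex_cnj_cnj complex_cnj complex_eq_iff complex.sel(2) cnj.sel(2) equation_minus_iff neg_equal_zero)
qed

lemma ev_compress:
 assumes f: "herm_fam f" and a: "alpha \<in> carrier_mat s r"
 shows "ev r f (compress alpha X) = ev s (%i j x. frm r f x (%a. alpha $$ (i, a)) (%b. alpha $$ (j, b))) X"
proof -
 have "ev r f (compress alpha X) = (SUM a<r. SUM b<r. SUM k<s. SUM l<s. cnj (alpha $$ (k, a)) * alpha $$ (l, b) * f a b (X $$ (k, l)))"
  unfolding ev_def by (intro sum.cong refl) (simp add: compress_index[OF a] clinD(2,7)[OF herm_famD(1)[OF f]])
 also have "... = (SUM k<s. SUM l<s. SUM a<r. SUM b<r. cnj (alpha $$ (k, a)) * alpha $$ (l, b) * f a b (X $$ (k, l)))" by (rule sum_swap4)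
 finally show ?thesis by (simp add: ev_def frm_def)
qed

lemma ev_rank_one:
 assumes f: "herm_fam f"
 shows "ev r f (Matrix.mat r r (%(a, b). vscale (cnj (rho a) * rho b) v)) = frm r f v rho rho" unfolding ev_def frm_def
 by (intro sum.cong refl) (simp add: clinD(2)[OF herm_famD(1)[OF f]])

lemma ev_eq_imp_eq:
 assumes f: "herm_fam f" and h: "herm_fam h"
  and e: "!!X. X \<in> herm r ==> Re (ev r f X) = Re (ev r h X)" and ij: "i < r" "j < r"
 shows "f i j x = h i j x"
proof -
 have R: "Re (f i j x) = Re (h i j x)" for x
 proof -
  define X where "X = Matrix.mat r r (%(a, b). (if a = i then if b = j then x else 0 else 0) + (if a = j then if b = i then vstar x else 0 else 0))"
  have X: "X \<in> herm r" by (rule hermI) (auto simp: X_def vstar_add)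
  have E: "ev r F X = F i j x + F j i (vstar x)" if F: "herm_fam F" for F :: "nat => nat => ('a, 'b) vns => complex"
  proof -
   have "ev r F X = (SUM a<r. SUM b<r. (if a = i then if b = j then F i j x else 0 else 0) + (if a = j then if b = i then F j i (vstar x) else 0 else 0))"
    unfolding ev_def X_def by (intro sum.cong refl) (auto simp: clinD[OF herm_famD(1)[OF F]])
   also have "... = F i j x + F j i (vstar x)" unfolding sum.distrib using ij by (simp add: sum_delta2)
   finally show ?thesis .
  qed
  show ?thesis using e[OF X] by (simp add: E f h herm_famD(2))
 qed
 have "Re (f i j (vscale \<i> x)) = Re (h i j (vscale \<i> x))" by (rule R)
 then have "Im (f i j x) = Im (h i j x)" by (simp add: clinD(2)[OF herm_famD(1)[OF f]] clinD(2)[OF herm_famD(1)[OF h]])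
 with R[of x] show ?thesis by (simp add: complex_eq_iff)
qed

text \<open>The cone D is pulled back along the hermitian part \<tau> to the real vector space of all arrays, where state_exists
applies; the complex-linear kernel arises from the real functional by the usual complexification.\<close>
lemma herm_state:
 fixes D :: "('i::finite, 'o::finite) vns mat set"
 assumes sub: "!!X. X \<in> D ==> X \<in> herm r"
  and add: "!!X Y. X \<in> D ==> Y \<in> D ==> X + Y \<in> D"
  and scale: "!!t X. X \<in> D ==> 0 <= t ==> smat t X \<in> D"
  and u: "u \<in> herm r" and unit: "!!X. X \<in> herm r ==> EX t>=0. X + smat t u \<in> D"
  and nu: "map_mat uminus u ~: D"
 shows "EX f. herm_fam f & (ALL i j. r <= i \<or> r <= j --> f i j = (%_. 0)) & (ALL X:D. 0 <= Re (ev r f X)) & ev r f u = 1"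
proof -
 define tau where "tau F = Matrix.mat r r (%(i, j). (1/2::real) *\<^sub>R (F (i, j) + vstar (F (j, i)) :: ('i, 'o) vns))" for F
 define K where "K = {F. tau F \<in> D}"
 define fn where "fn X = (%(i, j). if i < r & j < r then X $$ (i, j) else (0 :: ('i, 'o) vns))" for X :: "('i, 'o) vns mat"
 have td: "dim_row (tau F) = r" "dim_col (tau F) = r" for F by (simp_all add: tau_def)
 have th: "tau F \<in> herm r" for F by (rule hermI) (auto simp: tau_def vstar_add vstar_scaleR add.commute)
 have ta: "tau (F + G) = tau F + tau G" for F G by (rule eq_matI) (auto simp: tau_def vstar_add scaleR_right_distrib add_ac)
 have ts: "tau (t *\<^sub>R F) = smat t (tau F)" for t F
  by (rule eq_matI) (auto simp: tau_def scaleR_fun_def vstar_scaleR scaleR_right_distrib mult.commute)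
 have tfn: "tau (fn X) = X" if "X \<in> herm r" for X by (rule eq_matI) (use hermD[OF that] in "auto simp: tau_def fn_def simp flip: scaleR_2")
 have "EX L. linear L & (ALL x:K. 0 <= L x) & L (fn u) = (1::real)"
 proof (rule state_exists)
  show "F + G \<in> K" if "F \<in> K" "G \<in> K" for F G using that by (simp add: K_def ta add)
  show "t *\<^sub>R F \<in> K" if "0 <= t" "F \<in> K" for t F using that by (simp add: K_def ts scale)
  show "EX t>=0. F + t *\<^sub>R fn u \<in> K" for F using unit[OF th[of F]] by (simp add: K_def ta ts tfn u)
  have "tau (- fn u) = map_mat uminus u"
   using ts[of "-1" "fn u"] tfn[OF u] by (simp add: fun_Compl_def) (metis (no_types, lifting) scaleR_minus1_left map_mat_def eq_matI index_map_mat)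
  then show "- fn u ~: K" using nu by (simp add: K_def)
 qed
 then obtain L where L: "linear L" and Lp: "!!F. F \<in> K ==> 0 <= L F" and Lu: "L (fn u) = (1::real)" by blast
 have Ltau: "L F = L G" if "tau F = tau G" for F G
 proof -
  obtain t where t: "unit_mat 0 r + smat t u \<in> D" using unit[OF herm_unit] by blast
  from scale[OF this, of 0] have z: "unit_mat 0 r \<in> D" by (rule back_subst[of "%X. X \<in> D"], simp) (rule eq_matI, use hermD[OF u] in auto)
  have m: "tau (F - G) = unit_mat 0 r" if "tau F = tau G" for F G
  proof -
   have "tau (F - G) + tau G = tau F" by (simp flip: ta)
   then have "tau (F - G) $$ (i, j) + tau G $$ (i, j) = tau F $$ (i, j)" if "i < r" "j < r" for i j using that td by (metis index_add_mat(1))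
   then have "tau (F - G) $$ (i, j) = 0" if "i < r" "j < r" for i j using that \<open>tau F = tau G\<close> by (metis add_cancel_left_left)
   then show ?thesis by (intro eq_matI) (auto simp: td)
  qed
  have "0 <= L (F - G)" "0 <= L (G - F)" using m[OF that] m[OF that[symmetric]] z by (auto intro!: Lp simp: K_def)
  then show ?thesis using L by (simp add: linear_diff)
 qed
 define E where "E i j x = (%q. if q = (i, j) then x else (0 :: ('i, 'o) vns))" for i j :: nat and x
 define f where "f i j x = (if i < r & j < r then of_real (L (E i j x)) - \<i> * of_real (L (E i j (vscale \<i> x))) else 0)" for i j x
 have Ea: "E i j (x + y) = E i j x + E i j y" and Es: "E i j (t *\<^sub>R x) = t *\<^sub>R E i j x" for i j x y t
  by (auto simp: E_def fun_eq_iff scaleR_fun_def)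
 have La: "L (E i j (x + y)) = L (E i j x) + L (E i j y)" and Ls: "L (E i j (t *\<^sub>R x)) = t * L (E i j x)" for i j x y t
  using L by (simp_all add: Ea Es linear_add linear_cmul)
 have Lc: "L (E i j (vscale c x)) = Re c * L (E i j x) + Im c * L (E i j (vscale \<i> x))" for i j c x
 proof -
  have "vscale c x = Re c *\<^sub>R x + Im c *\<^sub>R vscale \<i> x"
   unfolding vscale_of_real[symmetric] vns.scale_scale vns.scale_left_distrib[symmetric] using complex_eq[of c] by (simp add: mult.commute)
  then show ?thesis by (simp add: La Ls)
 qed
 have "clin (f i j)" for i j unfolding clin_def
 proof (intro conjI allI)
  fix x y show "f i j (x + y) = f i j x + f i j y" by (simp add: f_def vns.scale_right_distrib La algebra_simps)
 next
  fix c x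
  have "L (E i j (vscale \<i> (vscale c x))) = - Im c * L (E i j x) + Re c * L (E i j (vscale \<i> x))" using Lc[of i j "\<i> * c" x] by simp
  then show "f i j (vscale c x) = c * f i j x" unfolding f_def Lc[of i j c x] by (simp add: complex_eq_iff algebra_simps)
 qed
 moreover have "f j i (vstar x) = cnj (f i j x)" for i j x
 proof (cases "i < r & j < r")
  case True
  have 1: "L (E j i (vstar y)) = L (E i j y)" for y
  proof (rule Ltau)
   have "E j i (vstar y) (a, b) = vstar (E i j y (b, a))" for a b by (simp add: E_def)
   then show "tau (E j i (vstar y)) = tau (E i j y)" by (intro eq_matI) (simp_all add: tau_def add.commute)
  qed
  have "vscale \<i> (vstar x) = vstar (vscale (- \<i>) x)" by (simp add: vstar_vscale vstar_minus)
  then have "L (E j i (vscale \<i> (vstar x))) = - L (E i j (vscale \<i> x))" using Lc[of i j "- \<i>" x] by (simp add: 1)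
  then show ?thesis using True by (simp add: f_def 1)
 qed (auto simp: f_def)
 ultimately have hf: "herm_fam f" by (simp add: herm_fam_def)
 have evL: "Re (ev r f X) = L (fn X)" if X: "X \<in> herm r" for X
 proof -
  have "fn X = (SUM i<r. SUM j<r. E i j (X $$ (i, j)))"
  proof (rule HOL.ext)
   fix q :: "nat \<times> nat"
   obtain a b where q: "q = (a, b)" by (cases q)
   have "(SUM i<r. SUM j<r. E i j (X $$ (i, j))) q = (SUM i<r. SUM j<r. if i = a then if j = b then X $$ (a, b) else 0 else 0)"
    unfolding sum_fun_apply q by (intro sum.cong refl) (auto simp: E_def)
   then show "fn X q = (SUM i<r. SUM j<r. E i j (X $$ (i, j))) q" by (simp add: sum_delta2 fn_def q)
  qed
  then have "L (fn X) = (SUM i<r. SUM j<r. L (E i j (X $$ (i, j))))" using L by (simp add: linear_sum)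
  also have "... = Re (ev r f X)" by (simp add: ev_def f_def)
  finally show ?thesis ..
 qed
 have "0 <= Re (ev r f X)" if "X \<in> D" for X using Lp[of "fn X"] that sub[OF that] by (simp add: evL K_def tfn)
 moreover have "ev r f u = 1" using evL[OF u] Lu ev_real[OF hf u] by (simp add: complex_eq_iff)
 moreover have "ALL i j. r <= i \<or> r <= j --> f i j = (%_. 0)" by (auto simp: f_def)
 ultimately show ?thesis using hf by blast
qed

context mord begin

lemma separation:
 assumes A: "arch C" and X: "X \<in> herm r" "X ~: C r"
 shows "EX f. herm_fam f & (ALL i j. r <= i \<or> r <= j --> f i j = (%_. 0)) & (ALL Y:C r. 0 <= Re (ev r f Y)) &
  ev r f (unit_mat 1 r) = 1 & Re (ev r f X) < 0"
proof -
 obtain eps where e: "eps > 0" "X + unit_mat eps r ~: C r" using A X unfolding arch_def by blast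
 define Z where "Z = X + unit_mat eps r"
 have Z: "Z \<in> herm r" "Z ~: C r" using e X by (auto simp: Z_def herm_add)
 note ZD = hermD[OF Z(1)]
 define D where "D = {Y \<in> herm r. EX s>=0. Y + smat s Z \<in> C r}"
 have "EX f. herm_fam f & (ALL i j. r <= i \<or> r <= j --> f i j = (%_. 0)) & (ALL X:D. 0 <= Re (ev r f X)) & ev r f (unit_mat 1 r) = 1"
 proof (rule herm_state)
  show "Y \<in> herm r" if "Y \<in> D" for Y using that by (simp add: D_def)
  show "Y + Y' \<in> D" if Y: "Y \<in> D" "Y' \<in> D" for Y Y'
  proof -
   obtain s s' where s: "s >= 0" "s' >= 0" "Y + smat s Z \<in> C r" "Y' + smat s' Z \<in> C r" and h: "Y \<in> herm r" "Y' \<in> herm r"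
    using Y unfolding D_def by blast
   have "Y + smat s Z + (Y' + smat s' Z) = Y + Y' + smat (s + s') Z"
    by (rule eq_matI) (use ZD hermD[OF h(1)] hermD[OF h(2)] in "auto simp: scaleR_left_distrib")
   then have "Y + Y' + smat (s + s') Z \<in> C r" using add[OF s(3,4)] by simp
   then show ?thesis unfolding D_def using s h herm_add by (intro CollectI conjI exI[of _ "s + s'"]) auto
  qed
  show "smat t Y \<in> D" if Y: "Y \<in> D" and t: "0 <= t" for t Y
  proof -
   obtain s where s: "s >= 0" "Y + smat s Z \<in> C r" and h: "Y \<in> herm r" using Y unfolding D_def by blast
   have "smat t (Y + smat s Z) = smat t Y + smat (t * s) Z" by (rule eq_matI) (use ZD hermD[OF h] in "auto simp: scaleR_right_distrib")
   moreover have "smat t Y \<in> herm r" by (rule hermI) (use hermD[OF h] in "auto simp: vstar_scaleR")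
   ultimately show ?thesis unfolding D_def using scale[OF s(2) t] s t by (intro CollectI conjI exI[of _ "t * s"]) auto
  qed
  have CD: "Y \<in> D" if "Y \<in> C r" for Y
  proof -
   have "Y + smat 0 Z = Y" by (rule eq_matI) (use ZD hermD[OF sub[OF that]] in auto)
   then show ?thesis unfolding D_def using that sub by (intro CollectI conjI exI[of _ 0]) auto
  qed
  have um: "smat t (unit_mat 1 r) = unit_mat t r" for t by (rule eq_matI) auto
  show "EX t>=0. Y + smat t (unit_mat 1 r) \<in> D" if "Y \<in> herm r" for Y using order_unit[OF that] CD unfolding um by blast
  show "map_mat uminus (unit_mat 1 r) ~: D"
  proof
   assume "map_mat uminus (unit_mat 1 r) \<in> D"
   then obtain s where s: "s >= 0" "map_mat uminus (unit_mat 1 r) + smat s Z \<in> C r" unfolding D_def by blast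
   have "map_mat uminus (unit_mat 1 r) + smat s Z + unit_mat 1 r \<in> C r" by (rule add[OF s(2)]) (simp add: unit_mem)
   also have "map_mat uminus (unit_mat 1 r) + smat s Z + unit_mat 1 r = smat s Z" by (rule eq_matI) (use ZD in auto)
   finally have sZ: "smat s Z \<in> C r" .
   show False
   proof (cases "s = 0")
    case False
    have "smat (1 / s) (smat s Z) \<in> C r" by (rule scale[OF sZ]) (use s in simp)
    also have "smat (1 / s) (smat s Z) = Z" by (rule eq_matI) (use ZD False in auto)
    finally show False using Z by simp
   next
    case True
    obtain c where c: "c >= 0" "Z + unit_mat c r \<in> C r" using order_unit[OF Z(1)] by blast
    have "Z + unit_mat c r + smat c (map_mat uminus (unit_mat 1 r) + smat s Z) \<in> C r" by (rule add[OF c(2)], rule scale[OF s(2) c(1)])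
    also have "Z + unit_mat c r + smat c (map_mat uminus (unit_mat 1 r) + smat s Z) = Z" by (rule eq_matI) (use ZD True in auto)
    finally show False using Z by simp
   qed
  qed
 qed simp
 then obtain f where f: "herm_fam f" "ALL i j. r <= i \<or> r <= j --> f i j = (%_. 0)" "!!X. X \<in> D ==> 0 <= Re (ev r f X)" "ev r f (unit_mat 1 r) = 1" by blast
 have CD: "Y \<in> D" if "Y \<in> C r" for Y
 proof -
  have "Y + smat 0 Z = Y" by (rule eq_matI) (use ZD hermD[OF sub[OF that]] in auto)
  then show ?thesis unfolding D_def using that sub by (intro CollectI conjI exI[of _ 0]) auto
 qed
 have "smat (-1) Z \<in> D"
 proof -
  have "smat (-1) Z + smat 1 Z = Matrix.mat r r (%_. 0)" by (rule eq_matI) (use ZD in auto)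
  moreover have "smat (-1) Z \<in> herm r" by (rule hermI) (use ZD in "auto simp: vstar_minus")
  ultimately show ?thesis unfolding D_def using zero[of r] by (intro CollectI conjI exI[of _ 1]) auto
 qed
 from f(3)[OF this] have "Re (ev r f Z) <= 0" using ev_scale[OF f(1), of Z r "-1"] ZD by simp
 moreover have "ev r f Z = ev r f X + of_real eps"
  using f(4) ev_unit[OF f(1), of r 1] ev_unit[OF f(1), of r eps] ev_add[OF f(1), of X r "unit_mat eps r"] hermD(1)[OF X(1)] by (simp add: Z_def)
 ultimately have "Re (ev r f X) < 0" using e(1) by simp
 then show ?thesis using f CD by blast
qed

end

section \<open>Splitting a functional along a projection\<close>

definition spread :: "nat => ('i::finite, 'o::finite) vns mat => ('i, 'o) vns mat" where
 "spread r X = dmat r (%(i, j). X $$ (i div 2, j div 2))"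

lemma spread_dims [simp]: "dim_row (spread r X) = 2 * r" "dim_col (spread r X) = 2 * r" by (simp_all add: spread_def)

lemma spread_herm: "X \<in> herm r ==> spread r X \<in> herm (2 * r)" by (rule hermI) (auto simp: spread_def hermD)

lemma ev_spread: "ev (2 * r) F (spread r X) = ev r (%i j x. F (2*i) (2*j) x + F (2*i) (2*j+1) x + (F (2*i+1) (2*j) x + F (2*i+1) (2*j+1) x)) X"
 unfolding ev_def sum_lessThan_double sum.distrib[symmetric] by (intro sum.cong refl) (simp add: spread_def)

lemma ev_ymat:
 assumes F: "herm_fam F"
 shows "ev (2 * k) F (ymat k p X eps t) = ev k (%i j x. F (2*i) (2*j) x + F (2*i) (2*j+1) x + (F (2*i+1) (2*j) x + F (2*i+1) (2*j+1) x)) X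
  + (SUM i<k. F (2*i) (2*i) (eps *\<^sub>R p + t *\<^sub>R perp p) + F (2*i+1) (2*i+1) (eps *\<^sub>R perp p + t *\<^sub>R p))"
proof -
 let ?e = "eps *\<^sub>R p + t *\<^sub>R perp p" and ?o = "eps *\<^sub>R perp p + t *\<^sub>R p"
 have "ev (2 * k) F (ymat k p X eps t) = (SUM i<k. SUM j<k.
   (F (2*i) (2*j) (X $$ (i, j)) + F (2*i) (2*j+1) (X $$ (i, j)) + (F (2*i+1) (2*j) (X $$ (i, j)) + F (2*i+1) (2*j+1) (X $$ (i, j))))
   + (if j = i then F (2*i) (2*i) ?e + F (2*i+1) (2*i+1) ?o else 0))" unfolding ev_def sum_lessThan_double sum.distrib[symmetric]
  by (intro sum.cong refl) (auto simp: ymat_def clinD(1,3)[OF herm_famD(1)[OF F]])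
 then show ?thesis unfolding ev_def by (simp add: sum.distrib)
qed

lemma map_mat_scale_herm: "X \<in> herm r ==> smat t X \<in> herm r" by (rule hermI) (auto simp: hermD vstar_scaleR)

text \<open>Let D consist of the matrices Y for which Y - x tensor J_2 + t (perp p, p) lies in C for some t and some x with f(x)
nonnegative. If minus the doubled unit were in D, closedness along p would produce a matrix in C on which f is
negative; hence D carries a state. It is nonnegative on x tensor J_2 whenever f(x) is, so there it is a multiple of f.
Finally D contains minus the penalty matrix, while the diagonal entries of that matrix are positive, so each of them
is killed.\<close>
lemma (in mord) riesz:
 fixes q :: "('i, 'o) lab"
 defines "p \<equiv> prj q :: ('i, 'o) vns"
 assumes closed: "proj_ord C p r <= C r"
  and f: "herm_fam f" and fpos: "ALL X:C r. 0 <= Re (ev r f X)"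
  and n: "ev r f (unit_mat 1 r) = cof n" "n > 0"
 shows "EX F. herm_fam F & (ALL Y:C (2 * r). 0 <= Re (ev (2 * r) F Y)) &
   (ALL i<r. ALL j<r. ALL x. f i j x = F (2*i) (2*j) x + F (2*i) (2*j+1) x + (F (2*i+1) (2*j) x + F (2*i+1) (2*j+1) x)) &
   (ALL i<r. F (2*i) (2*i) (perp p) = 0 & F (2*i+1) (2*i+1) p = 0)"
proof -
 have pp: "mat1 p \<in> C 1" "mat1 (perp p) \<in> C 1" unfolding p_def by (rule posv_gen posv_perp_gen)+
 have ps: "vstar p = p" unfolding p_def by (rule vstar_gen)
 let ?Y = "%x t. ymat r p (smat (-1) x) 0 t"
 define u :: "('i, 'o) vns mat" where "u = spread r (unit_mat 1 r)"
 have uh: "u \<in> herm (2 * r)" unfolding u_def by (intro spread_herm) simp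
 have ud: "dim_row u = 2 * r" "dim_col u = 2 * r" by (simp_all add: u_def)
 define D where "D = {Y \<in> herm (2 * r). EX x:herm r. EX t>=0. 0 <= Re (ev r f x) & Y + ?Y x t \<in> C (2 * r)}"
 have DI: "Y \<in> D" if "Y \<in> herm (2 * r)" "x \<in> herm r" "t >= 0" "0 <= Re (ev r f x)" "Y + ?Y x t \<in> C (2 * r)" for Y x t
  unfolding D_def using that by blast
 have ev0: "ev r f (unit_mat 0 r) = 0" by (simp add: ev_unit[OF f])
 let ?b = "%c v. dmat r (%(i, j). if i div 2 = j div 2 then (c (i mod 2) * c (j mod 2)) *\<^sub>R v else 0)"
 have "EX F. herm_fam F & (ALL i j. 2 * r <= i \<or> 2 * r <= j --> F i j = (%_. 0)) & (ALL X:D. 0 <= Re (ev (2 * r) F X)) & ev (2 * r) F u = 1"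
 proof (rule herm_state)
  show "Y \<in> herm (2 * r)" if "Y \<in> D" for Y using that by (simp add: D_def)
  show "u \<in> herm (2 * r)" by (rule uh)
  show "Y + Y' \<in> D" if Y: "Y \<in> D" "Y' \<in> D" for Y Y'
  proof -
   obtain x t where x: "x \<in> herm r" "t >= 0" "0 <= Re (ev r f x)" "Y + ?Y x t \<in> C (2 * r)" and h: "Y \<in> herm (2 * r)" using Y unfolding D_def by blast
   obtain x' t' where x': "x' \<in> herm r" "t' >= 0" "0 <= Re (ev r f x')" "Y' + ?Y x' t' \<in> C (2 * r)" and h': "Y' \<in> herm (2 * r)" using Y unfolding D_def by blast
   note hD = hermD[OF h] hermD[OF h'] hermD[OF x(1)] hermD[OF x'(1)]
   have eq: "Y + ?Y x t + (Y' + ?Y x' t') = Y + Y' + ?Y (x + x') (t + t')"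
   proof (rule eq_mat_double[of _ r])
    fix i j assume ij: "i < 2 * r" "j < 2 * r" "i div 2 < r" "j div 2 < r"
    then show "(Y + ?Y x t + (Y' + ?Y x' t')) $$ (i, j) = (Y + Y' + ?Y (x + x') (t + t')) $$ (i, j)" using hD by (simp add: ymat_def scaleR_left_distrib)
   qed (use hD in auto)
   show ?thesis
   proof (rule DI)
    show "Y + Y' + ?Y (x + x') (t + t') \<in> C (2 * r)" using add[OF x(4) x'(4)] by (simp only: eq)
    show "0 <= Re (ev r f (x + x'))" using ev_add[OF f, of x r x'] hD x(3) x'(3) by simp
   qed (use h h' x x' herm_add in auto)
  qed
  show "smat s Y \<in> D" if Y: "Y \<in> D" and s: "0 <= s" for s Y
  proof -
   obtain x t where x: "x \<in> herm r" "t >= 0" "0 <= Re (ev r f x)" "Y + ?Y x t \<in> C (2 * r)" and h: "Y \<in> herm (2 * r)" using Y unfolding D_def by blast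
   note hD = hermD[OF h] hermD[OF x(1)]
   have eq: "smat s (Y + ?Y x t) = smat s Y + ?Y (smat s x) (s * t)"
   proof (rule eq_mat_double[of _ r])
    fix i j assume ij: "i < 2 * r" "j < 2 * r" "i div 2 < r" "j div 2 < r"
    then show "smat s (Y + ?Y x t) $$ (i, j) = (smat s Y + ?Y (smat s x) (s * t)) $$ (i, j)"
     using hD by (simp add: ymat_def scaleR_right_distrib scaleR_right_diff_distrib)
   qed (use hD in auto)
   show ?thesis
   proof (rule DI)
    show "smat s Y + ?Y (smat s x) (s * t) \<in> C (2 * r)" using scale[OF x(4) s] by (simp only: eq)
    show "0 <= Re (ev r f (smat s x))" using ev_scale[OF f, of x r s] hD x(3) s by simp
   qed (use h x s map_mat_scale_herm in auto)
  qed
  show "EX t>=0. X + smat t u \<in> D" if X: "X \<in> herm (2 * r)" for X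
  proof -
   obtain c where c: "c >= 0" "X + unit_mat c (2 * r) \<in> C (2 * r)" using order_unit[OF X] by blast
   let ?d0 = "%i. if i = 0 then sqrt c else 2 * sqrt c" and ?d1 = "%i. if i = 0 then 2 * sqrt c else sqrt c"
   let ?e0 = "%i. if i = 0 then 0 else sqrt (5 * c)" and ?e1 = "%i. if i = 0 then sqrt (5 * c) else 0"
   have "X + unit_mat c (2 * r) + (?b ?d0 p + (?b ?d1 (perp p) + (?b ?e0 p + ?b ?e1 (perp p)))) \<in> C (2 * r)" by (intro add[OF c(2)] add block pp)
   also have "X + unit_mat c (2 * r) + (?b ?d0 p + (?b ?d1 (perp p) + (?b ?e0 p + ?b ?e1 (perp p))))
    = X + smat (2 * c) u + ?Y (unit_mat 0 r) (8 * c)"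
   proof (rule eq_mat_double[of _ r])
    fix i j assume ij: "i < 2 * r" "j < 2 * r" "i div 2 < r" "j div 2 < r"
    have uu: "vunit = p + perp p" by (simp add: perp_def)
    have sq: "sqrt c * sqrt c = c" "sqrt (5 * c) * sqrt (5 * c) = 4 * c + c"
     "2 * sqrt c * (2 * sqrt c) = 4 * c" "sqrt c * (2 * sqrt c) = 2 * c" "2 * sqrt c * sqrt c = 2 * c" using c(1) by simp_all
    have num: "(8 * c) *\<^sub>R v = c *\<^sub>R v + c *\<^sub>R v + (c *\<^sub>R v + c *\<^sub>R v) + (c *\<^sub>R v + c *\<^sub>R v + (c *\<^sub>R v + c *\<^sub>R v))"
     "(5 * c) *\<^sub>R v = c *\<^sub>R v + c *\<^sub>R v + (c *\<^sub>R v + c *\<^sub>R v) + c *\<^sub>R v" for v :: "('i, 'o) vns"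
     by (simp_all flip: scaleR_left_distrib)
    show "(X + unit_mat c (2 * r) + (?b ?d0 p + (?b ?d1 (perp p) + (?b ?e0 p + ?b ?e1 (perp p))))) $$ (i, j)
      = (X + smat (2 * c) u + ?Y (unit_mat 0 r) (8 * c)) $$ (i, j)" using ij hermD[OF X] mod2_cases[of i] mod2_cases[of j]
     by (elim disjE) (simp_all only: index_add_mat index_mat index_map_mat unit_mat_index unit_mat_carrier spread_def u_def ymat_def split if_True if_False
       eq_iff_half[of i j] refl simp_thms zero_neq_one one_neq_zero dim_row_mat dim_col_mat sq mult_zero_left mult_zero_right scaleR_zero_left scaleR_zero_right,
      auto simp: uu scaleR_left_distrib scaleR_right_distrib scaleR_double num add_ac)
   qed (use hermD[OF X] in "auto simp: ud")
   finally have Z: "X + smat (2 * c) u + ?Y (unit_mat 0 r) (8 * c) \<in> C (2 * r)" .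
   have "X + smat (2 * c) u \<in> D" by (rule DI[OF _ _ _ _ Z]) (use c(1) X uh in "auto simp: ev0 intro: herm_add map_mat_scale_herm")
   then show ?thesis using c(1) by (intro exI[of _ "2 * c"]) auto
  qed
  show "map_mat uminus u ~: D"
  proof
   assume "map_mat uminus u \<in> D"
   then obtain x t where x: "x \<in> herm r" "t >= 0" "0 <= Re (ev r f x)" "map_mat uminus u + ?Y x t \<in> C (2 * r)" unfolding D_def by blast
   note hD = hermD[OF x(1)]
   define y where "y = smat (-1) (x + unit_mat 1 r)"
   have yh: "y \<in> herm r" unfolding y_def by (intro map_mat_scale_herm herm_add x) simp
   have "y \<in> proj_ord C p r" unfolding proj_ord_alt
   proof (intro CollectI conjI allI impI exI[of _ "t + 1"])
    show "y \<in> herm r" by (rule yh)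
    show "t + 1 > 0" using x(2) by simp
    fix eps :: real assume e: "eps > 0"
    let ?c0 = "%s i. if i = 0 then sqrt s else (0::real)" and ?c1 = "%s i. if i = 0 then (0::real) else sqrt s"
    have "map_mat uminus u + ?Y x t + (?b (?c0 eps) p + (?b (?c1 eps) (perp p) + (?b (?c0 1) (perp p) + ?b (?c1 1) p))) \<in> C (2 * r)"
     by (intro add[OF x(4)] add block pp)
    also have "map_mat uminus u + ?Y x t + (?b (?c0 eps) p + (?b (?c1 eps) (perp p) + (?b (?c0 1) (perp p) + ?b (?c1 1) p))) = ymat r p y eps (t + 1)"
    proof (rule eq_mat_double[of _ r])
     fix i j assume ij: "i < 2 * r" "j < 2 * r" "i div 2 < r" "j div 2 < r"
     have sq: "sqrt eps * sqrt eps = eps" "sqrt 1 * sqrt 1 = (1::real)" using e by simp_all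
     show "(map_mat uminus u + ?Y x t + (?b (?c0 eps) p + (?b (?c1 eps) (perp p) + (?b (?c0 1) (perp p) + ?b (?c1 1) p)))) $$ (i, j) = ymat r p y eps (t + 1) $$ (i, j)"
      using ij hD mod2_cases[of i] mod2_cases[of j]
      by (elim disjE) (simp_all only: index_add_mat index_mat index_map_mat unit_mat_index unit_mat_carrier spread_def u_def ymat_def y_def split if_True if_False
        eq_iff_half[of i j] refl simp_thms zero_neq_one one_neq_zero dim_row_mat dim_col_mat sq mult_zero_left mult_zero_right scaleR_zero_left scaleR_zero_right,
       auto simp: scaleR_left_distrib)
    qed (auto simp: ud)
    finally show "ymat r p y eps (t + 1) \<in> C (2 * r)" .
   qed
   then have "0 <= Re (ev r f y)" using fpos closed by blast
   also have "ev r f y = - ev r f x - cof n"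
    using ev_scale[OF f, of "x + unit_mat 1 r" r "-1"] ev_add[OF f, of x r "unit_mat 1 r"] hD n(1) by (simp add: y_def)
   finally show False using x(3) n(2) by simp
  qed
 qed
 then obtain F0 where F0: "herm_fam F0" "!!X. X \<in> D ==> 0 <= Re (ev (2 * r) F0 X)" "ev (2 * r) F0 u = 1" by blast
 have CD: "Y \<in> D" if Y: "Y \<in> C (2 * r)" for Y
 proof -
  have eq: "Y + ?Y (unit_mat 0 r) 0 = Y" by (rule eq_matI) (use hermD[OF sub[OF Y]] in "auto simp: ymat_def")
  have Z: "Y + ?Y (unit_mat 0 r) 0 \<in> C (2 * r)" unfolding eq by (rule Y)
  show ?thesis by (rule DI[OF _ _ _ _ Z]) (use sub[OF Y] ev0 in auto)
 qed
 have spr: "Re (ev (2 * r) F0 (spread r x)) = Re (ev r f x) / n" if x: "x \<in> herm r" for x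
 proof -
  have le: "0 <= Re (ev (2 * r) F0 (spread r x))" if x: "x \<in> herm r" "0 <= Re (ev r f x)" for x
  proof -
   have eq: "spread r x + ?Y x 0 = dmat r (%_. 0)"
   proof (rule eq_mat_double[of _ r])
    fix i j assume ij: "i < 2 * r" "j < 2 * r" "i div 2 < r" "j div 2 < r"
    then show "(spread r x + ?Y x 0) $$ (i, j) = dmat r (%_. 0) $$ (i, j)" using hermD[OF x(1)] by (simp add: spread_def ymat_def)
   qed auto
   have Z: "spread r x + ?Y x 0 \<in> C (2 * r)" unfolding eq by (rule zero)
   show ?thesis by (rule F0(2), rule DI[OF _ _ _ _ Z]) (use x spread_herm in auto)
  qed
  define c where "c = Re (ev r f x) / n"
  let ?h0 = "%i j x. F0 (2*i) (2*j) x + F0 (2*i) (2*j+1) x + (F0 (2*i+1) (2*j) x + F0 (2*i+1) (2*j+1) x)"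
  have h0: "herm_fam ?h0" using F0(1) unfolding herm_fam_def by (auto intro!: clin_add)
  have lin: "ev r g (smat s x + unit_mat (- s * c) r) = of_real s * ev r g x - of_real (s * c) * ev r g (unit_mat 1 r)"
   if "herm_fam g" for g s using ev_add[OF that, of "smat s x" r "unit_mat (- s * c) r"] ev_scale[OF that, of x r s] ev_unit[OF that, of r 1]
    ev_unit[OF that, of r "- s * c"] hermD(1)[OF x] by simp
  have 1: "ev r ?h0 (unit_mat 1 r) = 1" using F0(3) unfolding u_def ev_spread .
  have "0 <= Re (ev (2 * r) F0 (spread r (smat s x + unit_mat (- s * c) r)))" for s
  proof (rule le)
   show "smat s x + unit_mat (- s * c) r \<in> herm r" using x by (intro herm_add map_mat_scale_herm) auto
   show "0 <= Re (ev r f (smat s x + unit_mat (- s * c) r))" unfolding lin[OF f] n(1) using n(2) by (simp add: c_def)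
  qed
  from this[of 1] this[of "-1"] show ?thesis unfolding ev_spread lin[OF h0] 1 by (simp add: c_def)
 qed
 define F where "F i j x = of_real n * F0 i j x" for i j x
 have F: "herm_fam F" using F0(1) by (simp add: herm_fam_def F_def[abs_def] clin_cmult)
 have evF: "ev (2 * r) F Y = of_real n * ev (2 * r) F0 Y" for Y by (simp add: ev_def F_def sum_distrib_left)
 have Fpos: "0 <= Re (ev (2 * r) F Y)" if "Y \<in> D" for Y using F0(2)[OF that] n(2) by (simp add: evF)
 let ?h = "%i j x. F (2*i) (2*j) x + F (2*i) (2*j+1) x + (F (2*i+1) (2*j) x + F (2*i+1) (2*j+1) x)"
 have hh: "herm_fam ?h" using F unfolding herm_fam_def by (auto intro!: clin_add)
 have fh: "f i j x = ?h i j x" if "i < r" "j < r" for i j x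
 proof (rule ev_eq_imp_eq[OF f hh _ that])
  fix X :: "('i, 'o) vns mat" assume X: "X \<in> herm r"
  show "Re (ev r f X) = Re (ev r ?h X)" unfolding ev_spread[symmetric] evF using spr[OF X] n(2) by simp
 qed
 have kill: "F (2*i) (2*i) (perp p) = 0 & F (2*i+1) (2*i+1) p = 0" if i: "i < r" for i
 proof -
  define B where "B = ymat r p (unit_mat 0 r) 0 1"
  have Bh: "B \<in> herm (2 * r)" unfolding B_def by (intro ymat_herm ps) simp
  have eq: "smat (-1) B + ?Y (unit_mat 0 r) 1 = dmat r (%_. 0)" by (rule eq_matI) (auto simp: B_def ymat_def)
  have Z: "smat (-1) B + ?Y (unit_mat 0 r) 1 \<in> C (2 * r)" unfolding eq by (rule zero)
  have "smat (-1) B \<in> D" by (rule DI[OF _ _ _ _ Z]) (use Bh ev0 map_mat_scale_herm in auto)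
  from Fpos[OF this] have le: "Re (ev (2 * r) F B) <= 0" using ev_scale[OF F, of B "2 * r" "-1"] hermD(1)[OF Bh] by simp
  have diag: "0 <= Re (F a a v)" if a: "a < 2 * r" and v: "mat1 v \<in> C 1" for a v
  proof -
   have "ev (2 * r) F (dmat r (%(i, j). vscale (cnj (if i = a then 1 else 0) * (if j = a then 1 else 0)) v))
    = (SUM i<2*r. SUM j<2*r. if i = a then if j = a then F a a v else 0 else 0)"
    unfolding ev_def by (intro sum.cong refl) (auto simp: clinD[OF herm_famD(1)[OF F]])
   also have "... = F a a v" using a by (simp add: sum_delta2)
   finally show ?thesis using Fpos[OF CD[OF rank_one[OF v, of "2 * r" "%i. if i = a then 1 else 0"]]] by simp
  qed
  have "ev (2 * r) F B = (SUM i<r. F (2*i) (2*i) (perp p) + F (2*i+1) (2*i+1) p)" unfolding B_def ev_ymat[OF F] using ev_unit[OF hh, of r 0] by simp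
  then have "(SUM i<r. Re (F (2*i) (2*i) (perp p)) + Re (F (2*i+1) (2*i+1) p)) <= 0" using le by simp
  moreover have nn: "0 <= Re (F (2*i) (2*i) (perp p))" "0 <= Re (F (2*i+1) (2*i+1) p)" if "i < r" for i using that pp by (auto intro!: diag)
  ultimately have "(SUM i<r. Re (F (2*i) (2*i) (perp p)) + Re (F (2*i+1) (2*i+1) p)) = 0" by (intro order_antisym sum_nonneg) auto
  then have "Re (F (2*i) (2*i) (perp p)) + Re (F (2*i+1) (2*i+1) p) = 0" using i nn by (subst (asm) sum_nonneg_eq_0_iff) auto
  then have "Re (F (2*i) (2*i) (perp p)) = 0" "Re (F (2*i+1) (2*i+1) p) = 0" using nn[OF i] by linarith+
  moreover have "Im (F a a v) = 0" if "vstar v = v" for a v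
  proof -
   have "F a a v = cnj (F a a v)" using herm_famD(2)[OF F, of a a v] that by simp
   then show ?thesis by (simp add: complex_eq_iff)
  qed
  ultimately show ?thesis using ps by (simp add: complex_eq_iff)
 qed
 show ?thesis using F Fpos CD fh kill by (intro exI[of _ F] conjI) auto
qed

section \<open>The limit functional\<close>

text \<open>A kernel on the natural numbers, nonnegative on generators and their complements, in which every basis vector splits:
it is u + (e_m - u) where perp p vanishes on u and p vanishes on e_m - u.\<close>
definition datum :: "('i::finite, 'o::finite) fam => bool" where
 "datum F \<longleftrightarrow> herm_fam F &
  (ALL q k c. 0 <= Re (frm k F (prj q) c c) & 0 <= Re (frm k F (perp (prj q)) c c)) &
  (ALL q m. EX k u. m < k & (ALL i>=k. u i = 0) & frm k F (perp (prj q)) u u = 0 &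
    frm k F (prj q) (%i. (if i = m then 1 else 0) - u i) (%i. (if i = m then 1 else 0) - u i) = 0)"

lemma frm_cong_dim:
 assumes "!!i. k <= i ==> i < l ==> c i = 0" "!!i. k <= i ==> i < l ==> d i = 0" "k <= l"
 shows "frm l F x c d = frm k F x c d"
proof -
 have "frm l F x c d = (SUM i<l. SUM j<k. cnj (c i) * d j * F i j x)"
  unfolding frm_def by (intro sum.cong refl sum.mono_neutral_right) (use assms in auto)
 also have "... = frm k F x c d" unfolding frm_def by (intro sum.mono_neutral_right) (use assms in auto)
 finally show ?thesis .
qed

lemma frm_single:
 assumes "a < k" "b < k"
 shows "frm k F x (%i. if i = a then 1 else 0) (%i. if i = b then 1 else 0) = F a b x"
proof -
 have "frm k F x (%i. if i = a then 1 else 0) (%i. if i = b then 1 else 0) = (SUM i<k. SUM j<k. if i = a then if j = b then F a b x else 0 else 0)"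
  unfolding frm_def by (intro sum.cong refl) auto
 then show ?thesis using assms by (simp add: sum_delta2)
qed

lemma frm_diff_left: "frm k F x (%i. c i - c' i) d = frm k F x c d - frm k F x c' d" by (simp add: frm_def algebra_simps sum_subtractf)
lemma frm_diff_right: "frm k F x c (%i. d i - d' i) = frm k F x c d - frm k F x c d'" by (simp add: frm_def algebra_simps sum_subtractf)
lemma frm_add_left: "frm k F x (%i. c i + c' i) d = frm k F x c d + frm k F x c' d" by (simp add: frm_def algebra_simps sum.distrib)
lemma frm_add_right: "frm k F x c (%i. d i + d' i) = frm k F x c d + frm k F x c d'" by (simp add: frm_def algebra_simps sum.distrib)
lemma frm_scale_left: "frm k F x (%i. t * c i) d = cnj t * frm k F x c d" by (simp add: frm_def algebra_simps sum_distrib_left)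
lemma frm_scale_right: "frm k F x c (%i. t * d i) = t * frm k F x c d" by (simp add: frm_def algebra_simps sum_distrib_left)

definition stage :: "(nat => ('i, 'o) lab) => nat => ('i::finite, 'o::finite) fam => bool" where
 "stage g n f \<longleftrightarrow> herm_fam f & (ALL X:E_proj g (2 ^ n). 0 <= Re (ev (2 ^ n) f X)) & f 0 0 vunit = 1"

lemma stage_psd:
 assumes "stage g n f" "mat1 v \<in> E_proj g 1"
 shows "0 <= Re (frm (2 ^ n) f v c c)"
proof -
 have "0 <= Re (ev (2 ^ n) f (Matrix.mat (2 ^ n) (2 ^ n) (%(a, b). vscale (cnj (c a) * c b) v)))"
  using assms(1) mord.rank_one[OF mord_E_proj assms(2)] unfolding stage_def by blast
 then show ?thesis using ev_rank_one assms(1) unfolding stage_def by metis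
qed

text \<open>riesz gives indices 2 i and 2 i + 1 for the two halves of the old index i. A change of basis puts the old vectors, the
sums of the halves, at the first 2^n indices, so that the kernels of successive stages extend each other.\<close>
lemma stage_step:
 fixes f :: "('i::finite, 'o::finite) fam"
 assumes g: "generator_enum g" and f: "stage g n f"
 shows "EX f'. stage g (Suc n) f' & (ALL i<2^n. ALL j<2^n. f' i j = f i j) &
  (ALL i<2^n. EX u. (ALL i>=2^Suc n. u i = 0) & frm (2 ^ Suc n) f' (perp (gen (Some (pgen g n)))) u u = 0 &
    frm (2 ^ Suc n) f' (gen (Some (pgen g n))) (%j. (if j = i then 1 else 0) - u j) (%j. (if j = i then 1 else 0) - u j) = 0)"
proof -
 interpret mord "E_proj g" by (rule mord_E_proj)
 let ?r = "2 ^ n :: nat" and ?p = "gen (Some (pgen g n)) :: ('i, 'o) vns"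
 have hf: "herm_fam f" and pf: "ALL X:E_proj g ?r. 0 <= Re (ev ?r f X)" and f0: "f 0 0 vunit = 1" using f by (auto simp: stage_def)
 define N where "N = Re (SUM i<?r. f i i vunit)"
 have im: "Im (f i i vunit) = 0" for i using herm_famD(2)[OF hf, of i i vunit] by (simp add: complex_eq_iff)
 have N1: "ev ?r f (unit_mat 1 ?r) = cof N" by (simp add: ev_unit[OF hf] N_def complex_eq_iff im)
 have "0 <= Re (f i i vunit)" if "i < ?r" for i
  using stage_psd[OF f posv_unit, of "%j. if j = i then 1 else 0"] frm_single[of i ?r i f vunit] that by simp
 then have "Re (f 0 0 vunit) <= N" unfolding N_def Re_sum by (intro member_le_sum) auto
 then have N0: "N > 0" using f0 by simp
 have cl: "proj_ord (E_proj g) ?p ?r <= E_proj g ?r" using E_proj_closed[OF g] by blast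
 obtain F where F: "herm_fam F" "!!Y. Y \<in> E_proj g (2 * ?r) ==> 0 <= Re (ev (2 * ?r) F Y)"
   and F2: "!!i j x. i < ?r ==> j < ?r ==> f i j x = F (2*i) (2*j) x + F (2*i) (2*j+1) x + (F (2*i+1) (2*j) x + F (2*i+1) (2*j+1) x)"
   and F3: "!!i. i < ?r ==> F (2*i) (2*i) (perp ?p) = 0" "!!i. i < ?r ==> F (2*i+1) (2*i+1) ?p = 0" using riesz[OF cl hf pf N1 N0] by blast
 \<comment> \<open>The first half of the new vectors are the sums of the two halves, the second half are the halves on which perp p vanishes.\<close>
 define delta where "delta a i = (if a < ?r then (if i = 2 * a \<or> i = 2 * a + 1 then 1 else 0) else (if i = 2 * (a - ?r) then 1 else 0 :: complex))" for a i
 define f' where "f' a b x = frm (2 * ?r) F x (delta a) (delta b)" for a b x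
 have hf': "herm_fam f'" unfolding f'_def[abs_def] by (rule herm_fam_frm[OF F(1)])
 define alpha where "alpha = Matrix.mat (2 * ?r) (2 * ?r) (%(a, i). delta a i)"
 have al: "alpha \<in> carrier_mat (2 * ?r) (2 * ?r)" by (simp add: alpha_def)
 have ev': "ev (2 * ?r) f' Y = ev (2 * ?r) F (compress alpha Y)" for Y
 proof -
  have "frm (2 * ?r) F x (delta a) (delta b) = frm (2 * ?r) F x (%i. alpha $$ (a, i)) (%i. alpha $$ (b, i))" if "a < 2 * ?r" "b < 2 * ?r" for a b x
   unfolding frm_def by (intro sum.cong refl) (use that in "auto simp: alpha_def")
  then show ?thesis unfolding ev_compress[OF F(1) al] by (simp add: ev_def f'_def)
 qed
 have split: "(SUM i<2*?r. delta a i * h i) = (if a < ?r then h (2*a) + h (2*a+1) else h (2*(a-?r)))" if "a < 2 * ?r" for a and h :: "nat => complex"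
 proof -
  have "(SUM i<2*?r. delta a i * h i) = (SUM i<?r. if i = (if a < ?r then a else a - ?r) then (if a < ?r then h (2*a) + h (2*a+1) else h (2*(a-?r))) else 0)"
   unfolding sum_lessThan_double
  proof (intro sum.cong refl)
   fix x :: nat
   have e: "2 * x = 2 * b \<longleftrightarrow> x = b" "2 * x = 2 * b + 1 \<longleftrightarrow> False" "2 * x + 1 = 2 * b \<longleftrightarrow> False" "2 * x + 1 = 2 * b + 1 \<longleftrightarrow> x = b" for b
    by presburger+
   show "delta a (2 * x) * h (2 * x) + delta a (2 * x + 1) * h (2 * x + 1) =
    (if x = (if a < ?r then a else a - ?r) then if a < ?r then h (2 * a) + h (2 * a + 1) else h (2 * (a - ?r)) else 0)" unfolding delta_def e by auto
  qed
  also have "... = (if a < ?r then h (2*a) + h (2*a+1) else h (2*(a-?r)))" using that by (subst sum.delta) auto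
  finally show ?thesis .
 qed
 have dr: "cnj (delta a i) = delta a i" for a i by (simp add: delta_def)
 have f'_exp: "f' a b x = (SUM i<2*?r. delta a i * (SUM j<2*?r. delta b j * F i j x))" for a b x
  unfolding f'_def frm_def dr by (simp add: sum_distrib_left mult.assoc)
 have f'00: "f' a b x = f a b x" if "a < ?r" "b < ?r" for a b x using that by (simp add: f'_exp split F2)
 have "stage g (Suc n) f'" unfolding stage_def
 proof (intro conjI ballI)
  show "herm_fam f'" by (rule hf')
  show "f' 0 0 vunit = 1" using f0 f'00[of 0 0] by simp
  fix X :: "('i, 'o) vns mat" assume "X \<in> E_proj g (2 ^ Suc n)"
  then have "compress alpha X \<in> E_proj g (2 * ?r)" by (intro comp[OF _ al]) simp
  then show "0 <= Re (ev (2 ^ Suc n) f' X)" using F(2) by (simp add: ev')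
 qed
 moreover have "EX u. (ALL i>=2^Suc n. u i = 0) & frm (2 ^ Suc n) f' (perp ?p) u u = 0 &
    frm (2 ^ Suc n) f' ?p (%j. (if j = i then 1 else 0) - u j) (%j. (if j = i then 1 else 0) - u j) = 0" if i: "i < ?r" for i
 proof (intro exI[of _ "%j. if j = ?r + i then 1 else 0"] conjI allI impI)
  have ii: "i < 2 * ?r" "?r + i < 2 * ?r" "\<not> ?r + i < ?r" "?r + i - ?r = i" using i by auto
  show "(if j = ?r + i then 1 else 0) = 0" if "j >= 2 ^ Suc n" for j using i that by auto
  show "frm (2 ^ Suc n) f' (perp ?p) (%j. if j = ?r + i then 1 else 0) (%j. if j = ?r + i then 1 else 0) = 0"
   using ii F3(1)[OF i] by (simp add: frm_single f'_exp split)
  show "frm (2 ^ Suc n) f' ?p (%j. (if j = i then 1 else 0) - (if j = ?r + i then 1 else 0)) (%j. (if j = i then 1 else 0) - (if j = ?r + i then 1 else 0)) = 0"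
   unfolding frm_diff_left frm_diff_right using ii i F3(2)[OF i] by (simp add: frm_single f'_exp split)
 qed
 ultimately show ?thesis using f'00 by (intro exI[of _ f'] conjI allI impI HOL.ext) auto
qed

text \<open>The kernels of the stages extend each other, so they have a union. A vector that enters at some stage splits along a
given generator when that generator next occurs in the periodic enumeration.\<close>
theorem datum_exists:
 fixes phi :: "('i::finite, 'o::finite) vns => complex"
 assumes g: "generator_enum g" and lin: "clin phi" and u: "phi vunit = 1" and nonneg: "nonneg_on phi (D_qc g)"
 shows "EX F. datum F & F 0 0 = phi"
proof -
 interpret mord "E_proj g" by (rule mord_E_proj)
 have real: "Im (phi (gen q)) = 0" for q
 proof -
  have "gen q \<in> D_qc g" using posv_gen[of q] by (simp add: D_qc_def)
  then show ?thesis using nonneg unfolding nonneg_on_def by (auto simp: complex_nonneg_Reals_iff)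
 qed
 have phi_star: "phi (vstar x) = cnj (phi x)" for x
 proof -
  have "phi (vstar x) = phi (SUM q:UNIV. vscale (cnj (rep_vns x q)) (gen q))"
   using arg_cong[OF vns_expand[of x], of vstar] by (simp add: vstar_sum vstar_vscale)
  also have "... = (SUM q:UNIV. cnj (rep_vns x q) * phi (gen q))" by (simp add: clinD[OF lin])
  also have "... = cnj (phi x)" using real by (simp add: clin_expand[OF lin, of x] complex_eq_iff)
  finally show ?thesis .
 qed
 define f0 where "f0 i j x = (if i = 0 & j = 0 then phi x else 0)" for i j :: nat and x
 have hf0: "herm_fam f0" unfolding herm_fam_def
 proof (intro conjI allI)
  show "clin (f0 i j)" for i j using lin by (auto simp: f0_def[abs_def] clin_def)
  show "f0 j i (vstar x) = cnj (f0 i j x)" for i j x by (simp add: f0_def phi_star)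
 qed
 have s0: "stage g 0 f0" unfolding stage_def
 proof (intro conjI ballI hf0)
  show "f0 0 0 vunit = 1" using u by (simp add: f0_def)
  fix X :: "('i, 'o) vns mat" assume X: "X \<in> E_proj g (2 ^ 0)"
  have "X = mat1 (X $$ (0, 0))" using hermD[OF sub[OF X]] by (intro eq_matI) (auto simp: mat1_def)
  then have "X $$ (0, 0) \<in> D_qc g" using X unfolding D_qc_def by simp
  then have "phi (X $$ (0, 0)) \<in> Rnn" using nonneg unfolding nonneg_on_def by blast
  then show "0 <= Re (ev (2 ^ 0) f0 X)" by (simp add: ev_def f0_def complex_nonneg_Reals_iff)
 qed
 define next_ok where "next_ok n f f' \<longleftrightarrow> (ALL i<2^n. ALL j<2^n. f' i j = f i j) &
  (ALL i<2^n. EX u. (ALL i>=2^Suc n. u i = 0) & frm (2 ^ Suc n) f' (perp (gen (Some (pgen g n)))) u u = 0 &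
    frm (2 ^ Suc n) f' (gen (Some (pgen g n))) (%j. (if j = i then 1 else 0) - u j) (%j. (if j = i then 1 else 0) - u j) = 0)"
  for n and f f' :: "('i, 'o) fam"
 define step where "step n f = (SOME f'. stage g (Suc n) f' & next_ok n f f')" for n f
 define fs where "fs = rec_nat f0 step"
 have fs0: "fs 0 = f0" and fsS: "fs (Suc n) = step n (fs n)" for n by (simp_all add: fs_def)
 have stp: "stage g (Suc n) (step n f) & next_ok n f (step n f)" if "stage g n f" for n f
  unfolding step_def using stage_step[OF g that] unfolding next_ok_def[symmetric] by (rule someI_ex)
 have st: "stage g n (fs n)" for n by (induction n) (simp_all add: fs0 fsS s0 stp)
 have nx: "next_ok n (fs n) (fs (Suc n))" for n using stp[OF st[of n]] by (simp add: fsS)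
 have mono: "fs m i j = fs n i j" if "n <= m" "i < 2 ^ n" "j < 2 ^ n" for m n i j using that(1)
 proof (induction m rule: dec_induct)
  case (step k)
  have "(2::nat) ^ n <= 2 ^ k" using step(1) by (simp add: power_increasing)
  then have "i < 2 ^ k" "j < 2 ^ k" using less_le_trans that(2,3) by blast+
  then show ?case using nx[of k] step(3) by (simp add: next_ok_def)
 qed simp
 define F where "F i j = fs (max i j) i j" for i j
 have lt: "i < 2 ^ i" for i :: nat by (rule less_exp)
 have F_eq: "F i j = fs n i j" if "i < 2 ^ n" "j < 2 ^ n" for i j n
 proof -
  have "i < 2 ^ max i j" "j < 2 ^ max i j" by (rule le_less_trans[OF _ lt], simp)+
  then have "fs (max (max i j) n) i j = fs (max i j) i j" by (intro mono) auto
  moreover have "fs (max (max i j) n) i j = fs n i j" by (intro mono that) auto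
  ultimately show ?thesis by (simp add: F_def)
 qed
 have frm_eq: "frm k F x c d = frm (2 ^ n) (fs n) x c d" if "k <= 2 ^ n" "!!i. i >= k ==> c i = 0" "!!i. i >= k ==> d i = 0" for k n x c d
 proof -
  have "frm (2 ^ n) F x c d = frm k F x c d" by (rule frm_cong_dim) (use that in auto)
  moreover have "frm (2 ^ n) F x c d = frm (2 ^ n) (fs n) x c d" unfolding frm_def by (intro sum.cong refl) (simp add: F_eq[of _ n])
  ultimately show ?thesis by simp
 qed
 have hF: "herm_fam F" unfolding herm_fam_def
 proof (intro conjI allI)
  show "clin (F i j)" for i j using st[of "max i j"] by (simp add: F_def stage_def herm_famD)
  show "F j i (vstar x) = cnj (F i j x)" for i j x using st[of "max i j"] by (simp add: F_def stage_def herm_famD max.commute)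
 qed
 have trunc: "frm k F x c c = frm k F x (%i. if i < k then c i else 0) (%i. if i < k then c i else 0)" for k x c
  unfolding frm_def by (intro sum.cong refl) auto
 have psdF: "0 <= Re (frm k F v c c)" if "mat1 v \<in> E_proj g 1" for k v c
 proof -
  have "frm k F v c c = frm (2 ^ k) (fs k) v (%i. if i < k then c i else 0) (%i. if i < k then c i else 0)"
   unfolding trunc[of k v c] by (rule frm_eq) (use lt[of k] in auto)
  then show ?thesis using stage_psd[OF st that] by simp
 qed
 have spl: "EX k u. m < k & (ALL i>=k. u i = 0) & frm k F (perp (prj q)) u u = 0 &
    frm k F (prj q) (%i. (if i = m then 1 else 0) - u i) (%i. (if i = m then 1 else 0) - u i) = 0" for q m
 proof -
  obtain n where n: "n >= m" "pgen g n = q" using pgen_ex[OF g] by blast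
  have "m < 2 ^ n" using n(1) lt[of n] by linarith
  then obtain u where u: "ALL i>=2^Suc n. u i = 0" "frm (2 ^ Suc n) (fs (Suc n)) (perp (prj q)) u u = 0"
    "frm (2 ^ Suc n) (fs (Suc n)) (prj q) (%j. (if j = m then 1 else 0) - u j) (%j. (if j = m then 1 else 0) - u j) = 0"
   using nx[of n] n(2) unfolding next_ok_def by blast
  have m: "m < 2 ^ Suc n" using \<open>m < 2 ^ n\<close> by simp
  have "frm (2 ^ Suc n) F (perp (prj q)) u u = 0"
   "frm (2 ^ Suc n) F (prj q) (%j. (if j = m then 1 else 0) - u j) (%j. (if j = m then 1 else 0) - u j) = 0"
   using u m by (simp_all add: frm_eq[of "2 ^ Suc n" "Suc n"] del: power_Suc)
  then show ?thesis using u(1) m by blast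
 qed
 have "datum F" unfolding datum_def using hF psdF posv_gen posv_perp_gen spl by blast
 moreover have "F 0 0 = phi" by (rule HOL.ext) (simp add: F_def fs0 f0_def)
 ultimately show ?thesis by blast
qed

section \<open>Positive semidefinite kernels\<close>

lemma cauchy_schwarz_2x2:
 fixes a b :: real and z :: complex
 assumes "!!s t :: complex. 0 <= Re (cnj s * s * a + cnj s * t * z + cnj t * s * cnj z + cnj t * t * b)"
 shows "(cmod z)\<^sup>2 <= a * b"
proof -
 have zz: "z * cnj z = of_real ((cmod z)\<^sup>2)" by (simp only: complex_norm_square)
 have key: "0 <= a - 2 * r * (cmod z)\<^sup>2 + r\<^sup>2 * (cmod z)\<^sup>2 * b" for r :: real
 proof -
  have "cnj 1 * 1 * a + cnj 1 * (- of_real r * cnj z) * z + cnj (- of_real r * cnj z) * 1 * cnj z + cnj (- of_real r * cnj z) * (- of_real r * cnj z) * b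
   = of_real a - 2 * of_real r * (z * cnj z) + (of_real r)\<^sup>2 * (z * cnj z) * of_real b" by (simp add: algebra_simps power2_eq_square)
  also have "... = of_real (a - 2 * r * (cmod z)\<^sup>2 + r\<^sup>2 * (cmod z)\<^sup>2 * b)" unfolding zz by simp
  finally show ?thesis using assms[of 1 "- of_real r * cnj z"] by (metis Re_complex_of_real)
 qed
 have b: "0 <= b" using assms[of 0 1] by simp
 show ?thesis
 proof (cases "b = 0")
  case True
  have "(cmod z)\<^sup>2 = 0"
  proof (rule ccontr)
   assume nz: "(cmod z)\<^sup>2 ~= 0"
   have "0 <= a - 2 * ((a + 1) / (cmod z)\<^sup>2) * (cmod z)\<^sup>2" using key[of "(a + 1) / (cmod z)\<^sup>2"] True by simp
   then have "a + 2 <= 0" using nz by simp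
   moreover have "0 <= a" using assms[of 1 0] by simp
   ultimately show False by simp
  qed
  then show ?thesis using True by simp
 next
  case False
  then have "0 <= a - (cmod z)\<^sup>2 / b" using key[of "1 / b"] b by (simp add: power2_eq_square field_simps)
  then show ?thesis using False b by (simp add: field_simps)
 qed
qed

definition FS :: "(nat => complex) set" where
 "FS = {c. EX k. ALL i>=k. c i = 0}"

definition bnd :: "(nat => complex) => nat" where
 "bnd c = (LEAST k. ALL i>=k. c i = 0)"

definition evec :: "nat => nat => complex" where
 "evec n = (%i. if i = n then 1 else 0)"

lemma FSI: "(!!i. i >= k ==> c i = 0) ==> c \<in> FS" by (auto simp: FS_def)

lemma bnd: "c \<in> FS ==> i >= bnd c ==> c i = 0"
proof -
 assume "c \<in> FS" and i: "i >= bnd c"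
 then obtain k where k: "ALL i>=k. c i = 0" unfolding FS_def by blast
 have "ALL i>=bnd c. c i = 0" unfolding bnd_def by (rule LeastI[of "%k. ALL i>=k. c i = 0", OF k])
 then show ?thesis using i by blast
qed

lemma bnd_le: "(!!i. i >= k ==> c i = 0) ==> bnd c <= k" unfolding bnd_def by (rule Least_le) simp

lemma FS_zero [simp]: "0 \<in> FS" by (rule FSI[of 0]) simp
lemma FS_add [simp]: "c \<in> FS ==> d \<in> FS ==> c + d \<in> FS" by (rule FSI[of "max (bnd c) (bnd d)"]) (simp add: bnd)
lemma FS_diff [simp]: "c \<in> FS ==> d \<in> FS ==> c - d \<in> FS" by (rule FSI[of "max (bnd c) (bnd d)"]) (simp add: bnd)
lemma FS_scale [simp]: "c \<in> FS ==> fscale t c \<in> FS" by (rule FSI[of "bnd c"]) (simp add: bnd fscale_def)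
lemma FS_evec [simp]: "evec n \<in> FS" by (rule FSI[of "Suc n"]) (simp add: evec_def)
lemma FS_sum: "(!!i. i \<in> I ==> c i \<in> FS) ==> (SUM i:I. c i) \<in> FS" by (induction I rule: infinite_finite_induct) simp_all

lemma FS_expand:
 assumes "!!i. i >= k ==> c i = 0"
 shows "c = (SUM n<k. fscale (c n) (evec n))"
proof (rule HOL.ext)
 fix i
 have "(SUM n<k. fscale (c n) (evec n)) i = (SUM n<k. if n = i then c i else 0)"
  unfolding sum_fun_apply by (intro sum.cong refl) (auto simp: fscale_def evec_def)
 then show "c i = (SUM n<k. fscale (c n) (evec n)) i" using assms[of i] by (simp add: not_less)
qed

definition frmI :: "('i::finite, 'o::finite) fam => ('i, 'o) vns =>
  (nat => complex) => (nat => complex) => complex" where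
 "frmI F x c d = frm (max (bnd c) (bnd d)) F x c d"

lemma frmI_eq:
 assumes "!!i. i >= k ==> c i = 0" "!!i. i >= k ==> d i = 0"
 shows "frmI F x c d = frm k F x c d"
proof -
 have "c \<in> FS" "d \<in> FS" using assms by (auto intro: FSI)
 then show ?thesis unfolding frmI_def by (intro frm_cong_dim[symmetric]) (auto simp: bnd intro!: bnd_le assms)
qed

lemma frmI_common:
 assumes "c \<in> FS" "d \<in> FS" "e \<in> FS"
 obtains k where "!!i. i >= k ==> c i = 0" "!!i. i >= k ==> d i = 0" "!!i. i >= k ==> e i = 0"
 by (rule that[of "max (bnd c) (max (bnd d) (bnd e))"]) (use assms in "auto simp: bnd")

lemma frm_plus:
 "frm k F x (c + c') d = frm k F x c d + frm k F x c' d" "frm k F x d (c + c') = frm k F x d c + frm k F x d c'"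
 "frm k F x (c - c') d = frm k F x c d - frm k F x c' d" "frm k F x d (c - c') = frm k F x d c - frm k F x d c'"
 "frm k F x (fscale t c) d = cnj t * frm k F x c d" "frm k F x d (fscale t c) = t * frm k F x d c"
 using frm_add_left[of k F x c c' d] frm_add_right[of k F x d c c'] frm_diff_left[of k F x c c' d] frm_diff_right[of k F x d c c']
  frm_scale_left[of k F x t c d] frm_scale_right[of k F x d t c] by (simp_all only: plus_fun_def fun_diff_def fscale_def)

lemma frmI_plus:
 assumes "c \<in> FS" "c' \<in> FS" "d \<in> FS"
 shows frmI_add_left: "frmI F x (c + c') d = frmI F x c d + frmI F x c' d"
  and frmI_add_right: "frmI F x d (c + c') = frmI F x d c + frmI F x d c'"
  and frmI_diff_left: "frmI F x (c - c') d = frmI F x c d - frmI F x c' d"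
  and frmI_diff_right: "frmI F x d (c - c') = frmI F x d c - frmI F x d c'"
proof -
 obtain k where k: "!!i. i >= k ==> c i = 0" "!!i. i >= k ==> c' i = 0" "!!i. i >= k ==> d i = 0" using frmI_common[OF assms] by metis
 have e: "frmI F x u v = frm k F x u v" if "!!i. i >= k ==> u i = 0" "!!i. i >= k ==> v i = 0" for u v by (rule frmI_eq) (use that in auto)
 show "frmI F x (c + c') d = frmI F x c d + frmI F x c' d" "frmI F x d (c + c') = frmI F x d c + frmI F x d c'"
  "frmI F x (c - c') d = frmI F x c d - frmI F x c' d" "frmI F x d (c - c') = frmI F x d c - frmI F x d c'" using k by (simp_all add: e frm_plus)
qed

lemma frmI_scale:
 assumes "c \<in> FS" "d \<in> FS"
 shows frmI_scale_left: "frmI F x (fscale t c) d = cnj t * frmI F x c d"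
  and frmI_scale_right: "frmI F x d (fscale t c) = t * frmI F x d c"
proof -
 obtain k where k: "!!i. i >= k ==> c i = 0" "!!i. i >= k ==> d i = 0" using frmI_common[OF assms(1,1,2)] by metis
 have e: "frmI F x u v = frm k F x u v" if "!!i. i >= k ==> u i = 0" "!!i. i >= k ==> v i = 0" for u v by (rule frmI_eq) (use that in auto)
 have t: "fscale t c i = 0" if "i >= k" for i using k(1)[OF that] by (simp add: fscale_def)
 show "frmI F x (fscale t c) d = cnj t * frmI F x c d" "frmI F x d (fscale t c) = t * frmI F x d c" using k t by (simp_all add: e frm_plus)
qed

lemma frmI_zero [simp]: "d \<in> FS ==> frmI F x 0 d = 0" "d \<in> FS ==> frmI F x d 0 = 0"
 using frmI_diff_left[of 0 0 d F x] frmI_diff_right[of 0 0 d F x] by simp_all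
lemma frmI_sum_left: "(!!i. i \<in> I ==> c i \<in> FS) ==> d \<in> FS ==> frmI F x (SUM i:I. c i) d = (SUM i:I. frmI F x (c i) d)"
 by (induction I rule: infinite_finite_induct) (simp_all add: frmI_add_left FS_sum)
lemma frmI_sum_right: "(!!i. i \<in> I ==> c i \<in> FS) ==> d \<in> FS ==> frmI F x d (SUM i:I. c i) = (SUM i:I. frmI F x d (c i))"
 by (induction I rule: infinite_finite_induct) (simp_all add: frmI_add_right FS_sum)

lemma frmI_evec: "frmI F x (evec a) (evec b) = F a b x" using frm_single[of a "Suc (max a b)" b F x] frmI_eq[of "Suc (max a b)" "evec a" "evec b" F x]
 by (simp add: evec_def)

definition psd_fam :: "('i::finite, 'o::finite) fam => bool" where
 "psd_fam F \<longleftrightarrow> herm_fam F &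
  (ALL q k c. 0 <= Re (frm k F (prj q) c c) & 0 <= Re (frm k F (perp (prj q)) c c))"

locale psd_family =
 fixes F :: "('i::finite, 'o::finite) fam"
 assumes psd_fam: "psd_fam F"
begin

abbreviation "B \<equiv> frmI F"

lemma herm: "herm_fam F" using psd_fam by (simp add: psd_fam_def)

lemma B_lin: "clin (%x. B x c d)" unfolding frmI_def by (rule clin_frm[OF herm])

lemma B_herm: "B (vstar x) d c = cnj (B x c d)" unfolding frmI_def by (subst max.commute) (rule frm_herm[OF herm])

lemma B_herm': "vstar x = x ==> B x d c = cnj (B x c d)" using B_herm[of x d c] by simp

lemma B_perp: "B (perp x) c d = B vunit c d - B x c d" by (rule clinD(8)[OF B_lin])

definition okv :: "('i, 'o) vns => bool" where
 "okv v \<longleftrightarrow> vstar v = v & (ALL c. 0 <= Re (B v c c))"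

lemma okv_gen: "okv (prj q)" and okv_perp: "okv (perp (prj q))"
proof -
 have "vstar (prj q) = prj q" "vstar (perp (prj q)) = perp (prj q)" by (simp_all only: vstar_gen vstar_perp)
 moreover have "0 <= Re (B (prj q) c c)" "0 <= Re (B (perp (prj q)) c c)" for c using psd_fam unfolding psd_fam_def frmI_def by blast+
 ultimately show "okv (prj q)" "okv (perp (prj q))" unfolding okv_def by blast+
qed

lemma okv_unit: "okv vunit"
proof -
 have "B vunit c c = B (prj q) c c + B (perp (prj q)) c c" for c q by (simp add: B_perp)
 then show ?thesis using okv_gen okv_perp unfolding okv_def by (metis (no_types, lifting) add_nonneg_nonneg plus_complex.sel(1) vstar_vunit)
qed

lemma okv_real: "okv v ==> Im (B v c c) = 0" using B_herm'[of v c c] unfolding okv_def by (simp add: complex_eq_iff)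

lemma okv_of_real: "okv v ==> B v c c = of_real (Re (B v c c))" using okv_real by (simp add: complex_eq_iff)

lemma B_CS:
 assumes v: "okv v" and cd: "c \<in> FS" "d \<in> FS"
 shows "(cmod (B v c d))\<^sup>2 <= Re (B v c c) * Re (B v d d)"
proof (rule cauchy_schwarz_2x2)
 fix s t :: complex
 have h: "B v d c = cnj (B v c d)" using v by (intro B_herm') (simp add: okv_def)
 have "B v (fscale s c + fscale t d) (fscale s c + fscale t d) =
  cnj s * s * B v c c + cnj s * t * B v c d + cnj t * s * B v d c + cnj t * t * B v d d"
  using cd by (simp add: frmI_add_left frmI_add_right frmI_scale_left frmI_scale_right algebra_simps)
 then have "B v (fscale s c + fscale t d) (fscale s c + fscale t d) =
  cnj s * s * Re (B v c c) + cnj s * t * B v c d + cnj t * s * cnj (B v c d) + cnj t * t * Re (B v d d)"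
  unfolding h using okv_of_real[OF v, of c] okv_of_real[OF v, of d] by simp
 then show "0 <= Re (cnj s * s * cof (Re (B v c c)) + cnj s * t * B v c d + cnj t * s * cnj (B v c d) + cnj t * t * cof (Re (B v d d)))"
  using v unfolding okv_def by metis
qed

text \<open>Cauchy-Schwarz: a null vector of a positive semidefinite form lies in its radical.\<close>
lemma B_null:
 assumes v: "okv v" and cd: "c \<in> FS" "d \<in> FS" and z: "B v c c = 0"
 shows "B v c d = 0" "B v d c = 0"
proof -
 show "B v c d = 0" using B_CS[OF v cd] z by simp
 then show "B v d c = 0" using B_herm'[of v d c] v by (simp add: okv_def)
qed

definition N :: "(nat => complex) => real" where "N c = sqrt (Re (B vunit c c))"

lemma N_ge0 [simp]: "0 <= N c" using okv_unit by (simp add: N_def okv_def)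

lemma N_sq: "B vunit c c = of_real ((N c)\<^sup>2)" using okv_of_real[OF okv_unit, of c] okv_unit by (simp add: N_def okv_def)

lemma N_zero: "N 0 = 0" unfolding N_def frmI_zero(1)[OF FS_zero] by simp

lemma N0: "N c = 0 \<longleftrightarrow> B vunit c c = 0" by (simp add: N_sq)

lemma N_CS: "c \<in> FS ==> d \<in> FS ==> cmod (B vunit c d) <= N c * N d"
 using B_CS[OF okv_unit, of c d] okv_unit unfolding N_def okv_def real_sqrt_mult[symmetric] by (simp add: real_le_rsqrt)

lemma null_dual: "c \<in> FS ==> (!!d. d \<in> FS ==> B vunit d c = 0) ==> N c = 0" by (simp add: N0)

lemma gen_le_unit:
 assumes "okv v" "okv (perp v)"
 shows "Re (B v c c) <= Re (B vunit c c)"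
proof -
 have "0 <= Re (B (perp v) c c)" using assms(2) unfolding okv_def by blast
 then show ?thesis by (simp add: B_perp)
qed

declare sum.cong [fundef_cong]

fun gs :: "nat => nat => complex" where
 "gs n = (let r = evec n - (SUM m<n. fscale (B vunit (gs m) (evec n)) (gs m))
      in if N r = 0 then 0 else fscale (of_real (1 / N r)) r)"

declare gs.simps [simp del]

definition gsr :: "nat => nat => complex" where
 "gsr n = evec n - (SUM m<n. fscale (B vunit (gs m) (evec n)) (gs m))"

lemma gs_eq: "gs n = (if N (gsr n) = 0 then 0 else fscale (of_real (1 / N (gsr n))) (gsr n))" by (subst gs.simps) (simp add: Let_def gsr_def)

lemma gs_supp: "i > n ==> gs n i = 0"
proof (induction n arbitrary: i rule: less_induct)
 case (less n)
 have "(SUM m<n. fscale (B vunit (gs m) (evec n)) (gs m)) i = 0" unfolding sum_fun_apply using less by (intro sum.neutral) (auto simp: fscale_def)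
 then have "gsr n i = 0" using less.prems by (simp add: gsr_def evec_def)
 then show ?case by (simp add: gs_eq fscale_def)
qed

lemma gs_FS [simp]: "gs n \<in> FS" by (rule FSI[of "Suc n"]) (simp add: gs_supp)

lemma gsr_FS [simp]: "gsr n \<in> FS" unfolding gsr_def by (intro FS_diff FS_sum FS_scale) simp_all

lemma gs_norm: "B vunit (gs n) (gs n) = (if N (gsr n) = 0 then 0 else 1)"
proof (cases "N (gsr n) = 0")
 case False
 then have "B vunit (gs n) (gs n) = of_real (1 / N (gsr n)) * (of_real (1 / N (gsr n)) * B vunit (gsr n) (gsr n))"
  by (simp add: gs_eq frmI_scale_left frmI_scale_right)
 also have "... = of_real (1 / N (gsr n) * (1 / N (gsr n)) * (N (gsr n))\<^sup>2)" unfolding N_sq by simp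
 also have "1 / N (gsr n) * (1 / N (gsr n)) * (N (gsr n))\<^sup>2 = 1" using False by (simp add: power2_eq_square)
 finally show ?thesis using False by simp
qed (simp add: gs_eq)

lemma gs_orth_less: "m < n ==> B vunit (gs m) (gs n) = 0"
proof (induction n arbitrary: m rule: less_induct)
 case (less n)
 have o: "B vunit (gs m) (gs l) = 0" if "l < n" "m ~= l" for l
 proof (cases "m < l")
  case True then show ?thesis using less.IH that by blast
 next
  case False
  then have "B vunit (gs l) (gs m) = 0" using less.IH[OF less.prems, of l] that by simp
  then show ?thesis using B_herm'[of vunit "gs m" "gs l"] by simp
 qed
 have "B vunit (gs m) (gsr n) = B vunit (gs m) (evec n) - (SUM l<n. B vunit (gs l) (evec n) * B vunit (gs m) (gs l))"
  by (simp add: gsr_def frmI_diff_right frmI_sum_right frmI_scale_right FS_sum)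
 also have "(SUM l<n. B vunit (gs l) (evec n) * B vunit (gs m) (gs l)) = (SUM l<n. if l = m then B vunit (gs m) (evec n) * B vunit (gs m) (gs m) else 0)"
  by (intro sum.cong refl) (use o in auto)
 also have "... = B vunit (gs m) (evec n) * B vunit (gs m) (gs m)" using less.prems by simp
 also have "... = B vunit (gs m) (evec n)" by (cases "N (gsr m) = 0") (simp_all add: gs_norm, simp add: gs_eq)
 finally show ?case by (simp add: gs_eq frmI_scale_right)
qed

lemma gs_orth: "m ~= n ==> B vunit (gs m) (gs n) = 0" using gs_orth_less[of m n] gs_orth_less[of n m] B_herm'[of vunit "gs m" "gs n"]
 by (cases "m < n") auto

lemma evec_expand: "N (evec n - (SUM l<Suc n. fscale (B vunit (gs l) (evec n)) (gs l))) = 0"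
proof -
 have e: "evec n - (SUM l<Suc n. fscale (B vunit (gs l) (evec n)) (gs l)) = gsr n - fscale (B vunit (gs n) (evec n)) (gs n)"
  by (simp add: gsr_def algebra_simps)
 show ?thesis
 proof (cases "N (gsr n) = 0")
  case True
  then show ?thesis unfolding e by (simp add: gs_eq fscale_def fun_diff_def)
 next
  case False
  have "B vunit (gs n) (evec n) = B vunit (gs n) (gsr n)" by (simp add: gsr_def frmI_diff_right frmI_sum_right frmI_scale_right FS_sum gs_orth)
  also have "... = of_real (1 / N (gsr n) * (N (gsr n))\<^sup>2)" using False by (simp add: gs_eq frmI_scale_left N_sq)
  also have "1 / N (gsr n) * (N (gsr n))\<^sup>2 = N (gsr n)" using False by (simp add: power2_eq_square)
  finally have "fscale (B vunit (gs n) (evec n)) (gs n) = gsr n" using False by (simp add: gs_eq fscale_def)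
  then show ?thesis unfolding e by (simp add: N_def)
 qed
qed

lemma N_add_null:
 assumes "c \<in> FS" "d \<in> FS" "N c = 0" "N d = 0"
 shows "N (c + d) = 0"
proof (rule null_dual)
 fix x assume x: "x \<in> FS"
 have "B vunit x c = 0" "B vunit x d = 0" using assms(3,4) by (auto intro!: B_null(2)[OF okv_unit] assms(1,2) x simp: N0)
 then show "B vunit x (c + d) = 0" using assms(1,2) x by (simp add: frmI_add_right)
qed (use assms in simp)

lemma N_scale_null: "c \<in> FS ==> N c = 0 ==> N (fscale t c) = 0" by (simp add: N0 frmI_scale_left frmI_scale_right)

lemma N_sum_null: "(!!i. i \<in> I ==> c i \<in> FS) ==> (!!i. i \<in> I ==> N (c i) = 0) ==> N (SUM i:I. c i) = 0"
proof (induction I rule: infinite_finite_induct)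
 case (insert i I)
 have "N (c i + (SUM i:I. c i)) = 0" using insert by (intro N_add_null FS_sum) auto
 then show ?case unfolding sum.insert[OF insert.hyps] .
next
 case (infinite I)
 show ?case unfolding sum.infinite[OF infinite(1)] by (rule N_zero)
next
 case empty
 show ?case unfolding sum.empty by (rule N_zero)
qed

lemma gs_evec_zero: "n < l ==> B vunit (gs l) (evec n) = 0"
proof -
 assume nl: "n < l"
 let ?s = "SUM m<Suc n. fscale (B vunit (gs m) (evec n)) (gs m)"
 have s: "?s \<in> FS" by (intro FS_sum FS_scale gs_FS)
 have "B vunit (gs l) (evec n - ?s) = 0" by (rule B_null(2)[OF okv_unit FS_diff[OF FS_evec s] gs_FS]) (use evec_expand[of n] in "simp only: N0")
 moreover have "B vunit (gs l) ?s = 0"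
 proof -
  have "B vunit (gs l) ?s = (SUM m<Suc n. B vunit (gs m) (evec n) * B vunit (gs l) (gs m))"
   by (simp add: frmI_sum_right frmI_scale_right del: sum.lessThan_Suc)
  also have "... = 0" by (rule sum.neutral) (use nl in "auto simp: gs_orth")
  finally show ?thesis .
 qed
 ultimately show ?thesis using s by (simp add: frmI_diff_right del: sum.lessThan_Suc)
qed

lemma gs_zero:
 assumes c: "!!i. i >= k ==> c i = 0" and l: "l >= k"
 shows "B vunit (gs l) c = 0"
proof -
 have "B vunit (gs l) c = B vunit (gs l) (SUM n<k. fscale (c n) (evec n))" using arg_cong[OF FS_expand[of k c, OF c], where f = "B vunit (gs l)"] .
 also have "... = (SUM n<k. c n * B vunit (gs l) (evec n))" by (simp add: frmI_sum_right frmI_scale_right)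
 also have "... = 0" by (rule sum.neutral) (use l in "auto simp: gs_evec_zero")
 finally show ?thesis .
qed

text \<open>Normalised Gram-Schmidt vectors are taken to be 0 whenever the residual is null, so that the expansion holds modulo
null vectors without any assumption of independence.\<close>
lemma gs_expand:
 assumes c: "!!i. i >= k ==> c i = 0"
 shows "N (c - (SUM l<k. fscale (B vunit (gs l) c) (gs l))) = 0"
proof -
 let ?x = "%n. SUM l<Suc n. fscale (B vunit (gs l) (evec n)) (gs l)"
 have ext: "?x n = (SUM l<k. fscale (B vunit (gs l) (evec n)) (gs l))" if "n < k" for n
  by (rule sum.mono_neutral_left) (use that in "auto simp: gs_evec_zero")
 have x: "?x n \<in> FS" for n by (intro FS_sum FS_scale gs_FS)
 have "N (SUM n<k. fscale (c n) (evec n - ?x n)) = 0" by (intro N_sum_null N_scale_null FS_scale FS_diff x FS_evec evec_expand)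
 also have "(SUM n<k. fscale (c n) (evec n - ?x n)) = (SUM n<k. fscale (c n) (evec n)) - (SUM n<k. fscale (c n) (SUM l<k. fscale (B vunit (gs l) (evec n)) (gs l)))"
  using ext by (simp add: fun_vs.scale_right_diff_distrib sum_subtractf del: sum.lessThan_Suc)
 also have "(SUM n<k. fscale (c n) (SUM l<k. fscale (B vunit (gs l) (evec n)) (gs l))) = (SUM l<k. fscale (SUM n<k. c n * B vunit (gs l) (evec n)) (gs l))"
  unfolding fun_vs.scale_sum_right fun_vs.scale_sum_left fun_vs.scale_scale by (rule sum.swap)
 also have "... = (SUM l<k. fscale (B vunit (gs l) (SUM n<k. fscale (c n) (evec n))) (gs l))" by (simp add: frmI_sum_right frmI_scale_right)
 finally show ?thesis by (simp only: FS_expand[of k c, OF c, symmetric])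
qed

lemma parseval:
 assumes c: "!!i. i >= k ==> c i = 0" and d: "d \<in> FS"
 shows "B vunit c d = (SUM l<k. cnj (B vunit (gs l) c) * B vunit (gs l) d)"
proof -
 let ?s = "SUM l<k. fscale (B vunit (gs l) c) (gs l)"
 have s: "?s \<in> FS" by (intro FS_sum FS_scale gs_FS)
 have cF: "c \<in> FS" using c by (rule FSI)
 have "B vunit (c - ?s) d = 0" by (rule B_null(1)[OF okv_unit FS_diff[OF cF s] d]) (use gs_expand[of k c, OF c] in "simp only: N0")
 then have "B vunit c d = B vunit ?s d" using s d cF by (simp add: frmI_diff_left)
 also have "... = (SUM l<k. cnj (B vunit (gs l) c) * B vunit (gs l) d)" using d by (simp add: frmI_sum_left frmI_scale_left)
 finally show ?thesis .
qed

end

section \<open>Operators on Hilbert spaces\<close>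

context hilbert_space begin

abbreviation "hn \<equiv> hnorm ip"

lemma H_zero [simp]: "0 \<in> H" and H_add [simp]: "u \<in> H ==> v \<in> H ==> u + v \<in> H"
 and H_scale [simp]: "u \<in> H ==> fscale c u \<in> H" and H_diff [simp]: "u \<in> H ==> v \<in> H ==> u - v \<in> H"
 using subspace by (auto intro: fun_vs.subspace_0 fun_vs.subspace_add fun_vs.subspace_scale fun_vs.subspace_diff)

lemma H_sum: "(!!i. i \<in> I ==> f i \<in> H) ==> (SUM i:I. f i) \<in> H" using subspace by (rule fun_vs.subspace_sum)

lemma diff_as_add: "u - v = u + fscale (-1) v" by (simp add: fun_eq_iff fscale_def)

lemma ip_add_right: "u \<in> H ==> v \<in> H ==> w \<in> H ==> ip w (u + v) = ip w u + ip w v"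
 using ip_cnj[of "u + v" w] ip_cnj[of u w] ip_cnj[of v w] ip_add[of u v w] by simp
lemma ip_scale_right: "u \<in> H ==> v \<in> H ==> ip u (fscale c v) = cnj c * ip u v"
 using ip_cnj[of "fscale c v" u] ip_cnj[of v u] ip_scale[of v u c] by simp
lemma ip_diff: "u \<in> H ==> v \<in> H ==> w \<in> H ==> ip (u - v) w = ip u w - ip v w"
proof -
 assume h: "u \<in> H" "v \<in> H" "w \<in> H"
 have "ip (u - v) w = ip u w + ip (fscale (-1) v) w" unfolding diff_as_add by (rule ip_add) (use h in "simp_all only: H_scale")
 then show ?thesis using ip_scale[OF h(2,3), of "-1"] by simp
qed
lemma ip_diff_right: "u \<in> H ==> v \<in> H ==> w \<in> H ==> ip w (u - v) = ip w u - ip w v"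
proof -
 assume h: "u \<in> H" "v \<in> H" "w \<in> H"
 have "ip w (u - v) = ip w u + ip w (fscale (-1) v)" unfolding diff_as_add by (rule ip_add_right) (use h in "simp_all only: H_scale")
 then show ?thesis using ip_scale_right[OF h(3,2), of "-1"] by simp
qed
lemma ip_zero [simp]: "w \<in> H ==> ip 0 w = 0" "w \<in> H ==> ip w 0 = 0" using ip_diff[of 0 0 w] ip_diff_right[of 0 0 w] by simp_all
lemma ip_sum: "(!!i. i \<in> I ==> f i \<in> H) ==> w \<in> H ==> ip (SUM i:I. f i) w = (SUM i:I. ip (f i) w)"
proof (induction I rule: infinite_finite_induct)
 case (insert i I)
 then show ?case unfolding sum.insert[OF insert.hyps] by (subst ip_add) (auto intro: H_sum)
qed simp_all

lemma ip_self: "u \<in> H ==> ip u u = of_real (Re (ip u u))" using ip_cnj[of u u] by (simp add: complex_eq_iff)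
lemma ip_ge0: "u \<in> H ==> 0 <= Re (ip u u)" using ip_pos[of u] by (cases "u = 0") auto
lemma hn_sq: "u \<in> H ==> (hn u)\<^sup>2 = Re (ip u u)" by (simp add: hnorm_def ip_ge0)
lemma hn_ge0 [simp]: "u \<in> H ==> 0 <= hn u" by (simp add: hnorm_def ip_ge0)
lemma hn_eq0: "u \<in> H ==> hn u = 0 \<longleftrightarrow> u = 0" using ip_pos[of u] by (cases "u = 0") (auto simp: hnorm_def)
lemma hn_zero [simp]: "hn 0 = 0" by (simp add: hnorm_def)

lemma ip_eq0: "u \<in> H ==> (!!w. w \<in> H ==> ip w u = 0) ==> u = 0" using ip_pos[of u] by fastforce

lemma ip_CS:
 assumes "u \<in> H" "v \<in> H"
 shows "cmod (ip u v) <= hn u * hn v"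
proof -
 have "(cmod (ip u v))\<^sup>2 <= Re (ip u u) * Re (ip v v)"
 proof (rule cauchy_schwarz_2x2)
  fix s t
  let ?w = "fscale (cnj s) u + fscale (cnj t) v"
  have "ip ?w ?w = cnj s * s * ip u u + cnj s * t * ip u v + cnj t * s * ip v u + cnj t * t * ip v v"
   using assms by (simp add: ip_add ip_add_right ip_scale ip_scale_right algebra_simps)
  also have "... = cnj s * s * Re (ip u u) + cnj s * t * ip u v + cnj t * s * cnj (ip u v) + cnj t * t * Re (ip v v)"
   using ip_cnj[OF assms] ip_self[OF assms(1)] ip_self[OF assms(2)] by simp
  finally show "0 <= Re (cnj s * s * cof (Re (ip u u)) + cnj s * t * ip u v + cnj t * s * cnj (ip u v) + cnj t * t * cof (Re (ip v v)))"
   using ip_ge0[of ?w] assms by simp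
 qed
 then have "sqrt ((cmod (ip u v))\<^sup>2) <= sqrt (Re (ip u u) * Re (ip v v))" by (rule real_sqrt_le_mono)
 then show ?thesis by (simp add: hnorm_def real_sqrt_mult)
qed

lemma hn_triangle:
 assumes "u \<in> H" "v \<in> H"
 shows "hn (u + v) <= hn u + hn v"
proof -
 have "(hn (u + v))\<^sup>2 = Re (ip u u) + 2 * Re (ip u v) + Re (ip v v)" using assms ip_cnj[OF assms] by (simp add: hn_sq ip_add ip_add_right)
 also have "... <= (hn u)\<^sup>2 + 2 * (hn u * hn v) + (hn v)\<^sup>2"
  using assms ip_CS[OF assms] complex_Re_le_cmod[of "ip u v"] by (simp add: hn_sq)
 also have "... = (hn u + hn v)\<^sup>2" by (simp add: power2_eq_square algebra_simps)
 finally show ?thesis using assms by (meson hn_ge0 add_nonneg_nonneg power2_le_imp_le)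
qed

lemma hn_scale: "u \<in> H ==> hn (fscale c u) = cmod c * hn u"
proof -
 assume u: "u \<in> H"
 have "ip (fscale c u) (fscale c u) = c * cnj c * ip u u" using u by (simp add: ip_scale ip_scale_right)
 also have "c * cnj c = of_real ((cmod c)\<^sup>2)" by (simp only: complex_norm_square)
 finally show ?thesis by (simp add: hnorm_def real_sqrt_mult)
qed

lemma hn_diff_commute: "u \<in> H ==> v \<in> H ==> hn (u - v) = hn (v - u)"
proof -
 assume uv: "u \<in> H" "v \<in> H"
 have "u - v = fscale (-1) (v - u)" by (simp add: fun_eq_iff fscale_def)
 then show ?thesis using uv hn_scale[of "v - u" "-1"] by simp
qed

lemma hn_triangle_diff: "u \<in> H ==> v \<in> H ==> w \<in> H ==> hn (u - w) <= hn (u - v) + hn (v - w)"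
 using hn_triangle[of "u - v" "v - w"] by simp

abbreviation "BO \<equiv> bounded_ops H ip"

lemma BO_I:
 assumes "!!v. v \<in> H ==> T v \<in> H" "!!v. v ~: H ==> T v = 0"
  "!!u v. u \<in> H ==> v \<in> H ==> T (u + v) = T u + T v" "!!c v. v \<in> H ==> T (fscale c v) = fscale c (T v)"
  "!!v. v \<in> H ==> hn (T v) <= K * hn v"
 shows "T \<in> BO" using assms unfolding bounded_ops_def by blast

lemma BO_D:
 assumes "T \<in> BO"
 shows "v \<in> H ==> T v \<in> H" "v ~: H ==> T v = 0"
  "u \<in> H ==> v \<in> H ==> T (u + v) = T u + T v" "v \<in> H ==> T (fscale c v) = fscale c (T v)"
  "T 0 = 0" "u \<in> H ==> v \<in> H ==> T (u - v) = T u - T v"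
proof -
 show "v \<in> H ==> T v \<in> H" "v ~: H ==> T v = 0" and a: "u \<in> H ==> v \<in> H ==> T (u + v) = T u + T v"
  and s: "v \<in> H ==> T (fscale c v) = fscale c (T v)" for u v c using assms unfolding bounded_ops_def by blast+
 show "T 0 = 0" using a[of 0 0] by simp
 show "u \<in> H ==> v \<in> H ==> T (u - v) = T u - T v" using a[of u "fscale (-1) v"] s[of v "-1"] by (simp only: diff_as_add H_scale)
qed

lemma BO_sum:
 assumes T: "T \<in> BO" and f: "!!i. i \<in> I ==> f i \<in> H"
 shows "T (SUM i:I. f i) = (SUM i:I. T (f i))" using f
proof (induction I rule: infinite_finite_induct)
 case (insert i I)
 then show ?case unfolding sum.insert[OF insert.hyps] by (subst BO_D(3)[OF T]) (auto intro: H_sum)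
qed (simp_all only: sum.infinite sum.empty BO_D(5)[OF T] not_False_eq_True)

lemma BO_bound:
 assumes "T \<in> BO"
 obtains K where "K >= 0" "!!v. v \<in> H ==> hn (T v) <= K * hn v"
proof -
 obtain K where K: "!!v. v \<in> H ==> hn (T v) <= K * hn v" using assms unfolding bounded_ops_def by blast
 have "hn (T v) <= \<bar>K\<bar> * hn v" if "v \<in> H" for v using K[OF that] mult_right_mono[OF abs_ge_self[of K] hn_ge0[OF that]] by linarith
 then show ?thesis using that[of "\<bar>K\<bar>"] by auto
qed

lemma BO_zero: "0 \<in> BO" by (rule BO_I[of _ 0]) (auto simp: fscale_def zero_fun_def[symmetric] hn_eq0)

lemma BO_add:
 assumes S: "S \<in> BO" and T: "T \<in> BO"
 shows "S + T \<in> BO"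
proof -
 obtain K L where K: "!!v. v \<in> H ==> hn (S v) <= K * hn v" and L: "!!v. v \<in> H ==> hn (T v) <= L * hn v"
  using BO_bound[OF S] BO_bound[OF T] by metis
 show ?thesis
 proof (rule BO_I[of _ "K + L"])
  fix v assume v: "v \<in> H"
  then have "hn ((S + T) v) <= hn (S v) + hn (T v)" using BO_D(1)[OF S] BO_D(1)[OF T] by (simp add: hn_triangle)
  then show "hn ((S + T) v) <= (K + L) * hn v" using K[OF v] L[OF v] by (simp add: distrib_right)
 qed (simp_all add: BO_D[OF S] BO_D[OF T] fun_vs.scale_right_distrib add_ac)
qed

lemma BO_comp:
 assumes S: "S \<in> BO" and T: "T \<in> BO"
 shows "S o T \<in> BO"
proof -
 obtain K L where K: "K >= 0" "!!v. v \<in> H ==> hn (S v) <= K * hn v" and L: "!!v. v \<in> H ==> hn (T v) <= L * hn v"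
  using BO_bound[OF S] BO_bound[OF T] by metis
 show ?thesis
 proof (rule BO_I[of _ "K * L"])
  fix v assume v: "v \<in> H"
  have "hn (S (T v)) <= K * hn (T v)" using K(2) BO_D(1)[OF T v] by blast
  also have "... <= K * (L * hn v)" using L[OF v] K(1) by (rule mult_left_mono)
  finally show "hn ((S o T) v) <= K * L * hn v" by (simp add: mult.assoc)
 qed (use BO_D[OF S] BO_D[OF T] in "auto")
qed

lemma BO_op_scale:
 assumes T: "T \<in> BO"
 shows "op_scale c T \<in> BO"
proof -
 obtain K where K: "!!v. v \<in> H ==> hn (T v) <= K * hn v" using BO_bound[OF T] by metis
 show ?thesis
 proof (rule BO_I[of _ "cmod c * K"])
  fix v assume v: "v \<in> H"
  show "hn (op_scale c T v) <= cmod c * K * hn v" using K[OF v] BO_D(1)[OF T v] by (simp add: op_scale_def hn_scale mult.assoc mult_left_mono)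
 qed (use BO_D[OF T] in "auto simp: op_scale_def fun_vs.scale_right_distrib mult.commute")
qed

lemma BO_id: "op_id H \<in> BO" by (rule BO_I[of _ 1]) (auto simp: op_id_def)

lemma BO_eqI: "S \<in> BO ==> T \<in> BO ==> (!!v. v \<in> H ==> S v = T v) ==> S = T"
proof (rule HOL.ext)
 fix v assume ST: "S \<in> BO" "T \<in> BO" "!!v. v \<in> H ==> S v = T v"
 show "S v = T v" using BO_D(2)[OF ST(1)] BO_D(2)[OF ST(2)] ST(3) by (cases "v \<in> H") auto
qed

lemma adj_D: "is_adjoint H ip S T ==> u \<in> H ==> v \<in> H ==> ip (T u) v = ip u (S v)" by (simp add: is_adjoint_def)

lemma adj_sym:
 assumes "is_adjoint H ip S T" "S \<in> BO" "T \<in> BO"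
 shows "is_adjoint H ip T S" unfolding is_adjoint_def
proof (intro ballI)
 fix u v assume uv: "u \<in> H" "v \<in> H"
 have "ip (S u) v = cnj (ip v (S u))" using ip_cnj[of v "S u"] BO_D(1)[OF assms(2) uv(1)] uv by simp
 also have "... = cnj (ip (T v) u)" using adj_D[OF assms(1) uv(2,1)] by simp
 also have "... = ip u (T v)" using ip_cnj[of "T v" u] BO_D(1)[OF assms(3) uv(2)] uv by simp
 finally show "ip (S u) v = ip u (T v)" .
qed

lemma adj_norm:
 assumes a: "!!u v. u \<in> H ==> v \<in> H ==> ip (T u) v = ip u (S v)" and S: "!!v. v \<in> H ==> S v \<in> H" and T: "!!v. v \<in> H ==> T v \<in> H"
  and K: "!!v. v \<in> H ==> hn (T v) <= K * hn v" and v: "v \<in> H"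
 shows "hn (S v) <= K * hn v"
proof (cases "hn (S v) = 0")
 case True
 show ?thesis
 proof (cases "hn v = 0")
  case False
  have "0 <= K * hn v" using K[OF v] hn_ge0[OF T[OF v]] by linarith
  then show ?thesis using True by simp
 qed (use True in simp)
next
 case False
 have "(hn (S v))\<^sup>2 = Re (ip (T (S v)) v)" using a[OF S[OF v] v] S[OF v] by (simp add: hn_sq)
 also have "... <= hn (T (S v)) * hn v" using ip_CS[of "T (S v)" v] T S v complex_Re_le_cmod order_trans by blast
 also have "... <= K * hn (S v) * hn v" using K[OF S[OF v]] v by (intro mult_right_mono) auto
 finally have "hn (S v) * hn (S v) <= hn (S v) * (K * hn v)" by (simp add: power2_eq_square mult_ac)
 then show ?thesis using False hn_ge0[OF S[OF v]] by simp
qed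

text \<open>Membership asks for an adjoint that also commutes with G, so that the commutant of an arbitrary set is closed under
adjoints.\<close>
definition commutant :: "'u op set => 'u op set" where
 "commutant G = {T \<in> BO. EX S:BO. is_adjoint H ip S T & (ALL X:G. T o X = X o T & S o X = X o S)}"

lemma limit_commutes:
 assumes T: "T \<in> BO" and X: "X \<in> BO"
  and ap: "!!eps. eps > 0 ==> EX S:BO. S o X = X o S & (ALL v:H. hn (T v - S v) <= eps * hn v)"
 shows "T o X = X o T"
proof (rule BO_eqI)
 show "T o X \<in> BO" "X o T \<in> BO" using T X by (auto intro: BO_comp)
 obtain K where K: "K >= 0" "!!v. v \<in> H ==> hn (X v) <= K * hn v" using BO_bound[OF X] by metis
 fix v assume v: "v \<in> H"
 have Xv: "X v \<in> H" "T v \<in> H" "T (X v) \<in> H" "X (T v) \<in> H" using BO_D(1)[OF X] BO_D(1)[OF T] v by auto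
 have "hn (T (X v) - X (T v)) <= 0"
 proof (rule field_le_epsilon)
  fix e :: real assume e: "e > 0"
  define eps where "eps = e / (2 * K * hn v + 1)"
  have pos: "2 * K * hn v + 1 > 0" using K(1) v by (simp add: add_nonneg_pos)
  then have "eps > 0" using e by (simp add: eps_def)
  then obtain S where S: "S \<in> BO" "S o X = X o S" "!!v. v \<in> H ==> hn (T v - S v) <= eps * hn v" using ap by blast
  have Sv: "S v \<in> H" "S (X v) \<in> H" using BO_D(1)[OF S(1)] v Xv by auto
  have c: "S (X v) = X (S v)" using S(2) by (metis comp_apply)
  have h1: "hn (T (X v) - X (T v)) <= hn (T (X v) - S (X v)) + hn (S (X v) - X (T v))" using Xv Sv by (intro hn_triangle_diff)
  have h2: "hn (T (X v) - S (X v)) <= eps * (K * hn v)" using S(3)[OF Xv(1)] mult_left_mono[OF K(2)[OF v], of eps] \<open>eps > 0\<close> by linarith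
  have h3: "S (X v) - X (T v) = X (S v - T v)" using c BO_D(6)[OF X Sv(1) Xv(2)] by simp
  have h4: "hn (X (S v - T v)) <= K * hn (S v - T v)" by (rule K(2)) (rule H_diff[OF Sv(1) Xv(2)])
  have h5: "hn (S v - T v) <= eps * hn v" using S(3)[OF v] hn_diff_commute[OF Sv(1) Xv(2)] by linarith
  have "hn (T (X v) - X (T v)) <= eps * (K * hn v) + K * (eps * hn v)" using h1 h2 h4 mult_left_mono[OF h5 K(1)] unfolding h3 by linarith
  also have "... <= eps * (2 * K * hn v + 1)" using \<open>eps > 0\<close> by (simp add: algebra_simps)
  also have "... = e" using pos by (simp add: eps_def)
  finally show "hn (T (X v) - X (T v)) <= 0 + e" by simp
 qed
 then have "hn (T (X v) - X (T v)) = 0" using Xv by (intro order_antisym) auto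
 then show "(T o X) v = (X o T) v" using hn_eq0[of "T (X v) - X (T v)"] Xv by simp
qed

text \<open>The approximants A_n have adjoints B_n with the same commutation properties. As the A_n converge in norm, so do the
B_n, and their limit is the adjoint of T and commutes with G.\<close>
lemma commutant_limit:
 assumes G: "G <= BO" and T: "T \<in> BO"
  and ap: "\<forall>eps>0. EX S:commutant G. ALL v:H. hn (T v - S v) <= eps * hn v"
 shows "T \<in> commutant G"
proof -
 define good where "good eps A B \<longleftrightarrow> A \<in> BO & B \<in> BO & is_adjoint H ip B A & (ALL X:G. A o X = X o A & B o X = X o B) &
  (ALL v:H. hn (T v - A v) <= eps * hn v)" for eps A B
 have "EX A B. good eps A B" if "eps > 0" for eps
 proof -
  obtain S where S: "S \<in> commutant G" "ALL v:H. hn (T v - S v) <= eps * hn v" using ap[rule_format, OF \<open>eps > 0\<close>] by blast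
  then show ?thesis unfolding commutant_def good_def by blast
 qed
 then have "ALL n. EX A B. good (inverse (real (Suc n))) A B" by (simp del: of_nat_Suc)
 then obtain A B where AB: "!!n. good (inverse (real (Suc n))) (A n) (B n)" by metis
 have A: "A n \<in> BO" and B: "B n \<in> BO" and adj: "is_adjoint H ip (B n) (A n)"
  and cA: "!!X. X \<in> G ==> A n o X = X o A n" and cB: "!!X. X \<in> G ==> B n o X = X o B n"
  and near: "!!v. v \<in> H ==> hn (T v - A n v) <= inverse (real (Suc n)) * hn v" for n using AB[of n] by (auto simp: good_def)
 have AH: "A n v \<in> H" and BH: "B n v \<in> H" and TH: "T v \<in> H" if "v \<in> H" for n v
  using BO_D(1)[OF A that] BO_D(1)[OF B that] BO_D(1)[OF T that] by auto
 have AA: "hn (A m v - A n v) <= (inverse (real (Suc m)) + inverse (real (Suc n))) * hn v" if v: "v \<in> H" for m n v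
 proof -
  have "hn (A m v - A n v) <= hn (A m v - T v) + hn (T v - A n v)" using v AH TH by (intro hn_triangle_diff)
  then show ?thesis using near[OF v, of m] near[OF v, of n] hn_diff_commute[of "A m v" "T v"] AH[OF v] TH[OF v] by (simp add: distrib_right)
 qed
 have BB: "hn (B m v - B n v) <= (inverse (real (Suc m)) + inverse (real (Suc n))) * hn v" if v: "v \<in> H" for m n v
 proof (rule adj_norm[where T = "%v. A m v - A n v" and S = "%v. B m v - B n v"])
  show "ip (A m u - A n u) v = ip u (B m v - B n v)" if "u \<in> H" "v \<in> H" for u v
   using that adj_D[OF adj] AH BH by (simp add: ip_diff ip_diff_right)
 qed (use v AA AH BH in auto)
 have "EX l:H. (%n. hn (B n v - l)) \<longlonglongrightarrow> 0" if v: "v \<in> H" for v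
 proof (rule complete)
  show "B n v \<in> H" for n using BH[OF v] .
  fix eps :: real assume e: "eps > 0"
  have "(%n. inverse (real (Suc n)) * hn v) \<longlonglongrightarrow> 0" using LIMSEQ_inverse_real_of_nat by (rule tendsto_mult_left_zero)
  then have "\<forall>\<^sub>F n in sequentially. inverse (real (Suc n)) * hn v < eps / 2" using e by (intro order_tendstoD(2)) auto
  then obtain M where M: "!!n. n >= M ==> inverse (real (Suc n)) * hn v < eps / 2" unfolding eventually_sequentially by blast
  have "hn (B i v - B j v) < eps" if "i >= M" "j >= M" for i j using BB[OF v, of i j] M[OF that(1)] M[OF that(2)] by (simp add: distrib_right)
  then show "EX M. ALL i>=M. ALL j>=M. hn (B i v - B j v) < eps" by blast
 qed
 then have "ALL v. EX l. v \<in> H --> l \<in> H & (%n. hn (B n v - l)) \<longlonglongrightarrow> 0" by blast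
 from choice[OF this] obtain S0 where S0: "!!v. v \<in> H ==> S0 v \<in> H" "!!v. v \<in> H ==> (%n. hn (B n v - S0 v)) \<longlonglongrightarrow> 0" by blast
 define S where "S v = (if v \<in> H then S0 v else 0)" for v
 have SH: "S v \<in> H" if "v \<in> H" for v using S0 that by (simp add: S_def)
 have adjS: "ip (T u) v = ip u (S v)" if uv: "u \<in> H" "v \<in> H" for u v
 proof -
  have "(%n. ip (A n u) v - ip (T u) v) \<longlonglongrightarrow> 0"
  proof (rule Lim_null_comparison)
   show "(%n. inverse (real (Suc n)) * (hn u * hn v)) \<longlonglongrightarrow> 0" by (intro tendsto_mult_left_zero LIMSEQ_inverse_real_of_nat)
   show "\<forall>\<^sub>F n in sequentially. norm (ip (A n u) v - ip (T u) v) <= inverse (real (Suc n)) * (hn u * hn v)"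
   proof (intro always_eventually allI)
    fix n
    have "ip (A n u) v - ip (T u) v = ip (A n u - T u) v" using uv AH TH by (simp add: ip_diff)
    then have "cmod (ip (A n u) v - ip (T u) v) <= hn (A n u - T u) * hn v" using uv AH TH ip_CS[of "A n u - T u" v] by simp
    also have "... <= (inverse (real (Suc n)) * hn u) * hn v"
     by (rule mult_right_mono) (use near[OF uv(1), of n] hn_diff_commute[OF AH[OF uv(1), of n] TH[OF uv(1)]] uv in simp_all)
    finally show "norm (ip (A n u) v - ip (T u) v) <= inverse (real (Suc n)) * (hn u * hn v)" by (simp add: mult.assoc)
   qed
  qed
  then have 1: "(%n. ip (A n u) v) \<longlonglongrightarrow> ip (T u) v" by (rule LIM_zero_cancel)
  have "(%n. ip u (B n v) - ip u (S v)) \<longlonglongrightarrow> 0"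
  proof (rule Lim_null_comparison)
   show "(%n. hn u * hn (B n v - S v)) \<longlonglongrightarrow> 0" using S0(2)[OF uv(2)] uv(2) unfolding S_def by (auto intro: tendsto_mult_right_zero)
   show "\<forall>\<^sub>F n in sequentially. norm (ip u (B n v) - ip u (S v)) <= hn u * hn (B n v - S v)"
   proof (intro always_eventually allI)
    fix n
    have "ip u (B n v) - ip u (S v) = ip u (B n v - S v)" using uv BH SH by (simp add: ip_diff_right)
    then show "norm (ip u (B n v) - ip u (S v)) <= hn u * hn (B n v - S v)" using uv BH SH ip_CS[of u "B n v - S v"] by simp
   qed
  qed
  then have 2: "(%n. ip u (B n v)) \<longlonglongrightarrow> ip u (S v)" by (rule LIM_zero_cancel)
  have "ip (A n u) v = ip u (B n v)" for n using adj_D[OF adj uv] .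
  then show ?thesis using LIMSEQ_unique[OF 1] 2 by simp
 qed
 obtain K where K: "K >= 0" "!!v. v \<in> H ==> hn (T v) <= K * hn v" using BO_bound[OF T] by metis
 have S: "S \<in> BO"
 proof (rule BO_I[of _ K])
  fix u v assume uv: "u \<in> H" "v \<in> H"
  have "S (u + v) - (S u + S v) = 0" by (rule ip_eq0) (use uv SH in "simp_all add: ip_diff_right ip_add_right adjS[symmetric] TH")
  then show "S (u + v) = S u + S v" by simp
 next
  fix c v assume v: "v \<in> H"
  have "S (fscale c v) - fscale c (S v) = 0" by (rule ip_eq0) (use v SH in "simp_all add: ip_diff_right ip_scale_right adjS[symmetric] TH")
  then show "S (fscale c v) = fscale c (S v)" by simp
 next
  fix v assume v: "v \<in> H"
  show "hn (S v) <= K * hn v" by (rule adj_norm[OF adjS SH TH K(2) v])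
 qed (use SH in "auto simp: S_def")
 have nearS: "hn (S v - B n v) <= inverse (real (Suc n)) * hn v" if v: "v \<in> H" for n v
 proof (rule adj_norm[where T = "%v. T v - A n v" and S = "%v. S v - B n v"])
  show "ip (T u - A n u) v = ip u (S v - B n v)" if "u \<in> H" "v \<in> H" for u v
   using that adj_D[OF adj] adjS AH BH TH SH by (simp add: ip_diff ip_diff_right)
 qed (use v near AH BH TH SH in auto)
 have arch': "EX n. ALL x>=0. inverse (real (Suc n)) * x <= eps * x" if "eps > 0" for eps
  using reals_Archimedean[OF that] by (meson less_imp_le mult_right_mono)
 have "T o X = X o T & S o X = X o S" if X: "X \<in> G" for X
 proof
  have XB: "X \<in> BO" using X G by blast
  show "T o X = X o T"
  proof (rule limit_commutes[OF T XB])
   fix eps :: real assume "eps > 0"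
   then obtain n where n: "!!x. x >= 0 ==> inverse (real (Suc n)) * x <= eps * x" using arch' by blast
   show "EX S:BO. S o X = X o S & (ALL v:H. hn (T v - S v) <= eps * hn v)"
    using A[of n] cA[OF X, of n] order_trans[OF near[of _ n] n[OF hn_ge0]] by (intro bexI[of _ "A n"]) blast+
  qed
  show "S o X = X o S"
  proof (rule limit_commutes[OF S XB])
   fix eps :: real assume "eps > 0"
   then obtain n where n: "!!x. x >= 0 ==> inverse (real (Suc n)) * x <= eps * x" using arch' by blast
   show "EX T:BO. T o X = X o T & (ALL v:H. hn (S v - T v) <= eps * hn v)"
    using B[of n] cB[OF X, of n] order_trans[OF nearS[of _ n] n[OF hn_ge0]] by (intro bexI[of _ "B n"]) blast+
  qed
 qed
 then show ?thesis unfolding commutant_def using T S adjS by (auto simp: is_adjoint_def)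
qed

lemma commutant_cstar:
 assumes G: "G <= BO"
 shows "cstar_algebra H ip (commutant G)" unfolding cstar_algebra_def
proof (intro conjI ballI allI impI)
 show "commutant G <= BO" by (auto simp: commutant_def)
 have X0: "X 0 = 0" if "X \<in> G" for X using BO_D(5) G that by blast
 have z: "(0 :: 'u op) = (%_. 0)" by (simp add: fun_eq_iff)
 have "is_adjoint H ip 0 0" by (auto simp: is_adjoint_def)
 moreover have "0 o X = X o 0" if "X \<in> G" for X using X0[OF that] by (auto simp: fun_eq_iff z zero_fun_def)
 ultimately show "0 \<in> commutant G" using BO_zero unfolding commutant_def by blast
next
 fix S T assume ST: "S \<in> commutant G" "T \<in> commutant G"
 obtain S' where S: "S \<in> BO" "S' \<in> BO" "is_adjoint H ip S' S" "!!X. X \<in> G ==> S o X = X o S" "!!X. X \<in> G ==> S' o X = X o S'"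
  using ST(1) unfolding commutant_def by blast
 obtain T' where T: "T \<in> BO" "T' \<in> BO" "is_adjoint H ip T' T" "!!X. X \<in> G ==> T o X = X o T" "!!X. X \<in> G ==> T' o X = X o T'"
  using ST(2) unfolding commutant_def by blast
 have p: "S v \<in> H" "S' v \<in> H" "T v \<in> H" "T' v \<in> H" if "v \<in> H" for v
  using BO_D(1)[OF S(1)] BO_D(1)[OF S(2)] BO_D(1)[OF T(1)] BO_D(1)[OF T(2)] that by auto
 have addc: "(U + V) o X = X o (U + V)" if "U \<in> BO" "V \<in> BO" "U o X = X o U" "V o X = X o V" "X \<in> G" for U V X
 proof (rule BO_eqI)
  have X: "X \<in> BO" using that G by blast
  show "(U + V) o X \<in> BO" "X o (U + V) \<in> BO" using that X by (auto intro: BO_comp BO_add)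
  fix v assume v: "v \<in> H"
  have "U (X v) = X (U v)" "V (X v) = X (V v)" using that by (metis comp_apply)+
  then show "((U + V) o X) v = (X o (U + V)) v" using v BO_D(1)[OF that(1)] BO_D(1)[OF that(2)] by (simp add: BO_D(3)[OF X])
 qed
 have "is_adjoint H ip (S' + T') (S + T)" unfolding is_adjoint_def using p adj_D[OF S(3)] adj_D[OF T(3)] by (simp add: ip_add ip_add_right)
 then show "S + T \<in> commutant G" unfolding commutant_def using S T by (blast intro: BO_add addc)
 have "is_adjoint H ip (T' o S') (S o T)" unfolding is_adjoint_def using p adj_D[OF S(3)] adj_D[OF T(3)] by simp
 moreover have "(S o T) o X = X o (S o T)" "(T' o S') o X = X o (T' o S')" if "X \<in> G" for X
  using S(4,5)[OF that, THEN fun_cong] T(4,5)[OF that, THEN fun_cong] by (simp_all add: fun_eq_iff[where ?'b = "'u => complex"])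
 ultimately show "S o T \<in> commutant G" unfolding commutant_def using S(1,2) T(1,2) by (blast intro: BO_comp)
next
 fix c T assume "T \<in> commutant G"
 then obtain T' where T: "T \<in> BO" "T' \<in> BO" "is_adjoint H ip T' T" "!!X. X \<in> G ==> T o X = X o T" "!!X. X \<in> G ==> T' o X = X o T'"
  unfolding commutant_def by blast
 have sc: "op_scale c U o X = X o op_scale c U" if "U \<in> BO" "U o X = X o U" "X \<in> G" for U X c
 proof (rule BO_eqI)
  have X: "X \<in> BO" using that G by blast
  show "op_scale c U o X \<in> BO" "X o op_scale c U \<in> BO" using that X by (auto intro: BO_comp BO_op_scale)
  fix v assume v: "v \<in> H"
  have "U (X v) = X (U v)" using that by (metis comp_apply)
  then show "(op_scale c U o X) v = (X o op_scale c U) v" using v BO_D(1)[OF that(1)] by (simp add: op_scale_def BO_D(4)[OF X])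
 qed
 have "is_adjoint H ip (op_scale (cnj c) T') (op_scale c T)"
  unfolding is_adjoint_def using BO_D(1)[OF T(1)] BO_D(1)[OF T(2)] adj_D[OF T(3)] by (simp add: op_scale_def ip_scale ip_scale_right)
 then show "op_scale c T \<in> commutant G" unfolding commutant_def using T by (blast intro: BO_op_scale sc)
next
 fix T assume "T \<in> commutant G"
 then obtain T' where T: "T \<in> BO" "T' \<in> BO" "is_adjoint H ip T' T" "!!X. X \<in> G ==> T o X = X o T" "!!X. X \<in> G ==> T' o X = X o T'"
  unfolding commutant_def by blast
 then have "T' \<in> commutant G" unfolding commutant_def using adj_sym by blast
 then show "EX S:commutant G. is_adjoint H ip S T" using T by blast
next
 fix T assume "T \<in> BO" "\<forall>eps>0. EX S:commutant G. ALL v:H. hn (T v - S v) <= eps * hn v"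
 then show "T \<in> commutant G" using commutant_limit[OF G] by blast
qed

text \<open>If P a = a and P w = 0, then norm(s a) is at most norm(s a + t w) for all scalars s and t. So the hermitian form with
diagonal entries 0 and norm(w)^2 and off-diagonal entry ip a w is positive semidefinite, and ip a w = 0: range and
kernel of P are orthogonal.\<close>
lemma idempotent_contraction_selfadjoint:
 assumes P: "P \<in> BO" and id: "P o P = P" and c: "!!v. v \<in> H ==> hn (P v) <= hn v"
 shows "is_adjoint H ip P P"
proof -
 have PP: "P (P v) = P v" for v using id by (metis comp_apply)
 note PH = BO_D(1)[OF P]
 have orth: "ip (P u) (v - P v) = 0" if uv: "u \<in> H" "v \<in> H" for u v
 proof -
  define a w where "a = P u" and "w = v - P v"
  have aw: "a \<in> H" "w \<in> H" "P a = a" "P w = 0" using uv PH by (auto simp: a_def w_def PP BO_D(6)[OF P])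
  have "(cmod (ip a w))\<^sup>2 <= 0 * Re (ip w w)"
  proof (rule cauchy_schwarz_2x2)
   fix s t :: complex
   have "P (fscale (cnj s) a + fscale (cnj t) w) = fscale (cnj s) a" using aw by (simp add: BO_D(3,4)[OF P])
   then have "hn (fscale (cnj s) a) <= hn (fscale (cnj s) a + fscale (cnj t) w)" using c[of "fscale (cnj s) a + fscale (cnj t) w"] aw by simp
   then have "(hn (fscale (cnj s) a))\<^sup>2 <= (hn (fscale (cnj s) a + fscale (cnj t) w))\<^sup>2" using aw by (simp add: power_mono)
   then have "Re (ip (fscale (cnj s) a) (fscale (cnj s) a)) <= Re (ip (fscale (cnj s) a + fscale (cnj t) w) (fscale (cnj s) a + fscale (cnj t) w))"
    using aw by (simp add: hn_sq)
   also have "ip (fscale (cnj s) a + fscale (cnj t) w) (fscale (cnj s) a + fscale (cnj t) w) =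
     ip (fscale (cnj s) a) (fscale (cnj s) a) + (cnj s * t * ip a w + cnj t * s * ip w a + cnj t * t * ip w w)"
    using aw by (simp add: ip_add ip_add_right ip_scale ip_scale_right algebra_simps)
   also have "ip w a = cnj (ip a w)" using aw by (intro ip_cnj)
   finally show "0 <= Re (cnj s * s * cof 0 + cnj s * t * ip a w + cnj t * s * cnj (ip a w) + cnj t * t * cof (Re (ip w w)))"
    using ip_self[OF aw(2)] by simp
  qed
  then show ?thesis by (simp add: a_def w_def)
 qed
 show ?thesis unfolding is_adjoint_def
 proof (intro ballI)
  fix u v assume uv: "u \<in> H" "v \<in> H"
  have 1: "ip (P u) v = ip (P u) (P v)" using orth[OF uv] uv PH by (simp add: ip_diff_right)
  have "ip (P v) u = ip (P v) (P u)" using orth[OF uv(2,1)] uv PH by (simp add: ip_diff_right)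
  then have "ip u (P v) = ip (P u) (P v)" using ip_cnj[of "P v" u] ip_cnj[of "P v" "P u"] uv PH by simp
  with 1 show "ip (P u) v = ip u (P v)" by simp
 qed
qed

end

section \<open>Commuting models from projections\<close>

context hilbert_space begin

lemma BO_Sum: "(!!i. i \<in> I ==> f i \<in> BO) ==> (SUM i:I. f i) \<in> BO"
proof (induction I rule: infinite_finite_induct)
 case (insert i I)
 then show ?case unfolding sum.insert[OF insert.hyps] by (intro BO_add) auto
qed (simp_all only: sum.infinite sum.empty BO_zero not_False_eq_True)

text \<open>Sums of mutually orthogonal projections along rows of a complete array form a projection-valued measure.\<close>
lemma marginal_pvm:
 fixes Q :: "'o::finite => 'o => 'u op"
 assumes BO: "!!c d. Q c d \<in> BO" and adj: "!!c d u v. u \<in> H ==> v \<in> H ==> ip (Q c d u) v = ip u (Q c d v)"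
  and orth: "!!c d c' d' v. v \<in> H ==> Q c d (Q c' d' v) = (if c = c' then if d = d' then Q c d v else 0 else 0)"
  and one: "!!v. v \<in> H ==> (SUM c:UNIV. SUM d:UNIV. Q c d v) = v"
 shows "pvm H ip (%c. SUM d:UNIV. Q c d)"
proof -
 define E where "E c = (SUM d:UNIV. Q c d)" for c
 have EB: "E c \<in> BO" for c unfolding E_def by (intro BO_Sum BO)
 have Ev: "E c v = (SUM d:UNIV. Q c d v)" for c v by (simp add: E_def sum_fun_apply)
 have QH: "Q c d v \<in> H" if "v \<in> H" for c d v using BO_D(1)[OF BO that] .
 have "E c o E c = E c" for c
 proof (rule BO_eqI)
  show "E c o E c \<in> BO" "E c \<in> BO" by (intro BO_comp EB)+
 qed (simp add: Ev BO_sum[OF BO] QH orth)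
 moreover have "ip u (SUM i:UNIV. f i) = (SUM i:UNIV. ip u (f i))" if "u \<in> H" "!!i. f i \<in> H" for u and f :: "'o => 'u => complex"
  using ip_cnj[of "SUM i:UNIV. f i" u] ip_cnj[of "f _" u] that ip_sum[of UNIV f u] by (simp add: H_sum)
 then have "is_adjoint H ip (E c) (E c)" for c unfolding is_adjoint_def using QH adj by (auto simp: Ev ip_sum)
 moreover have "(SUM c:UNIV. E c) = op_id H" by (rule BO_eqI[OF BO_Sum BO_id]) (simp_all add: EB sum_fun_apply Ev one op_id_def)
 ultimately show ?thesis unfolding pvm_def E_def[symmetric] using EB by blast
qed

text \<open>Projections summing to the identity are mutually orthogonal, so the marginals E x a and F y b are projections whose
product in either order is P a b x y. In particular they commute, and the commutant of the F y b together with its own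
commutant provides the two C*-algebras.\<close>
lemma commuting_model_of_projections:
 fixes P :: "'o::finite => 'o => 'i::finite => 'i => 'u op"
 assumes BO: "!!a b x y. P a b x y \<in> BO" and idem: "!!a b x y. P a b x y o P a b x y = P a b x y"
  and contr: "!!a b x y v. v \<in> H ==> hn (P a b x y v) <= hn v"
  and r1: "!!x y v. v \<in> H ==> (SUM a:UNIV. SUM b:UNIV. P a b x y v) = v"
  and r2: "!!a x y z v. v \<in> H ==> (SUM b:UNIV. P a b x y v) = (SUM b:UNIV. P a b x z v)"
  and r3: "!!a x y z v. v \<in> H ==> (SUM b:UNIV. P b a y x v) = (SUM b:UNIV. P b a z x v)"
  and W: "Omega \<in> H" "ip Omega Omega = 1" and p: "!!a b x y. p a b x y = ip (P a b x y Omega) Omega"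
 shows "commuting_model H ip p" "correlation p"
proof -
 have PH: "P a b x y v \<in> H" if "v \<in> H" for a b x y v using BO_D(1)[OF BO that] .
 have PP: "P a b x y (P a b x y v) = P a b x y v" for a b x y v using idem by (metis comp_apply)
 have adj: "ip (P a b x y u) v = ip u (P a b x y v)" if "u \<in> H" "v \<in> H" for a b x y u v
  using adj_D[OF idempotent_contraction_selfadjoint[OF BO idem contr] that] .
 have sq: "ip (P a b x y v) v = ip (P a b x y v) (P a b x y v)" if "v \<in> H" for a b x y v
  using adj[OF PH[OF that] that, of a b x y a b x y] by (simp add: PP)
 have orth: "P a b x y (P a' b' x y v) = (if a = a' then if b = b' then P a b x y v else 0 else 0)" if v: "v \<in> H" for a b a' b' x y v
 proof (cases "(a, b) = (a', b')")
  case ne: False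
  define w where "w = P a' b' x y v"
  define h where "h q = Re (ip (P (fst q) (snd q) x y w) (P (fst q) (snd q) x y w))" for q
  have w: "w \<in> H" using PH v by (simp add: w_def)
  have h0: "h q >= 0" for q using ip_ge0[OF PH[OF w]] by (simp add: h_def)
  have "ip w w = (SUM a:UNIV. SUM b:UNIV. ip (P a b x y w) w)" using arg_cong[OF r1[OF w, of x y], of "%u. ip u w"] w PH by (simp add: ip_sum H_sum)
  then have "Re (ip w w) = (SUM a:UNIV. SUM b:UNIV. h (a, b))" by (simp add: sq[OF w] h_def)
  also have "... = (SUM q:UNIV. h q)" by (simp add: sum.cartesian_product)
  also have "... = h (a', b') + (SUM q:UNIV - {(a', b')}. h q)" by (rule sum.remove) auto
  also have "h (a', b') = Re (ip w w)" by (simp add: h_def w_def PP)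
  finally have "(SUM q:UNIV - {(a', b')}. h q) = 0" by simp
  then have "h (a, b) = 0" using ne h0 by (subst (asm) sum_nonneg_eq_0_iff) auto
  then have "hn (P a b x y w) = 0" by (simp add: h_def hnorm_def)
  then show ?thesis using hn_eq0[OF PH[OF w]] ne by (auto simp: w_def)
 qed (simp add: PP)
 \<comment> \<open>By the nonsignalling relations the marginals do not depend on the other input, so any input will do.\<close>
 define x0 where "x0 = (undefined :: 'i)"
 define E where "E x a = (SUM b:UNIV. P a b x x0)" for x a
 define F where "F y b = (SUM a:UNIV. P a b x0 y)" for y b
 have EB: "E x a \<in> BO" and FB: "F x a \<in> BO" for x a unfolding E_def F_def by (intro BO_Sum BO)+
 have Ev: "E x a v = (SUM b:UNIV. P a b x y v)" if "v \<in> H" for x a y v using r2[OF that] by (simp add: E_def sum_fun_apply)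
 have Fv: "F y b v = (SUM a:UNIV. P a b x y v)" if "v \<in> H" for x b y v using r3[OF that] by (simp add: F_def sum_fun_apply)
 have EH: "E x a v \<in> H" and FH: "F x a v \<in> H" if "v \<in> H" for x a v using BO_D(1)[OF EB that] BO_D(1)[OF FB that] by auto
 note dist = BO_sum[OF BO] PH
 have orth': "P a b x y (P a' b' x y v) = (if b = b' then if a = a' then P a b x y v else 0 else 0)" if "v \<in> H" for a b a' b' x y v
  using orth[OF that] by simp
 have EF: "E x a (F y b v) = P a b x y v" if v: "v \<in> H" for x a y b v
  unfolding Ev[OF FH[OF v], where y = y] by (subst Fv[OF v, where x = x]) (simp add: dist orth v)
 have FE: "F y b (E x a v) = P a b x y v" if v: "v \<in> H" for x a y b v
  unfolding Fv[OF EH[OF v], where x = x] by (subst Ev[OF v, where y = y]) (simp add: dist orth' v)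
 have pv: "pvm H ip (E x)" "pvm H ip (F x)" for x
 proof -
  show "pvm H ip (E x)" unfolding E_def by (rule marginal_pvm) (simp_all add: BO adj orth r1)
  have "(SUM b:UNIV. SUM a:UNIV. P a b x0 x v) = v" if "v \<in> H" for v using r1[OF that, of x0 x] by (subst sum.swap)
  then show "pvm H ip (F x)" unfolding F_def by (intro marginal_pvm) (simp_all add: BO adj orth)
 qed
 then have Eadj: "is_adjoint H ip (E x a) (E x a)" and Fadj: "is_adjoint H ip (F x a) (F x a)" for x a unfolding pvm_def by blast+
 have comm: "E x a o F y b = F y b o E x a" for x a y b by (rule BO_eqI) (auto intro: BO_comp EB FB simp: EF FE)
 define G where "G = {F y b | y b. True}"
 define \<A> where "\<A> = commutant G"
 define \<B> where "\<B> = commutant \<A>"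
 have G: "G <= BO" using FB by (auto simp: G_def)
 have \<A>: "\<A> <= BO" by (auto simp: \<A>_def commutant_def)
 have \<B>: "\<B> <= BO" by (auto simp: \<B>_def commutant_def)
 have cA: "cstar_algebra H ip \<A>" unfolding \<A>_def by (rule commutant_cstar[OF G])
 have cB: "cstar_algebra H ip \<B>" unfolding \<B>_def by (rule commutant_cstar[OF \<A>])
 have AB: "S o T = T o S" if "S \<in> \<A>" "T \<in> \<B>" for S T using that unfolding \<B>_def commutant_def by force
 have EA: "E x a \<in> \<A>" for x a unfolding \<A>_def commutant_def using EB Eadj comm by (auto simp: G_def intro!: bexI[of _ "E x a"])
 have FBB: "F y b \<in> \<B>" for y b
 proof -
  have FG: "F y b \<in> G" by (auto simp: G_def)
  have "F y b o X = X o F y b" if "X \<in> \<A>" for X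
  proof -
   have "X o Y = Y o X" if "Y \<in> G" for Y using \<open>X \<in> \<A>\<close> that unfolding \<A>_def commutant_def by blast
   from this[OF FG] show ?thesis by (rule sym)
  qed
  then show ?thesis unfolding \<B>_def commutant_def using FB Fadj by blast
 qed
 have "cstar_generated H ip (\<A> \<union> \<B>) <= commutant {}"
 proof -
  have "\<A> \<union> \<B> <= commutant {}" unfolding \<A>_def \<B>_def commutant_def by blast
  then show ?thesis unfolding cstar_generated_def using commutant_cstar[of "{}"] by blast
 qed
 then have gen: "cstar_generated H ip (\<A> \<union> \<B>) <= BO" by (auto simp: commutant_def)
 define phi where "phi T = ip (T Omega) Omega" for T
 have st: "state_on H ip (cstar_generated H ip (\<A> \<union> \<B>)) phi" unfolding state_on_def
 proof (intro conjI ballI allI impI)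
  fix S T assume "S \<in> cstar_generated H ip (\<A> \<union> \<B>)" "T \<in> cstar_generated H ip (\<A> \<union> \<B>)"
  then have ST: "S \<in> BO" "T \<in> BO" using gen by auto
  note h = BO_D(1)[OF ST(1)] BO_D(1)[OF ST(2)]
  show "phi (S + T) = phi S + phi T" using h W by (simp add: phi_def ip_add)
  assume a: "is_adjoint H ip S T"
  have "ip (S (T Omega)) Omega = cnj (ip Omega (S (T Omega)))" using h W by (intro ip_cnj) auto
  also have "... = cnj (ip (T Omega) (T Omega))" using adj_D[OF a W(1) h(2)[OF W(1)]] by simp
  finally show "phi (S o T) \<in> Rnn" using ip_self[OF h(2)[OF W(1)]] ip_ge0[OF h(2)[OF W(1)]]
   by (simp add: phi_def complex_nonneg_Reals_iff) (metis Im_complex_of_real)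
 next
  fix c T assume "T \<in> cstar_generated H ip (\<A> \<union> \<B>)"
  then have T: "T \<in> BO" using gen by auto
  show "phi (op_scale c T) = c * phi T" using BO_D(1)[OF T] W by (simp add: phi_def op_scale_def ip_scale)
 next
  show "phi (op_id H) = 1" using W by (simp add: phi_def op_id_def)
 qed
 have pE: "p a b x y = phi (E x a o F y b)" for a b x y using EF[OF W(1)] by (simp add: p phi_def)
 show "commuting_model H ip p" unfolding commuting_model_def
 proof (intro conjI exI)
  show "hilbert_space H ip" by unfold_locales
  show "cstar_algebra H ip \<A>" "cstar_algebra H ip \<B>" by (fact cA cB)+
  show "ALL S:\<A>. ALL T:\<B>. S o T = T o S" using AB by blast
  show "ALL x. pvm H ip (E x) & (ALL a. E x a \<in> \<A>)" using pv EA by blast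
  show "ALL y. pvm H ip (F y) & (ALL b. F y b \<in> \<B>)" using pv FBB by blast
  show "state_on H ip (cstar_generated H ip (\<A> \<union> \<B>)) phi" by (rule st)
  show "ALL a b x y. p a b x y = phi (E x a o F y b)" using pE by blast
 qed
 show "correlation p" unfolding correlation_def
 proof (intro conjI allI)
  fix a b x y
  have "p a b x y = of_real (Re (ip (P a b x y Omega) (P a b x y Omega)))"
   using sq[OF W(1), of a b x y] ip_self[OF PH[OF W(1)], of a b x y] by (simp add: p)
  then show "p a b x y \<in> Rnn" using ip_ge0[OF PH[OF W(1)], of a b x y] by simp
 next
  fix x y
  have "(SUM a:UNIV. SUM b:UNIV. p a b x y) = ip (SUM a:UNIV. SUM b:UNIV. P a b x y Omega) Omega" using PH W by (simp add: p ip_sum H_sum)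
  then show "(SUM a:UNIV. SUM b:UNIV. p a b x y) = 1" using r1[OF W(1)] W by simp
 qed
qed

end

section \<open>The reproducing kernel Hilbert space\<close>

definition hap :: "(nat => complex) => (nat => complex) => complex" where
 "hap h c = (SUM n<bnd c. cnj (c n) * h n)"

lemma hap_eq: "(!!i. i >= k ==> c i = 0) ==> hap h c = (SUM n<k. cnj (c n) * h n)"
proof -
 assume c: "!!i. i >= k ==> c i = 0"
 have "c \<in> FS" using c by (rule FSI)
 then show ?thesis unfolding hap_def by (intro sum.mono_neutral_left) (use bnd_le[of k c, OF c] bnd[of c] in auto)
qed

lemma hap_zero [simp]: "hap h 0 = 0" by (simp add: hap_def)

lemma re_cnj_mult: "Re (cnj z * z) = (cmod z)\<^sup>2" unfolding cmod_power2 by (simp add: power2_eq_square)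

lemma hap_add_arg:
 assumes "c \<in> FS" "d \<in> FS"
 shows "hap h (c + d) = hap h c + hap h d" "hap h (c - d) = hap h c - hap h d" "hap h (fscale t c) = cnj t * hap h c"
proof -
 obtain k where k: "!!i. i >= k ==> c i = 0" "!!i. i >= k ==> d i = 0" using frmI_common[OF assms(1,1,2)] by metis
 show "hap h (c + d) = hap h c + hap h d" "hap h (c - d) = hap h c - hap h d" "hap h (fscale t c) = cnj t * hap h c"
  using k by (simp_all add: hap_eq[of k] fscale_def algebra_simps sum.distrib sum_subtractf sum_distrib_left)
qed

lemma hap_scale_arg: "c \<in> FS ==> hap h (fscale t c) = cnj t * hap h c" by (rule hap_add_arg(3))

lemma hap_sum_arg: "(!!i. i \<in> I ==> c i \<in> FS) ==> hap h (SUM i:I. c i) = (SUM i:I. hap h (c i))"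
proof (induction I rule: infinite_finite_induct)
 case (insert i I)
 then show ?case unfolding sum.insert[OF insert.hyps] by (subst hap_add_arg) (auto intro: FS_sum)
qed (simp_all only: sum.infinite sum.empty not_False_eq_True hap_zero)

lemma hap_add: "hap (h + h') c = hap h c + hap h' c" and hap_diff: "hap (h - h') c = hap h c - hap h' c"
 and hap_scale: "hap (fscale t h) c = t * hap h c" by (simp_all add: hap_def fscale_def algebra_simps sum.distrib sum_subtractf sum_distrib_left)

lemma hap_evec: "hap h (evec n) = h n"
proof -
 have "hap h (evec n) = (SUM i<Suc n. if i = n then h n else 0)" by (subst hap_eq[of "Suc n"]) (auto simp: evec_def intro!: sum.cong)
 then show ?thesis by simp
qed

context psd_family begin

text \<open>The reproducing kernel Hilbert space: functions h on the basis whose pairing hap with finitely supported vectors is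
bounded for the seminorm N. Functions are used in place of classes modulo null vectors because the carrier of a
Hilbert space is a set of functions.\<close>
definition H0 :: "(nat => complex) set" where
 "H0 = {h. EX K. ALL c:FS. cmod (hap h c) <= K * N c}"

definition hat :: "(nat => complex) => nat => complex" where "hat h l = hap h (gs l)"

definition ip0 :: "(nat => complex) => (nat => complex) => complex" where
 "ip0 h h' = (\<Sum>l. hat h l * cnj (hat h' l))"

lemma H0_null: "h \<in> H0 ==> c \<in> FS ==> N c = 0 ==> hap h c = 0" unfolding H0_def by force

lemma hap_cong_null: "h \<in> H0 ==> c \<in> FS ==> d \<in> FS ==> N (c - d) = 0 ==> hap h c = hap h d"
 using H0_null[of h "c - d"] by (simp add: hap_add_arg)

lemma H0_subspace: "fun_vs.subspace H0"
proof (rule fun_vs.subspaceI)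
 show "0 \<in> H0" unfolding H0_def by (auto simp: hap_def intro!: exI[of _ 0])
 fix h h' assume "h \<in> H0" "h' \<in> H0"
 then obtain K K' where K: "!!c. c \<in> FS ==> cmod (hap h c) <= K * N c" "!!c. c \<in> FS ==> cmod (hap h' c) <= K' * N c" unfolding H0_def by blast
 have "cmod (hap (h + h') c) <= (K + K') * N c" if "c \<in> FS" for c
  using norm_triangle_ineq[of "hap h c" "hap h' c"] K[OF that] by (simp add: hap_add distrib_right)
 then show "h + h' \<in> H0" unfolding H0_def by blast
next
 fix t h assume "h \<in> H0"
 then obtain K where K: "!!c. c \<in> FS ==> cmod (hap h c) <= K * N c" unfolding H0_def by blast
 have "cmod (hap (fscale t h) c) <= (cmod t * K) * N c" if "c \<in> FS" for c
  using K[OF that] by (simp add: hap_scale norm_mult mult.assoc mult_left_mono)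
 then show "fscale t h \<in> H0" unfolding H0_def by blast
qed

lemma hap_expand:
 assumes h: "h \<in> H0" and c: "!!i. i >= k ==> c i = 0"
 shows "hap h c = (SUM l<k. cnj (B vunit (gs l) c) * hat h l)"
proof -
 have cF: "c \<in> FS" using c by (rule FSI)
 have s: "(SUM l<k. fscale (B vunit (gs l) c) (gs l)) \<in> FS" by (intro FS_sum FS_scale gs_FS)
 have "hap h c = hap h (SUM l<k. fscale (B vunit (gs l) c) (gs l))" by (rule hap_cong_null[OF h cF s gs_expand[of k c, OF c]])
 also have "... = (SUM l<k. cnj (B vunit (gs l) c) * hat h l)" by (subst hap_sum_arg) (simp_all add: hap_scale_arg hat_def)
 finally show ?thesis .
qed

lemma bessel:
 assumes K: "!!c. c \<in> FS ==> cmod (hap h c) <= K * N c" and K0: "0 <= K"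
 shows "(SUM l<k. (cmod (hat h l))\<^sup>2) <= K\<^sup>2"
proof -
 define c where "c = (SUM l<k. fscale (hat h l) (gs l))"
 define S where "S = (SUM l<k. (cmod (hat h l))\<^sup>2)"
 have c: "c \<in> FS" unfolding c_def by (intro FS_sum FS_scale gs_FS)
 have S0: "S >= 0" unfolding S_def by (simp add: sum_nonneg)
 have "hap h c = (SUM l<k. cnj (hat h l) * hat h l)" unfolding c_def by (subst hap_sum_arg) (simp_all add: hap_scale_arg hat_def)
 also have "... = of_real S" unfolding S_def of_real_sum by (intro sum.cong refl) (simp add: complex_norm_square[unfolded of_real_power] mult.commute)
 finally have 1: "cmod (hap h c) = S" using S0 by simp
 have gc: "B vunit (gs m) c = hat h m * B vunit (gs m) (gs m)" if "m < k" for m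
 proof -
  have "B vunit (gs m) c = (SUM l<k. hat h l * B vunit (gs m) (gs l))" unfolding c_def by (simp add: frmI_sum_right frmI_scale_right)
  also have "... = (SUM l<k. if l = m then hat h m * B vunit (gs m) (gs m) else 0)" by (intro sum.cong refl) (auto simp: gs_orth)
  finally show ?thesis using that by simp
 qed
 have "B vunit c c = (SUM l<k. cnj (hat h l) * B vunit (gs l) c)" by (subst (1) c_def) (simp add: frmI_sum_left frmI_scale_left c)
 then have "Re (B vunit c c) = (SUM l<k. Re (cnj (hat h l) * B vunit (gs l) c))" by (simp only: Re_sum)
 also have "... = (SUM l<k. (cmod (hat h l))\<^sup>2 * (if N (gsr l) = 0 then 0 else 1))"
  by (intro sum.cong refl) (auto simp: gc gs_norm re_cnj_mult simp del: times_complex.sel)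
 also have "... <= S" unfolding S_def by (intro sum_mono) auto
 finally have "N c <= sqrt S" unfolding N_def by (rule real_sqrt_le_mono)
 then have "S <= K * sqrt S" using K[OF c] 1 mult_left_mono[OF _ K0] by (metis order_trans)
 then have "sqrt S * sqrt S <= K * sqrt S" using S0 by simp
 then have "sqrt S <= K \<or> sqrt S = 0" using S0 by (metis mult_le_cancel_right real_sqrt_ge_zero order_le_less not_less)
 then have "sqrt S <= K" using K0 by auto
 then show ?thesis unfolding S_def[symmetric] using sqrt_le_D by blast
qed

lemma hat_summable: "h \<in> H0 ==> summable (%l. (cmod (hat h l))\<^sup>2)"
proof -
 assume "h \<in> H0"
 then obtain K where K: "!!c. c \<in> FS ==> cmod (hap h c) <= K * N c" unfolding H0_def by blast
 have "cmod (hap h c) <= \<bar>K\<bar> * N c" if "c \<in> FS" for c using K[OF that] mult_right_mono[OF abs_ge_self[of K] N_ge0[of c]] by linarith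
 then have "(SUM l<k. (cmod (hat h l))\<^sup>2) <= \<bar>K\<bar>\<^sup>2" for k by (rule bessel[OF _ abs_ge_zero])
 then have "(SUM l<=k. (cmod (hat h l))\<^sup>2) <= \<bar>K\<bar>\<^sup>2" for k unfolding lessThan_Suc_atMost[symmetric] .
 then show ?thesis by (intro bounded_imp_summable[of _ "\<bar>K\<bar>\<^sup>2"]) auto
qed

lemma hat_prod_summable: "h \<in> H0 ==> h' \<in> H0 ==> summable (%l. hat h l * cnj (hat h' l))"
proof (rule summable_comparison_test'[where N = 0])
 assume "h \<in> H0" "h' \<in> H0"
 then show "summable (%l. (cmod (hat h l))\<^sup>2 + (cmod (hat h' l))\<^sup>2)" by (intro summable_add hat_summable)
 fix l
 have "2 * (cmod (hat h l) * cmod (hat h' l)) <= (cmod (hat h l))\<^sup>2 + (cmod (hat h' l))\<^sup>2"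
  using sum_squares_bound[of "cmod (hat h l)" "cmod (hat h' l)"] by simp
 moreover have "0 <= cmod (hat h l) * cmod (hat h' l)" by simp
 ultimately show "norm (hat h l * cnj (hat h' l)) <= (cmod (hat h l))\<^sup>2 + (cmod (hat h' l))\<^sup>2" by (simp only: norm_mult complex_mod_cnj)
qed

lemma ip0_self: "h \<in> H0 ==> ip0 h h = of_real (\<Sum>l. (cmod (hat h l))\<^sup>2)"
proof -
 assume h: "h \<in> H0"
 have "(%l. hat h l * cnj (hat h l)) = (%l. of_real ((cmod (hat h l))\<^sup>2))" by (simp only: complex_norm_square)
 then show ?thesis unfolding ip0_def by (simp only: suminf_of_real[OF hat_summable[OF h]])
qed

lemma hnorm0: "h \<in> H0 ==> hnorm ip0 h = sqrt (\<Sum>l. (cmod (hat h l))\<^sup>2)" by (simp add: hnorm_def ip0_self)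

lemma hnorm0_le:
 assumes "h \<in> H0" "!!c. c \<in> FS ==> cmod (hap h c) <= K * N c" "0 <= K"
 shows "hnorm ip0 h <= K"
proof -
 have "(\<Sum>l. (cmod (hat h l))\<^sup>2) <= K\<^sup>2" by (rule suminf_le_const[OF hat_summable[OF assms(1)]]) (rule bessel[OF assms(2,3)])
 then show ?thesis using assms(3) by (simp add: hnorm0[OF assms(1)] real_le_lsqrt)
qed

lemma hap_le:
 assumes h: "h \<in> H0" and c: "c \<in> FS"
 shows "cmod (hap h c) <= hnorm ip0 h * N c"
proof -
 define k where "k = bnd c"
 have ck: "c i = 0" if "i >= k" for i using bnd[OF c] that by (simp add: k_def)
 have e: "hap h c = (SUM l<k. cnj (B vunit (gs l) c) * hat h l)" by (rule hap_expand[OF h ck])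
 have p: "B vunit c c = (SUM l<k. cnj (B vunit (gs l) c) * B vunit (gs l) c)" by (rule parseval[OF ck c])
 have "cmod (hap h c) <= (SUM l<k. cmod (B vunit (gs l) c) * cmod (hat h l))" unfolding e by (rule order_trans[OF norm_sum]) (simp add: norm_mult)
 also have "... <= L2_set (%l. cmod (B vunit (gs l) c)) {..<k} * L2_set (%l. cmod (hat h l)) {..<k}"
  using L2_set_mult_ineq[of "%l. cmod (B vunit (gs l) c)" "%l. cmod (hat h l)" "{..<k}"] by simp
 also have "L2_set (%l. cmod (B vunit (gs l) c)) {..<k} = N c" unfolding L2_set_def N_def p Re_sum by (simp only: re_cnj_mult)
 finally have 1: "cmod (hap h c) <= N c * L2_set (%l. cmod (hat h l)) {..<k}" .
 have "L2_set (%l. cmod (hat h l)) {..<k} <= hnorm ip0 h"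
  unfolding L2_set_def hnorm0[OF h] by (intro real_sqrt_le_mono sum_le_suminf hat_summable[OF h]) auto
 from mult_left_mono[OF this N_ge0[of c]] 1 show ?thesis by (simp add: mult.commute)
qed

lemma hat_add: "hat (h + h') l = hat h l + hat h' l" and hat_scale: "hat (fscale t h) l = t * hat h l" and hat_diff: "hat (h - h') l = hat h l - hat h' l"
 by (simp_all add: hat_def hap_add hap_scale hap_diff)

lemma H0_diff: "h \<in> H0 ==> h' \<in> H0 ==> h - h' \<in> H0" by (rule fun_vs.subspace_diff[OF H0_subspace])

text \<open>A Cauchy sequence converges pointwise, and the pointwise limit obeys the same bound.\<close>
lemma H0_complete:
 assumes s: "!!i. s i \<in> H0" and C: "!!eps. 0 < eps ==> EX M. ALL i>=M. ALL j>=M. hnorm ip0 (s i - s j) < eps"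
 shows "EX l:H0. (%i. hnorm ip0 (s i - l)) \<longlonglongrightarrow> 0"
proof -
 have bound: "cmod (hap (s i) c - hap (s j) c) <= hnorm ip0 (s i - s j) * N c" if "c \<in> FS" for i j c
  using hap_le[OF H0_diff[OF s s] that, of i j] by (simp add: hap_diff)
 have "Cauchy (%i. s i n)" for n
 proof (rule metric_CauchyI)
  fix e :: real assume "e > 0"
  then have "e / (N (evec n) + 1) > 0" by (simp add: add_nonneg_pos)
  then obtain M where M: "!!i j. i >= M ==> j >= M ==> hnorm ip0 (s i - s j) < e / (N (evec n) + 1)" using C by blast
  have "dist (s i n) (s j n) < e" if "i >= M" "j >= M" for i j
  proof -
   have p: "N (evec n) + 1 > 0" by (simp add: add_nonneg_pos)
   have "dist (s i n) (s j n) <= hnorm ip0 (s i - s j) * N (evec n)" using bound[of "evec n" i j] by (simp add: hap_evec dist_norm)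
   also have "... <= e / (N (evec n) + 1) * N (evec n)" using M[OF that] by (intro mult_right_mono) auto
   also have "... < e" using p \<open>e > 0\<close> by (simp add: field_simps)
   finally show ?thesis .
  qed
  then show "EX M. ALL m>=M. ALL n'>=M. dist (s m n) (s n' n) < e" by blast
 qed
 then have "ALL n. EX l. (%i. s i n) \<longlonglongrightarrow> l" by (simp add: Cauchy_convergent_iff convergent_def)
 from choice[OF this] obtain h where h: "!!n. (%i. s i n) \<longlonglongrightarrow> h n" by blast
 have hc: "(%i. hap (s i) c) \<longlonglongrightarrow> hap h c" for c unfolding hap_def by (intro tendsto_intros h)
 have near: "cmod (hap (s i - h) c) <= eps * N c" if i: "!!j. j >= M ==> hnorm ip0 (s i - s j) < eps" and c: "c \<in> FS" for i M eps c
 proof -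
  have "(%j. cmod (hap (s i) c - hap (s j) c)) \<longlonglongrightarrow> cmod (hap (s i) c - hap h c)" by (intro tendsto_intros hc)
  then have "cmod (hap (s i) c - hap h c) <= eps * N c"
  proof (rule LIMSEQ_le_const2)
   have "cmod (hap (s i) c - hap (s j) c) <= eps * N c" if "j >= M" for j
    using bound[OF c, of i j] i[OF that] mult_right_mono[of "hnorm ip0 (s i - s j)" eps "N c"] by simp
   then show "EX M. ALL j>=M. cmod (hap (s i) c - hap (s j) c) <= eps * N c" by blast
  qed
  then show ?thesis by (simp add: hap_diff)
 qed
 obtain M where M: "!!i j. i >= M ==> j >= M ==> hnorm ip0 (s i - s j) < 1" using C[of 1] by auto
 have sh: "s M - h \<in> H0" unfolding H0_def using near[of M M 1] M by blast
 have m: "s M - (s M - h) \<in> H0" by (rule H0_diff[OF s sh])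
 have "s M - (s M - h) = h" by (simp add: fun_eq_iff)
 then have hH: "h \<in> H0" using m by (simp only:)
 have "(%i. hnorm ip0 (s i - h)) \<longlonglongrightarrow> 0"
 proof (rule LIMSEQ_I)
  fix r :: real assume r: "0 < r"
  then obtain M where M: "!!i j. i >= M ==> j >= M ==> hnorm ip0 (s i - s j) < r / 2" using C[of "r / 2"] by auto
  have "norm (hnorm ip0 (s i - h) - 0) < r" if "i >= M" for i
  proof -
   have "hnorm ip0 (s i - h) <= r / 2" using near[of M i "r / 2"] M that r by (intro hnorm0_le H0_diff s hH) auto
   moreover have "0 <= hnorm ip0 (s i - h)" by (simp add: hnorm0[OF H0_diff[OF s hH]] suminf_nonneg hat_summable[OF H0_diff[OF s hH]])
   ultimately show ?thesis using r by simp
  qed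
  then show "EX M. ALL n>=M. norm (hnorm ip0 (s n - h) - 0) < r" by blast
 qed
 then show ?thesis using hH by blast
qed

lemma H0_pos: "h \<in> H0 ==> h ~= 0 ==> 0 < Re (ip0 h h)"
proof -
 assume h: "h \<in> H0" and "h ~= 0"
 then obtain n where "h n ~= 0" by (auto simp: fun_eq_iff)
 then have "0 < hnorm ip0 h * N (evec n)" using hap_le[OF h, of "evec n"] by (simp add: hap_evec less_le_trans[OF _ hap_le[OF h, of "evec n", unfolded hap_evec]])
 then have "hnorm ip0 h ~= 0" by auto
 then have "(\<Sum>l. (cmod (hat h l))\<^sup>2) ~= 0" by (simp add: hnorm0[OF h])
 moreover have "0 <= (\<Sum>l. (cmod (hat h l))\<^sup>2)" by (intro suminf_nonneg hat_summable h) simp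
 ultimately show ?thesis by (simp add: ip0_self[OF h])
qed

end

section \<open>Models from splitting kernels\<close>

lemma finite_dim_subspace:
 assumes S: "fun_vs.subspace S" and "S <= fun_vs.span B" "finite B"
 shows "finite_dim S"
proof -
 obtain B' where B': "B' <= S" "fun_vs.independent B'" "S <= fun_vs.span B'" using fun_vs.maximal_independent_subset[of S] by blast
 have "finite B'" using fun_vs.independent_span_bound[OF assms(3) B'(2)] B'(1) assms(2) by blast
 moreover have "fun_vs.span B' = S" using B' S by (intro subset_antisym fun_vs.span_minimal)
 ultimately show ?thesis unfolding finite_dim_def by blast
qed

locale split_family = psd_family F for F :: "('i::finite, 'o::finite) fam" +
 fixes iota :: "nat => 'u"
 assumes split: "!!q m. EX u:FS. B (perp (prj q)) u u = 0 & B (prj q) (evec m - u) (evec m - u) = 0"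
  and inj: "inj iota"
begin

text \<open>The component of the m-th basis vector in the range of the projection for q.\<close>
definition uvec :: "('i, 'o) lab => nat => nat => complex" where
 "uvec q m = (SOME u. u \<in> FS & B (perp (prj q)) u u = 0 & B (prj q) (evec m - u) (evec m - u) = 0)"

lemma uvec: "uvec q m \<in> FS" "B (perp (prj q)) (uvec q m) (uvec q m) = 0"
 "B (prj q) (evec m - uvec q m) (evec m - uvec q m) = 0"
proof -
 have "EX u. u \<in> FS & B (perp (prj q)) u u = 0 & B (prj q) (evec m - u) (evec m - u) = 0" using split by blast
 from someI_ex[OF this] show "uvec q m \<in> FS" "B (perp (prj q)) (uvec q m) (uvec q m) = 0"
  "B (prj q) (evec m - uvec q m) (evec m - uvec q m) = 0" unfolding uvec_def by blast+
qed

lemma uvec_B: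
 assumes d: "d \<in> FS"
 shows "B (prj q) d (uvec q m) = B (prj q) d (evec m)"
  "B vunit d (uvec q m) = B (prj q) d (evec m)"
proof -
 have "B (prj q) d (evec m - uvec q m) = 0" by (rule B_null(2)[OF okv_gen FS_diff[OF FS_evec uvec(1)] d uvec(3)])
 then show 1: "B (prj q) d (uvec q m) = B (prj q) d (evec m)" using frmI_diff_right[OF FS_evec uvec(1) d, of F "prj q" m q m] by simp
 have "B (perp (prj q)) d (uvec q m) = 0" by (rule B_null(2)[OF okv_perp uvec(1) d uvec(2)])
 then show "B vunit d (uvec q m) = B (prj q) d (evec m)" unfolding B_perp using 1 by (simp only: right_minus_eq)
qed

text \<open>The linear extension of uvec to finitely supported vectors. It is determined modulo null vectors, hence well defined
on the Hilbert space.\<close>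
definition pv :: "('i, 'o) lab => (nat => complex) => nat => complex" where
 "pv q c = (SUM n<bnd c. fscale (c n) (uvec q n))"

lemma pv_eq:
 assumes "!!i. i >= k ==> c i = 0"
 shows "pv q c = (SUM n<k. fscale (c n) (uvec q n))"
proof -
 have "c \<in> FS" using assms by (rule FSI)
 then show ?thesis unfolding pv_def by (intro sum.mono_neutral_left) (use bnd_le[of k c, OF assms] bnd[of c] in "auto simp: fscale_def zero_fun_def")
qed

lemma pv_FS [simp]: "pv q c \<in> FS" unfolding pv_def by (intro FS_sum FS_scale uvec)

lemma pv_evec: "pv q (evec n) = uvec q n"
proof -
 have "pv q (evec n) = (SUM m<Suc n. fscale (evec n m) (uvec q m))" by (rule pv_eq) (simp add: evec_def)
 also have "... = (SUM m<Suc n. if m = n then uvec q n else 0)" by (intro sum.cong refl) (auto simp: evec_def fscale_def zero_fun_def)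
 also have "... = uvec q n" by (subst sum.delta) auto
 finally show ?thesis .
qed

text \<open>perp p is null on pv c and p is null on c - pv c, so pairing with p amounts to pairing pv c with the unit. The
properties of the projection follow from this identity.\<close>
lemma pv_B:
 assumes c: "c \<in> FS" and d: "d \<in> FS"
 shows "B vunit d (pv q c) = B (prj q) d c" "B (prj q) d (pv q c) = B (prj q) d c"
proof -
 have e: "B (prj q) d c = (SUM n<bnd c. c n * B (prj q) d (evec n))"
  by (subst FS_expand[of "bnd c" c, OF bnd[OF c]]) (use d in "simp_all only: frmI_sum_right frmI_scale_right FS_scale FS_evec")
 show "B vunit d (pv q c) = B (prj q) d c" "B (prj q) d (pv q c) = B (prj q) d c"
  unfolding e pv_def using d uvec(1) by (simp_all only: frmI_sum_right frmI_scale_right FS_scale uvec_B)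
qed

lemma pv_B_left: "c \<in> FS ==> d \<in> FS ==> B vunit (pv q c) d = B (prj q) c d"
 using pv_B(1)[of c d q] B_herm'[of vunit "pv q c" d] B_herm'[of "prj q" c d] by (simp only: vstar_vunit vstar_gen simp_thms)

lemma pv_idem: "c \<in> FS ==> N (pv q (pv q c) - pv q c) = 0" by (rule null_dual) (simp_all only: FS_diff pv_FS frmI_diff_right pv_B diff_self)

lemma pv_contr: "c \<in> FS ==> N (pv q c) <= N c"
proof -
 assume c: "c \<in> FS"
 have "B vunit (pv q c) (pv q c) = B (prj q) c c" using pv_B_left[OF c pv_FS] pv_B(2)[OF c c] by (rule trans)
 then show ?thesis unfolding N_def using gen_le_unit[OF okv_gen okv_perp, of q c] by (simp only: real_sqrt_le_iff)
qed

lemma hap_pv: "hap (%n. hap h (pv q (evec n))) c = hap h (pv q c)"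
proof -
 have "hap h (pv q c) = (SUM n<bnd c. cnj (c n) * hap h (uvec q n))" unfolding pv_def by (simp add: hap_sum_arg uvec hap_scale_arg)
 then show ?thesis by (simp only: pv_evec hap_def[of "%n. hap h (uvec q n)" c])
qed

definition H :: "('u => complex) set" where
 "H = {g. (%n. g (iota n)) \<in> H0 & (ALL u. u ~: range iota --> g u = 0)}"

definition ip :: "('u => complex) => ('u => complex) => complex" where
 "ip g g' = ip0 (%n. g (iota n)) (%n. g' (iota n))"

definition emb :: "(nat => complex) => 'u => complex" where
 "emb h u = (if u \<in> range iota then h (inv_into UNIV iota u) else 0)"

lemma emb_iota [simp]: "emb h (iota n) = h n" using inj by (simp add: emb_def)

lemma emb_H: "emb h \<in> H \<longleftrightarrow> h \<in> H0" by (simp add: H_def) (auto simp: emb_def)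

lemma H_eqI: "g \<in> H ==> g' \<in> H ==> (!!n. g (iota n) = g' (iota n)) ==> g = g'"
 unfolding H_def by (rule HOL.ext) (rename_tac u, case_tac "u \<in> range iota", auto)

lemma hnorm_H: "hnorm ip g = hnorm ip0 (%n. g (iota n))" by (simp add: hnorm_def ip_def)

lemma H_H0: "g \<in> H ==> (%n. g (iota n)) \<in> H0" by (simp add: H_def)

lemma res_add: "(%n. (g + g') (iota n)) = (%n. g (iota n)) + (%n. g' (iota n))"
 and res_diff: "(%n. (g - g') (iota n)) = (%n. g (iota n)) - (%n. g' (iota n))"
 and res_scale: "(%n. fscale c g (iota n)) = fscale c (%n. g (iota n))" by (simp_all add: fun_eq_iff fscale_def)

lemma H_subspace: "fun_vs.subspace H"
proof (rule fun_vs.subspaceI)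
 have "(%n. 0 (iota n)) = (0 :: nat => complex)" by (simp add: fun_eq_iff)
 then show "0 \<in> H" unfolding H_def using fun_vs.subspace_0[OF H0_subspace] by simp
 fix g g' assume "g \<in> H" "g' \<in> H"
 then show "g + g' \<in> H" unfolding H_def mem_Collect_eq res_add using fun_vs.subspace_add[OF H0_subspace] by simp
next
 fix c g assume "g \<in> H"
 then show "fscale c g \<in> H" unfolding H_def mem_Collect_eq res_scale using fun_vs.subspace_scale[OF H0_subspace] by (simp add: fscale_def)
qed

sublocale Hil: hilbert_space H ip
proof
 show "fun_vs.subspace H" by (rule H_subspace)
 show "ip (u + v) w = ip u w + ip v w" if "u \<in> H" "v \<in> H" "w \<in> H" for u v w unfolding ip_def res_add ip0_def
  using suminf_add[OF hat_prod_summable[OF H_H0 H_H0] hat_prod_summable[OF H_H0 H_H0], OF that(1,3) that(2,3)] by (simp add: hat_add distrib_right)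
 show "ip (fscale c u) v = c * ip u v" if "u \<in> H" "v \<in> H" for u v c unfolding ip_def res_scale ip0_def
  using suminf_mult[OF hat_prod_summable[OF H_H0 H_H0], OF that, of c] by (simp add: hat_scale mult.assoc)
 show "ip v u = cnj (ip u v)" if uv: "u \<in> H" "v \<in> H" for u v
 proof -
  have "(%l. hat (%n. u (iota n)) l * cnj (hat (%n. v (iota n)) l)) sums ip u v"
   unfolding ip_def ip0_def using hat_prod_summable[OF H_H0 H_H0, OF uv] by (rule summable_sums)
  then have "(%l. cnj (hat (%n. u (iota n)) l * cnj (hat (%n. v (iota n)) l))) sums cnj (ip u v)" by (simp only: sums_cnj)
  then show ?thesis unfolding ip_def[of v u] ip0_def by (simp add: sums_iff mult.commute)
 qed
 show "0 < Re (ip u u)" if u: "u \<in> H" "u ~= 0" for u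
 proof -
  have "(%n. u (iota n)) ~= 0"
  proof
   assume "(%n. u (iota n)) = 0"
   then have "u (iota n) = 0 (iota n)" for n by (metis zero_fun_apply)
   then have "u = 0" using H_eqI[OF u(1) fun_vs.subspace_0[OF H_subspace]] by blast
   then show False using u(2) by blast
  qed
  then show ?thesis unfolding ip_def by (rule H0_pos[OF H_H0[OF u(1)]])
 qed
 show "EX l:H. (%i. hnorm ip (s i - l)) \<longlonglongrightarrow> 0"
  if s: "!!i. s i \<in> H" and C: "!!eps. 0 < eps ==> EX M. ALL i>=M. ALL j>=M. hnorm ip (s i - s j) < eps" for s
 proof -
  obtain l where l: "l \<in> H0" "(%i. hnorm ip0 ((%n. s i (iota n)) - l)) \<longlonglongrightarrow> 0"
   using H0_complete[of "%i n. s i (iota n)"] H_H0[OF s] C unfolding hnorm_H res_diff by blast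
  have "hnorm ip (s i - emb l) = hnorm ip0 ((%n. s i (iota n)) - l)" for i unfolding hnorm_H res_diff by simp
  then show ?thesis using l emb_H by (intro bexI[of _ "emb l"]) simp_all
 qed
qed

definition T :: "('i, 'o) lab => 'u op" where
 "T q g = (if g \<in> H then emb (%n. hap (%n. g (iota n)) (pv q (evec n))) else 0)"

lemma T_iota: "g \<in> H ==> T q g (iota n) = hap (%n. g (iota n)) (pv q (evec n))" by (simp add: T_def)

lemma T_hap: "g \<in> H ==> hap (%n. T q g (iota n)) c = hap (%n. g (iota n)) (pv q c)" by (simp add: T_iota hap_pv)

lemma T_bound:
 assumes g: "g \<in> H" and c: "c \<in> FS"
 shows "cmod (hap (%n. T q g (iota n)) c) <= hnorm ip g * N c"
proof -
 have "cmod (hap (%n. T q g (iota n)) c) <= hnorm ip g * N (pv q c)" unfolding T_hap[OF g] hnorm_H by (rule hap_le[OF H_H0[OF g] pv_FS])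
 also have "... <= hnorm ip g * N c" using pv_contr[OF c] Hil.hn_ge0[OF g] by (rule mult_left_mono)
 finally show ?thesis .
qed

lemma T_H: "g \<in> H ==> T q g \<in> H"
proof -
 assume g: "g \<in> H"
 have "(%n. T q g (iota n)) \<in> H0" unfolding H0_def using T_bound[OF g] by blast
 moreover have "T q g = emb (%n. T q g (iota n))" using g by (simp add: T_def)
 ultimately show ?thesis using emb_H by metis
qed

lemma T_contr: "g \<in> H ==> hnorm ip (T q g) <= hnorm ip g" unfolding hnorm_H[of "T q g"] by (rule hnorm0_le[OF H_H0[OF T_H] T_bound Hil.hn_ge0])

lemma T_BO: "T q \<in> bounded_ops H ip"
proof (rule Hil.BO_I[of _ 1])
 show "T q v \<in> H" if "v \<in> H" for v using T_H[OF that] .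
 show "T q v = 0" if "v ~: H" for v using that by (simp add: T_def)
 show "T q (u + v) = T q u + T q v" if uv: "u \<in> H" "v \<in> H" for u v
 proof (rule H_eqI)
  show "T q (u + v) \<in> H" "T q u + T q v \<in> H" using T_H uv by simp_all
  fix n
  have "T q (u + v) (iota n) = hap (%n. (u + v) (iota n)) (pv q (evec n))" using uv by (intro T_iota) simp
  then show "T q (u + v) (iota n) = (T q u + T q v) (iota n)" unfolding res_add hap_add using uv by (simp add: T_iota)
 qed
 show "T q (fscale c v) = fscale c (T q v)" if v: "v \<in> H" for c v
 proof (rule H_eqI)
  show "T q (fscale c v) \<in> H" "fscale c (T q v) \<in> H" using T_H v by simp_all
  fix n
  have "T q (fscale c v) (iota n) = hap (%n. fscale c v (iota n)) (pv q (evec n))" using v by (intro T_iota) simp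
  then show "T q (fscale c v) (iota n) = fscale c (T q v) (iota n)" unfolding res_scale hap_scale using v by (simp add: T_iota fscale_def)
 qed
 show "hnorm ip (T q v) <= 1 * hnorm ip v" if "v \<in> H" for v using T_contr[OF that] by simp
qed

lemma T_idem: "T q o T q = T q"
proof (rule Hil.BO_eqI[OF Hil.BO_comp[OF T_BO T_BO] T_BO])
 fix g assume g: "g \<in> H"
 show "(T q o T q) g = T q g"
 proof (rule H_eqI)
  show "(T q o T q) g \<in> H" "T q g \<in> H" using T_H g by simp_all
  fix n
  have "(T q o T q) g (iota n) = hap (%n. g (iota n)) (pv q (pv q (evec n)))"
   using T_iota[OF T_H[OF g], of q q n] T_hap[OF g] by (simp only: comp_apply)
  also have "... = hap (%n. g (iota n)) (pv q (evec n))" by (rule hap_cong_null[OF H_H0[OF g] pv_FS pv_FS pv_idem[OF FS_evec]])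
  finally show "(T q o T q) g (iota n) = T q g (iota n)" using g by (simp add: T_iota)
 qed
qed

lemma T_relation:
 assumes g: "g \<in> H" and "finite I" "finite J" and e: "(SUM i:I. gen (Some (s i))) = (SUM j:J. gen (Some (t j)) :: ('i, 'o) vns)"
 shows "(SUM i:I. T (s i) g) = (SUM j:J. T (t j) g)"
proof (rule H_eqI)
 show "(SUM i:I. T (s i) g) \<in> H" "(SUM j:J. T (t j) g) \<in> H" by (intro Hil.H_sum T_H[OF g])+
 fix n
 have F: "(SUM i:I. pv (s i) (evec n)) \<in> FS" "(SUM j:J. pv (t j) (evec n)) \<in> FS" by (intro FS_sum pv_FS)+
 have "N ((SUM i:I. pv (s i) (evec n)) - (SUM j:J. pv (t j) (evec n))) = 0"
 proof (rule null_dual)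
  fix d assume d: "d \<in> FS"
  show "B vunit d ((SUM i:I. pv (s i) (evec n)) - (SUM j:J. pv (t j) (evec n))) = 0"
   using F d frmI_sum_right[of I "%i. pv (s i) (evec n)" d F vunit, OF pv_FS d] frmI_sum_right[of J "%i. pv (t i) (evec n)" d F vunit, OF pv_FS d]
    arg_cong[OF e, where f = "%x. B x d (evec n)", unfolded clinD(7)[OF B_lin[of d "evec n"]]]
   by (simp only: frmI_diff_right pv_FS pv_B FS_evec simp_thms diff_self)
 qed (use F in simp)
 from hap_cong_null[OF H_H0[OF g] F this]
 show "(SUM i:I. T (s i) g) (iota n) = (SUM j:J. T (t j) g) (iota n)" by (simp add: hap_sum_arg sum_fun_apply T_iota[OF g])
qed

lemma T_unit:
 assumes g: "g \<in> H" and e: "(SUM i:I. gen (Some (s i))) = (vunit :: ('i, 'o) vns)"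
 shows "(SUM i:I. T (s i) g) = g"
proof (rule H_eqI)
 show "(SUM i:I. T (s i) g) \<in> H" "g \<in> H" by (intro Hil.H_sum T_H[OF g], rule g)
 fix n
 have F: "(SUM i:I. pv (s i) (evec n)) \<in> FS" by (intro FS_sum pv_FS)
 have "N ((SUM i:I. pv (s i) (evec n)) - evec n) = 0"
 proof (rule null_dual)
  fix d assume d: "d \<in> FS"
  show "B vunit d ((SUM i:I. pv (s i) (evec n)) - evec n) = 0" using F d frmI_sum_right[of I "%i. pv (s i) (evec n)" d F vunit, OF pv_FS d]
    arg_cong[OF e, where f = "%x. B x d (evec n)", unfolded clinD(7)[OF B_lin[of d "evec n"]]]
   by (simp only: frmI_diff_right pv_FS pv_B FS_evec simp_thms diff_self)
 qed (use F in simp)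
 from hap_cong_null[OF H_H0[OF g] F FS_evec this]
 show "(SUM i:I. T (s i) g) (iota n) = g (iota n)" by (simp add: hap_sum_arg sum_fun_apply T_iota[OF g] hap_evec)
qed

lemma gns_model:
 assumes w: "w \<in> FS" and w1: "B vunit w w = 1"
 shows "commuting_model H ip (%a b x y. B (vP a b x y) w w)" "correlation (%a b x y. B (vP a b x y) w w)"
proof -
 define h where "h n = B vunit (evec n) w" for n
 have hw: "hap h c = B vunit c w" if "c \<in> FS" for c
 proof -
  have "B vunit c w = (SUM n<bnd c. cnj (c n) * B vunit (evec n) w)"
   by (subst FS_expand[of "bnd c" c, OF bnd[OF that]]) (use w in "simp_all only: frmI_sum_left frmI_scale_left FS_scale FS_evec")
  then show ?thesis by (simp add: hap_def h_def)
 qed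
 have hH0: "h \<in> H0" unfolding H0_def using N_CS[OF _ w] hw by (auto intro!: exI[of _ "N w"] simp: mult.commute)
 define Omega where "Omega = emb h"
 have W: "Omega \<in> H" by (simp add: Omega_def emb_H hH0)
 have Wi: "(%n. Omega (iota n)) = h" by (simp add: Omega_def)
 have hath: "hat h l = B vunit (gs l) w" for l by (simp add: hat_def hw)
 have fin: "ip u Omega = (SUM l<bnd w. hat (%n. u (iota n)) l * cnj (B vunit (gs l) w))" for u unfolding ip_def Wi ip0_def hath
  by (rule suminf_finite) (use gs_zero[of "bnd w" w, OF bnd[OF w]] in "auto simp: not_less")
 have ipW: "ip Omega Omega = 1"
 proof -
  have "ip Omega Omega = (SUM l<bnd w. cnj (B vunit (gs l) w) * B vunit (gs l) w)" unfolding fin Wi hath by (simp add: mult.commute)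
  also have "... = B vunit w w" by (rule parseval[OF bnd[OF w] w, symmetric])
  finally show ?thesis using w1 by simp
 qed
 have ipT: "ip (T q Omega) Omega = B (prj q) w w" for q
 proof -
  have "hat (%n. T q Omega (iota n)) l = B vunit (gs l) (pv q w)" for l
   unfolding hat_def T_hap[OF W] Wi using w by (simp only: hw pv_FS pv_B_left pv_B gs_FS)
  then have "ip (T q Omega) Omega = (SUM l<bnd w. cnj (B vunit (gs l) w) * B vunit (gs l) (pv q w))" unfolding fin by (simp add: mult.commute)
  also have "... = B vunit w (pv q w)" by (rule parseval[OF bnd[OF w] pv_FS, symmetric])
  also have "... = B (prj q) w w" using w by (simp only: pv_B)
  finally show ?thesis .
 qed
 have r1: "(SUM a:UNIV. SUM b:UNIV. T (a, b, x, y) v) = v" if v: "v \<in> H" for x y v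
 proof -
  have "(SUM q:UNIV \<times> UNIV. gen (Some (fst q, snd q, x, y))) = (vunit :: ('i, 'o) vns)"
   using vns_relations(1)[of x y] by (simp add: sum.cartesian_product case_prod_unfold)
  from T_unit[OF v this] show ?thesis by (simp add: sum.cartesian_product case_prod_unfold)
 qed
 have r2: "(SUM b:UNIV. T (a, b, x, y) v) = (SUM b:UNIV. T (a, b, x, z) v)" if v: "v \<in> H" for a x y z v
  by (rule T_relation[OF v]) (simp_all, rule vns_relations(2))
 have r3: "(SUM b:UNIV. T (b, a, y, x) v) = (SUM b:UNIV. T (b, a, z, x) v)" if v: "v \<in> H" for a x y z v
  by (rule T_relation[OF v]) (simp_all, rule vns_relations(3))
 have pT: "B (vP a b x y) w w = ip (T (a, b, x, y) Omega) Omega" for a b x y by (simp add: ipT)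
 note M = Hil.commuting_model_of_projections[where P = "%a b x y. T (a, b, x, y)" and Omega = Omega and p = "%a b x y. B (vP a b x y) w w",
   OF T_BO T_idem T_contr r1 r2 r3 W ipW pT]
 show "commuting_model H ip (%a b x y. B (vP a b x y) w w)" by (rule M(1)) assumption+
 show "correlation (%a b x y. B (vP a b x y) w w)" by (rule M(2)) assumption+
qed

text \<open>Functions in H are bounded by the kernel, so they vanish wherever its diagonal does.\<close>
lemma H_finite_dim:
 assumes z: "!!i. i >= k ==> F i i vunit = 0"
 shows "finite_dim H"
proof (rule finite_dim_subspace[OF H_subspace])
 show "H <= fun_vs.span (basis_fun ` iota ` {..<k})"
 proof
  fix g assume g: "g \<in> H"
  have zero: "g (iota n) = 0" if "n >= k" for n
  proof -
   have "N (evec n) = 0" using z[OF that] by (simp add: N0 frmI_evec)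
   from H0_null[OF H_H0[OF g] FS_evec this] show ?thesis by (simp add: hap_evec)
  qed
  have "g = (SUM n<k. fscale (g (iota n)) (basis_fun (iota n)))"
  proof (rule HOL.ext)
   fix u
   show "g u = (SUM n<k. fscale (g (iota n)) (basis_fun (iota n))) u"
   proof (cases "u \<in> range iota")
    case True
    then obtain m where u: "u = iota m" by blast
    have "(SUM n<k. fscale (g (iota n)) (basis_fun (iota n))) u = (SUM n<k. if n = m then g (iota m) else 0)"
     unfolding sum_fun_apply u by (intro sum.cong refl) (use inj in "auto simp: fscale_def basis_fun_def inj_def")
    then show ?thesis using zero[of m] by (simp add: u not_less)
   next
    case False
    then have "g u = 0" using g by (simp add: H_def)
    moreover have "(SUM n<k. fscale (g (iota n)) (basis_fun (iota n))) u = 0"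
     unfolding sum_fun_apply by (rule sum.neutral) (use False in "auto simp: fscale_def basis_fun_def")
    ultimately show ?thesis by simp
   qed
  qed
  also have "... \<in> fun_vs.span (basis_fun ` iota ` {..<k})" by (intro fun_vs.span_sum fun_vs.span_scale fun_vs.span_base) auto
  finally show "g \<in> fun_vs.span (basis_fun ` iota ` {..<k})" .
 qed
qed simp

end

lemma datum_psd_fam: "datum F ==> psd_fam F" by (simp add: datum_def psd_fam_def)

lemma datum_split_family:
 assumes F: "datum F" and i: "inj iota"
 shows "split_family F iota"
proof -
 interpret psd_family F using F by unfold_locales (rule datum_psd_fam)
 show ?thesis
 proof
  fix q m
  obtain k u where u: "m < k" "ALL i>=k. u i = 0" "frm k F (perp (prj q)) u u = 0"
    "frm k F (prj q) (%i. (if i = m then 1 else 0) - u i) (%i. (if i = m then 1 else 0) - u i) = 0" using F unfolding datum_def by blast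
  have e: "(%i. (if i = m then 1 else 0) - u i) = evec m - u" by (simp add: evec_def fun_diff_def)
  have "frmI F (prj q) (evec m - u) (evec m - u) = frm k F (prj q) (evec m - u) (evec m - u)" by (rule frmI_eq) (use u in "auto simp: evec_def")
  moreover have "frmI F (perp (prj q)) u u = frm k F (perp (prj q)) u u" by (rule frmI_eq) (use u in auto)
  moreover have "u \<in> FS" using u(2) by (auto intro: FSI)
  ultimately show "EX u:FS. frmI F (perp (prj q)) u u = 0 & frmI F (prj q) (evec m - u) (evec m - u) = 0"
   using u(3,4) unfolding e by (intro bexI[of _ u]) simp_all
 qed (rule i)
qed

theorem datum_in_C_qc:
 assumes F: "datum F" and "infinite (UNIV :: 'u set)" and w: "w \<in> FS" "frmI F vunit w w = 1"
 shows "(%a b x y. frmI F (vP a b x y) w w) \<in> C_qc TYPE('u)"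
proof -
 obtain iota :: "nat => 'u" where i: "inj iota" using assms(2) infinite_countable_subset by blast
 interpret split_family F iota by (rule datum_split_family[OF F i])
 show ?thesis unfolding C_qc_def using gns_model[OF w] by blast
qed

theorem datum_in_C_q:
 assumes F: "datum F" and "infinite (UNIV :: 'u set)" and w: "w \<in> FS" "frmI F vunit w w = 1"
  and z: "!!i. i >= k ==> F i i vunit = 0"
 shows "(%a b x y. frmI F (vP a b x y) w w) \<in> C_q TYPE('u)"
proof -
 obtain iota :: "nat => 'u" where i: "inj iota" using assms(2) infinite_countable_subset by blast
 interpret split_family F iota by (rule datum_split_family[OF F i])
 show ?thesis unfolding C_q_def using gns_model[OF w] H_finite_dim[of k, OF z] by blast
qed

section \<open>The cones for a fixed matrix size\<close>

definition dilation_rows :: "nat => complex mat => complex mat => complex mat" where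
 "dilation_rows k alpha beta = Matrix.mat (2 * k) k (%(i, j). (if even i then alpha else beta) $$ (i div 2, j))"

text \<open>The expression defining C[p] is the compression of the doubled matrix to size k by the rows of \<alpha> and \<beta>,
so C[p] is level k of a projection ordering.\<close>
lemma compress_ymat:
 fixes X :: "('i::finite, 'o::finite) vns mat"
 assumes X: "X \<in> carrier_mat k k" and a: "alpha \<in> carrier_mat k k" and b: "beta \<in> carrier_mat k k"
 shows "compress (dilation_rows k alpha beta) (ymat k p X eps t) = compress (alpha + beta) X
     + tensor_elem (cof eps \<cdot>\<^sub>m adj_mult alpha + cof t \<cdot>\<^sub>m adj_mult beta) p
     + tensor_elem (cof eps \<cdot>\<^sub>m adj_mult beta + cof t \<cdot>\<^sub>m adj_mult alpha) (perp p)" (is "_ = ?R")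
proof (rule eq_matI)
 have D: "dilation_rows k alpha beta \<in> carrier_mat (2 * k) k" by (simp add: dilation_rows_def)
 have ab: "alpha + beta \<in> carrier_mat k k" using a b by simp
 have adj: "adj_mult gamma $$ (i, j) = (SUM l<k. cnj (gamma $$ (l, i)) * gamma $$ (l, j))" if "gamma \<in> carrier_mat k k" "i < k" "j < k" for gamma i j
  using that unfolding adj_mult_def by (simp add: scalar_prod_def atLeast0LessThan)
 have dims: "dim_row (adj_mult gamma) = k" "dim_col (adj_mult gamma) = k" if "gamma \<in> carrier_mat k k" for gamma
  using that by (auto simp: adj_mult_def)
 fix i j
 assume "i < dim_row ?R"
  "j < dim_col ?R"
 then have ij: "i < k" "j < k" using dims[OF a] by (auto simp: tensor_elem_def)
 let ?e = "eps *\<^sub>R p + t *\<^sub>R perp p" and ?o = "eps *\<^sub>R perp p + t *\<^sub>R p"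
 have "compress (dilation_rows k alpha beta) (ymat k p X eps t) $$ (i, j) =
  (SUM K<k. SUM L<k. vscale (cnj (alpha $$ (K, i)) * alpha $$ (L, j)) (X $$ (K, L) + (if K = L then ?e else 0))
    + vscale (cnj (alpha $$ (K, i)) * beta $$ (L, j)) (X $$ (K, L))
    + (vscale (cnj (beta $$ (K, i)) * alpha $$ (L, j)) (X $$ (K, L))
    + vscale (cnj (beta $$ (K, i)) * beta $$ (L, j)) (X $$ (K, L) + (if K = L then ?o else 0))))"
  unfolding compress_index[OF D ij] sum_lessThan_double sum.distrib[symmetric]
  by (intro sum.cong refl) (use ij in "auto simp: ymat_def dilation_rows_def algebra_simps")
 also have "... = (SUM K<k. SUM L<k. vscale (cnj ((alpha + beta) $$ (K, i)) * (alpha + beta) $$ (L, j)) (X $$ (K, L))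
    + (if L = K then vscale (cnj (alpha $$ (K, i)) * alpha $$ (K, j)) ?e + vscale (cnj (beta $$ (K, i)) * beta $$ (K, j)) ?o else 0))"
  by (intro sum.cong refl) (use a b ij in "auto simp: algebra_simps vns.scale_right_distrib vns.scale_left_distrib")
 also have "... = compress (alpha + beta) X $$ (i, j) +
    (SUM K<k. vscale (cnj (alpha $$ (K, i)) * alpha $$ (K, j)) ?e + vscale (cnj (beta $$ (K, i)) * beta $$ (K, j)) ?o)"
  unfolding compress_index[OF ab ij] by (simp add: sum.distrib)
 also have "... = ?R $$ (i, j)" using ij a b dims[OF a] dims[OF b]
  by (simp add: tensor_elem_def adj vns.scale_right_distrib vns.scale_left_distrib vns.scale_sum_left sum.distrib
    vscale_of_real[symmetric] sum_distrib_left mult.commute mult.left_commute)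
 finally show "compress (dilation_rows k alpha beta) (ymat k p X eps t) $$ (i, j) = ?R $$ (i, j)" .
qed (use a b in "simp_all add: tensor_elem_def dilation_rows_def adj_mult_def")

lemma proj_cone_alt:
 fixes p :: "('i::finite, 'o::finite) vns"
 assumes p: "vstar p = p"
 shows "proj_cone k C p = proj_ord (kmin k C) p k"
proof -
 have "ymat k p X eps t \<in> kmin k C (2 * k) \<longleftrightarrow> (ALL alpha:carrier_mat k k. ALL beta:carrier_mat k k.
   compress (dilation_rows k alpha beta) (ymat k p X eps t) \<in> C)" (is "?l \<longleftrightarrow> ?r") if X: "X \<in> herm k" for X eps t
 proof
  assume ?l then show ?r by (auto simp: kmin_def dilation_rows_def)
 next
  assume r: ?r
  show ?l unfolding kmin_def
  proof (intro CollectI conjI ballI)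
   show "ymat k p X eps t \<in> herm (2 * k)" by (rule ymat_herm[OF X p])
   fix gamma :: "complex mat" assume g: "gamma \<in> carrier_mat (2 * k) k"
   let ?a = "Matrix.mat k k (%(i, j). gamma $$ (2 * i, j))" and ?b = "Matrix.mat k k (%(i, j). gamma $$ (2 * i + 1, j))"
   have "dilation_rows k ?a ?b = gamma" by (rule eq_matI) (use g in "auto simp: dilation_rows_def elim!: oddE evenE")
   then show "compress gamma (ymat k p X eps t) \<in> C" using r[rule_format, of ?a ?b] by simp
  qed
 qed
 then have "(ALL alpha:carrier_mat k k. ALL beta:carrier_mat k k.
    compress (alpha + beta) X
     + tensor_elem (cof eps \<cdot>\<^sub>m adj_mult alpha + cof t \<cdot>\<^sub>m adj_mult beta) p
     + tensor_elem (cof eps \<cdot>\<^sub>m adj_mult beta + cof t \<cdot>\<^sub>m adj_mult alpha) (perp p) \<in> C) \<longleftrightarrow>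
   ymat k p X eps t \<in> kmin k C (2 * k)" if "X \<in> herm k" for X eps t using that compress_ymat[OF hermD(1)[OF that], of _ _ p eps t] by simp
 then show ?thesis unfolding proj_cone_def proj_ord_alt by (intro Collect_cong conj_cong refl) simp
qed

lemma vstar_gen_Some: "vstar (prj q) = prj q" by (rule vstar_gen)

lemma Ek_seq_cone: "kcone k (Ek_seq g k j)" and Ek_seq_arch: "karch k (Ek_seq g k j)"
proof (induction j)
 case 0
 interpret mord "Dmax :: nat => ('a, 'b) vns mat set" by (rule mord_Dmax)
 show "kcone k (Ek_seq g k 0)" unfolding Ek_seq.simps Emax_clo by (rule mord_kcone[OF mord_clo])
 show "karch k (Ek_seq g k 0)" unfolding Ek_seq.simps Emax_clo by (rule arch_karch[OF arch_clo])
next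
 case (Suc j)
 interpret mord "kmin k (Ek_seq g k j)" by (rule mord_kmin[OF Suc(1)])
 note e = proj_cone_alt[OF vstar_gen_Some]
 show "kcone k (Ek_seq g k (Suc j))" unfolding Ek_seq.simps periodic_gen_eq e by (rule mord_kcone[OF mord_proj_ord[OF posv_gen posv_perp_gen]])
 show "karch k (Ek_seq g k (Suc j))" unfolding Ek_seq.simps periodic_gen_eq e by (rule arch_karch[OF arch_proj_ord[OF posv_gen posv_perp_gen]])
qed

lemma Ek_seq_Suc: "X \<in> Ek_seq g k j ==> X \<in> Ek_seq g k (Suc j)"
proof -
 assume X: "X \<in> Ek_seq g k j"
 interpret mord "kmin k (Ek_seq g k j)" by (rule mord_kmin[OF Ek_seq_cone])
 have "X \<in> kmin k (Ek_seq g k j) k" using X by (simp add: kmin_self[OF Ek_seq_cone])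
 from proj_ord_mono[OF this posv_gen posv_perp_gen] show ?thesis unfolding Ek_seq.simps periodic_gen_eq proj_cone_alt[OF vstar_gen_Some] .
qed

lemma Ek_seq_mono: "i <= j ==> X \<in> Ek_seq g k i ==> X \<in> Ek_seq g k j"
 by (induction rule: dec_induct) (auto intro: Ek_seq_Suc simp del: Ek_seq.simps)

lemma Ek_proj_alt: "Ek_proj g k = {X \<in> herm k. \<forall>eps>0. EX j. X + unit_mat eps k \<in> Ek_seq g k j}" unfolding Ek_proj_def unit_mat_def ..

lemma Ek_proj_cone: "kcone k (Ek_proj g k)"
proof -
 let ?U = "%r. \<Union>j. kmin k (Ek_seq g k j) r"
 have m: "mord (kmin k (Ek_seq g k j))" for j by (rule mord_kmin[OF Ek_seq_cone])
 have mono: "X \<in> kmin k (Ek_seq g k i) r ==> i <= j ==> X \<in> kmin k (Ek_seq g k j) r" for X i j r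
  unfolding kmin_def using Ek_seq_mono[of i j _ g k] by auto
 have "mord ?U"
 proof (rule mord.intro)
  fix X Y and r s :: nat and alpha :: "complex mat"
  show "X \<in> ?U r ==> X \<in> herm r" using mord.sub[OF m, of X] by auto
  show "X + Y \<in> ?U r" if XY: "X \<in> ?U r" "Y \<in> ?U r"
  proof -
   obtain i j where ij: "X \<in> kmin k (Ek_seq g k i) r" "Y \<in> kmin k (Ek_seq g k j) r" using XY by auto
   have "X + Y \<in> kmin k (Ek_seq g k (max i j)) r" by (rule mord.add[OF m mono[OF ij(1)] mono[OF ij(2)]]) simp_all
   then show ?thesis by auto
  qed
  show "compress alpha X \<in> ?U r" if "X \<in> ?U s" "alpha \<in> carrier_mat s r" using mord.comp[OF m _ that(2)] that(1) by auto
  show "mat1 (vP a b x y) \<in> ?U 1" "mat1 (perp (vP a b x y)) \<in> ?U 1" for a b x y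
   by (rule UN_I[OF UNIV_I], rule mord.pos[OF m], rule UN_I[OF UNIV_I], rule mord.pos'[OF m])
 qed
 then interpret mord ?U .
 have "clo ?U k = Ek_proj g k" unfolding clo_def Ek_proj_alt by (simp add: kmin_self[OF Ek_seq_cone])
 then show ?thesis using mord_kcone[OF mord_clo, of k] by simp
qed

section \<open>Compact sets of functionals\<close>

lemma compact_box:
 fixes A :: "'a => 'b::topological_space set"
 assumes "!!i. compact (A i)"
 shows "compact {f. ALL i. f i \<in> A i}"
proof -
 have "compactin (product_topology (%_. euclidean) UNIV) (PiE UNIV A)" using assms by (simp add: compactin_PiE)
 moreover have "PiE UNIV A = {f. ALL i. f i \<in> A i}" by (auto simp: PiE_def Pi_def)
 ultimately show ?thesis by (simp add: euclidean_product_topology)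
qed

lemma Hausdorff_euclidean_fun:
 "Hausdorff_space (euclidean :: 'b::topological_space topology) ==> Hausdorff_space (euclidean :: ('a => 'b) topology)"
 unfolding euclidean_product_topology[symmetric] Hausdorff_space_product_topology by simp

lemma compact_families_closed:
 fixes S :: "('a => 'b => 'c => complex) set"
 assumes "compact S"
 shows "closed S"
proof -
 have "Hausdorff_space (euclidean :: ('a => 'b => 'c => complex) topology)" by (intro Hausdorff_euclidean_fun) simp
 then show ?thesis using compactin_imp_closedin[of euclidean S] assms by simp
qed

text \<open>The compactness argument behind the penalties: approximate solutions with penalty n accumulate at an exact solution.\<close>
lemma nested_compact:
 fixes T :: "nat => 'a::topological_space set"
 assumes K: "compact K" and T: "!!n. closed (T n)" "!!n. T (Suc n) <= T n" "!!n. K \<inter> T n ~= {}"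
 shows "EX x:K. ALL n. x \<in> T n"
proof -
 have "K \<inter> (\<Inter>n\<in>UNIV. T n) ~= {}"
 proof (rule compact_imp_fip_image[OF K T(1)])
  fix I :: "nat set" assume "finite I"
  have "T (Max (insert 0 I)) <= T i" if "i \<in> I" for i using that \<open>finite I\<close> by (intro lift_Suc_antimono_le[of T, OF T(2)]) simp
  then show "K \<inter> (\<Inter>n\<in>I. T n) ~= {}" using T(3)[of "Max (insert 0 I)"] by blast
 qed
 then show ?thesis by blast
qed

lemma cont_fun1: "continuous_on S f ==> continuous_on S (%z. f z i)" by (rule continuous_on_product_then_coordinatewise)

section \<open>Positive functionals on cones of a fixed size\<close>

context psd_family
begin

lemma okv_gen': "okv (gen q)" using okv_unit okv_gen by (cases q) auto

lemma B_null_all: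
 assumes u: "u \<in> FS" and d: "d \<in> FS" and n: "N u = 0"
 shows "B x u d = 0" "B x d u = 0"
proof -
 have e: "B vunit u u = 0" using n by (simp add: N0)
 have "B (gen q) u u = 0" for q
 proof (cases q)
  case (Some q')
  have "Re (B (gen q) u u) <= 0" using gen_le_unit[OF okv_gen okv_perp, of q' u] e Some by simp
  moreover have "0 <= Re (B (gen q) u u)" using okv_gen'[of q] by (simp add: okv_def)
  ultimately show ?thesis using okv_of_real[OF okv_gen', of q u] by (simp add: complex_eq_iff)
 qed (use e in simp)
 note z = B_null[OF okv_gen' u d this]
 show "B x u d = 0" using clin_expand[OF B_lin, of x u d] z by simp
 show "B x d u = 0" using clin_expand[OF B_lin, of x d u] z by simp
qed

lemma B_cong_null:
 assumes "u \<in> FS" "u' \<in> FS" "d \<in> FS" "N (u - u') = 0"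
 shows "B x u d = B x u' d" "B x d u = B x d u'" using B_null_all[of "u - u'" d x] assms by (simp_all add: frmI_diff_left frmI_diff_right)

end

lemma frm_zero: "frm k F x 0 d = 0" "frm k F x d 0 = 0" by (simp_all add: frm_def)

lemma frm_sum_left: "frm k F x (SUM l:I. c l) d = (SUM l:I. frm k F x (c l) d)"
 and frm_sum_right: "frm k F x d (SUM l:I. c l) = (SUM l:I. frm k F x d (c l))"
 by (induction I rule: infinite_finite_induct) (simp_all add: frm_plus frm_zero)

lemma frm_cong: "(!!i. i < k ==> c i = c' i) ==> (!!i. i < k ==> d i = d' i) ==> frm k F x c d = frm k F x c' d'"
 unfolding frm_def by (intro sum.cong refl) auto

definition pull :: "nat => ('i::finite, 'o::finite) fam => (nat => nat => complex) =>
  ('i, 'o) fam" where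
 "pull k f delta i j x = (if i < k & j < k then frm k f x (delta i) (delta j) else 0)"

definition supp :: "nat => ('i::finite, 'o::finite) fam => bool" where
 "supp k f \<longleftrightarrow> (ALL i j x. k <= i \<or> k <= j --> f i j x = 0)"

definition pos_fun :: "nat => ('i::finite, 'o::finite) vns mat set => ('i, 'o) fam set" where
 "pos_fun k C = {f. herm_fam f & supp k f & (ALL Y:C. 0 <= Re (ev k f Y))}"

definition trc :: "nat => ('i::finite, 'o::finite) fam => real" where
 "trc k f = Re (SUM i<k. f i i vunit)"

definition states :: "nat => ('i::finite, 'o::finite) vns mat set => ('i, 'o) fam set" where
 "states k C = {f \<in> pos_fun k C. trc k f = 1}"

lemma pull_herm:
 assumes "herm_fam f"
 shows "herm_fam (pull k f delta)"
proof -
 have "pull k f delta i j = (if i < k & j < k then (%x. frm k f x (delta i) (delta j)) else (%x. 0))" for i j by (auto simp: pull_def fun_eq_iff)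
 then have "clin (pull k f delta i j)" for i j using clin_frm[OF assms] by simp
 then show ?thesis using frm_herm[OF assms] by (auto simp: herm_fam_def pull_def)
qed

lemma pull_supp: "supp k (pull k f delta)" by (simp add: supp_def pull_def)

lemma ev_cong: "(!!i j x. i < k ==> j < k ==> f i j x = h i j x) ==> ev k f X = ev k h X" unfolding ev_def by (intro sum.cong refl) auto

lemma ev_pull:
 assumes "herm_fam f"
 shows "ev k (pull k f delta) X = ev k f (compress (Matrix.mat k k (%(i, j). delta i j)) X)"
 unfolding ev_compress[OF assms, of "Matrix.mat k k (%(i, j). delta i j)" k k X, simplified]
 by (rule ev_cong) (simp add: pull_def, rule frm_cong, simp_all)

lemma frm_pull: "frm k (pull k f delta) x c d = frm k f x (SUM i<k. fscale (c i) (delta i)) (SUM i<k. fscale (d i) (delta i))"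
proof -
 have "frm k f x (SUM i<k. fscale (c i) (delta i)) (SUM i<k. fscale (d i) (delta i)) =
  (SUM i<k. frm k f x (fscale (c i) (delta i)) (SUM j<k. fscale (d j) (delta j)))" by (rule frm_sum_left)
 also have "... = (SUM i<k. SUM j<k. cnj (c i) * (d j * frm k f x (delta i) (delta j)))"
  by (simp add: frm_sum_right frm_plus sum_distrib_left algebra_simps)
 finally show ?thesis by (simp add: frm_def[of k "pull k f delta"] pull_def mult.assoc)
qed

lemma frm_supp:
 assumes f: "supp k f" and K: "k <= K"
 shows "frm K f x c d = frm k f x c d"
proof -
 have "frm K f x c d = (SUM i<K. SUM j<k. cnj (c i) * d j * f i j x)"
  unfolding frm_def by (intro sum.cong refl sum.mono_neutral_right) (use f K in "auto simp: supp_def")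
 also have "... = frm k f x c d" unfolding frm_def by (intro sum.mono_neutral_right) (use f K in "auto simp: supp_def")
 finally show ?thesis .
qed

lemma frmI_supp:
 assumes "supp k f" "c \<in> FS" "d \<in> FS"
 shows "frmI f x c d = frm k f x c d"
proof -
 obtain m where m: "!!i. i >= m ==> c i = 0" "!!i. i >= m ==> d i = 0" using frmI_common[OF assms(2,3,3)] by metis
 have "frmI f x c d = frm (max m k) f x c d" by (rule frmI_eq) (simp_all add: m)
 also have "... = frm k f x c d" by (rule frm_supp[OF assms(1)]) simp
 finally show ?thesis .
qed

lemma pos_fun_psd:
 assumes C: "kcone k C" and f: "f \<in> pos_fun k C"
 shows "psd_fam f"
proof -
 have h: "herm_fam f" and s: "supp k f" and p: "!!Y. Y \<in> C ==> 0 <= Re (ev k f Y)" using f by (auto simp: pos_fun_def)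
 have "0 <= Re (frm k f (prj q) c c)" "0 <= Re (frm k f (perp (prj q)) c c)" for q c
  unfolding ev_rank_one[OF h, symmetric] by (rule p, use C in "unfold kcone_def, blast")+
 note 1 = this
 have 2: "frm l f x c c = frm k f x (%i. if i < l then c i else 0) (%i. if i < l then c i else 0)" for l x c
 proof -
  have "frm l f x c c = frm l f x (%i. if i < l then c i else 0) (%i. if i < l then c i else 0)" by (rule frm_cong) auto
  also have "... = frm (max k l) f x (%i. if i < l then c i else 0) (%i. if i < l then c i else 0)" by (rule frm_cong_dim[symmetric]) auto
  also have "... = frm k f x (%i. if i < l then c i else 0) (%i. if i < l then c i else 0)" by (rule frm_supp[OF s]) simp
  finally show ?thesis .
 qed
 show ?thesis unfolding psd_fam_def by (intro conjI allI h) (subst 2, rule 1)+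
qed

lemma pull_pos:
 assumes C: "kcone k C" and f: "f \<in> pos_fun k C"
 shows "pull k f delta \<in> pos_fun k C"
proof -
 have h: "herm_fam f" using f by (simp add: pos_fun_def)
 have "0 <= Re (ev k (pull k f delta) Y)" if "Y \<in> C" for Y unfolding ev_pull[OF h] using that f C by (simp add: pos_fun_def kcone_def)
 then show ?thesis unfolding pos_fun_def using pull_herm[OF h] pull_supp by blast
qed

lemma scale_fam_herm: "herm_fam f ==> herm_fam (%i j x. cof t * f i j x)" unfolding herm_fam_def by (auto intro: clin_cmult)

lemma ev_scale_fam: "ev k (%i j x. c * f i j x) X = c * ev k f X" by (simp add: ev_def sum_distrib_left)

lemma trc_scale_fam: "trc k (%i j x. cof t * f i j x) = t * trc k f" by (simp add: trc_def sum_distrib_left[symmetric])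

lemma frm_scale_fam: "frm k (%i j x. t * f i j x) x c d = t * frm k f x c d" by (simp add: frm_def sum_distrib_left algebra_simps)

lemma scale_pos: "f \<in> pos_fun k C ==> 0 <= t ==> (%i j x. cof t * f i j x) \<in> pos_fun k C"
 unfolding pos_fun_def by (auto simp: scale_fam_herm ev_scale_fam supp_def)

lemma trc_diag:
 assumes "kcone k C" and f: "f \<in> pos_fun k C"
 shows "f i i vunit = of_real (Re (f i i vunit))" "0 <= Re (f i i vunit)" "i < k ==> Re (f i i vunit) <= trc k f" "0 <= trc k f"
proof -
 interpret psd_family f by unfold_locales (rule pos_fun_psd[OF assms])
 show "f i i vunit = of_real (Re (f i i vunit))" using okv_of_real[OF okv_unit, of "evec i"] by (simp only: frmI_evec)
 have p: "0 <= Re (f j j vunit)" for j using okv_unit by (auto simp: okv_def frmI_evec[symmetric])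
 then show "0 <= Re (f i i vunit)" "0 <= trc k f" by (simp_all add: trc_def sum_nonneg)
 show "Re (f i i vunit) <= trc k f" if "i < k" unfolding trc_def Re_sum by (rule member_le_sum) (use that p in auto)
qed

lemma entry_bound:
 assumes C: "kcone k C" and f: "f \<in> pos_fun k C"
 shows "cmod (f i j (gen q)) <= trc k f"
proof (cases "i < k & j < k")
 case True
 interpret psd_family f by unfold_locales (rule pos_fun_psd[OF assms])
 have g: "0 <= Re (f i i (gen q))" "Re (f i i (gen q)) <= Re (f i i vunit)" for i using okv_gen'[of q] gen_le_unit[OF okv_gen okv_perp, of _ "evec i"]
  by (simp add: okv_def frmI_evec[symmetric], cases q) (simp_all add: frmI_evec)
 have "(cmod (f i j (gen q)))\<^sup>2 <= Re (f i i (gen q)) * Re (f j j (gen q))"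
  using B_CS[OF okv_gen'[of q] FS_evec[of i] FS_evec[of j]] by (simp only: frmI_evec)
 also have "... <= trc k f * trc k f" using g[of i] g[of j] trc_diag[OF assms] True by (intro mult_mono) (auto intro: order_trans)
 finally show ?thesis using trc_diag(4)[OF assms] by (simp add: power2_eq_square[symmetric] power_mono_iff)
next
 case False
 then have "f i j (gen q) = 0" using f by (auto simp: pos_fun_def supp_def)
 then show ?thesis using trc_diag(4)[OF assms] by simp
qed

lemma cont_coord: "continuous_on S (%f :: 'a => 'b => 'c => complex. f i j x)"
proof -
 have "continuous_on S (%f :: 'a => 'b => 'c => complex. f)" by (rule continuous_on_id)
 then have "continuous_on S (%f :: 'a => 'b => 'c => complex. f i)" by (rule cont_fun1)
 then have "continuous_on S (%f :: 'a => 'b => 'c => complex. f i j)" by (rule cont_fun1)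
 then show ?thesis by (rule cont_fun1)
qed

lemma cont_fst: "continuous_on S (%z :: ('a => 'b => 'c => complex) \<times> _. fst z i j x)"
 by (rule continuous_on_compose2[OF cont_coord[of UNIV i j x]]) (simp_all add: continuous_on_fst continuous_on_id)

lemma cont_snd: "continuous_on S (%z :: _ \<times> ('a => 'b => complex). snd z i j)"
proof -
 have "continuous_on S (%z :: _ \<times> ('a => 'b => complex). snd z)" by (simp add: continuous_on_snd continuous_on_id)
 then have "continuous_on S (%z :: _ \<times> ('a => 'b => complex). snd z i)" by (rule cont_fun1)
 then show ?thesis by (rule cont_fun1)
qed

lemma states_closed: "closed (states k C)"
proof -
 have e: "states k C = {f. (ALL i j x y. f i j (x + y) = f i j x + f i j y) & (ALL i j c x. f i j (vscale c x) = c * f i j x) &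
   (ALL i j x. f j i (vstar x) = cnj (f i j x)) & (ALL i j x. k <= i \<or> k <= j --> f i j x = 0) &
   (ALL Y:C. 0 <= Re (SUM i<k. SUM j<k. f i j (Y $$ (i, j)))) & Re (SUM i<k. f i i vunit) = 1}"
  unfolding states_def pos_fun_def herm_fam_def clin_def supp_def ev_def trc_def by blast
 show ?thesis unfolding e Ball_def
  by (intro closed_Collect_conj closed_Collect_all closed_Collect_imp closed_Collect_eq closed_Collect_le open_Collect_const
    continuous_intros cont_coord)
qed

lemma compact_states:
 fixes C :: "('i::finite, 'o::finite) vns mat set"
 assumes C: "kcone k C"
 shows "compact (states k C)"
proof -
 let ?K = "{f :: ('i, 'o) fam.
  ALL i. f i \<in> {h. ALL j. h j \<in> {l. ALL x. l x \<in> cball 0 (SUM q:UNIV. cmod (rep_vns x q))}}}"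
 have cK: "compact ?K" by (intro compact_box compact_cball)
 have sub: "states k C <= ?K"
 proof
  fix f assume f: "f \<in> states k C"
  have "cmod (f i j x) <= (SUM q:UNIV. cmod (rep_vns x q))" for i j x
  proof -
   have "f i j x = (SUM q:UNIV. rep_vns x q * f i j (gen q))" by (rule clin_expand[OF herm_famD(1)]) (use f in "simp add: states_def pos_fun_def")
   also have "cmod ... <= (SUM q:UNIV. cmod (rep_vns x q) * 1)"
   proof (intro order_trans[OF norm_sum] sum_mono)
    fix q
    have "cmod (f i j (gen q)) <= 1" using entry_bound[OF C, of f i j] f by (simp add: states_def)
    then show "cmod (rep_vns x q * f i j (gen q)) <= cmod (rep_vns x q) * 1" unfolding norm_mult by (rule mult_left_mono) simp
   qed
   finally show ?thesis by simp
  qed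
  then show "f \<in> ?K" by simp
 qed
 show ?thesis using compact_Int_closed[OF cK states_closed[of k C]] unfolding inf.absorb2[OF sub] .
qed

section \<open>Dilations\<close>

definition dil :: "nat => ('i::finite, 'o::finite) fam => (nat => nat => complex) =>
  ('i, 'o) fam" where
 "dil k h gamma = pull k h (%i. gamma (2 * i) + gamma (2 * i + 1))"

definition coef_box :: "nat => (nat => nat => complex) set" where
 "coef_box k = {gamma. ALL i. gamma i \<in> {c. ALL l. c l \<in> (if i < 2 * k & l < k then cball 0 1 else {0})}}"

definition nrm :: "nat => ('i::finite, 'o::finite) fam => (nat => nat => complex) => real" where
 "nrm k h gamma = Re (SUM i<2 * k. frm k h vunit (gamma i) (gamma i))"

definition kill :: "nat => ('i, 'o) lab => ('i::finite, 'o::finite) fam => (nat => nat => complex) => real" where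
 "kill k q h gamma = Re (SUM i<k. frm k h (perp (prj q)) (gamma (2 * i)) (gamma (2 * i)) + frm k h (prj q) (gamma (2 * i + 1)) (gamma (2 * i + 1)))"

text \<open>Compressions to size k of states h in S along vectors \<gamma>(2 i) + \<gamma>(2 i + 1), where perp p is null on the
first summands and p on the second, normalised to trace 1. The lower bound c on the trace keeps the set compact.\<close>
definition Dil :: "nat => ('i, 'o) lab => ('i::finite, 'o::finite) fam set => real =>
  ('i, 'o) fam set" where
 "Dil k q S c = {(%i j x. cof (1 / trc k (dil k h gamma)) * dil k h gamma i j x) | h gamma.
   h \<in> S & gamma \<in> coef_box k & kill k q h gamma = 0 & c <= trc k (dil k h gamma)}"

lemma compact_zbox: "compact (coef_box k)" unfolding coef_box_def by (intro compact_box) auto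

lemma cont_dil: "continuous_on S (%z. dil k (fst z) (snd z) i j x)"
proof (cases "i < k & j < k")
 case True
 then show ?thesis unfolding dil_def pull_def frm_def plus_fun_apply by (simp, intro continuous_intros cont_fst cont_snd)
next
 case False
 then have "dil k h gamma i j x = 0" for h :: "nat => nat => ('a, 'b) vns => complex" and gamma by (auto simp: dil_def pull_def)
 then show ?thesis by (simp add: continuous_on_const)
qed

lemma cont_trc_dil: "continuous_on S (%z. trc k (dil k (fst z) (snd z)))" unfolding trc_def by (intro continuous_intros cont_dil)

lemma cont_ev_dil: "continuous_on S (%z. Re (ev k (dil k (fst z) (snd z)) X))" unfolding ev_def by (intro continuous_intros cont_dil)

lemma cont_nrm: "continuous_on S (%z. nrm k (fst z) (snd z))" unfolding nrm_def frm_def by (intro continuous_intros cont_fst cont_snd)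

lemma cont_kill: "continuous_on S (%z. kill k q (fst z) (snd z))" unfolding kill_def frm_def by (intro continuous_intros cont_fst cont_snd)

lemma compact_Dil:
 assumes S: "compact S" and c: "c > 0"
 shows "compact (Dil k q S c)"
proof -
 let ?Z = "(S \<times> coef_box k) \<inter> {z. kill k q (fst z) (snd z) = 0 & c <= trc k (dil k (fst z) (snd z))}"
 let ?d = "%z i j x. cof (1 / trc k (dil k (fst z) (snd z))) * dil k (fst z) (snd z) i j x"
 have "closed {z. kill k q (fst z) (snd z) = 0 & c <= trc k (dil k (fst z) (snd z))}"
  by (intro closed_Collect_conj closed_Collect_eq closed_Collect_le continuous_intros cont_kill cont_trc_dil)
 then have Z: "compact ?Z" by (intro compact_Int_closed compact_Times S compact_zbox)
 have "continuous_on ?Z (%z i j x. cof (1 / trc k (dil k (fst z) (snd z))) * dil k (fst z) (snd z) i j x)"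
  by (intro continuous_on_coordinatewise_then_product continuous_intros cont_dil cont_trc_dil) (use c in auto)
 from compact_continuous_image[OF this Z]
 have "compact ((%z i j x. cof (1 / trc k (dil k (fst z) (snd z))) * dil k (fst z) (snd z) i j x) ` ?Z)" .
 also have "?d ` ?Z = Dil k q S c"
 proof (intro subset_antisym subsetI)
  fix f assume "f \<in> Dil k q S c"
  then obtain h gamma where h: "f = (%i j x. cof (1 / trc k (dil k h gamma)) * dil k h gamma i j x)" "h \<in> S" "gamma \<in> coef_box k"
   "kill k q h gamma = 0" "c <= trc k (dil k h gamma)" unfolding Dil_def by blast
  have "(h, gamma) \<in> ?Z" using h(2-5) by simp
  then show "f \<in> ?d ` ?Z" unfolding h(1) by (rule rev_image_eqI) (simp only: fst_conv snd_conv)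
 next
  fix f assume "f \<in> ?d ` ?Z"
  then obtain z where z: "z \<in> ?Z" "f = ?d z" by (rule imageE)
  then show "f \<in> Dil k q S c" unfolding Dil_def by (intro CollectI exI[of _ "fst z"] exI[of _ "snd z"]) auto
 qed
 finally show ?thesis .
qed

lemma (in psd_family) gs_expand_supp:
 assumes s: "supp k F" and v: "v \<in> FS"
 shows "N (v - (SUM l<k. fscale (B vunit (gs l) v) (gs l))) = 0"
proof -
 define v' where "v' i = (if i < k then v i else 0)" for i
 have v'F: "v' \<in> FS" by (rule FSI[of k]) (simp add: v'_def)
 have c: "B x d v' = B x d v" if "d \<in> FS" for x d
  using frmI_supp[OF s that v'F] frmI_supp[OF s that v] frm_cong[of k d d v' v F x] by (simp add: v'_def)
 have "B vunit (v - v') (v - v') = 0" using c[of "v - v'" vunit] v v'F frmI_diff_right[OF v v'F, of "v - v'" F vunit] by simp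
 then have 1: "N (v - v') = 0" by (simp add: N0)
 have 2: "N (v' - (SUM l<k. fscale (B vunit (gs l) v') (gs l))) = 0" by (rule gs_expand) (simp add: v'_def)
 have "N ((v - v') + (v' - (SUM l<k. fscale (B vunit (gs l) v') (gs l)))) = 0"
  by (rule N_add_null[OF _ _ 1 2]) (intro FS_diff FS_sum FS_scale gs_FS v v'F)+
 then show ?thesis by (simp add: c)
qed

context psd_family
begin

text \<open>Coordinates of a vector in the Gram-Schmidt system of the kernel; syn recovers the vector from them modulo null
vectors.\<close>
definition coords :: "nat => (nat => complex) => nat => complex" where
 "coords k v l = (if l < k then B vunit (gs l) v else 0)"

definition syn :: "nat => (nat => complex) => nat => complex" where
 "syn k c = (SUM l<k. fscale (c l) (gs l))"

lemma syn_FS: "syn k c \<in> FS" unfolding syn_def by (intro FS_sum FS_scale gs_FS)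

lemma syn_coords: "supp k F ==> v \<in> FS ==> N (v - syn k (coords k v)) = 0" using gs_expand_supp[of k v] by (simp add: syn_def coords_def)

lemma syn_coords_form:
 assumes s: "supp k F" and v: "v \<in> FS" "w \<in> FS"
 shows "B x (syn k (coords k v)) (syn k (coords k w)) = B x v w"
 using B_cong_null(1)[OF v(1) syn_FS syn_FS syn_coords[OF s v(1)]] B_cong_null(2)[OF v(2) syn_FS v(1) syn_coords[OF s v(2)]] by simp

lemma coords_le: "v \<in> FS ==> cmod (coords k v l) <= N v"
proof -
 assume v: "v \<in> FS"
 have "cmod (B vunit (gs l) v) <= N (gs l) * N v" by (rule N_CS[OF gs_FS v])
 also have "... <= 1 * N v" by (intro mult_right_mono N_ge0) (simp add: N_def gs_norm)
 finally show ?thesis by (simp add: coords_def)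
qed

text \<open>The kernel in Gram-Schmidt coordinates. Its diagonal entries are 0 or 1, which gives a state after division by the
number d of nonzero ones; coefficients of bounded vectors are then bounded.\<close>
lemma normalised_kernel:
 assumes C: "kcone k C" and f: "F \<in> pos_fun k C" and v: "v \<in> FS" "N v ~= 0"
 shows "EX h:states k C. EX d>0. d <= real k & (ALL x c c'. frm k h x c c' = of_real (1 / d) * B x (syn k c) (syn k c'))"
proof -
 define h0 where "h0 = pull k F gs"
 define d where "d = trc k h0"
 have sf: "supp k F" using f by (simp add: pos_fun_def)
 have h0: "h0 \<in> pos_fun k C" unfolding h0_def by (rule pull_pos[OF C f])
 have gsB: "h0 l l vunit = B vunit (gs l) (gs l)" if "l < k" for l using that by (simp add: h0_def pull_def frmI_supp[OF sf])
 have "d <= (SUM i<k. 1)" unfolding d_def trc_def Re_sum by (intro sum_mono) (simp add: gsB gs_norm)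
 then have dk: "d <= real k" by simp
 have d0: "d > 0"
 proof (rule ccontr)
  assume "\<not> d > 0"
  then have d: "d = 0" using trc_diag(4)[OF C h0] by (simp add: d_def)
  have "B vunit (gs l) (gs l) = 0" if "l < k" for l using trc_diag(1-3)[OF C h0, of l] d gsB[OF that] that by (simp add: d_def[symmetric] antisym)
  then have "N (gs l) = 0" if "l < k" for l using that by (simp add: N0)
  then have "N (syn k (coords k v)) = 0" unfolding syn_def by (intro N_sum_null N_scale_null FS_scale gs_FS) auto
  then show False using syn_coords_form[OF sf v(1) v(1), of vunit] v(2) by (simp add: N0)
 qed
 define h where "h = (%i j x. cof (1 / d) * h0 i j x)"
 have "h \<in> states k C" unfolding states_def h_def using scale_pos[OF h0, of "1 / d"] d0
  by (simp add: trc_scale_fam d_def[symmetric] del: of_real_divide)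
 moreover have "frm k h x c c' = of_real (1 / d) * B x (syn k c) (syn k c')" for x c c'
  unfolding h_def frm_scale_fam h0_def frm_pull syn_def[symmetric] frmI_supp[OF sf syn_FS syn_FS] ..
 ultimately show ?thesis using dk d0 by blast
qed

end

lemma dil_eq:
 "i < k ==> j < k ==> dil k h gamma i j x = frm k h x (gamma (2*i)) (gamma (2*j)) + frm k h x (gamma (2*i)) (gamma (2*j+1))
   + (frm k h x (gamma (2*i+1)) (gamma (2*j)) + frm k h x (gamma (2*i+1)) (gamma (2*j+1)))" by (simp add: dil_def pull_def frm_plus)

text \<open>Coefficient vectors are unbounded, but in Gram-Schmidt coordinates they can be scaled into the unit box without
changing signs. This makes the data of a dilation range over a compact set.\<close>
lemma normal_form:
 assumes C: "kcone k C" and f: "f \<in> pos_fun k C" and r: "!!i l. l >= k ==> r i l = 0"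
  and s: "nrm k f r > 0"
 shows "EX h:states k C. EX gamma:coef_box k. EX t>0. nrm k h gamma >= 1 / real k &
  Re (ev k (dil k h gamma) X) = t * Re (ev k (dil k f r) X) & kill k q h gamma = t * kill k q f r"
proof -
 interpret psd_family f by unfold_locales (rule pos_fun_psd[OF C f])
 have sf: "supp k f" using f by (simp add: pos_fun_def)
 define s where "s = nrm k f r"
 have s0: "s > 0" using assms(4) by (simp add: s_def)
 have rF: "r i \<in> FS" for i by (rule FSI[of k]) (rule r)
 have nn: "0 <= Re (B vunit (r i) (r i))" for i using okv_unit by (simp add: okv_def)
 have sB: "s = (SUM i<2 * k. Re (B vunit (r i) (r i)))" unfolding s_def nrm_def Re_sum by (simp add: frmI_supp[OF sf rF rF])
 have rs: "N (r i) <= sqrt s" if "i < 2 * k" for i unfolding N_def sB by (intro real_sqrt_le_mono member_le_sum nn) (use that in auto)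
 obtain i0 where "N (r i0) ~= 0" using s0 sB by (force simp: N_def)
 from normalised_kernel[OF C f rF this] obtain h d where hS: "h \<in> states k C" and d0: "d > 0" and dk: "d <= real k"
  and hG: "!!x c c'. frm k h x c c' = of_real (1 / d) * B x (syn k c) (syn k c')" by blast
 define gamma where "gamma i = (if i < 2 * k then fscale (of_real (1 / sqrt s)) (coords k (r i)) else 0)" for i
 define t where "t = 1 / (s * d)"
 have t0: "t > 0" using s0 d0 by (simp add: t_def)
 have fr: "frm k h x (gamma i) (gamma j) = of_real t * frm k f x (r i) (r j)" if "i < 2 * k" "j < 2 * k" for x i j
 proof -
  have "frm k h x (coords k (r i)) (coords k (r j)) = of_real (1 / d) * frm k f x (r i) (r j)"
   unfolding hG syn_coords_form[OF sf rF rF] frmI_supp[OF sf rF rF] ..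
  moreover have "cof (1 / sqrt s) * cof (1 / sqrt s) = of_real (1 / s)" using s0 by (simp add: of_real_mult[symmetric] del: of_real_mult of_real_divide)
  ultimately show ?thesis using that unfolding gamma_def by (simp add: frm_plus t_def mult.assoc)
 qed
 have gb: "gamma \<in> coef_box k"
 proof -
  have "cmod (gamma i l) <= 1" if "i < 2 * k" for i l
   using order_trans[OF coords_le[OF rF, of k i l] rs[OF that]] that s0 by (simp add: gamma_def fscale_def norm_mult norm_divide divide_simps)
  moreover have "gamma i l = 0" if "l >= k" for i l using that by (simp add: gamma_def fscale_def coords_def)
  ultimately show ?thesis by (auto simp: coef_box_def) (simp add: gamma_def)
 qed
 have "nrm k h gamma = t * s" unfolding nrm_def s_def Re_sum sum_distrib_left by (intro sum.cong refl) (simp add: fr)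
 also have "t * s = 1 / d" using s0 by (simp add: t_def)
 also have "1 / d >= 1 / real k" using d0 dk by (simp add: frac_le)
 finally have n: "nrm k h gamma >= 1 / real k" .
 have "ev k (dil k h gamma) X = ev k (%i j x. of_real t * dil k f r i j x) X" by (rule ev_cong) (simp add: dil_eq fr algebra_simps)
 then have e: "Re (ev k (dil k h gamma) X) = t * Re (ev k (dil k f r) X)" by (simp add: ev_scale_fam)
 have "kill k q h gamma = t * kill k q f r" unfolding kill_def Re_sum sum_distrib_left by (intro sum.cong refl) (simp add: fr algebra_simps)
 then show ?thesis using hS gb t0 n e by blast
qed

text \<open>Since X fails the condition with a large t, some compression of the doubled matrix by rows \<alpha>, \<beta> lies
outside C. A state that separates it, together with the coefficient vectors \<gamma> formed by \<alpha> and \<beta>,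
gives a negative pairing that includes the penalty with weight n.\<close>
lemma dil_from_rows:
 assumes C: "kcone k C" and A: "karch k C" and X: "X \<in> herm k" "X ~: proj_cone k C (prj q)" and n: "n > 0"
 shows "EX h:states k C. EX gamma:coef_box k. nrm k h gamma >= 1 / real k & Re (ev k (dil k h gamma) X) + n * kill k q h gamma <= 0"
proof -
 let ?p = "prj q"
 have "X ~: proj_ord (kmin k C) ?p k" using X(2) proj_cone_alt[OF vstar_gen_Some] by blast
 then obtain eps where e: "eps > 0" "!!t. t > 0 ==> ymat k ?p X eps t ~: kmin k C (2 * k)" using X(1) unfolding proj_ord_alt by auto
 obtain rho where rho: "rho \<in> carrier_mat (2 * k) k" "compress rho (ymat k ?p X eps n) ~: C"
  using e(2)[OF n] ymat_herm[OF X(1) vstar_gen_Some] unfolding kmin_def by blast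
 have yh: "compress rho (ymat k ?p X eps n) \<in> herm k" by (rule compress_herm[OF ymat_herm[OF X(1) vstar_gen_Some] rho(1)])
 interpret M: mord "kmin k C" by (rule mord_kmin[OF C])
 obtain f where f: "herm_fam f" "!!i j. k <= i \<or> k <= j ==> f i j = (%_. 0)" "!!Y. Y \<in> C ==> 0 <= Re (ev k f Y)"
  "Re (ev k f (compress rho (ymat k ?p X eps n))) < 0" using M.separation[OF arch_kmin[OF C A] yh] rho(2) unfolding kmin_self[OF C] by blast
 have fp: "f \<in> pos_fun k C" using f by (simp add: pos_fun_def supp_def)
 interpret psd_family f by unfold_locales (rule pos_fun_psd[OF C fp])
 have sf: "supp k f" using fp by (simp add: pos_fun_def)
 define r where "r i l = (if l < k then rho $$ (i, l) else 0)" for i l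
 have rF: "r i \<in> FS" for i by (rule FSI[of k]) (simp add: r_def)
 define G where "G i j x = frm k f x (r i) (r j)" for i j x
 have G: "herm_fam G" unfolding G_def by (rule herm_fam_frm[OF f(1)])
 have "ev k f (compress rho (ymat k ?p X eps n)) = ev (2 * k) G (ymat k ?p X eps n)"
  unfolding ev_compress[OF f(1) rho(1)] G_def by (rule ev_cong, rule frm_cong) (simp_all add: r_def)
 also have "... = ev k (dil k f r) X + (SUM i<k. G (2*i) (2*i) (eps *\<^sub>R ?p + n *\<^sub>R perp ?p) + G (2*i+1) (2*i+1) (eps *\<^sub>R perp ?p + n *\<^sub>R ?p))"
  unfolding ev_ymat[OF G] by (intro arg_cong2[where f = "(+)"] ev_cong refl) (simp add: dil_eq G_def)
 finally have "Re (ev k f (compress rho (ymat k ?p X eps n))) = Re (ev k (dil k f r) X) +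
   (SUM i<k. eps * (Re (G (2*i) (2*i) ?p) + Re (G (2*i+1) (2*i+1) (perp ?p))) + n * (Re (G (2*i) (2*i) (perp ?p)) + Re (G (2*i+1) (2*i+1) ?p)))"
  by (simp add: clinD[OF herm_famD(1)[OF G]] algebra_simps)
 also have "... = Re (ev k (dil k f r) X) + eps * (SUM i<k. Re (G (2*i) (2*i) ?p) + Re (G (2*i+1) (2*i+1) (perp ?p))) + n * kill k q f r"
  by (simp add: sum.distrib sum_distrib_left[symmetric] kill_def G_def)
 finally have k1: "Re (ev k (dil k f r) X) + eps * (SUM i<k. Re (G (2*i) (2*i) ?p) + Re (G (2*i+1) (2*i+1) (perp ?p))) + n * kill k q f r < 0"
  using f(4) by simp
 have GB: "G i j x = B x (r i) (r j)" for i j x by (simp add: G_def frmI_supp[OF sf rF rF])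
 have "0 <= (SUM i<k. Re (G (2*i) (2*i) ?p) + Re (G (2*i+1) (2*i+1) (perp ?p)))"
  using okv_gen[of q] okv_perp[of q] by (intro sum_nonneg add_nonneg_nonneg) (auto simp: GB okv_def)
 then have "0 <= eps * (SUM i<k. Re (G (2*i) (2*i) ?p) + Re (G (2*i+1) (2*i+1) (perp ?p)))" using e(1) by simp
 then have neg: "Re (ev k (dil k f r) X) + n * kill k q f r < 0" using k1 by linarith
 have nn: "Re (B vunit (r i) (r i)) >= 0" for i using okv_unit by (simp add: okv_def)
 have nr: "nrm k f r = (SUM i<2*k. Re (B vunit (r i) (r i)))" by (simp add: nrm_def frmI_supp[OF sf rF rF])
 have "nrm k f r > 0"
 proof (rule ccontr)
  assume "\<not> nrm k f r > 0"
  then have "nrm k f r = 0" using nn by (simp add: nr sum_nonneg antisym)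
  then have "Re (B vunit (r i) (r i)) = 0" if "i < 2 * k" for i using nn that unfolding nr by (subst (asm) sum_nonneg_eq_0_iff) auto
  then have "N (r i) = 0" if "i < 2 * k" for i using that by (simp add: N_def)
  then have z: "frm k f x (r i) (r j) = 0" if "i < 2 * k" for x i j
   using B_null_all(1)[OF rF rF, of i x j] that frmI_supp[OF sf rF rF, of x i j] by simp
  have "ev k (dil k f r) X = ev k (%_ _ _. 0) X" by (rule ev_cong) (simp add: dil_eq z)
  moreover have "kill k q f r = 0" unfolding kill_def by (simp add: z)
  ultimately show False using neg by (simp add: ev_def)
 qed
 from normal_form[OF C fp _ this, of X q] obtain h gamma t where h: "h \<in> states k C" "gamma \<in> coef_box k" "t > 0" "nrm k h gamma >= 1 / real k"
  "Re (ev k (dil k h gamma) X) = t * Re (ev k (dil k f r) X)" "kill k q h gamma = t * kill k q f r" by (auto simp: r_def)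
 have "Re (ev k (dil k h gamma) X) + n * kill k q h gamma = t * (Re (ev k (dil k f r) X) + n * kill k q f r)" by (simp add: h algebra_simps)
 then have "Re (ev k (dil k h gamma) X) + n * kill k q h gamma <= 0" using neg h(3) by (simp add: mult_le_0_iff)
 then show ?thesis using h by blast
qed

lemma box_supp:
 assumes "gamma \<in> coef_box k" "l >= k"
 shows "gamma i l = 0"
proof -
 from assms have "gamma i l \<in> (if i < 2 * k & l < k then cball 0 1 else {0})" unfolding coef_box_def by blast
 then show ?thesis using assms(2) by simp
qed

lemma box_FS: "gamma \<in> coef_box k ==> gamma i \<in> FS" by (rule FSI[of k]) (rule box_supp)

text \<open>When the penalty vanishes the two halves are orthogonal for the unit, because p and perp p sum to it and each is null
on one half. Hence the trace of the dilation is the full norm.\<close>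
lemma kill_props:
 assumes C: "kcone k C" and h: "h \<in> pos_fun k C" and g: "gamma \<in> coef_box k"
 shows "0 <= kill k q h gamma"
  and "kill k q h gamma = 0 ==> i < k ==> frm k h (perp (prj q)) (gamma (2 * i)) (gamma (2 * i)) = 0"
  and "kill k q h gamma = 0 ==> i < k ==> frm k h (prj q) (gamma (2 * i + 1)) (gamma (2 * i + 1)) = 0"
  and "kill k q h gamma = 0 ==> trc k (dil k h gamma) = nrm k h gamma"
proof -
 interpret psd_family h by unfold_locales (rule pos_fun_psd[OF C h])
 let ?p = "prj q"
 have sh: "supp k h" using h by (simp add: pos_fun_def)
 have e: "frm k h x (gamma i) (gamma j) = B x (gamma i) (gamma j)" for x i j by (simp add: frmI_supp[OF sh box_FS[OF g] box_FS[OF g]])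
 have p: "0 <= Re (B (perp ?p) c c)" "0 <= Re (B ?p c c)" for c using okv_gen[of q] okv_perp[of q] by (auto simp: okv_def)
 have k: "kill k q h gamma = (SUM i<k. Re (B (perp ?p) (gamma (2 * i)) (gamma (2 * i))) + Re (B ?p (gamma (2 * i + 1)) (gamma (2 * i + 1))))"
  unfolding kill_def e Re_sum plus_complex.sel ..
 show "0 <= kill k q h gamma" unfolding k by (intro sum_nonneg add_nonneg_nonneg p)
 have z: "B (perp ?p) (gamma (2 * i)) (gamma (2 * i)) = 0" "B ?p (gamma (2 * i + 1)) (gamma (2 * i + 1)) = 0"
  if "kill k q h gamma = 0" "i < k" for i
 proof -
  have "Re (B (perp ?p) (gamma (2 * i)) (gamma (2 * i))) + Re (B ?p (gamma (2 * i + 1)) (gamma (2 * i + 1))) = 0"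
   using that p unfolding k by (subst (asm) sum_nonneg_eq_0_iff) (auto intro: add_nonneg_nonneg)
  then have "Re (B (perp ?p) (gamma (2 * i)) (gamma (2 * i))) = 0" "Re (B ?p (gamma (2 * i + 1)) (gamma (2 * i + 1))) = 0"
   using p(1)[of "gamma (2 * i)"] p(2)[of "gamma (2 * i + 1)"] by linarith+
  then show "B (perp ?p) (gamma (2 * i)) (gamma (2 * i)) = 0" "B ?p (gamma (2 * i + 1)) (gamma (2 * i + 1)) = 0"
   using okv_real[OF okv_gen[of q]] okv_real[OF okv_perp[of q]] by (simp_all add: complex_eq_iff)
 qed
 then show "kill k q h gamma = 0 ==> i < k ==> frm k h (perp (prj q)) (gamma (2 * i)) (gamma (2 * i)) = 0"
  "kill k q h gamma = 0 ==> i < k ==> frm k h (prj q) (gamma (2 * i + 1)) (gamma (2 * i + 1)) = 0" unfolding e by blast+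
 show "trc k (dil k h gamma) = nrm k h gamma" if kz: "kill k q h gamma = 0"
 proof -
  have "B vunit (gamma (2 * i)) (gamma (2 * i + 1)) = 0" "B vunit (gamma (2 * i + 1)) (gamma (2 * i)) = 0" if "i < k" for i
  proof -
   note n1 = B_null[OF okv_perp[of q] box_FS[OF g] box_FS[OF g] z(1)[OF kz that], of "2 * i + 1"]
   note n2 = B_null[OF okv_gen[of q] box_FS[OF g] box_FS[OF g] z(2)[OF kz that], of "2 * i"]
   show "B vunit (gamma (2 * i)) (gamma (2 * i + 1)) = 0" using n1(1) n2(2) unfolding B_perp by simp
   show "B vunit (gamma (2 * i + 1)) (gamma (2 * i)) = 0" using n1(2) n2(1) unfolding B_perp by simp
  qed
  then have "dil k h gamma i i vunit = B vunit (gamma (2 * i)) (gamma (2 * i)) + B vunit (gamma (2 * i + 1)) (gamma (2 * i + 1))" if "i < k" for i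
   using that by (simp add: dil_eq e)
  then show ?thesis unfolding trc_def nrm_def sum_lessThan_double e by simp
 qed
qed

lemma Ek_states_mono: "i <= j ==> states k (Ek_seq g k j) <= states k (Ek_seq g k i)"
 unfolding states_def pos_fun_def using Ek_seq_mono[of i j _ g k] by blast

lemma dil_pos: "kcone k C ==> h \<in> pos_fun k C ==> dil k h gamma \<in> pos_fun k C" unfolding dil_def by (rule pull_pos)

lemma Ek_proj_states:
 assumes h: "!!j. h \<in> states k (Ek_seq g k j)"
 shows "h \<in> states k (Ek_proj g k)"
proof -
 have hf: "herm_fam h" "trc k h = 1" using h[of 0] by (auto simp: states_def pos_fun_def)
 have "0 <= Re (ev k h Y)" if Y: "Y \<in> Ek_proj g k" for Y
 proof (rule field_le_epsilon)
  fix eps :: real assume "eps > 0"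
  then obtain j where "Y + unit_mat eps k \<in> Ek_seq g k j" using Y by (auto simp: Ek_proj_alt)
  then have "0 <= Re (ev k h (Y + unit_mat eps k))" using h[of j] by (auto simp: states_def pos_fun_def)
  also have "... = Re (ev k h Y) + eps" using Y hf hermD(1)[of Y k] by (simp add: Ek_proj_alt ev_add ev_unit trc_def del: Re_sum)
  finally show "0 <= Re (ev k h Y) + eps" .
 qed
 then show ?thesis using h[of 0] by (auto simp: states_def pos_fun_def)
qed

lemma Dil_sub:
 assumes C: "kcone k C" and S: "S <= states k C" and c: "c > 0"
 shows "Dil k q S c <= states k C"
proof
 fix f assume "f \<in> Dil k q S c"
 then obtain h gamma where h: "f = (%i j x. cof (1 / trc k (dil k h gamma)) * dil k h gamma i j x)" "h \<in> S"
  "c <= trc k (dil k h gamma)" unfolding Dil_def by blast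
 have "dil k h gamma \<in> pos_fun k C" using S h(2) by (intro dil_pos C) (auto simp: states_def)
 then show "f \<in> states k C" unfolding h(1) states_def using h(3) c by (auto intro!: scale_pos simp: trc_scale_fam simp del: of_real_divide)
qed

text \<open>X plus a small multiple of the unit lies outside all stages, so dil_from_rows applies to later and later stages with
penalties of growing weight. The resulting data lie in nested compact sets; at a common point the state is nonnegative
on the limit cone and the penalty is 0.\<close>
lemma dilated_separation:
 fixes g :: "nat => ('i::finite, 'o::finite) lab"
 assumes g: "generator_enum g" and k: "k >= 1" and X: "X \<in> herm k" "X ~: Ek_proj g k"
 shows "EX f:Dil k q (states k (Ek_proj g k)) (1 / real k). Re (ev k f X) < 0"
proof -
 let ?S = "%j. states k (Ek_seq g k j)"
 obtain eps where e: "eps > 0" "!!j. X + unit_mat eps k ~: Ek_seq g k j" using X by (auto simp: Ek_proj_alt)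
 define X' where "X' = X + unit_mat eps k"
 have X': "X' \<in> herm k" unfolding X'_def by (intro herm_add X herm_unit)
 define T where "T n = {z. fst z \<in> ?S n & 1 / real k <= nrm k (fst z) (snd z) & 0 <= kill k q (fst z) (snd z) &
   Re (ev k (dil k (fst z) (snd z)) X') + real n * kill k q (fst z) (snd z) <= 0}" for n
 have "EX z:?S 0 \<times> coef_box k. ALL n. z \<in> T n"
 proof (rule nested_compact[of "?S 0 \<times> coef_box k" T])
  show "compact (?S 0 \<times> coef_box k)" by (intro compact_Times compact_states Ek_seq_cone compact_zbox)
  have "{z :: _ \<times> (nat => nat => complex). fst z \<in> ?S n} = ?S n \<times> UNIV" for n by auto
  then have "closed {z :: _ \<times> (nat => nat => complex). fst z \<in> ?S n}" for n by (simp only: closed_Times[OF states_closed closed_UNIV])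
  then show "closed (T n)" for n unfolding T_def by (intro closed_Collect_conj closed_Collect_le continuous_intros cont_nrm cont_kill cont_ev_dil)
  show "T (Suc n) <= T n" for n
  proof
   fix z assume z: "z \<in> T (Suc n)"
   then have "fst z \<in> ?S n" using Ek_states_mono[of n "Suc n" k g] by (auto simp: T_def simp del: Ek_seq.simps)
   moreover have "real n * kill k q (fst z) (snd z) <= real (Suc n) * kill k q (fst z) (snd z)" using z by (intro mult_right_mono) (auto simp: T_def)
   ultimately show "z \<in> T n" using z by (auto simp: T_def simp del: Ek_seq.simps of_nat_Suc)
  qed
  show "?S 0 \<times> coef_box k \<inter> T n ~= {}" for n
  proof -
   obtain j where j: "j >= n" "pgen g j = q" using pgen_ex[OF g] by blast
   have "X' ~: proj_cone k (Ek_seq g k j) (prj q)" using e(2)[of "Suc j"] j(2) by (simp add: X'_def periodic_gen_eq)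
   from dil_from_rows[OF Ek_seq_cone Ek_seq_arch X' this, of "real (Suc n)"] obtain h gamma where
    h: "h \<in> ?S j" "gamma \<in> coef_box k" "1 / real k <= nrm k h gamma" "Re (ev k (dil k h gamma) X') + real (Suc n) * kill k q h gamma <= 0" by auto
   have k0: "0 <= kill k q h gamma" using h(1) by (intro kill_props(1)[OF Ek_seq_cone _ h(2)]) (auto simp: states_def)
   have "real n * kill k q h gamma <= real (Suc n) * kill k q h gamma" by (rule mult_right_mono[OF _ k0]) simp
   then have le: "Re (ev k (dil k h gamma) X') + real n * kill k q h gamma <= 0" using h(4) by linarith
   have "h \<in> ?S n" "h \<in> ?S 0" using h(1) Ek_states_mono[of _ j k g] j(1) by blast+
   then have "(h, gamma) \<in> ?S 0 \<times> coef_box k \<inter> T n" using h(2,3) k0 le unfolding T_def by (simp del: Ek_seq.simps)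
   then show ?thesis by blast
  qed
 qed
 then obtain z where z: "z \<in> ?S 0 \<times> coef_box k" "!!n. z \<in> T n" by blast
 obtain h gamma where hg: "z = (h, gamma)" by (cases z)
 have hS: "h \<in> ?S n" "1 / real k <= nrm k h gamma" "0 <= kill k q h gamma"
  "Re (ev k (dil k h gamma) X') + real n * kill k q h gamma <= 0" for n using z(2)[of n] by (auto simp: T_def hg simp del: Ek_seq.simps)
 have gb: "gamma \<in> coef_box k" using z(1) hg by simp
 have h: "h \<in> states k (Ek_proj g k)" by (rule Ek_proj_states) (rule hS)
 then have hp: "h \<in> pos_fun k (Ek_proj g k)" by (simp add: states_def)
 have kz: "kill k q h gamma = 0"
 proof (rule ccontr)
  assume "kill k q h gamma ~= 0"
  then have "kill k q h gamma > 0" using hS(3) by linarith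
  then obtain n where "real n * kill k q h gamma > - Re (ev k (dil k h gamma) X')" using ex_less_of_nat_mult by blast
  then show False using hS(4)[of n] by linarith
 qed
 define t where "t = trc k (dil k h gamma)"
 have t: "1 / real k <= t" using kill_props(4)[OF Ek_proj_cone hp gb kz] hS(2) by (simp add: t_def)
 then have t0: "t > 0" using k by (intro less_le_trans[OF _ t]) simp
 define f where "f = (%i j x. cof (1 / t) * dil k h gamma i j x)"
 have "f \<in> Dil k q (states k (Ek_proj g k)) (1 / real k)" unfolding Dil_def f_def t_def using h gb kz t[unfolded t_def] by blast
 moreover have "Re (ev k f X) < 0"
 proof -
  have hd: "herm_fam (dil k h gamma)" using dil_pos[OF Ek_proj_cone hp] by (simp add: pos_fun_def)
  have "Re (ev k (dil k h gamma) X') = Re (ev k (dil k h gamma) X) + eps * t"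
   unfolding X'_def using hd hermD(1)[OF X(1)] by (simp add: ev_add ev_unit t_def trc_def del: Re_sum)
  then have "Re (ev k (dil k h gamma) X) <= - (eps * t)" using hS(4)[of 0] by simp
  then have "Re (ev k (dil k h gamma) X) < 0" using e(1) t0 by (smt (verit) mult_pos_pos)
  then show ?thesis unfolding f_def ev_scale_fam using t0 by (simp add: divide_neg_pos)
 qed
 ultimately show ?thesis by blast
qed

section \<open>Exposed states\<close>

definition rep :: "nat => (('i::finite, 'o::finite) fam => real) => bool" where
 "rep k L \<longleftrightarrow> (EX Y:herm k. ALL h. herm_fam h --> L h = Re (ev k h Y))"

lemma rep_ev: "Y \<in> herm k ==> rep k (%h. Re (ev k h Y))" by (auto simp: rep_def)

lemma rep_add:
 assumes "rep k L" "rep k M" shows "rep k (%h. L h + M h)"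
proof -
 obtain Y Z where Y: "Y \<in> herm k" "!!h. herm_fam h ==> L h = Re (ev k h Y)" and Z: "Z \<in> herm k" "!!h. herm_fam h ==> M h = Re (ev k h Z)"
  using assms by (auto simp: rep_def)
 show ?thesis unfolding rep_def by (rule bexI[OF _ herm_add[OF Y(1) Z(1)]]) (simp add: Y Z ev_add[OF _ hermD(1)[OF Y(1)] hermD(1)[OF Z(1)]])
qed

lemma rep_scale:
 assumes "rep k L" shows "rep k (%h. t * L h)"
proof -
 obtain Y where Y: "Y \<in> herm k" "!!h. herm_fam h ==> L h = Re (ev k h Y)" using assms by (auto simp: rep_def)
 show ?thesis unfolding rep_def by (rule bexI[OF _ map_mat_scale_herm[OF Y(1), of t]]) (simp add: Y ev_scale[OF _ hermD(1)[OF Y(1)]])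
qed

lemma rep_zero: "rep k (%h. 0)" using rep_scale[OF rep_ev[OF herm_unit[of 0 k]], of 0] by simp

lemma rep_sum: "(!!i. i \<in> I ==> rep k (L i)) ==> rep k (%h. SUM i:I. L i h)"
 by (induction I rule: infinite_finite_induct) (simp_all add: rep_zero rep_add)

lemma rep_trc: "rep k (trc k)" unfolding rep_def by (rule bexI[OF _ herm_unit[of 1 k]]) (simp add: ev_unit trc_def)

lemma rep_frm:
 assumes "vstar v = v" shows "rep k (%h. Re (frm k h v c c))" unfolding rep_def
proof (rule bexI[of _ "Matrix.mat k k (%(a, b). vscale (cnj (c a) * c b) v)"])
 show "ALL h. herm_fam h --> Re (frm k h v c c) = Re (ev k h (Matrix.mat k k (%(a, b). vscale (cnj (c a) * c b) v)))"
  using ev_rank_one[of _ k c v] by auto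
 show "Matrix.mat k k (%(a, b). vscale (cnj (c a) * c b) v) \<in> herm k" by (rule hermI) (simp_all add: vstar_vscale assms mult.commute)
qed

lemma rep_pull:
 assumes "rep k L" shows "rep k (%h. if herm_fam h then L (pull k h delta) else 0)"
proof -
 obtain Y where Y: "Y \<in> herm k" "!!h. herm_fam h ==> L h = Re (ev k h Y)" using assms by (auto simp: rep_def)
 show ?thesis unfolding rep_def by (rule bexI[of _ "compress (Matrix.mat k k (%(i, j). delta i j)) Y"])
   (auto simp: Y(2)[OF pull_herm] ev_pull intro!: compress_herm[OF Y(1)])
qed

definition nn :: "nat => ('i::finite, 'o::finite) fam => real" where
 "nn k f = (SUM i<k. SUM j<k. SUM q:UNIV. (cmod (f i j (gen q)))\<^sup>2)"

definition inn :: "nat => ('i::finite, 'o::finite) fam => ('i, 'o) fam => real" where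
 "inn k f h = (SUM i<k. SUM j<k. SUM q:UNIV. Re (cnj (f i j (gen q)) * h i j (gen q)))"

lemma nn_diff: "nn k (h - f) = nn k h - 2 * inn k f h + nn k f"
proof -
 have e: "(cmod (a - b))\<^sup>2 = (cmod a)\<^sup>2 - 2 * Re (cnj b * a) + (cmod b)\<^sup>2" for a b
  unfolding cmod_power2 by (simp add: power2_eq_square algebra_simps)
 show ?thesis unfolding nn_def inn_def by (simp add: e sum.distrib sum_subtractf sum_distrib_left)
qed

lemma inn_self: "inn k f f = nn k f" unfolding inn_def nn_def cmod_power2 by (simp add: power2_eq_square)

lemma rep_inn:
 assumes f: "herm_fam f" shows "rep k (inn k f)"
proof -
 let ?W = "Matrix.mat k k (%(i, j). SUM q:UNIV. vscale (cnj (f i j (gen q))) (gen q))"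
 have s: "vstar (SUM q:I. h q) = (SUM q:I. vstar (h q))" for I and h :: "_ => ('a, 'b) vns"
  by (induction I rule: infinite_finite_induct) (simp_all add: vstar_add)
 have "?W \<in> herm k" by (rule hermI) (simp_all add: s vstar_vscale, intro sum.cong refl, metis herm_famD(2)[OF f] vstar_gen)
 moreover have "inn k f h = Re (ev k h ?W)" if h: "herm_fam h" for h
  unfolding inn_def ev_def Re_sum by (intro sum.cong refl) (simp add: clinD[OF herm_famD(1)[OF h]])
 ultimately show ?thesis unfolding rep_def by blast
qed

lemma nn_zero_imp_eq:
 assumes f: "herm_fam f" "supp k f" and h: "herm_fam h" "supp k h" and z: "nn k (h - f) <= 0"
 shows "h = f"
proof -
 have e: "h i j (gen q) = f i j (gen q)" if ij: "i < k" "j < k" for i j q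
 proof -
  have "(cmod ((h - f) i j (gen q)))\<^sup>2 <= (SUM q:UNIV. (cmod ((h - f) i j (gen q)))\<^sup>2)" by (rule member_le_sum) auto
  also have "... <= (SUM j<k. SUM q:UNIV. (cmod ((h - f) i j (gen q)))\<^sup>2)"
   using ij by (intro member_le_sum[of j "{..<k}" "%j. SUM q:UNIV. (cmod ((h - f) i j (gen q)))\<^sup>2"]) (auto intro: sum_nonneg)
  also have "... <= nn k (h - f)"
   unfolding nn_def using ij by (intro member_le_sum[of i "{..<k}" "%i. SUM j<k. SUM q:UNIV. (cmod ((h - f) i j (gen q)))\<^sup>2"]) (auto intro!: sum_nonneg)
  finally have "(cmod ((h - f) i j (gen q)))\<^sup>2 <= 0" using z by linarith
  then show ?thesis by simp
 qed
 have "h i j = f i j" for i j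
 proof (cases "i < k & j < k")
  case True then show ?thesis using e by (intro clin_cong herm_famD(1)[OF f(1)] herm_famD(1)[OF h(1)]) blast
 next
  case False then show ?thesis using f(2) h(2) by (auto simp: supp_def fun_eq_iff)
 qed
 then show ?thesis by (simp add: fun_eq_iff)
qed

locale dilating_cone =
 fixes k :: nat and C :: "('i::finite, 'o::finite) vns mat set"
 assumes cone: "kcone k C" and k1: "k >= 1"
  and dilate: "X \<in> herm k ==> X ~: C ==> EX f:Dil k q (states k C) (1 / real k). Re (ev k f X) < 0"
begin

abbreviation "S \<equiv> states k C"

lemma S_D: "f \<in> S ==> herm_fam f" "f \<in> S ==> supp k f" "f \<in> S ==> f \<in> pos_fun k C" "f \<in> S ==> trc k f = 1"
 by (auto simp: states_def pos_fun_def)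

lemma rep_cont: "rep k L ==> continuous_on S L"
proof -
 assume "rep k L"
 then obtain Y where "!!h. herm_fam h ==> L h = Re (ev k h Y)" by (auto simp: rep_def)
 then have "continuous_on S L \<longleftrightarrow> continuous_on S (%h. Re (ev k h Y))" by (intro continuous_on_cong refl) (simp add: S_D)
 then show ?thesis unfolding ev_def by (simp only:) (intro continuous_intros cont_coord)
qed

lemma nn_cont: "continuous_on S (nn k)" "continuous_on S (%h. nn k (h - f))" unfolding nn_def fun_diff_def by (intro continuous_intros cont_coord)+

definition bd :: real where "bd = real k * (real k * real CARD((('i, 'o) lab) option))"

lemma nn_bound: "f \<in> S ==> 0 <= nn k f & nn k f <= bd"
proof
 assume f: "f \<in> S"
 show "0 <= nn k f" unfolding nn_def by (intro sum_nonneg) simp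
 have "nn k f <= (SUM i<k. SUM j<k. SUM q:(UNIV :: (('i, 'o) lab) option set). 1)"
  unfolding nn_def using entry_bound[OF cone S_D(3)[OF f]] S_D(4)[OF f] by (intro sum_mono) (simp add: power_le_one)
 then show "nn k f <= bd" by (simp add: bd_def)
qed

lemma bd_pos: "0 < bd"
proof -
 have "0 < CARD((('i, 'o) lab) option)" by (rule zero_less_card_finite)
 then have "0 < real CARD((('i, 'o) lab) option)" by (simp only: of_nat_0_less_iff)
 moreover have "0 < real k" using k1 by simp
 ultimately show ?thesis unfolding bd_def by (intro mult_pos_pos)
qed

text \<open>States that are strictly exposed with a quadratic margin: an affine functional vanishes at f and dominates the squared
distance from f. Maximisers of the squared norm plus a linear functional are of this kind.\<close>
definition exposed :: "('i, 'o) fam set" where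
 "exposed = {f \<in> S. EX Z. rep k Z & Z f = 0 & (ALL f':S. nn k (f' - f) <= Z f')}"

lemma maximizer:
 assumes L: "rep k L" and ne: "f0 \<in> S"
 obtains f where "f \<in> exposed" "!!f'. f' \<in> S ==> nn k f' + L f' <= nn k f + L f"
proof -
 obtain f where f: "f \<in> S" "!!f'. f' \<in> S ==> nn k f' + L f' <= nn k f + L f"
  using continuous_attains_sup[OF compact_states[OF cone], of "%f. nn k f + L f"] ne
   continuous_on_add[OF nn_cont(1) rep_cont[OF L]] by blast
 define Z where "Z h = (-2) * inn k f h + ((-1) * L h + (2 * nn k f + L f) * trc k h)" for h
 have "rep k Z" unfolding Z_def by (intro rep_add rep_scale rep_inn L rep_trc S_D(1)[OF f(1)])
 moreover have "Z f = 0" by (simp add: Z_def inn_self S_D(4)[OF f(1)])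
 moreover have "nn k (f' - f) <= Z f'" if "f' \<in> S" for f' using f(2)[OF that] by (simp add: Z_def nn_diff S_D(4)[OF that])
 ultimately have "f \<in> exposed" unfolding exposed_def using f(1) by blast
 then show ?thesis using that f(2) by blast
qed

lemma Dil_S: "A <= S ==> c > 0 ==> Dil k q A c <= S" by (rule Dil_sub[OF cone])

lemma rep_S_pos:
 assumes Z: "rep k Z" "!!f. f \<in> S ==> 0 <= Z f" and f: "f \<in> pos_fun k C"
 shows "0 <= Z f"
proof -
 obtain Y where Y: "!!h. herm_fam h ==> Z h = Re (ev k h Y)" using Z(1) by (auto simp: rep_def)
 have fh: "herm_fam f" using f by (simp add: pos_fun_def)
 show ?thesis
 proof (cases "trc k f = 0")
  case True
  then have "f i j (gen q) = 0" for i j q using entry_bound[OF cone f, of i j q] by simp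
  then have "f i j x = 0" for i j x using clin_expand[OF herm_famD(1)[OF fh], of i j x] by simp
  then show ?thesis by (simp add: Y[OF fh] ev_def)
 next
  case False
  then have t: "trc k f > 0" using trc_diag(4)[OF cone f] by simp
  let ?f = "%i j x. cof (1 / trc k f) * f i j x"
  have "?f \<in> S" unfolding states_def using scale_pos[OF f, of "1 / trc k f"] t by (simp add: trc_scale_fam del: of_real_divide)
  then have "0 <= Re (ev k ?f Y)" using Z(2) Y[OF S_D(1)] by fastforce
  then show ?thesis using t unfolding ev_scale_fam Y[OF fh] by (simp add: zero_le_divide_iff)
 qed
qed

text \<open>If Z is the margin functional of f, then Z - \<epsilon> trc is negative at f, so its matrix lies outside C and it is
negative on some dilation, whose squared distance from f is then below \<epsilon>. As Dil is compact, f belongs to it.\<close>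
lemma exposed_Dil: "exposed <= Dil k q S (1 / real k)"
proof
 fix f assume f: "f \<in> exposed"
 then obtain Z where fS: "f \<in> S" and Z: "rep k Z" "Z f = 0" "!!f'. f' \<in> S ==> nn k (f' - f) <= Z f'" by (auto simp: exposed_def)
 let ?D = "Dil k q S (1 / real k)"
 have D: "?D <= S" using k1 by (intro Dil_S) auto
 have close: "EX f':?D. nn k (f' - f) < eps" if e: "eps > 0" for eps
 proof -
  have "rep k (%h. Z h + (-eps) * trc k h)" by (intro rep_add rep_scale Z(1) rep_trc)
  then obtain Y where Y: "Y \<in> herm k" "!!h. herm_fam h ==> Z h + (-eps) * trc k h = Re (ev k h Y)" by (auto simp: rep_def)
  have "Re (ev k f Y) < 0" using Y(2)[OF S_D(1)[OF fS]] Z(2) e S_D(4)[OF fS] by simp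
  then have "Y ~: C" using fS by (force simp: states_def pos_fun_def)
  from dilate[OF Y(1) this] obtain f' where f': "f' \<in> ?D" "Re (ev k f' Y) < 0" by blast
  then have "f' \<in> S" using D by blast
  then have "nn k (f' - f) < eps" using f'(2) Y(2)[OF S_D(1), of f'] Z(3)[of f'] S_D(4)[of f'] by simp
  then show ?thesis using f'(1) by blast
 qed
 have cD: "compact ?D" using k1 by (intro compact_Dil compact_states cone) simp
 have "?D ~= {}" using close[of 1] by auto
 from continuous_attains_inf[OF cD this continuous_on_subset[OF nn_cont(2) D], of f]
 obtain f' where f': "f' \<in> ?D" "!!h. h \<in> ?D ==> nn k (f' - f) <= nn k (h - f)" by blast
 have "nn k (f' - f) <= 0"
 proof (rule ccontr)
  assume "\<not> ?thesis"
  then show False using close[of "nn k (f' - f)"] f'(2) by fastforce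
 qed
 moreover have "f' \<in> S" using f'(1) D by blast
 ultimately have "f' = f" using fS by (intro nn_zero_imp_eq[of f k f'] S_D)
 then show "f \<in> ?D" using f'(1) by simp
qed

definition "R = closure exposed"

lemma R_S: "R <= S" unfolding R_def by (rule closure_minimal[OF _ states_closed]) (auto simp: exposed_def)

lemma R_compact: "compact R"
proof -
 have "compact (S \<inter> R)" unfolding R_def by (intro compact_Int_closed compact_states cone closed_closure)
 then show ?thesis using R_S by (simp add: inf.absorb2)
qed

lemma exposed_R: "exposed <= R" unfolding R_def by (rule closure_subset)

lemma R_separates:
 assumes X: "X \<in> herm k" "X ~: C"
 shows "EX f:R. Re (ev k f X) < 0"
proof -
 obtain f0 where f0: "f0 \<in> S" "Re (ev k f0 X) < 0"
 proof -
  obtain f where f: "f \<in> Dil k undefined S (1 / real k)" "Re (ev k f X) < 0" using dilate[OF X, of undefined] by blast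
  have "Dil k undefined S (1 / real k) <= S" using k1 by (intro Dil_S) simp_all
  then show thesis using f that by blast
 qed
 define rho where "rho = (bd + 1) / (- Re (ev k f0 X))"
 have rho: "rho > 0" using f0(2) bd_pos by (simp add: rho_def divide_pos_neg)
 obtain f where f: "f \<in> exposed" "nn k f0 + (-rho) * Re (ev k f0 X) <= nn k f + (-rho) * Re (ev k f X)"
  using maximizer[OF rep_scale[OF rep_ev[OF X(1)], of "-rho"] f0(1)] f0(1) by metis
 have "f \<in> S" using f(1) by (simp add: exposed_def)
 then have "(-rho) * Re (ev k f0 X) <= bd + (-rho) * Re (ev k f X)" using nn_bound[of f] nn_bound[OF f0(1)] f(2) by linarith
 moreover have "(-rho) * Re (ev k f0 X) = bd + 1" using f0(2) by (simp add: rho_def)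
 ultimately have "rho * Re (ev k f X) < 0" by simp
 then have "Re (ev k f X) < 0" using rho by (simp add: mult_less_0_iff)
 then show ?thesis using f(1) exposed_R by blast
qed

text \<open>Maximisers of the squared norm plus \<rho> Y - n L over all states are exposed. For large \<rho> the norm has little
influence, so Y is nearly as large at a maximiser as at h0, and L is of order 1 / n there; a limit point lies on the
face L = 0.\<close>
lemma R_face:
 assumes L: "rep k L" "!!f. f \<in> S ==> 0 <= L f" and h0: "h0 \<in> S" "L h0 = 0" and Y: "rep k Y" and eta: "eta > 0"
 shows "EX h:R. L h = 0 & Y h0 - eta <= Y h"
proof -
 obtain b where b: "!!f. f \<in> S ==> Y f <= b" using continuous_attains_sup[OF compact_states[OF cone] _ rep_cont[OF Y]] h0(1) by (metis empty_iff)
 \<comment> \<open>The squared norm varies by at most bd over the states, and rho eta = bd.\<close>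
 define rho where "rho = bd / eta"
 have rho: "rho > 0" using eta bd_pos by (simp add: rho_def)
 define c where "c = bd + rho * (b - Y h0)"
 obtain L' Y' where L': "!!h. herm_fam h ==> L h = Re (ev k h L')" and Y': "!!h. herm_fam h ==> Y h = Re (ev k h Y')"
  using L(1) Y by (auto simp: rep_def)
 define T where "T n = {h. h \<in> R & Y h0 - eta <= Re (ev k h Y') & real n * Re (ev k h L') <= c}" for n
 have cR: "closed {h. h \<in> R}" by (simp add: R_def)
 have "EX h:R. ALL n. h \<in> T n"
 proof (rule nested_compact[of R T, OF R_compact])
  show "closed (T n)" for n unfolding T_def ev_def by (intro closed_Collect_conj closed_Collect_le continuous_intros cont_coord cR)
  show "T (Suc n) <= T n" for n
  proof
   fix h assume h: "h \<in> T (Suc n)"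
   then have "h \<in> S" using R_S by (auto simp: T_def)
   then have "0 <= Re (ev k h L')" using L(2)[of h] L'[OF S_D(1)] by simp
   then have "real n * Re (ev k h L') <= real (Suc n) * Re (ev k h L')" by (intro mult_right_mono) auto
   then show "h \<in> T n" using h unfolding T_def by (auto simp del: of_nat_Suc)
  qed
  show "R \<inter> T n ~= {}" for n
  proof -
   obtain f where f: "f \<in> exposed" "nn k h0 + (rho * Y h0 + (- real n) * L h0) <= nn k f + (rho * Y f + (- real n) * L f)"
    using maximizer[OF rep_add[OF rep_scale[OF Y, of rho] rep_scale[OF L(1), of "- real n"]] h0(1)] h0(1) by metis
   have fS: "f \<in> S" using f(1) by (simp add: exposed_def)
   have i: "real n * L f <= bd + rho * (Y f - Y h0)" using f(2) h0(2) nn_bound[OF fS] nn_bound[OF h0(1)] by (simp add: algebra_simps)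
   have "0 <= real n * L f" using L(2)[OF fS] by simp
   then have "0 <= rho * (eta + (Y f - Y h0))" using i eta by (simp add: distrib_left rho_def)
   then have "Y h0 - eta <= Y f" using rho by (simp add: zero_le_mult_iff)
   moreover have "rho * (Y f - Y h0) <= rho * (b - Y h0)" using b[OF fS] rho by simp
   ultimately have "f \<in> T n" unfolding T_def c_def using i f(1) exposed_R L'[OF S_D(1)[OF fS]] Y'[OF S_D(1)[OF fS]] by auto
   then show ?thesis using f(1) exposed_R by blast
  qed
 qed
 then obtain h where h: "h \<in> R" "!!n. h \<in> T n" by blast
 have hS: "h \<in> S" using h(1) R_S by blast
 have "L h = 0"
 proof (rule ccontr)
  assume "L h ~= 0"
  then have "L h > 0" using L(2)[OF hS] by simp
  then obtain n where "real n * L h > c" using ex_less_of_nat_mult by blast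
  then show False using h(2)[of n] L'[OF S_D(1)[OF hS]] by (simp add: T_def)
 qed
 then show ?thesis using h(1) h(2)[of 0] Y'[OF S_D(1)[OF hS]] by (auto simp: T_def)
qed

text \<open>An exposed state f is the normalised dilation of some state h0. Let Z be its margin functional and let L h be Z at the
dilation of h along the same vectors plus the penalty. L vanishes at h0, and whenever it vanishes at h, the margin
forces the normalised dilation of h to be f again. So R_face replaces h0 by a state in R, with a loss in the trace
that the constant 1 / (2 k) allows.\<close>
lemma R_Dil: "R <= Dil k q R (1 / (2 * real k))"
proof -
 have "f \<in> Dil k q R (1 / (2 * real k))" if fE: "f \<in> exposed" for f
 proof -
  obtain Z where fS: "f \<in> S" and Z: "rep k Z" "Z f = 0" "!!f'. f' \<in> S ==> nn k (f' - f) <= Z f'" using fE by (auto simp: exposed_def)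
  obtain h0 gamma where h0: "f = (%i j x. cof (1 / trc k (dil k h0 gamma)) * dil k h0 gamma i j x)" "h0 \<in> S" "gamma \<in> coef_box k"
   "kill k q h0 gamma = 0" "1 / real k <= trc k (dil k h0 gamma)" using exposed_Dil[of q] fE unfolding Dil_def by blast
  let ?delta = "%i. gamma (2 * i) + gamma (2 * i + 1)"
  define K where "K h = (SUM i<k. Re (frm k h (perp (prj q)) (gamma (2 * i)) (gamma (2 * i))) + Re (frm k h (prj q) (gamma (2 * i + 1)) (gamma (2 * i + 1))))" for h
  have K: "K h = kill k q h gamma" for h by (simp add: K_def kill_def)
  define L where "L h = (if herm_fam h then Z (dil k h gamma) else 0) + K h" for h
  have L: "rep k L" unfolding L_def K_def dil_def by (intro rep_add rep_pull rep_sum rep_frm Z(1)) simp_all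
  have Zpos: "0 <= Z f'" if "f' \<in> pos_fun k C" for f'
  proof (rule rep_S_pos[OF Z(1) _ that])
   fix f' assume "f' \<in> S"
   have "0 <= nn k (f' - f)" unfolding nn_def by (intro sum_nonneg) simp
   then show "0 <= Z f'" using Z(3)[OF \<open>f' \<in> S\<close>] by simp
  qed
  have LS: "L h = Z (dil k h gamma) + kill k q h gamma" "0 <= Z (dil k h gamma)" "0 <= kill k q h gamma" if "h \<in> S" for h
   using S_D[OF that] Zpos[OF dil_pos[OF cone S_D(3)[OF that]]] kill_props(1)[OF cone S_D(3)[OF that] h0(3)] by (simp_all add: L_def K)
  have "trc k (dil k h0 gamma) > 0" using h0(5) k1 by (intro less_le_trans[OF _ h0(5)]) simp
  have scaleZ: "Z (%i j x. cof t * h i j x) = t * Z h" if "herm_fam h" for t h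
   using Z(1) scale_fam_herm[OF that, of t] that by (auto simp: rep_def ev_scale_fam)
  have "Z (dil k h0 gamma) = 0"
   using Z(2) scaleZ[OF pull_herm[OF S_D(1)[OF h0(2)]], of "1 / trc k (dil k h0 gamma)" k ?delta] \<open>trc k (dil k h0 gamma) > 0\<close>
   unfolding dil_def[symmetric] h0(1)[symmetric] by simp
  then have Lh0: "L h0 = 0" using LS(1)[OF h0(2)] h0(4) by simp
  have "0 < 1 / (2 * real k)" using k1 by simp
  from R_face[OF L _ h0(2) Lh0 rep_pull[OF rep_trc, of k ?delta] this] LS
  obtain h where h: "h \<in> R" "L h = 0" "(if herm_fam h0 then trc k (dil k h0 gamma) else 0) - 1 / (2 * real k) <= (if herm_fam h then trc k (dil k h gamma) else 0)"
   unfolding dil_def by fastforce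
  have hS: "h \<in> S" using h(1) R_S by blast
  define c where "c = trc k (dil k h gamma)"
  have "1 / real k - 1 / (2 * real k) <= c" using h(3) h0(5) S_D(1)[OF hS] S_D(1)[OF h0(2)] by (simp add: c_def)
  moreover have "1 / real k - 1 / (2 * real k) = 1 / (2 * real k)" using k1 by (simp add: field_simps)
  ultimately have c: "1 / (2 * real k) <= c" by simp
  then have c0: "c > 0" using \<open>0 < 1 / (2 * real k)\<close> by linarith
  have kz: "kill k q h gamma = 0" "Z (dil k h gamma) = 0" using LS[OF hS] h(2) by linarith+
  define f' where "f' = (%i j x. cof (1 / c) * dil k h gamma i j x)"
  have D: "f' \<in> Dil k q R (1 / (2 * real k))" unfolding Dil_def f'_def c_def using h(1) h0(3) kz(1) c[unfolded c_def] by blast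
  have f'S: "f' \<in> S" using D Dil_S[OF R_S \<open>0 < 1 / (2 * real k)\<close>] by blast
  have "Z f' = 0" unfolding f'_def using scaleZ[of "dil k h gamma" "1 / c"] pull_herm[OF S_D(1)[OF hS]] kz(2) unfolding dil_def by simp
  then have "nn k (f' - f) <= 0" using Z(3)[OF f'S] by simp
  then have "f' = f" using fS f'S by (intro nn_zero_imp_eq[of f k f'] S_D)
  then show ?thesis using D by simp
 qed
 then show ?thesis unfolding R_def
  by (intro closure_minimal compact_families_closed compact_Dil R_compact[unfolded R_def] subsetI) (use k1 in simp_all)
qed

end

section \<open>States of maximal rank split\<close>

context psd_family
begin

lemma bessel_residual:
 fixes m :: nat
 assumes u: "!!i. i < m ==> u i \<in> FS" and v: "v \<in> FS"
  and o: "!!i j. i < m ==> j < m ==> B vunit (u i) (u j) = (if i = j then 1 else 0)"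
 defines "r \<equiv> v - (SUM i<m. fscale (B vunit (u i) v) (u i))"
 shows "r \<in> FS" and "j < m ==> B vunit (u j) r = 0"
  and "Re (B vunit r r) = Re (B vunit v v) - (SUM i<m. (cmod (B vunit (u i) v))\<^sup>2)"
proof -
 let ?s = "SUM i<m. fscale (B vunit (u i) v) (u i)"
 have s: "?s \<in> FS" by (intro FS_sum FS_scale u) simp
 show r: "r \<in> FS" unfolding r_def using v s by simp
 have ds: "B vunit d ?s = (SUM i<m. B vunit (u i) v * B vunit d (u i))" if "d \<in> FS" for d
 proof -
  have "B vunit d ?s = (SUM i<m. B vunit d (fscale (B vunit (u i) v) (u i)))" by (rule frmI_sum_right) (use u that in auto)
  also have "... = (SUM i<m. B vunit (u i) v * B vunit d (u i))" by (intro sum.cong refl frmI_scale_right) (use u that in auto)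
  finally show ?thesis .
 qed
 have o': "B vunit (u j) r = 0" if "j < m" for j
 proof -
  have "B vunit (u j) ?s = (SUM i<m. if i = j then B vunit (u j) v else 0)" unfolding ds[OF u[OF that]] by (intro sum.cong refl) (use o that in auto)
  also have "... = B vunit (u j) v" using that by simp
  finally show ?thesis unfolding r_def using frmI_diff_right[OF v s u[OF that], of F vunit] by simp
 qed
 then show "j < m ==> B vunit (u j) r = 0" .
 have "B vunit r r = B vunit v r - B vunit ?s r" using frmI_diff_left[OF v s r, of F vunit] by (simp add: r_def)
 also have "B vunit ?s r = (SUM i<m. B vunit (fscale (B vunit (u i) v) (u i)) r)" by (rule frmI_sum_left) (use u r in auto)
 also have "... = 0" by (intro sum.neutral ballI) (use u r o' in "simp add: frmI_scale_left")
 also have "B vunit v r - 0 = B vunit v v - B vunit v ?s" using frmI_diff_right[OF v s v, of F vunit] by (simp add: r_def)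
 also have "B vunit v ?s = (SUM i<m. of_real ((cmod (B vunit (u i) v))\<^sup>2))" unfolding ds[OF v]
 proof (intro sum.cong refl)
  fix i
  have "B vunit v (u i) = cnj (B vunit (u i) v)" by (rule B_herm') simp
  then show "B vunit (u i) v * B vunit v (u i) = of_real ((cmod (B vunit (u i) v))\<^sup>2)" by (simp only: complex_norm_square)
 qed
 finally show "Re (B vunit r r) = Re (B vunit v v) - (SUM i<m. (cmod (B vunit (u i) v))\<^sup>2)" by simp
qed

lemma orthonormal_le:
 assumes u: "!!i l. i < m ==> l >= k ==> u i l = 0"
  and o: "!!i j. i < m ==> j < m ==> B vunit (u i) (u j) = (if i = j then 1 else 0)"
 shows "m <= k"
proof -
 have uF: "u i \<in> FS" if "i < m" for i by (rule FSI[of k]) (rule u[OF that])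
 have 1: "(SUM l<k. (cmod (B vunit (u i) (gs l)))\<^sup>2) = 1" if i: "i < m" for i
 proof -
  have "B vunit (u i) (u i) = (SUM l<k. of_real ((cmod (B vunit (u i) (gs l)))\<^sup>2))"
   unfolding parseval[of k "u i" "u i", OF u[OF i] uF[OF i], simplified]
  proof (intro sum.cong refl)
   fix l
   have "B vunit (gs l) (u i) = cnj (B vunit (u i) (gs l))" by (rule B_herm') simp
   then show "cnj (B vunit (gs l) (u i)) * B vunit (gs l) (u i) = of_real ((cmod (B vunit (u i) (gs l)))\<^sup>2)"
    by (simp only: complex_cnj_cnj complex_norm_square)
  qed
  then have "cof (SUM l<k. (cmod (B vunit (u i) (gs l)))\<^sup>2) = of_real 1" using o[OF i i] by simp
  then show ?thesis by (simp only: of_real_eq_iff)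
 qed
 have 2: "(SUM i<m. (cmod (B vunit (u i) (gs l)))\<^sup>2) <= 1" for l
 proof -
  note b = bessel_residual[OF uF gs_FS[of l] o]
  have "0 <= Re (B vunit (gs l - (SUM i<m. fscale (B vunit (u i) (gs l)) (u i))) (gs l - (SUM i<m. fscale (B vunit (u i) (gs l)) (u i))))"
   using okv_unit by (simp add: okv_def)
  also have "... = Re (B vunit (gs l) (gs l)) - (SUM i<m. (cmod (B vunit (u i) (gs l)))\<^sup>2)" by (rule b(3))
  also have "Re (B vunit (gs l) (gs l)) <= 1" by (simp add: gs_norm)
  finally show ?thesis by simp
 qed
 have "real m = (SUM i<m. SUM l<k. (cmod (B vunit (u i) (gs l)))\<^sup>2)" by (simp add: 1)
 also have "... = (SUM l<k. SUM i<m. (cmod (B vunit (u i) (gs l)))\<^sup>2)" by (rule sum.swap)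
 also have "... <= (SUM l<k. 1)" by (rule sum_mono) (rule 2)
 finally show ?thesis by simp
qed

end

definition orthonormal :: "nat => nat => ('i::finite, 'o::finite) fam => (nat => nat => complex) => bool" where
 "orthonormal k m f u \<longleftrightarrow> (ALL i<m. ALL l>=k. u i l = 0) & (ALL i<m. ALL j<m. frm k f vunit (u i) (u j) = (if i = j then 1 else 0))"

lemma datum_supp_I:
 assumes "psd_fam f" and s: "supp k f"
  and sp: "!!q m. m < k ==> EX u. (ALL i>=k. u i = 0) & frm k f (perp (prj q)) u u = 0 & frm k f (prj q) (evec m - u) (evec m - u) = 0"
 shows "datum f"
proof -
 have "EX K u. m < K & (ALL i>=K. u i = 0) & frm K f (perp (prj q)) u u = 0 &
    frm K f (prj q) (%i. (if i = m then 1 else 0) - u i) (%i. (if i = m then 1 else 0) - u i) = 0" for q m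
 proof (cases "m < k")
  case True
  have e: "(%i. (if i = m then 1 else 0) - u i) = evec m - u" for u by (simp add: evec_def fun_diff_def)
  obtain u where u: "ALL i>=k. u i = 0" "frm k f (perp (prj q)) u u = 0" "frm k f (prj q) (evec m - u) (evec m - u) = 0"
   using sp[OF True, of q] by blast
  show ?thesis by (intro exI[of _ k] exI[of _ u] conjI) (use True u in "simp_all only: e")
 next
  case False
  have s1: "frm (Suc m) f x c d = frm k f x c d" for x c d by (rule frm_supp[OF s]) (use False in simp)
  have "frm k f (prj q) (%i. (if i = m then 1 else 0) - 0 i) (%i. (if i = m then 1 else 0) - 0 i) = 0"
   unfolding frm_def using False by (intro sum.neutral ballI) auto
  moreover have "ALL i>=Suc m. (0 :: nat => complex) i = 0" by simp
  ultimately show ?thesis by (intro exI[of _ "Suc m"] exI[of _ 0] conjI lessI) (simp_all only: s1 frm_zero)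
 qed
 note sp' = this
 show ?thesis unfolding datum_def
 proof (intro conjI allI)
  show "herm_fam f" using assms(1) by (simp add: psd_fam_def)
  show "0 <= Re (frm l f (prj q) c c)" "0 <= Re (frm l f (perp (prj q)) c c)" for q l c using assms(1) unfolding psd_fam_def by blast+
 qed (rule sp')
qed

context dilating_cone
begin

text \<open>Among the states in R on which y is negative somewhere, choose f with an orthonormal system of maximal length m. It is
a compression along V of some h in R with killed halves. V carries the orthonormal system and the negative vector over
to h, so by maximality its image is everything modulo null vectors. The killed half \<gamma>(2 n) is therefore V c for
some c, and e_n = c + (e_n - c) is the splitting for f.\<close>
theorem splitting_state:
 assumes f0: "f0 \<in> R" "Re (frm k f0 y w0 w0) < 0"
 shows "EX f:S. EX w. datum f & Re (frm k f y w w) < 0"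
proof -
 \<comment> \<open>Q m bounds the rank from below without mentioning dimensions.\<close>
 define Q where "Q m \<longleftrightarrow> (EX f:R. (EX w. Re (frm k f y w w) < 0) & (EX u. orthonormal k m f u))" for m
 have psd: "psd_family f" if "f \<in> R" for f using that R_S by unfold_locales (blast intro: pos_fun_psd[OF cone] S_D)
 have frm_B: "frm k f x c d = frmI f x c d" if "f \<in> R" "!!i. i >= k ==> c i = 0" "!!i. i >= k ==> d i = 0" for f x c d
  by (rule frmI_eq[symmetric]) (use that in auto)
 have "m <= k" if Qm: "Q m" for m
 proof -
  obtain f u where f: "f \<in> R" and u: "orthonormal k m f u" using Qm by (auto simp: Q_def)
  interpret psd_family f by (rule psd[OF f])
  have u0: "u i l = 0" if "i < m" "k <= l" for i l using u that by (simp add: orthonormal_def)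
  have "B vunit (u i) (u j) = (if i = j then 1 else 0)" if "i < m" "j < m" for i j
   using u that frm_B[OF f, of "u i" "u j" vunit, OF u0[OF that(1)] u0[OF that(2)]] by (simp add: orthonormal_def)
  from orthonormal_le[of m k u, OF u0 this] show ?thesis by blast
 qed
 moreover have "Q 0" unfolding Q_def orthonormal_def using f0 by auto
 ultimately obtain m where m: "Q m" "!!m'. Q m' ==> m' <= m" using GreatestI_nat[of Q 0 k] Greatest_le_nat[of Q _ k] by blast
 obtain f w u where f: "f \<in> R" "Re (frm k f y w w) < 0" and u: "orthonormal k m f u" using m(1) by (auto simp: Q_def)
 have fS: "f \<in> S" using f(1) R_S by blast
 have "datum f"
 proof (rule datum_supp_I[of f k])
  show "psd_fam f" by (rule pos_fun_psd[OF cone S_D(3)[OF fS]])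
  show "supp k f" by (rule S_D(2)[OF fS])
  fix q :: "('i, 'o) lab" and n assume n: "n < k"
  let ?p = "prj q"
  obtain h gamma where h: "f = (%i j x. cof (1 / trc k (dil k h gamma)) * dil k h gamma i j x)" "h \<in> R" "gamma \<in> coef_box k"
   "kill k q h gamma = 0" "1 / (2 * real k) <= trc k (dil k h gamma)" using subsetD[OF R_Dil f(1), of q] unfolding Dil_def by blast
  define t where "t = trc k (dil k h gamma)"
  have "0 < 1 / (2 * real k)" using k1 by simp
  then have t0: "t > 0" unfolding t_def using h(5) by (rule less_le_trans)
  have hS: "h \<in> S" using h(2) R_S by blast
  interpret psd_family h by (rule psd[OF h(2)])
  define delta where "delta i = gamma (2 * i) + gamma (2 * i + 1)" for i
  define V where "V c = (SUM i<k. fscale (c i) (delta i))" for c :: "nat => complex"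
  have d0: "delta i l = 0" if "l >= k" for i l using box_supp[OF h(3) that] by (simp add: delta_def)
  have V0: "V c l = 0" if "l >= k" for c l by (simp add: V_def sum_fun_apply fscale_def d0[OF that])
  have VF: "V c \<in> FS" for c by (rule FSI[of k]) (rule V0)
  have Vs: "V (fscale a c) = fscale a (V c)" for a c by (rule HOL.ext) (simp add: V_def sum_fun_apply fscale_def sum_distrib_left mult.assoc)
  have Va: "V (c + d) = V c + V d" "V (c - d) = V c - V d" for c d
   by (rule HOL.ext, simp add: V_def sum_fun_apply fscale_def algebra_simps sum.distrib sum_subtractf)+
  have "V 0 = 0" by (rule HOL.ext) (simp add: V_def sum_fun_apply fscale_def)
  then have Vsum: "V (SUM i:I. c i) = (SUM i:I. V (c i))" for I and c :: "nat => nat => complex"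
   by (induction I rule: infinite_finite_induct) (simp_all add: Va)
  have Ve: "V (evec n) = delta n"
  proof -
   have "V (evec n) = (SUM i<k. if i = n then delta n else 0)" unfolding V_def by (intro sum.cong refl) (auto simp: evec_def fscale_def zero_fun_def)
   then show ?thesis using n by simp
  qed
  have fV: "frm k f x c d = of_real (1 / t) * B x (V c) (V d)" for x c d
   unfolding h(1) frm_scale_fam t_def[symmetric] unfolding dil_def frm_pull V_def[symmetric] delta_def[symmetric] by (simp add: frm_B[OF h(2) V0 V0])
  have hB: "frm k h x (V c) (V d) = B x (V c) (V d)" for x c d by (rule frm_B[OF h(2)]) (simp_all add: V0)
  have ww: "Re (frm k h y (V w) (V w)) < 0" using f(2) t0 unfolding fV hB by (simp add: divide_less_0_iff)
  define u' where "u' i = fscale (of_real (1 / sqrt t)) (V (u i))" for i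
  have u'F: "u' i \<in> FS" for i unfolding u'_def using VF by simp
  have u'0: "u' i l = 0" if "l >= k" for i l by (simp add: u'_def fscale_def V0[OF that])
  have st: "cof (1 / sqrt t) * cof (1 / sqrt t) = of_real (1 / t)" using t0 by (simp add: of_real_mult[symmetric] del: of_real_mult of_real_divide)
  have u'o: "B vunit (u' i) (u' j) = (if i = j then 1 else 0)" if "i < m" "j < m" for i j
  proof -
   have "B vunit (u' i) (u' j) = of_real (1 / t) * B vunit (V (u i)) (V (u j))"
    unfolding u'_def using VF by (simp only: frmI_scale_left frmI_scale_right FS_scale complex_cnj_complex_of_real mult.assoc[symmetric] st)
   also have "... = frm k f vunit (u i) (u j)" by (simp add: fV)
   finally show ?thesis using u that by (simp add: orthonormal_def)
  qed
  let ?A = "gamma (2 * n)" and ?B = "gamma (2 * n + 1)"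
  have AF: "?A \<in> FS" "?B \<in> FS" using box_FS[OF h(3)] by blast+
  define r where "r = ?A - (SUM i<m. fscale (B vunit (u' i) ?A) (u' i))"
  note bes = bessel_residual[of m u', OF u'F AF(1) u'o, folded r_def]
  have rF: "r \<in> FS" using bes(1) by blast
  have r0: "r l = 0" if "l >= k" for l using box_supp[OF h(3) that] u'0[OF that] by (simp add: r_def sum_fun_apply fscale_def)
  have Nr: "N r = 0"
  proof (rule ccontr)
   assume nz: "N r ~= 0"
   define u'' where "u'' i = (if i < m then u' i else fscale (of_real (1 / N r)) r)" for i
   have ur: "B vunit (u' j) r = 0" "B vunit r (u' j) = 0" if "j < m" for j using bes(2)[OF _ _ that] B_herm'[of vunit "u' j" r] by auto
   have rr: "B vunit (fscale (of_real (1 / N r)) r) (fscale (of_real (1 / N r)) r) = 1"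
    using rF nz N_sq[of r] by (simp only: frmI_scale_left frmI_scale_right FS_scale complex_cnj_complex_of_real)
     (simp add: power2_eq_square)
   have "orthonormal k (Suc m) h u''" unfolding orthonormal_def
   proof (intro conjI allI impI)
    show z: "u'' i l = 0" if "l >= k" for i l using u'0[OF that] r0[OF that] by (simp add: u''_def fscale_def)
    fix i j assume "i < Suc m" "j < Suc m"
    moreover have "frm k h vunit (u'' i) (u'' j) = B vunit (u'' i) (u'' j)" by (rule frm_B[OF h(2)]) (simp_all add: z)
    ultimately show "frm k h vunit (u'' i) (u'' j) = (if i = j then 1 else 0)" using rr ur rF u'F u'o
     by (auto simp: u''_def less_Suc_eq frmI_scale_left frmI_scale_right)
   qed
   then have "Q (Suc m)" unfolding Q_def using h(2) ww by blast
   then show False using m(2)[of "Suc m"] by simp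
  qed
  define c where "c = (SUM i<m. fscale (B vunit (u' i) ?A * of_real (1 / sqrt t)) (u i))"
  have c0: "c l = 0" if "l >= k" for l using u that by (simp add: c_def sum_fun_apply fscale_def orthonormal_def)
  have Vc: "V c = (SUM i<m. fscale (B vunit (u' i) ?A) (u' i))" unfolding c_def Vsum Vs u'_def fun_vs.scale_scale ..
  have N1: "N (?A - V c) = 0" using Nr by (simp add: r_def Vc)
  have "B (perp ?p) (V c) (V c) = B (perp ?p) ?A ?A"
   using B_cong_null[OF AF(1) VF AF(1) N1, of "perp ?p"] B_cong_null[OF AF(1) VF VF N1, of "perp ?p"] by simp
  also have "... = 0" using kill_props(2)[OF cone S_D(3)[OF hS] h(3,4) n] frm_B[OF h(2) box_supp[OF h(3)] box_supp[OF h(3)]] by simp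
  finally have s1: "frm k f (perp ?p) c c = 0" by (simp add: fV)
  have Ve': "V (evec n - c) = delta n - V c" by (simp add: Va Ve)
  have N2: "N ((delta n - V c) - ?B) = 0" using N1 by (simp add: delta_def algebra_simps)
  have DF: "delta n - V c \<in> FS" using AF VF by (simp add: delta_def)
  have "B ?p (delta n - V c) (delta n - V c) = B ?p ?B ?B" using B_cong_null[OF DF AF(2) AF(2) N2, of ?p] B_cong_null[OF DF AF(2) DF N2, of ?p] by simp
  also have "... = 0" using kill_props(3)[OF cone S_D(3)[OF hS] h(3,4) n] frm_B[OF h(2) box_supp[OF h(3)] box_supp[OF h(3)]] by simp
  finally have s2: "frm k f ?p (evec n - c) (evec n - c) = 0" by (simp add: fV Ve')
  show "EX u. (ALL i>=k. u i = 0) & frm k f (perp ?p) u u = 0 & frm k f ?p (evec n - u) (evec n - u) = 0" using c0 s1 s2 by blast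
 qed
 then show ?thesis using f(2) fS by blast
qed

end

text \<open>An element outside the cone has a compression to size k outside E^proj(k), on which some state of maximal rank is
negative.\<close>
theorem D_q_separation:
 fixes g :: "nat => ('i::finite, 'o::finite) lab"
 assumes g: "generator_enum g" and k: "k >= 1" and y: "vstar y = y" "y ~: D_q g k"
 shows "EX f:states k (Ek_proj g k). EX w. datum f & Re (frm k f y w w) < 0"
proof -
 interpret dilating_cone k "Ek_proj g k"
 proof
  show "kcone k (Ek_proj g k)" by (rule Ek_proj_cone)
  show "k >= 1" by (rule k)
  show "EX f:Dil k q (states k (Ek_proj g k)) (1 / real k). Re (ev k f X) < 0"
   if "X \<in> herm k" "X ~: Ek_proj g k" for X q by (rule dilated_separation[OF g k that])
 qed
 obtain alpha where a: "alpha \<in> carrier_mat 1 k" "compress alpha (mat1 y) ~: Ek_proj g k" using y by (auto simp: D_q_def)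
 have e: "compress alpha (mat1 y) = Matrix.mat k k (%(i, j). vscale (cnj (alpha $$ (0, i)) * alpha $$ (0, j)) y)"
  by (rule eq_matI) (use a(1) in "auto simp: compress_index[OF a(1)] mat1_def")
 have "mat1 y \<in> herm 1" by (rule hermI) (simp_all add: y mat1_def)
 from compress_herm[OF this a(1)] have "compress alpha (mat1 y) \<in> herm k" .
 from R_separates[OF this a(2)] obtain f where f: "f \<in> R" "Re (ev k f (compress alpha (mat1 y))) < 0" by blast
 have "herm_fam f" using f(1) R_S S_D(1) by blast
 then have "Re (frm k f y (%i. alpha $$ (0, i)) (%i. alpha $$ (0, i))) < 0" using f(2) unfolding e by (simp add: ev_rank_one)
 from splitting_state[OF f(1) this] show ?thesis .
qed

section \<open>Correlations of finite splitting kernels\<close>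

type_synonym ('i, 'o) cvec = "complex ^ (('i, 'o) lab)"

definition cvec :: "(('i::finite, 'o::finite) vns => complex) => ('i, 'o) cvec" where
 "cvec psi = (\<chi> q. psi (prj q))"

text \<open>Vector states of kernels with finite support in which all generators split, that is, of finite-dimensional models.\<close>
definition split_states :: "(('i::finite, 'o::finite) vns => complex) set" where
 "split_states = {psi. EX f k w. datum f & supp k f & (ALL i>=k. w i = 0) & frm k f vunit w w = 1 & psi = (%x. frm k f x w w)}"

lemma split_state_C_q:
 assumes "psi \<in> split_states" and inf: "infinite (UNIV :: 'u set)"
 shows "(%a b x y. psi (vP a b x y)) \<in> C_q TYPE('u)"
proof -
 obtain f k w where f: "datum f" "supp k f" "ALL i>=k. w i = 0" "frm k f vunit w w = 1" "psi = (%x. frm k f x w w)"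
  using assms(1) unfolding split_states_def by blast
 have w: "w \<in> FS" using f(3) by (auto intro: FSI)
 have e: "frm k f x w w = frmI f x w w" for x by (rule frmI_supp[OF f(2) w w, symmetric])
 show ?thesis unfolding f(5) e by (rule datum_in_C_q[OF f(1) inf w, of k]) (use f(2,4) in "simp_all add: e[symmetric] supp_def")
qed

lemma split_states_clin: "psi \<in> split_states ==> clin psi" "psi \<in> split_states ==> psi vunit = 1"
 and split_states_nonneg: "psi \<in> split_states ==> psi (prj q) \<in> Rnn"
proof -
 assume "psi \<in> split_states"
 then obtain f k w where f: "datum f" "supp k f" "ALL i>=k. w i = 0" "frm k f vunit w w = 1" "psi = (%x. frm k f x w w)"
  unfolding split_states_def by blast
 interpret psd_family f by unfold_locales (rule datum_psd_fam[OF f(1)])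
 have w: "w \<in> FS" using f(3) by (auto intro: FSI)
 show "clin psi" "psi vunit = 1" using clin_frm[OF herm] f(4,5) by simp_all
 have "psi (prj q) = B (prj q) w w" unfolding f(5) by (rule frmI_supp[OF f(2) w w, symmetric])
 then show "psi (prj q) \<in> Rnn" using okv_gen[of q] okv_real[OF okv_gen[of q], of w] by (simp add: okv_def complex_nonneg_Reals_iff)
qed

definition direct_sum :: "('i::finite, 'o::finite) fam => ('i, 'o) fam =>
  ('i, 'o) fam" where
 "direct_sum f h i j x = (if even i & even j then f (i div 2) (j div 2) x else if odd i & odd j then h (i div 2) (j div 2) x else 0)"

lemma frm_direct_sum: "frm (2 * K) (direct_sum f h) x c d =
  frm K f x (%i. c (2 * i)) (%i. d (2 * i)) + frm K h x (%i. c (2 * i + 1)) (%i. d (2 * i + 1))"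
 unfolding frm_def sum_lessThan_double by (simp add: direct_sum_def sum.distrib)

lemma datum_direct_sum:
 assumes f: "datum f" "supp k f" and h: "datum h" "supp l h" and K: "K = max k l"
 shows "datum (direct_sum f h)" "supp (2 * K) (direct_sum f h)"
proof -
 have s: "supp K f" "supp K h" using f(2) h(2) by (auto simp: supp_def K)
 show sF: "supp (2 * K) (direct_sum f h)" using s unfolding supp_def direct_sum_def by auto
 have pf: "psd_fam f" "psd_fam h" using f h by (simp_all add: datum_psd_fam)
 have hm: "herm_fam (direct_sum f h)" unfolding herm_fam_def
 proof (intro conjI allI)
  have "direct_sum f h i j = (if even i & even j then f (i div 2) (j div 2) else if odd i & odd j then h (i div 2) (j div 2) else (%_. 0))" for i j
   by (auto simp: direct_sum_def fun_eq_iff)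
  then show "clin (direct_sum f h i j)" for i j using pf by (simp add: psd_fam_def herm_famD)
  show "direct_sum f h j i (vstar x) = cnj (direct_sum f h i j x)" for i j x using pf by (auto simp: psd_fam_def direct_sum_def herm_famD(2))
 qed
 have e: "frm n (direct_sum f h) x c c = frm (2 * n) (direct_sum f h) x (%i. if i < n then c i else 0) (%i. if i < n then c i else 0)" for n x c
 proof -
  have "frm n (direct_sum f h) x c c = frm n (direct_sum f h) x (%i. if i < n then c i else 0) (%i. if i < n then c i else 0)" by (rule frm_cong) auto
  also have "... = frm (2 * n) (direct_sum f h) x (%i. if i < n then c i else 0) (%i. if i < n then c i else 0)" by (rule frm_cong_dim[symmetric]) auto
  finally show ?thesis .
 qed
 have nf: "0 <= Re (frm n f (prj q) c c)" "0 <= Re (frm n f (perp (prj q)) c c)"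
  "0 <= Re (frm n h (prj q) c c)" "0 <= Re (frm n h (perp (prj q)) c c)" for n q c using pf unfolding psd_fam_def by blast+
 have p: "psd_fam (direct_sum f h)" unfolding psd_fam_def
  by (intro conjI allI hm; subst e; unfold frm_direct_sum plus_complex.sel; intro add_nonneg_nonneg nf)
 show "datum (direct_sum f h)"
 proof (rule datum_supp_I[OF p sF])
  fix q m assume m: "m < 2 * K"
  interpret f: split_family f "id :: nat => nat" by (rule datum_split_family[OF f(1)]) simp
  interpret h: split_family h "id :: nat => nat" by (rule datum_split_family[OF h(1)]) simp
  let ?n = "m div 2"
  let ?u = "%i. if i < 2 * K & i mod 2 = m mod 2 then (if even m then f.uvec q ?n else h.uvec q ?n) (i div 2) else 0"
  have fu: "frm K f x (%i. if i < K then f.uvec q ?n i else 0) (%i. if i < K then f.uvec q ?n i else 0) = f.B x (f.uvec q ?n) (f.uvec q ?n)"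
   "frm K f x (%i. evec ?n i - (if i < K then f.uvec q ?n i else 0)) (%i. evec ?n i - (if i < K then f.uvec q ?n i else 0)) = f.B x (evec ?n - f.uvec q ?n) (evec ?n - f.uvec q ?n)" for x
   using frmI_supp[OF s(1), of _ _ x] f.uvec(1)[of q ?n] by (auto intro!: frm_cong)
  have hu: "frm K h x (%i. if i < K then h.uvec q ?n i else 0) (%i. if i < K then h.uvec q ?n i else 0) = h.B x (h.uvec q ?n) (h.uvec q ?n)"
   "frm K h x (%i. evec ?n i - (if i < K then h.uvec q ?n i else 0)) (%i. evec ?n i - (if i < K then h.uvec q ?n i else 0)) = h.B x (evec ?n - h.uvec q ?n) (evec ?n - h.uvec q ?n)" for x
   using frmI_supp[OF s(2), of _ _ x] h.uvec(1)[of q ?n] by (auto intro!: frm_cong)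
  show "EX u. (ALL i>=2 * K. u i = 0) & frm (2 * K) (direct_sum f h) (perp (prj q)) u u = 0 &
    frm (2 * K) (direct_sum f h) (prj q) (evec m - u) (evec m - u) = 0"
  proof (intro exI[of _ ?u] conjI allI impI)
   show "?u i = 0" if "2 * K <= i" for i using that by simp
   show "frm (2 * K) (direct_sum f h) (perp (prj q)) ?u ?u = 0"
   proof (cases "even m")
    case True
    have "frm (2 * K) (direct_sum f h) (perp (prj q)) ?u ?u =
     frm K f (perp (prj q)) (%i. if i < K then f.uvec q ?n i else 0) (%i. if i < K then f.uvec q ?n i else 0) + frm K h (perp (prj q)) 0 0"
     unfolding frm_direct_sum by (intro arg_cong2[where f = "(+)"] frm_cong) (use True in "simp_all add: even_iff_mod_2_eq_zero")
    then show ?thesis using fu(1) f.uvec(2) by (simp add: frm_zero)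
   next
    case False
    then have m1: "m mod 2 = 1" by presburger
    have "frm (2 * K) (direct_sum f h) (perp (prj q)) ?u ?u =
     frm K f (perp (prj q)) 0 0 + frm K h (perp (prj q)) (%i. if i < K then h.uvec q ?n i else 0) (%i. if i < K then h.uvec q ?n i else 0)"
     unfolding frm_direct_sum by (intro arg_cong2[where f = "(+)"] frm_cong) (use False m1 in simp_all)
    then show ?thesis using hu(1) h.uvec(2) by (simp add: frm_zero)
   qed
   show "frm (2 * K) (direct_sum f h) (prj q) (evec m - ?u) (evec m - ?u) = 0"
   proof (cases "even m")
    case True
    then have m2: "m = 2 * ?n" by simp
    have "frm (2 * K) (direct_sum f h) (prj q) (evec m - ?u) (evec m - ?u) =
     frm K f (prj q) (%i. evec ?n i - (if i < K then f.uvec q ?n i else 0)) (%i. evec ?n i - (if i < K then f.uvec q ?n i else 0)) + frm K h (prj q) 0 0"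
     unfolding frm_direct_sum by (intro arg_cong2[where f = "(+)"] frm_cong) (use True m2 in "auto simp: even_iff_mod_2_eq_zero evec_def")
    then show ?thesis using fu(2) f.uvec(3) by (simp add: frm_zero)
   next
    case False
    then have m2: "m = 2 * ?n + 1" and m1: "m mod 2 = 1" by presburger+
    have "frm (2 * K) (direct_sum f h) (prj q) (evec m - ?u) (evec m - ?u) =
     frm K f (prj q) 0 0 + frm K h (prj q) (%i. evec ?n i - (if i < K then h.uvec q ?n i else 0)) (%i. evec ?n i - (if i < K then h.uvec q ?n i else 0))"
     unfolding frm_direct_sum by (intro arg_cong2[where f = "(+)"] frm_cong) (use False m1 m2 in "auto simp: evec_def")
    then show ?thesis using hu(2) h.uvec(3) by (simp add: frm_zero)
   qed
  qed
 qed
qed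

text \<open>A convex combination is the vector state of the direct sum of the two kernels at a suitably weighted vector.\<close>
lemma split_states_convex:
 assumes f: "psi \<in> split_states" and h: "psi' \<in> split_states" and st: "0 <= s" "0 <= t" "s + t = 1"
 shows "(%x. cof s * psi x + cof t * psi' x) \<in> split_states"
proof -
 obtain f k w where f: "datum f" "supp k f" "ALL i>=k. w i = 0" "frm k f vunit w w = 1" "psi = (%x. frm k f x w w)"
  using assms(1) unfolding split_states_def by blast
 obtain h l v where h: "datum h" "supp l h" "ALL i>=l. v i = 0" "frm l h vunit v v = 1" "psi' = (%x. frm l h x v v)"
  using assms(2) unfolding split_states_def by blast
 let ?K = "max k l"
 let ?w = "%i. if even i then of_real (sqrt s) * w (i div 2) else of_real (sqrt t) * v (i div 2)"
 have sq: "cof (sqrt a) * cof (sqrt a) = of_real a" if "0 <= a" for a using that by (simp add: of_real_mult[symmetric] del: of_real_mult)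
 have "frm (2 * ?K) (direct_sum f h) x ?w ?w = frm ?K f x (fscale (of_real (sqrt s)) w) (fscale (of_real (sqrt s)) w)
   + frm ?K h x (fscale (of_real (sqrt t)) v) (fscale (of_real (sqrt t)) v)" for x
  unfolding frm_direct_sum by (intro arg_cong2[where f = "(+)"] frm_cong) (simp_all add: fscale_def)
 moreover have fs: "frm ?K f x c d = frm k f x c d" "frm ?K h x c d = frm l h x c d" for x c d
  by (rule frm_supp[OF f(2)], simp, rule frm_supp[OF h(2)], simp)
 moreover have "frm ?K f x (fscale (of_real (sqrt s)) w) (fscale (of_real (sqrt s)) w) = of_real s * frm k f x w w" for x
  unfolding frm_plus complex_cnj_complex_of_real mult.assoc[symmetric] sq[OF st(1)] fs(1) ..
 moreover have "frm ?K h x (fscale (of_real (sqrt t)) v) (fscale (of_real (sqrt t)) v) = of_real t * frm l h x v v" for x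
  unfolding frm_plus complex_cnj_complex_of_real mult.assoc[symmetric] sq[OF st(2)] fs(2) ..
 ultimately have e: "frm (2 * ?K) (direct_sum f h) x ?w ?w = of_real s * frm k f x w w + of_real t * frm l h x v v" for x by (simp only:)
 have "cof s + cof t = 1" using st(3) by (metis of_real_1 of_real_add)
 then have e1: "frm (2 * ?K) (direct_sum f h) vunit ?w ?w = 1" unfolding e f(4) h(4) by simp
 have e2: "(%x. cof s * psi x + cof t * psi' x) = (%x. frm (2 * ?K) (direct_sum f h) x ?w ?w)" unfolding e f(5) h(5) ..
 have "ALL i>=2 * ?K. ?w i = 0" using f(3) h(3) by auto
 then show ?thesis unfolding split_states_def using e1 e2 datum_direct_sum[OF f(1,2) h(1,2) refl]
  by (intro CollectI exI[of _ "direct_sum f h"] exI[of _ "2 * ?K"] exI[of _ ?w] conjI)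
qed

lemma cvec_convex: "convex (cvec ` split_states :: ('i::finite, 'o::finite) cvec set)" unfolding convex_def
proof (intro ballI allI impI)
 fix v v' :: "('i, 'o) cvec" and s t :: real
 assume "v \<in> cvec ` split_states" "v' \<in> cvec ` split_states" and st: "0 <= s" "0 <= t" "s + t = 1"
 then obtain psi psi' where p: "psi \<in> split_states" "psi' \<in> split_states" "v = cvec psi" "v' = cvec psi'" by blast
 have "s *\<^sub>R v + t *\<^sub>R v' = cvec (%x. cof s * psi x + cof t * psi' x)"

  unfolding p(3,4) cvec_def Finite_Cartesian_Product.vec_eq_iff vector_add_component vector_scaleR_component vec_lambda_beta by (simp add: scaleR_conv_of_real)
 then show "s *\<^sub>R v + t *\<^sub>R v' \<in> cvec ` split_states" using split_states_convex[OF p(1,2) st] by blast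
qed

text \<open>A functional is determined by its values on finitely many generators, so separating hyperplanes in a
finite-dimensional space apply.\<close>
lemma functional_in_closed_convex:
 fixes phi :: "('i::finite, 'o::finite) vns => complex"
 assumes S: "closed S" "convex S" and real: "!!v q. v \<in> S ==> vec_nth v q \<in> Rnn"
  and phi: "clin phi" "phi vunit = 1" "nonneg_on phi D"
  and D: "!!y. vstar y = y ==> y ~: D ==> EX psi. clin psi & psi vunit = 1 & cvec psi \<in> S & Re (psi y) < 0"
 shows "cvec phi \<in> S"
proof (rule ccontr)
 assume "cvec phi ~: S"
 then obtain a b where ab: "inner a (cvec phi) < b" "!!v. v \<in> S ==> b < inner a v" using separating_hyperplane_closed_point[OF S(2,1)] by blast
 have in_D: "y \<in> D" if "vstar y = y" "!!psi. clin psi ==> psi vunit = 1 ==> cvec psi \<in> S ==> 0 <= Re (psi y)" for y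
  using D[OF that(1)] that(2) by force
 have g: "phi (prj q) \<in> Rnn" for q
 proof -
  have "prj q \<in> D"
  proof (rule in_D)
   fix psi :: "('i, 'o) vns => complex" assume "cvec psi \<in> S"
   from real[OF this, of q] show "0 <= Re (psi (prj q))" by (simp add: cvec_def complex_nonneg_Reals_iff)
  qed (rule vstar_gen)
  then show ?thesis using phi(3) by (simp add: nonneg_on_def)
 qed
 define y where "y = (SUM q:UNIV. Re (vec_nth a q) *\<^sub>R prj q) - b *\<^sub>R (vunit :: ('i, 'o) vns)"
 have ev: "Re (psi y) = inner a (cvec psi) - b" if "clin psi" "psi vunit = 1" "!!q. psi (prj q) \<in> Rnn" for psi
 proof -
  have "Im (psi (prj q)) = 0" for q using that(3)[of q] by (simp add: complex_nonneg_Reals_iff)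
  then show ?thesis unfolding y_def inner_vec_def using that(1,2) by (simp add: clinD cvec_def inner_complex_def)
 qed
 have s: "vstar (SUM q:I. h q) = (SUM q:I. vstar (h q))" for I and h :: "_ => ('i, 'o) vns"
  by (induction I rule: infinite_finite_induct) (simp_all add: vstar_add)
 have "y \<in> D"
 proof (rule in_D)
  show "vstar y = y" unfolding y_def using vstar_gen[of None] by (simp add: vstar_diff s vstar_scaleR del: split_paired_All)
  fix psi :: "('i, 'o) vns => complex" assume p: "clin psi" "psi vunit = 1" "cvec psi \<in> S"
  have "psi (prj q) \<in> Rnn" for q using real[OF p(3), of q] by (simp add: cvec_def)
  from ev[OF p(1,2) this] ab(2)[OF p(3)] show "0 <= Re (psi y)" by simp
 qed
 then have "phi y \<in> Rnn" using phi(3) by (simp add: nonneg_on_def)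
 then show False using ev[OF phi(1,2) g] ab(1) by (simp add: complex_nonneg_Reals_iff)
qed

section \<open>Compactness for a fixed size\<close>

definition vbox :: "nat => (nat => complex) set" where
 "vbox k = {c. ALL l. c l \<in> (if l < k then cball 0 1 else {0})}"

text \<open>Models of size k with all their data: a state of size k, the vectors splitting the basis vectors along each generator,
and the vector whose state is taken, all in compact ranges.\<close>
definition size_set :: "nat => ('i::finite, 'o::finite) vns mat set =>
  (('i, 'o) fam \<times> (('i, 'o) lab => nat => nat => complex) \<times> (nat => complex)) set" where
 "size_set k C = (states k C \<times> {A. ALL q. A q \<in> {A. ALL m. A m \<in> vbox k}} \<times> vbox k) \<inter>
   {z. 1 / real k <= Re (frm k (fst z) vunit (snd (snd z)) (snd (snd z))) &
    (ALL q m. m < k --> frm k (fst z) (perp (prj q)) (fst (snd z) q m) (fst (snd z) q m) = 0 &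
     frm k (fst z) (prj q) (%i. evec m i - fst (snd z) q m i) (%i. evec m i - fst (snd z) q m i) = 0)}"

definition size_val :: "nat => ('i::finite, 'o::finite) fam \<times> 'a \<times> (nat => complex) => ('i, 'o) vns => complex" where
 "size_val k z x = frm k (fst z) x (snd (snd z)) (snd (snd z)) / of_real (Re (frm k (fst z) vunit (snd (snd z)) (snd (snd z))))"

lemma compact_size_set:
 fixes C :: "('i::finite, 'o::finite) vns mat set"
 assumes C: "kcone k C" shows "compact (size_set k C)"
proof -
 have vb: "compact (vbox k)" unfolding vbox_def by (intro compact_box) auto
 have c1: "continuous_on UNIV (%z :: _ \<times> (('i, 'o) lab => nat => nat => complex) \<times> (nat => complex). fst (snd z) q m i)" for q m i
  by (rule continuous_on_compose2[OF cont_coord[of UNIV q m i], of UNIV "%z. fst (snd z)"])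
   (intro continuous_on_fst continuous_on_snd continuous_on_id, rule subset_UNIV)
 have c2: "continuous_on UNIV (%z :: _ \<times> (('i, 'o) lab => nat => nat => complex) \<times> (nat => complex). snd (snd z) i)" for i
  by (rule continuous_on_compose2[OF continuous_on_product_coordinates[of i], of UNIV "%z. snd (snd z)"])
   (intro continuous_on_snd continuous_on_id, rule subset_UNIV)
 show ?thesis unfolding size_set_def frm_def
  by (intro compact_Int_closed compact_Times compact_states C vb compact_box closed_Collect_conj closed_Collect_all closed_Collect_imp open_Collect_const
    closed_Collect_le closed_Collect_eq continuous_intros cont_fst c1 c2)
qed

lemma size_val_cont:
 fixes C :: "('i::finite, 'o::finite) vns mat set"
 assumes k: "k >= 1" shows "continuous_on (size_set k C) (%z. cvec (size_val k z))"
proof -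
 have c2: "continuous_on S (%z :: _ \<times> (('i, 'o) lab => nat => nat => complex) \<times> (nat => complex). snd (snd z) i)" for i S
  by (rule continuous_on_compose2[OF continuous_on_product_coordinates[of i], of S "%z. snd (snd z)"])
   (intro continuous_on_snd continuous_on_id, rule subset_UNIV)
 have nz: "cof (Re (frm k (fst z) vunit (snd (snd z)) (snd (snd z)))) ~= 0" if "z \<in> size_set k C" for z
 proof -
  have "0 < 1 / real k" using k by simp
  also have "... <= Re (frm k (fst z) vunit (snd (snd z)) (snd (snd z)))" using that by (simp add: size_set_def)
  finally show ?thesis by simp
 qed
 have "continuous_on (size_set k C) (%z. size_val k z x)" for x unfolding size_val_def
 proof (rule continuous_on_divide)
  show "continuous_on (size_set k C) (%z. frm k (fst z) x (snd (snd z)) (snd (snd z)))"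
   "continuous_on (size_set k C) (%z. cof (Re (frm k (fst z) vunit (snd (snd z)) (snd (snd z)))))"
   unfolding frm_def by (intro continuous_intros cont_fst c2)+
 qed (use nz in blast)
 then show ?thesis unfolding cvec_def by (intro continuous_on_vec_lambda)
qed

lemma vbox_supp: "c \<in> vbox k ==> l >= k ==> c l = 0" unfolding vbox_def by (auto dest!: spec[of _ l])

lemma size_val_split:
 fixes C :: "('i::finite, 'o::finite) vns mat set"
 assumes C: "kcone k C" and k: "k >= 1" and z: "z \<in> size_set k C"
 shows "size_val k z \<in> split_states"
proof -
 obtain h A w where hz: "z = (h, A, w)" by (cases z)
 have h: "h \<in> states k C" "!!q m. A q m \<in> vbox k" "w \<in> vbox k" "1 / real k <= Re (frm k h vunit w w)"
  "!!q m. m < k ==> frm k h (perp (prj q)) (A q m) (A q m) = 0"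
  "!!q m. m < k ==> frm k h (prj q) (%i. evec m i - A q m i) (%i. evec m i - A q m i) = 0" using z unfolding hz size_set_def by auto
 have hp: "h \<in> pos_fun k C" using h(1) by (simp add: states_def)
 have sh: "supp k h" using hp by (simp add: pos_fun_def)
 have pf: "psd_fam h" by (rule pos_fun_psd[OF C hp])
 interpret psd_family h by unfold_locales (rule pf)
 have d: "datum h"
 proof (rule datum_supp_I[OF pf sh])
  fix q m assume m: "m < k"
  show "EX u. (ALL i>=k. u i = 0) & frm k h (perp (prj q)) u u = 0 & frm k h (prj q) (evec m - u) (evec m - u) = 0"
   using h(5,6)[OF m, of q] vbox_supp[OF h(2)[of q m]] by (intro exI[of _ "A q m"]) (simp add: fun_diff_def)
 qed
 define s where "s = Re (frm k h vunit w w)"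
 have "0 < 1 / real k" using k by simp
 then have s: "s > 0" using h(4) unfolding s_def by (rule less_le_trans)
 have wF: "w \<in> FS" by (rule FSI[of k]) (rule vbox_supp[OF h(3)])
 have se: "frm k h vunit w w = of_real s" using okv_of_real[OF okv_unit, of w] unfolding s_def frmI_supp[OF sh wF wF] .
 define v where "v = fscale (of_real (1 / sqrt s)) w"
 have st: "cof (1 / sqrt s) * cof (1 / sqrt s) = of_real (1 / s)" using s by (simp add: of_real_mult[symmetric] del: of_real_mult of_real_divide)
 have e: "frm k h x v v = frm k h x w w / of_real s" for x unfolding v_def frm_plus complex_cnj_complex_of_real mult.assoc[symmetric] st by simp
 have "size_val k z = (%x. frm k h x v v)" unfolding e by (rule HOL.ext) (simp add: size_val_def hz s_def)
 moreover have "frm k h vunit v v = 1" using s by (simp add: e se)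
 moreover have "ALL i>=k. v i = 0" using vbox_supp[OF h(3)] by (simp add: v_def fscale_def)
 ultimately show ?thesis unfolding split_states_def using d sh by blast
qed

text \<open>Rewriting the splitting data in Gram-Schmidt coordinates brings them into the compact ranges; dividing by the rank d,
at most k, explains the lower bound 1 / k.\<close>
lemma size_set_negative:
 fixes C :: "('i::finite, 'o::finite) vns mat set"
 assumes C: "kcone k C" and k: "k >= 1" and f: "f \<in> states k C" "datum f" and neg: "Re (frm k f y w0 w0) < 0"
 shows "EX z:size_set k C. Re (size_val k z y) < 0"
proof -
 interpret split_family f "id :: nat => nat" by (rule datum_split_family[OF f(2)]) simp
 have fp: "f \<in> pos_fun k C" using f(1) by (simp add: states_def)
 have sf: "supp k f" using fp by (simp add: pos_fun_def)
 define w1 where "w1 i = (if i < k then w0 i else 0)" for i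
 have w1F: "w1 \<in> FS" by (rule FSI[of k]) (simp add: w1_def)
 have "frm k f y w0 w0 = frm k f y w1 w1" by (rule frm_cong) (simp_all add: w1_def)
 then have neg1: "Re (B y w1 w1) < 0" using neg by (simp add: frmI_supp[OF sf w1F w1F])
 have n1: "N w1 > 0"
 proof (rule ccontr)
  assume "\<not> N w1 > 0"
  then have "N w1 = 0" using N_ge0[of w1] by linarith
  then show False using B_null_all(1)[OF w1F w1F, of y] neg1 by simp
 qed
 define w where "w = fscale (of_real (1 / N w1)) w1"
 have wF: "w \<in> FS" using w1F by (simp add: w_def)
 have cc: "B x w w = of_real ((1 / N w1)\<^sup>2) * B x w1 w1" for x
  unfolding w_def using w1F by (simp only: frmI_scale_left frmI_scale_right FS_scale complex_cnj_complex_of_real power2_eq_square of_real_mult mult.assoc)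
 have Nw: "B vunit w w = 1" using n1 unfolding cc N_sq of_real_mult[symmetric] by (simp add: power_divide)
 have negw: "Re (B y w w) < 0"
 proof -
  have "Re (B y w w) = (1 / N w1)\<^sup>2 * Re (B y w1 w1)" unfolding cc by (simp del: of_real_power of_real_divide)
  then show ?thesis using neg1 n1 by (simp add: mult_less_0_iff)
 qed
 have gs1: "N (gs l) <= 1" for l by (simp add: N_def gs_norm)
 have "N w ~= 0" by (simp add: N_def Nw)
 from normalised_kernel[OF C fp wF this] obtain h d where hS: "h \<in> states k C" and d0: "d > 0" and dk: "d <= real k"
  and hG: "!!x c c'. frm k h x c c' = of_real (1 / d) * B x (syn k c) (syn k c')" by blast
 note GF = syn_FS and Gh = syn_coords[OF sf] and hatB = syn_coords_form[OF sf]
 have coords_box: "coords k v \<in> vbox k" if "v \<in> FS" "N v <= 1" for v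
  using order_trans[OF coords_le[OF that(1)] that(2)] by (auto simp: vbox_def) (simp add: coords_def)
 define A where "A q m = coords k (pv q (gs m))" for q m
 have Ab: "A q m \<in> vbox k" for q m unfolding A_def by (rule coords_box[OF pv_FS]) (rule order_trans[OF pv_contr[OF gs_FS] gs1])
 have A1: "frm k h (perp (prj q)) (A q m) (A q m) = 0" for q m
 proof -
  have "B (perp (prj q)) (pv q (gs m)) (pv q (gs m)) = 0" unfolding B_perp pv_B(1)[OF gs_FS pv_FS] pv_B(2)[OF gs_FS pv_FS] by simp
  then show ?thesis unfolding hG A_def hatB[OF pv_FS pv_FS] by simp
 qed
 have A2: "frm k h (prj q) (%i. evec m i - A q m i) (%i. evec m i - A q m i) = 0" if m: "m < k" for q m
 proof -
  have "syn k (%i. evec m i - A q m i) = (SUM l<k. if l = m then gs m else 0) - syn k (A q m)"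
   unfolding syn_def sum_subtractf[symmetric] by (intro sum.cong refl) (auto simp: fun_eq_iff fscale_def evec_def algebra_simps)
  then have e: "syn k (%i. evec m i - A q m i) = gs m - syn k (A q m)" using m by simp
  let ?a = "gs m - syn k (A q m)" and ?b = "gs m - pv q (gs m)"
  have "N (?b - ?a) = 0"
  proof -
   have "?b - ?a = fscale (-1) (pv q (gs m) - syn k (A q m))" by (simp add: fun_eq_iff fscale_def)
   moreover have "N (fscale (-1) (pv q (gs m) - syn k (A q m))) = 0" unfolding A_def by (rule N_scale_null) (simp_all add: GF Gh)
   ultimately show ?thesis by simp
  qed
  note N = this
  have F: "?a \<in> FS" "?b \<in> FS" by (simp_all add: GF)
  have "B (prj q) ?a ?a = B (prj q) ?b ?b" using B_cong_null[OF F(2,1,1) N, of "prj q"] B_cong_null[OF F(2,1,2) N, of "prj q"] by simp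
  also have "... = 0" unfolding frmI_diff_right[OF gs_FS pv_FS F(2)] pv_B(2)[OF gs_FS F(2)] by simp
  finally show ?thesis unfolding hG e by simp
 qed
 have wb: "coords k w \<in> vbox k" by (rule coords_box[OF wF]) (simp add: N_def Nw)
 have w1: "frm k h vunit (coords k w) (coords k w) = of_real (1 / d)" unfolding hG hatB[OF wF wF] by (simp add: Nw)
 have zs: "(h, A, coords k w) \<in> size_set k C" unfolding size_set_def using hS Ab wb A1 A2 w1 d0 dk by (auto simp: frac_le)
 have "size_val k (h, A, coords k w) y = of_real (1 / d) * B y w w / of_real (1 / d)"
  unfolding size_val_def fst_conv snd_conv w1 unfolding hG hatB[OF wF wF] by simp
 also have "... = B y w w" using d0 by simp
 finally show ?thesis using zs negw by (intro bexI[of _ "(h, A, coords k w)"]) simp_all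
qed

text \<open>The values of models of size k form a compact set, whose convex hull is closed. A functional outside it would be
separated by an element y on which all models of size k are nonnegative; this y lies in the cone for k.\<close>
theorem D_q_nonneg_split:
 fixes g :: "nat => ('i::finite, 'o::finite) lab"
 assumes g: "generator_enum g" and k: "k >= 1" and phi: "clin phi" "phi vunit = 1" "nonneg_on phi (D_q g k)"
 shows "cvec phi \<in> cvec ` split_states"
proof -
 let ?Z = "(%z. cvec (size_val k z)) ` size_set k (Ek_proj g k)"
 have sub: "?Z <= cvec ` split_states" using size_val_split[OF Ek_proj_cone k] by blast
 have "compact ?Z" by (rule compact_continuous_image[OF size_val_cont[OF k] compact_size_set[OF Ek_proj_cone]])
 then have cl: "closed (convex hull ?Z)" by (intro compact_imp_closed compact_convex_hull)
 have hs: "convex hull ?Z <= cvec ` split_states" by (intro hull_minimal sub cvec_convex)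
 have "cvec phi \<in> convex hull ?Z"
 proof (rule functional_in_closed_convex[OF cl convex_convex_hull _ phi])
  show "vec_nth v q \<in> Rnn" if v: "v \<in> convex hull ?Z" for v q
  proof -
   obtain psi where "psi \<in> split_states" "v = cvec psi" using hs v by blast
   then show ?thesis by (simp only: cvec_def vec_lambda_beta split_states_nonneg)
  qed
  fix y assume "vstar y = y" "y ~: D_q g k"
  from D_q_separation[OF g k this] obtain f w where "f \<in> states k (Ek_proj g k)" "datum f" "Re (frm k f y w w) < 0" by blast
  from size_set_negative[OF Ek_proj_cone k this] obtain z where z: "z \<in> size_set k (Ek_proj g k)" "Re (size_val k z y) < 0" by blast
  have "cvec (size_val k z) \<in> convex hull ?Z" using z(1) by (intro hull_inc) blast
  then show "EX psi. clin psi & psi vunit = 1 & cvec psi \<in> convex hull ?Z & Re (psi y) < 0"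
   using z size_val_split[OF Ek_proj_cone k z(1)] split_states_clin by blast
 qed
 then show ?thesis using hs by blast
qed

text \<open>An element on which all finite-dimensional models are nonnegative lies in every cone D_q(k), so a functional
nonnegative on their intersection is a limit of finite-dimensional models.\<close>
theorem D_qa_nonneg_split:
 fixes g :: "nat => ('i::finite, 'o::finite) lab"
 assumes g: "generator_enum g" and phi: "clin phi" "phi vunit = 1" "nonneg_on phi (D_qa g)"
 shows "cvec phi \<in> closure (cvec ` split_states)"
proof (rule functional_in_closed_convex[OF closed_closure convex_closure[OF cvec_convex] _ phi])
 have "closed {v :: ('i, 'o) cvec. ALL q. vec_nth v q \<in> Rnn}" unfolding complex_nonneg_Reals_iff
  by (intro closed_Collect_all closed_Collect_conj closed_Collect_le closed_Collect_eq continuous_intros)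
 then have "closure (cvec ` split_states) <= {v :: ('i, 'o) cvec. ALL q. vec_nth v q \<in> Rnn}"
  by (intro closure_minimal subsetI CollectI allI) (elim imageE, simp_all only: cvec_def vec_lambda_beta split_states_nonneg)
 then show "vec_nth v q \<in> Rnn" if "v \<in> closure (cvec ` split_states)" for v :: "('i, 'o) cvec" and q using that by blast
 fix y assume y: "vstar y = y" "y ~: D_qa g"
 then obtain k where k: "k >= 1" "y ~: D_q g k" by (auto simp: D_qa_def)
 from D_q_separation[OF g k(1) y(1) k(2)] obtain f w where "f \<in> states k (Ek_proj g k)" "datum f" "Re (frm k f y w w) < 0" by blast
 from size_set_negative[OF Ek_proj_cone k(1) this] obtain z where z: "z \<in> size_set k (Ek_proj g k)" "Re (size_val k z y) < 0" by blast
 have s: "size_val k z \<in> split_states" by (rule size_val_split[OF Ek_proj_cone k(1) z(1)])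
 then have "cvec (size_val k z) \<in> closure (cvec ` split_states)" by (intro subsetD[OF closure_subset] imageI)
 then show "EX psi. clin psi & psi vunit = 1 & cvec psi \<in> closure (cvec ` split_states) & Re (psi y) < 0"
  using z(2) split_states_clin[OF s] by blast
qed

section \<open>Kernels of commuting models\<close>

context hilbert_space
begin

lemma BO_in [simp]: "T \<in> BO ==> T v \<in> H" using BO_D(1)[of T v] BO_D(2)[of T v] by (cases "v \<in> H") simp_all

lemma adjoint_unique:
 assumes "S \<in> BO" "S' \<in> BO" "is_adjoint H ip S T" "is_adjoint H ip S' T"
 shows "S = S'"
proof (rule BO_eqI[OF assms(1,2)])
 fix v assume v: "v \<in> H"
 have "S v - S' v = 0"
 proof (rule ip_eq0)
  fix u assume u: "u \<in> H"
  show "ip u (S v - S' v) = 0" using adj_D[OF assms(3) u v] adj_D[OF assms(4) u v] u assms(1,2) by (simp add: ip_diff_right)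
 qed (use assms(1,2) in simp)
 then show "S v = S' v" by simp
qed

lemma comp_op_add: "S \<in> BO ==> T \<in> BO ==> U \<in> BO ==> S o (T + U) = (S o T) + (S o U)"
 by (rule HOL.ext) (simp add: BO_D(3), simp add: plus_fun_def)

lemma op_add_comp: "(T + U) o S = (T o S) + (U o S)" by (rule HOL.ext) simp

lemma comp_op_scale: "S \<in> BO ==> T \<in> BO ==> S o op_scale c T = op_scale c (S o T)" by (rule HOL.ext) (simp add: BO_D(4) op_scale_def)

lemma op_scale_add: "op_scale c (S + T) = op_scale c S + op_scale c T" by (simp add: op_scale_def fun_eq_iff fscale_def algebra_simps)

lemma op_scale_comp: "op_scale c T o S = op_scale c (T o S)" by (rule HOL.ext) (simp add: op_scale_def)

lemma comp_zero: "S \<in> BO ==> S o 0 = 0" "0 o S = 0" by (auto simp: fun_eq_iff BO_D(5)[unfolded fun_eq_iff])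

lemma comp_id: "S \<in> BO ==> op_id H o S = S" "S \<in> BO ==> S o op_id H = S"
 by (auto simp: fun_eq_iff op_id_def BO_D(5)[unfolded fun_eq_iff] BO_D(2)[unfolded fun_eq_iff])

end

text \<open>The data of a commuting model that matter for positivity: an algebra of adjointable operators, a state on it, and the
projections P q representing the generators.\<close>
locale operator_state = hilbert_space H ip
 for H :: "('u => complex) set" and ip +
 fixes A0 :: "'u op set" and phi :: "'u op => complex" and P :: "('i::finite, 'o::finite) lab => 'u op"
 assumes A0_BO: "T \<in> A0 ==> T \<in> bounded_ops H ip" and A0_zero: "0 \<in> A0" and A0_id: "op_id H \<in> A0"
  and A0_add: "S \<in> A0 ==> T \<in> A0 ==> S + T \<in> A0" and A0_comp: "S \<in> A0 ==> T \<in> A0 ==> S o T \<in> A0"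
  and A0_scale: "T \<in> A0 ==> op_scale c T \<in> A0"
  and A0_adj: "T \<in> A0 ==> EX S:A0. is_adjoint H ip S T"
  and phi_add: "S \<in> A0 ==> T \<in> A0 ==> phi (S + T) = phi S + phi T"
  and phi_scale: "T \<in> A0 ==> phi (op_scale c T) = c * phi T"
  and phi_pos: "S \<in> A0 ==> T \<in> A0 ==> is_adjoint H ip S T ==> phi (S o T) \<in> Rnn"
  and phi_id: "phi (op_id H) = 1"
  and P: "P q \<in> A0" "P q o P q = P q" "is_adjoint H ip (P q) (P q)"
  and P1: "(SUM a:UNIV. SUM b:UNIV. P (a, b, x, y)) = op_id H"
  and P2: "(SUM b:UNIV. P (a, b, x, y)) = (SUM b:UNIV. P (a, b, x, z))"
  and P3: "(SUM b:UNIV. P (b, a, y, x)) = (SUM b:UNIV. P (b, a, z, x))"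
begin

definition star :: "'u op => 'u op" where
 "star T = (SOME S. S \<in> A0 & is_adjoint H ip S T)"

lemma star: "T \<in> A0 ==> star T \<in> A0" "T \<in> A0 ==> is_adjoint H ip (star T) T"
 using someI_ex[of "%S. S \<in> A0 & is_adjoint H ip S T"] A0_adj[of T] unfolding star_def by blast+

lemma star_eq: "T \<in> A0 ==> S \<in> A0 ==> is_adjoint H ip S T ==> star T = S" using adjoint_unique[of "star T" S T] star[of T] A0_BO by blast

lemma star_add: "S \<in> A0 ==> T \<in> A0 ==> star (S + T) = star S + star T"
 by (rule star_eq) (auto intro!: A0_add star simp: is_adjoint_def ip_add ip_add_right A0_BO star adj_D[OF star(2)])

lemma star_scale: "T \<in> A0 ==> star (op_scale c T) = op_scale (cnj c) (star T)"
proof (rule star_eq[OF A0_scale A0_scale])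
 assume T: "T \<in> A0"
 then show "star T \<in> A0" by (rule star)
 show "is_adjoint H ip (op_scale (cnj c) (star T)) (op_scale c T)"
  using T by (auto simp: is_adjoint_def op_scale_def ip_scale ip_scale_right A0_BO star adj_D[OF star(2)])
qed

lemma phi_adj:
 assumes S: "S \<in> A0" and T: "T \<in> A0" and a: "is_adjoint H ip S T"
 shows "phi S = cnj (phi T)"
proof -
 have key: "phi (S o T) + c * phi S + (cnj c * phi T + cnj c * c) \<in> Rnn" for c
 proof -
  let ?T = "T + op_scale c (op_id H)" and ?S = "S + op_scale (cnj c) (op_id H)"
  have m: "op_scale c (op_id H) \<in> A0" "op_scale (cnj c) (op_id H) \<in> A0" by (intro A0_scale A0_id)+
  have "is_adjoint H ip ?S ?T" unfolding is_adjoint_def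
  proof (intro ballI)
   fix u v assume uv: "u \<in> H" "v \<in> H"
   then show "ip (?T u) v = ip u (?S v)" using adj_D[OF a uv] A0_BO[OF S] A0_BO[OF T]
    by (simp add: op_scale_def op_id_def ip_add ip_add_right ip_scale ip_scale_right)
  qed
  then have "phi (?S o ?T) \<in> Rnn" by (intro phi_pos A0_add m S T)
  moreover have "?S o ?T = ((S o T) + op_scale c S) + (op_scale (cnj c) T + op_scale (cnj c) (op_scale c (op_id H)))"
   using A0_BO[OF S] A0_BO[OF T] A0_BO[OF m(1)] A0_BO[OF m(2)] A0_BO[OF A0_add[OF T m(1)]] BO_id
   by (simp add: op_add_comp comp_op_add comp_op_scale op_scale_comp op_scale_add comp_id)
  ultimately show ?thesis using S T A0_id by (simp add: phi_add phi_scale A0_add A0_comp A0_scale phi_id)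
 qed
 have 0: "Im (phi (S o T)) = 0" using phi_pos[OF S T a] by (simp add: complex_nonneg_Reals_iff)
 have "Im (phi S) + Im (phi T) = 0" using key[of 1] 0 by (simp add: complex_nonneg_Reals_iff)
 moreover have "Re (phi S) - Re (phi T) = 0" using key[of "\<i>"] 0 by (simp add: complex_nonneg_Reals_iff)
 ultimately show ?thesis by (simp add: complex_eq_iff)
qed

definition gop :: "(('i, 'o) lab) option => 'u op" where
 "gop q = (case q of None => op_id H | Some q => P q)"

lemma gop_A0: "gop q \<in> A0" by (cases q) (simp_all add: gop_def A0_id P)

lemma gop_adj: "is_adjoint H ip (gop q) (gop q)" by (cases q) (simp_all add: gop_def P, simp add: is_adjoint_def op_id_def)

definition sand :: "'u op => 'u op => 'u op => complex" where
 "sand u v T = phi (star u o (T o v))"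

lemma sand_add: "u \<in> A0 ==> v \<in> A0 ==> S \<in> A0 ==> T \<in> A0 ==> sand u v (S + T) = sand u v S + sand u v T"
 unfolding sand_def op_add_comp by (subst comp_op_add) (simp_all add: A0_BO A0_comp star phi_add)

lemma sand_scale: "u \<in> A0 ==> v \<in> A0 ==> T \<in> A0 ==> sand u v (op_scale c T) = c * sand u v T"
 unfolding sand_def op_scale_comp by (subst comp_op_scale) (simp_all add: A0_BO A0_comp star phi_scale)

lemma sand_zero: "u \<in> A0 ==> v \<in> A0 ==> sand u v 0 = 0" using sand_add[of u v 0 0] A0_zero by simp

lemma A0_sum: "(!!i. i \<in> I ==> T i \<in> A0) ==> (SUM i:I. T i) \<in> A0"
 by (induction I rule: infinite_finite_induct) (simp_all add: A0_zero A0_add)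

lemma sand_sum: "u \<in> A0 ==> v \<in> A0 ==> (!!i. i \<in> I ==> T i \<in> A0) ==> sand u v (SUM i:I. T i) = (SUM i:I. sand u v (T i))"
 by (induction I rule: infinite_finite_induct) (simp_all add: sand_zero sand_add A0_sum)

definition Lf :: "'u op => 'u op => ('i, 'o) vns => complex" where
 "Lf u v = ns_ext (%q. sand u v (gop q))"

lemma Lf:
 assumes u: "u \<in> A0" and v: "v \<in> A0"
 shows "clin (Lf u v)" "Lf u v (gen q) = sand u v (gop q)"
proof -
 have s: "(SUM i:I. sand u v (P (t i))) = sand u v (SUM i:I. P (t i))" for I and t :: "'o => _" by (rule sand_sum[symmetric]) (simp_all add: u v P)
 have s2: "(SUM i:I. sand u v (SUM b:UNIV. P (t i b))) = sand u v (SUM i:I. SUM b:UNIV. P (t i b))" for I and t :: "'o => 'o => _"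
  by (rule sand_sum[symmetric]) (simp_all add: u v P A0_sum)
 have "ns_rel (%q. sand u v (gop q))" unfolding ns_rel_def gop_def option.case s s2 P1 using P2 P3
  by (intro conjI allI) (rule refl, rule arg_cong[OF P2], rule arg_cong[OF P3])
 from ns_ext[OF this] show "clin (Lf u v)" "Lf u v (gen q) = sand u v (gop q)" by (simp_all add: Lf_def)
qed

lemma Lf_add:
 assumes u: "u \<in> A0" "u' \<in> A0" and v: "v \<in> A0"
 shows "Lf (u + u') v x = Lf u v x + Lf u' v x" "Lf v (u + u') x = Lf v u x + Lf v u' x"
proof -
 have "Lf (u + u') v = (%x. Lf u v x + Lf u' v x)"
  by (rule clin_cong) (use u v in "simp_all add: clin_add Lf A0_add, simp add: sand_def star_add op_add_comp phi_add A0_comp star gop_A0")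
 then show "Lf (u + u') v x = Lf u v x + Lf u' v x" by simp
 have "gop q o (u + u') = (gop q o u) + (gop q o u')" for q using u by (intro comp_op_add A0_BO gop_A0)
 moreover have "star v o ((gop q o u) + (gop q o u')) = (star v o (gop q o u)) + (star v o (gop q o u'))" for q
  using u v by (intro comp_op_add A0_BO A0_comp gop_A0 star)
 ultimately have "Lf v (u + u') = (%x. Lf v u x + Lf v u' x)"
  by (intro clin_cong) (use u v in "simp_all add: clin_add Lf A0_add, simp add: sand_def phi_add A0_comp star gop_A0")
 then show "Lf v (u + u') x = Lf v u x + Lf v u' x" by simp
qed

lemma Lf_scale:
 assumes u: "u \<in> A0" and v: "v \<in> A0"
 shows "Lf (op_scale c u) v x = cnj c * Lf u v x" "Lf v (op_scale c u) x = c * Lf v u x"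
proof -
 have "Lf (op_scale c u) v = (%x. cnj c * Lf u v x)"
  by (rule clin_cong) (use u v in "simp_all add: clin_cmult Lf A0_scale, simp add: sand_def star_scale op_scale_comp phi_scale A0_comp star gop_A0")
 then show "Lf (op_scale c u) v x = cnj c * Lf u v x" by simp
 have "gop q o op_scale c u = op_scale c (gop q o u)" for q using u by (intro comp_op_scale A0_BO gop_A0)
 moreover have "star v o op_scale c (gop q o u) = op_scale c (star v o (gop q o u))" for q using u v by (intro comp_op_scale A0_BO A0_comp gop_A0 star)
 ultimately have "Lf v (op_scale c u) = (%x. c * Lf v u x)"
  by (intro clin_cong) (use u v in "simp_all add: clin_cmult Lf A0_scale, simp add: sand_def phi_scale A0_comp star gop_A0")
 then show "Lf v (op_scale c u) x = c * Lf v u x" by simp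
qed

lemma Lf_zero: "v \<in> A0 ==> Lf 0 v x = 0" "v \<in> A0 ==> Lf v 0 x = 0" using Lf_add[of 0 0 v x] A0_zero by simp_all

lemma Lf_sum_left:
 assumes "!!i. i \<in> I ==> a i \<in> A0" and "v \<in> A0"
 shows "Lf (SUM i:I. op_scale (c i) (a i)) v x = (SUM i:I. cnj (c i) * Lf (a i) v x)" using assms
 by (induction I rule: infinite_finite_induct) (simp_all add: Lf_zero Lf_add Lf_scale A0_sum A0_scale)

lemma Lf_sum_right:
 assumes "!!i. i \<in> I ==> a i \<in> A0" and "v \<in> A0"
 shows "Lf v (SUM i:I. op_scale (c i) (a i)) x = (SUM i:I. c i * Lf v (a i) x)" using assms
 by (induction I rule: infinite_finite_induct) (simp_all add: Lf_zero Lf_add Lf_scale A0_sum A0_scale)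

lemma Lf_herm:
 assumes u: "u \<in> A0" and v: "v \<in> A0"
 shows "Lf v u (vstar x) = cnj (Lf u v x)"
proof -
 have c: "clin (%x. cnj (Lf v u (vstar x)))" unfolding clin_def using Lf(1)[OF v u] by (simp add: clinD vstar_add vstar_vscale)
 have "Lf u v = (%x. cnj (Lf v u (vstar x)))"
 proof (rule clin_cong[OF Lf(1)[OF u v] c])
  fix q
  have "is_adjoint H ip (star v o (gop q o u)) (star u o (gop q o v))" unfolding is_adjoint_def
  proof (intro ballI)
   fix x y assume x: "x \<in> H" and y: "y \<in> H"
   note [simp] = A0_BO u v star gop_A0
   have 1: "is_adjoint H ip u (star u)" by (rule adj_sym[OF star(2)]) simp_all
   have "ip ((star u o (gop q o v)) x) y = ip (gop q (v x)) (u y)" using y by (simp add: adj_D[OF 1])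
   also have "... = ip (v x) (gop q (u y))" by (simp add: adj_D[OF gop_adj])
   also have "... = ip x (star v (gop q (u y)))" using x by (simp add: adj_D[OF star(2)])
   finally show "ip ((star u o (gop q o v)) x) y = ip x ((star v o (gop q o u)) y)" by simp
  qed
  from phi_adj[OF _ _ this] show "Lf u v (gen q) = cnj (Lf v u (vstar (gen q)))" using u v by (simp add: Lf sand_def A0_comp star gop_A0 del: gen_simps)
 qed
 from fun_cong[OF this, of x] show ?thesis by simp
qed

definition perp_op :: "('i, 'o) lab => 'u op" where
 "perp_op q = op_id H + op_scale (-1) (P q)"

lemma perp_op: "perp_op q \<in> A0" "P q o perp_op q = 0" "perp_op q o perp_op q = perp_op q" "is_adjoint H ip (perp_op q) (perp_op q)"
proof -
 have neg: "T + op_scale (-1) T = 0" for T :: "'u op" by (simp add: op_scale_def fun_eq_iff fscale_def)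
 note BO = A0_BO[OF P(1)] BO_id BO_op_scale[OF A0_BO[OF P(1)]] BO_comp[OF A0_BO[OF P(1)] A0_BO[OF P(1)]]
 show A: "perp_op q \<in> A0" unfolding perp_op_def by (intro A0_add A0_id A0_scale P)
 show z: "P q o perp_op q = 0"
  unfolding perp_op_def comp_op_add[OF BO(1) BO_id BO(3)] comp_op_scale[OF BO(1) BO(1)] comp_id(2)[OF BO(1)] P(2) by (rule neg)
 have "perp_op q o perp_op q = (op_id H o perp_op q) + op_scale (-1) (P q o perp_op q)"
  by (subst (1) perp_op_def) (simp add: op_add_comp op_scale_comp)
 also have "... = perp_op q" unfolding z using A0_BO[OF A] by (simp add: comp_id) (simp add: op_scale_def fun_eq_iff fscale_def)
 finally show "perp_op q o perp_op q = perp_op q" .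
 show "is_adjoint H ip (perp_op q) (perp_op q)" unfolding is_adjoint_def perp_op_def
  using adj_D[OF P(3)] BO(1) by (simp add: op_id_def op_scale_def ip_add ip_add_right ip_scale ip_scale_right ip_diff ip_diff_right)
qed

lemma sand_proj:
 assumes u: "u \<in> A0" and R: "R \<in> A0" "R o R = R" "is_adjoint H ip R R"
 shows "sand u u R \<in> Rnn"
proof -
 have "is_adjoint H ip (star u o R) (R o u)" unfolding is_adjoint_def using adj_D[OF R(3)] adj_D[OF star(2)[OF u]] A0_BO[OF u] A0_BO[OF R(1)] by simp
 then have "phi ((star u o R) o (R o u)) \<in> Rnn" using u R by (intro phi_pos A0_comp star)
 also have "(star u o R) o (R o u) = star u o ((R o R) o u)" by (simp only: comp_assoc)
 finally show ?thesis unfolding sand_def R(2) .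
qed

lemma Lf_perp: "u \<in> A0 ==> v \<in> A0 ==> Lf u v (perp (prj q)) = sand u v (perp_op q)"
 using Lf(2)[of u v None] Lf(2)[of u v "Some q"] sand_add[of u v "op_id H" "op_scale (-1) (P q)"]
 by (simp add: clinD(8)[OF Lf(1)] perp_op_def gop_def sand_scale A0_id A0_scale P del: gen_simps(2))

lemma Lf_nonneg:
 assumes u: "u \<in> A0"
 shows "Lf u u (gen q) \<in> Rnn" "Lf u u (perp (gen (Some q'))) \<in> Rnn"
proof -
 have "gop q o gop q = gop q" by (cases q) (simp_all add: gop_def P comp_id BO_id)
 then show "Lf u u (gen q) \<in> Rnn" using sand_proj[OF u gop_A0 _ gop_adj] u by (simp add: Lf)
 show "Lf u u (perp (gen (Some q'))) \<in> Rnn" using sand_proj[OF u perp_op(1,3,4)] u by (simp only: Lf_perp)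
qed

abbreviation "Fam a \<equiv> %i j. Lf (a i) (a j)"

lemma Fam_herm: "(!!i. a i \<in> A0) ==> herm_fam (Fam a)" by (simp add: herm_fam_def Lf Lf_herm)

lemma frm_Fam:
 assumes "!!i. a i \<in> A0"
 shows "frm r (Fam a) x c d = Lf (SUM i<r. op_scale (c i) (a i)) (SUM i<r. op_scale (d i) (a i)) x"
proof -
 have "(SUM i<r. op_scale (d i) (a i)) \<in> A0" by (intro A0_sum A0_scale assms)
 then show ?thesis using assms by (simp add: Lf_sum_left Lf_sum_right frm_def sum_distrib_left mult.assoc)
qed

lemma Re_ev_unit: "(!!i. a i \<in> A0) ==> Re (ev r (Fam a) (unit_mat eps r)) = eps * (SUM i<r. Re (Lf (a i) (a i) vunit))"
 by (simp add: ev_unit[OF Fam_herm])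

lemma ev_limit:
 assumes a: "!!i. a i \<in> A0" and X: "X \<in> herm r" and h: "!!eps. eps > 0 ==> 0 <= Re (ev r (Fam a) (X + unit_mat eps r))"
 shows "0 <= Re (ev r (Fam a) X)"
proof (rule ccontr)
 assume n: "\<not> ?thesis"
 define s where "s = (SUM i<r. Re (Lf (a i) (a i) vunit))"
 have s0: "0 <= s" unfolding s_def using Lf_nonneg(1)[OF a, of _ None] by (intro sum_nonneg) (simp add: complex_nonneg_Reals_iff)
 have e: "Re (ev r (Fam a) (X + unit_mat eps r)) = Re (ev r (Fam a) X) + eps * s" for eps
  using ev_add[OF Fam_herm, of a X r "unit_mat eps r"] hermD(1)[OF X] a by (simp add: Re_ev_unit s_def)
 define eps where "eps = - Re (ev r (Fam a) X) / (2 * (s + 1))"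
 have "eps > 0" unfolding eps_def using n s0 by (intro divide_pos_pos) auto
 from h[OF this] have "0 <= Re (ev r (Fam a) X) + eps * s" by (simp only: e)
 also have "eps * s <= eps * (s + 1)" using \<open>eps > 0\<close> by simp
 also have "eps * (s + 1) = - Re (ev r (Fam a) X) / 2" using s0 by (simp add: eps_def field_simps)
 finally show False using n by simp
qed

lemma ev_Emax:
 assumes a: "!!i. a i \<in> A0" and X: "X \<in> Emax r"
 shows "0 <= Re (ev r (Fam a) X)"
proof (rule ev_limit[OF a])
 show "X \<in> herm r" using X by (simp add: Emax_def)
 fix eps :: real assume "eps > 0"
 then have "X + unit_mat eps r \<in> Dmax r" using X by (simp add: Emax_def unit_mat_def)
 then obtain alpha n s where s: "X + unit_mat eps r = compress alpha (mat_diag n s)" "alpha \<in> carrier_mat n r" "ALL i<n. s i \<in> E_cone"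
  by (auto simp: Dmax_def)
 have "ev r (Fam a) (compress alpha (mat_diag n s)) = (SUM i<n. frm r (Fam a) (s i) (%j. alpha $$ (i, j)) (%j. alpha $$ (i, j)))"
 proof -
  have "ev r (Fam a) (compress alpha (mat_diag n s)) = (SUM i<n. SUM j<n. if j = i then frm r (Fam a) (s i) (%j. alpha $$ (i, j)) (%j. alpha $$ (i, j)) else 0)"
   unfolding ev_compress[OF Fam_herm[OF a] s(2)] unfolding ev_def
   by (intro sum.cong refl) (auto simp: mat_diag_def clinD(3)[OF clin_frm[OF Fam_herm[OF a]]])
  then show ?thesis by simp
 qed
 moreover have "0 <= Re (frm r (Fam a) (s i) c c)" if "i < n" for i c
 proof -
  let ?u = "SUM i<r. op_scale (c i) (a i)"
  have u: "?u \<in> A0" by (intro A0_sum A0_scale a)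
  have z: "Lf ?u ?u (vP a b x y) \<in> Rnn" "Lf ?u ?u (perp (vP a b x y)) \<in> Rnn" "Lf ?u ?u vunit \<in> Rnn" for a b x y
   using Lf_nonneg(1)[OF u, of "Some (a, b, x, y)"] Lf_nonneg(2)[OF u, of "(a, b, x, y)"] Lf_nonneg(1)[OF u, of None] by simp_all
  have "s i \<in> E_cone" using s(3) that by blast
  from E_cone_nonneg[OF Lf(1)[OF u u] z(1) z(2) z(3) this] have "Lf ?u ?u (s i) \<in> Rnn" .
  then show ?thesis unfolding frm_Fam[OF a] by (simp add: complex_nonneg_Reals_iff)
 qed
 ultimately show "0 <= Re (ev r (Fam a) (X + unit_mat eps r))" unfolding s(1) by (auto intro!: sum_nonneg)
qed

text \<open>The kernel for the doubled family P a_i, (1 - P) a_i, evaluated at the doubled matrix, is the old kernel at x plus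
\<epsilon> times its trace; the terms with t vanish since P (1 - P) = 0.\<close>
lemma ev_proj_step:
 assumes D: "!!b Y. (!!i. b i \<in> A0) ==> Y \<in> C (2 * r) ==> 0 <= Re (ev (2 * r) (Fam b) Y)"
  and X: "X \<in> proj_ord C (prj q) r" and a: "!!i. a i \<in> A0"
 shows "0 <= Re (ev r (Fam a) X)"
proof -
 let ?p = "prj q :: ('i, 'o) vns"
 \<comment> \<open>The halves P a_i and (1 - P) a_i add up to a_i.\<close>
 define b where "b i = (if even i then P q o a (i div 2) else perp_op q o a (i div 2))" for i
 have b: "b i \<in> A0" for i unfolding b_def by (simp add: A0_comp P a perp_op)
 have be: "b (2 * i) = P q o a i" "b (2 * i + 1) = perp_op q o a i" for i by (simp_all add: b_def)
 have sum: "b (2 * i) + b (2 * i + 1) = a i" for i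
 proof -
  have "P q + perp_op q = op_id H" by (simp add: perp_op_def op_scale_def fun_eq_iff fscale_def)
  then show ?thesis unfolding be op_add_comp[symmetric] using A0_BO[OF a] by (simp add: comp_id)
 qed
 have four: "Lf (b (2*i)) (b (2*j)) x + Lf (b (2*i)) (b (2*j+1)) x + (Lf (b (2*i+1)) (b (2*j)) x + Lf (b (2*i+1)) (b (2*j+1)) x) = Lf (a i) (a j) x" for i j x
 proof -
  have r: "Lf v (a j) x = Lf v (b (2*j)) x + Lf v (b (2*j+1)) x" if "v \<in> A0" for v unfolding sum[of j, symmetric] by (rule Lf_add(2)[OF b b that])
  have "Lf (a i) (a j) x = Lf (b (2*i)) (a j) x + Lf (b (2*i+1)) (a j) x" unfolding sum[of i, symmetric] by (rule Lf_add(1)[OF b b a])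
  then show ?thesis by (simp only: r[OF b])
 qed
 have PP: "P q o b (2 * i) = b (2 * i)" "P q o b (2 * i + 1) = 0" for i
  unfolding be comp_assoc[symmetric] P(2) perp_op(2) by (simp_all add: comp_zero A0_BO a)
 have sz: "star u o 0 = 0" if "u \<in> A0" for u using that by (simp add: comp_zero A0_BO star)
 have g1: "Lf (b (2*i)) (b (2*i)) ?p = Lf (b (2*i)) (b (2*i)) vunit" "Lf (b (2*i+1)) (b (2*i+1)) ?p = 0" for i
  using Lf(2)[OF b b, of "2*i" "2*i" None] Lf(2)[OF b b, of "2*i" "2*i" "Some q"] Lf(2)[OF b b, of "2*i+1" "2*i+1" "Some q"] sand_zero[OF b b, of "2*i+1" "2*i+1"]
  by (simp_all add: sand_def gop_def PP[simplified] comp_id A0_BO b sz comp_zero del: gen_simps(2))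
 have lin: "clin (Lf (b i) (b i))" for i by (rule Lf(1)[OF b b])
 define s where "s = (SUM i<2*r. Re (Lf (b i) (b i) vunit))"
 have s0: "0 <= s" unfolding s_def using Lf_nonneg(1)[OF b, of _ None] by (intro sum_nonneg) (simp add: complex_nonneg_Reals_iff)
 have e: "Re (ev (2 * r) (Fam b) (ymat r ?p X eps t)) = Re (ev r (Fam a) X) + eps * s" for eps t
 proof -
  have "ev (2 * r) (Fam b) (ymat r ?p X eps t) = ev r (Fam a) X +
   (SUM i<r. Lf (b (2*i)) (b (2*i)) (eps *\<^sub>R ?p + t *\<^sub>R perp ?p) + Lf (b (2*i+1)) (b (2*i+1)) (eps *\<^sub>R perp ?p + t *\<^sub>R ?p))"
   unfolding ev_ymat[OF Fam_herm[OF b]] four ..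
  also have "(SUM i<r. Lf (b (2*i)) (b (2*i)) (eps *\<^sub>R ?p + t *\<^sub>R perp ?p) + Lf (b (2*i+1)) (b (2*i+1)) (eps *\<^sub>R perp ?p + t *\<^sub>R ?p)) =
   (SUM i<r. of_real eps * (Lf (b (2*i)) (b (2*i)) vunit + Lf (b (2*i+1)) (b (2*i+1)) vunit))"
   by (intro sum.cong refl) (simp only: clinD(1,6,8)[OF lin] g1, simp add: algebra_simps)
  finally show ?thesis unfolding s_def sum_lessThan_double by (simp add: sum_distrib_left)
 qed
 have bound: "0 <= Re (ev r (Fam a) X) + eps * s" if e0: "eps > 0" for eps
 proof -
  obtain t where y: "ymat r ?p X eps t \<in> C (2 * r)" using proj_ordD[OF X e0] by blast
  from D[of b, OF b y] show ?thesis unfolding e .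
 qed
 show ?thesis
 proof (rule field_le_epsilon)
  fix delta :: real assume d: "delta > 0"
  have "delta / (s + 1) * s <= delta" using d s0 by (simp add: field_simps)
  then show "0 <= Re (ev r (Fam a) X) + delta" using bound[of "delta / (s + 1)"] d s0 by simp
 qed
qed

lemma ev_E_seq: "(!!i. a i \<in> A0) ==> X \<in> E_seq g j r ==> 0 <= Re (ev r (Fam a) X)"
proof (induction j arbitrary: r X a)
 case 0 then show ?case by (simp add: ev_Emax)
next
 case (Suc j)
 show ?case by (rule ev_proj_step[of "E_seq g j" r X "pgen g j" a])
   (use Suc in "simp_all only: E_seq.simps periodic_gen_eq")
qed

lemma ev_mat1: "ev 1 (Fam (%_. op_id H)) (mat1 x) = Lf (op_id H) (op_id H) x" by (simp add: ev_def)

lemma Lf_real: "u \<in> A0 ==> vstar x = x ==> Im (Lf u u x) = 0" using Lf_herm[of u u x] by (simp add: complex_eq_iff)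

theorem D_qc_sound:
 assumes "x \<in> D_qc g" shows "Lf (op_id H) (op_id H) x \<in> Rnn"
proof -
 have m: "mat1 x \<in> E_proj g 1" using assms by (simp add: D_qc_def)
 then have h: "mat1 x \<in> herm 1" by (simp add: E_proj_def)
 have "0 <= Re (ev 1 (Fam (%_. op_id H)) (mat1 x))"
 proof (rule ev_limit[OF A0_id h])
  fix eps :: real assume "eps > 0"
  then obtain j where "mat1 x + unit_mat eps 1 \<in> E_seq g j 1" using m by (auto simp: E_proj_def unit_mat_def)
  then show "0 <= Re (ev 1 (Fam (%_. op_id H)) (mat1 x + unit_mat eps 1))" by (rule ev_E_seq[OF A0_id])
 qed
 then have "0 <= Re (Lf (op_id H) (op_id H) x)" unfolding ev_mat1 .
 moreover have "vstar x = x" using hermD(4)[OF h, of 0 0] by simp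
 ultimately show ?thesis using Lf_real[OF A0_id] by (simp add: complex_nonneg_Reals_iff)
qed

lemma ev_Ek_seq:
 assumes sp: "!!T. T \<in> A0 ==> EX m. T = (SUM l<k. op_scale (m l) (b l))" and b: "!!l. b l \<in> A0"
 shows "(!!i. a i \<in> A0) ==> X \<in> Ek_seq g k j ==> 0 <= Re (ev k (Fam a) X)"
proof (induction j arbitrary: X a)
 case 0 then show ?case by (simp add: ev_Emax)
next
 case (Suc j)
 have "0 <= Re (ev (2 * k) (Fam c) Y)" if c: "!!i. c i \<in> A0" and Y: "Y \<in> kmin k (Ek_seq g k j) (2 * k)" for c Y
 proof -
  obtain m where m: "!!i. c i = (SUM l<k. op_scale (m i l) (b l))" using sp[OF c] by metis
  let ?gamma = "Matrix.mat (2 * k) k (%(i, l). m i l)"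
  have "ev (2 * k) (Fam c) Y = ev (2 * k) (%i j x. frm k (Fam b) x (%l. ?gamma $$ (i, l)) (%l. ?gamma $$ (j, l))) Y"
   by (rule ev_cong) (simp add: frm_Fam[OF b] m)
  also have "... = ev k (Fam b) (compress ?gamma Y)" by (rule ev_compress[OF Fam_herm[OF b], symmetric]) simp
  finally show ?thesis using Suc.IH[of b, OF b] Y by (simp add: kmin_def)
 qed
 from ev_proj_step[of "kmin k (Ek_seq g k j)" k X "pgen g j" a, OF this _ Suc.prems(1)] Suc.prems(2)
 show ?case by (simp only: Ek_seq.simps periodic_gen_eq proj_cone_alt[OF vstar_gen_Some])
qed

theorem D_q_sound:
 assumes sp: "!!T. T \<in> A0 ==> EX m. T = (SUM l<k. op_scale (m l) (b l))" and b: "!!l. b l \<in> A0" and k: "k >= 1"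
  and x: "x \<in> D_q g k"
 shows "Lf (op_id H) (op_id H) x \<in> Rnn"
proof -
 let ?alpha = "Matrix.mat 1 k (%(_, j). if j = 0 then 1 else 0 :: complex)" and ?a = "%_ :: nat. op_id H"
 have m: "compress ?alpha (mat1 x) \<in> Ek_proj g k" and s: "vstar x = x" using x by (auto simp: D_q_def)
 have h: "compress ?alpha (mat1 x) \<in> herm k" using m by (simp add: Ek_proj_alt)
 have "0 <= Re (ev k (Fam ?a) (compress ?alpha (mat1 x)))"
 proof (rule ev_limit[OF A0_id h])
  fix eps :: real assume "eps > 0"
  then obtain j where j: "compress ?alpha (mat1 x) + unit_mat eps k \<in> Ek_seq g k j" using m by (auto simp: Ek_proj_alt)
  show "0 <= Re (ev k (Fam ?a) (compress ?alpha (mat1 x) + unit_mat eps k))"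
   by (rule ev_Ek_seq[where k = k and b = b and a = ?a, OF _ b A0_id j]) (rule sp)
 qed
 also have "ev k (Fam ?a) (compress ?alpha (mat1 x)) = Lf (op_id H) (op_id H) x"
 proof -
  have "ev k (Fam ?a) (compress ?alpha (mat1 x)) = frm k (Fam ?a) x (%j. ?alpha $$ (0, j)) (%j. ?alpha $$ (0, j))"
   by (subst ev_compress[OF Fam_herm[OF A0_id], of _ 1]) (simp_all add: ev_def)
  also have "... = frm k (Fam ?a) x (%j. if j = 0 then 1 else 0) (%j. if j = 0 then 1 else 0)" by (rule frm_cong) simp_all
  also have "... = Lf (op_id H) (op_id H) x" using k by (intro frm_single[of 0 k 0 "Fam ?a" x]) simp_all
  finally show ?thesis .
 qed
 finally show ?thesis using Lf_real[OF A0_id s] by (simp add: complex_nonneg_Reals_iff)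
qed

lemma Lf_id_P: "Lf (op_id H) (op_id H) (vP a b x y) = phi (P (a, b, x, y))" "Lf (op_id H) (op_id H) vunit = 1"
proof -
 have "star (op_id H) = op_id H" by (rule star_eq[OF A0_id A0_id]) (simp add: is_adjoint_def op_id_def)
 then show "Lf (op_id H) (op_id H) (vP a b x y) = phi (P (a, b, x, y))" "Lf (op_id H) (op_id H) vunit = 1"
  using Lf(2)[OF A0_id A0_id, of "Some (a, b, x, y)"] Lf(2)[OF A0_id A0_id, of None] by (simp_all add: sand_def gop_def comp_id A0_BO P BO_id phi_id)
qed

end

context hilbert_space
begin

text \<open>Operators on a finite-dimensional space are determined by their matrix entries on a basis, so they span a space of
dimension at most the square of the dimension.\<close>
lemma operators_finite_span:
 assumes fd: "finite_dim H" and A: "A <= BO" "0 \<in> A" "!!S T. S \<in> A ==> T \<in> A ==> S + T \<in> A" "!!c T. T \<in> A ==> op_scale c T \<in> A"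
 shows "EX k>=1. EX b :: nat => 'u op. (ALL l. b l \<in> A) & (ALL T:A. EX m. T = (SUM l<k. op_scale (m l) (b l)))"
proof -
 obtain B0 where B0: "finite B0" "H = fun_vs.span B0" using fd by (auto simp: finite_dim_def)
 obtain Bs where Bs: "Bs <= B0" "fun_vs.independent Bs" "B0 <= fun_vs.span Bs" using fun_vs.maximal_independent_subset[of B0] by blast
 have fB: "finite Bs" using B0(1) Bs(1) by (rule rev_finite_subset)
 have HB: "H = fun_vs.span Bs" using B0(2) Bs(1,3) by (metis fun_vs.span_eq fun_vs.span_superset order_trans)
 define co where "co = fun_vs.representation Bs"
 have co: "v = (SUM e:Bs. fscale (co v e) e)" if "v \<in> H" for v
  using fun_vs.sum_representation_eq[OF Bs(2) _ fB subset_refl, of v] that by (simp add: co_def HB)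
 define J :: "'u op => ('u => complex) \<times> 'u => complex" where "J T = (%(v, i). T v i)" for T
 have Ja: "J (S + T) = J S + J T" "J (op_scale c T) = fscale c (J T)" "J 0 = 0" for S T c by (auto simp: J_def fun_eq_iff op_scale_def fscale_def)
 have Ji: "J S = J T ==> S = T" for S T by (auto simp: J_def fun_eq_iff)
 define U where "U = (%(e, e' :: 'u => complex) (v, i). if v \<in> H then co v e * e' i else (0 :: complex))"
 have Bsub: "e \<in> Bs ==> e \<in> H" for e unfolding HB by (rule fun_vs.span_base)
 have "J T \<in> fun_vs.span (U ` (Bs \<times> Bs))" if T: "T \<in> A" for T
 proof -
  have TB: "T \<in> BO" using A(1) T by blast
  have jt: "J T = (SUM z:Bs \<times> Bs. fscale (co (T (fst z)) (snd z)) (U z))"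
  proof (rule HOL.ext, clarify)
   fix v i
   show "J T (v, i) = (SUM z:Bs \<times> Bs. fscale (co (T (fst z)) (snd z)) (U z)) (v, i)"
   proof (cases "v \<in> H")
    case True
    have "T v = T (SUM e:Bs. fscale (co v e) e)" using co[OF True] by simp
    also have "... = (SUM e:Bs. fscale (co v e) (T e))" by (subst BO_sum[OF TB]) (simp_all add: Bsub BO_D(4)[OF TB])
    also have "... = (SUM e:Bs. fscale (co v e) (SUM e':Bs. fscale (co (T e) e') e'))"
     by (intro sum.cong refl arg_cong[where f = "fscale _"] co) (simp add: TB)
    finally have "T v i = (SUM e:Bs. SUM e':Bs. co v e * (co (T e) e' * e' i))" by (simp add: sum_fun_apply fscale_def sum_distrib_left)
    then show ?thesis using True by (simp add: J_def sum_fun_apply fscale_def U_def sum.cartesian_product case_prod_unfold mult.left_commute)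
   next
    case False
    then show ?thesis using BO_D(2)[OF TB False] by (simp add: J_def sum_fun_apply fscale_def U_def case_prod_unfold)
   qed
  qed
  show ?thesis unfolding jt by (intro fun_vs.span_sum fun_vs.span_scale fun_vs.span_base imageI)
 qed
 then have sub: "J ` A <= fun_vs.span (U ` (Bs \<times> Bs))" by blast
 have ss: "fun_vs.subspace (J ` A)"
 proof (rule fun_vs.subspaceI)
  show "0 \<in> J ` A" using A(2) Ja(3) by (metis imageI)
  show "x + y \<in> J ` A" if "x \<in> J ` A" "y \<in> J ` A" for x y using that A(3) Ja(1) by (metis (no_types, lifting) image_iff)
  show "fscale c x \<in> J ` A" if "x \<in> J ` A" for c x using that A(4) Ja(2) by (metis (no_types, lifting) image_iff)
 qed
 obtain B' where B': "B' <= J ` A" "finite B'" "J ` A <= fun_vs.span B'"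
 proof -
  obtain B' where b: "B' <= J ` A" "fun_vs.independent B'" "J ` A <= fun_vs.span B'" using fun_vs.maximal_independent_subset[of "J ` A"] by blast
  have "finite B'" using fun_vs.independent_span_bound[OF _ b(2), of "U ` (Bs \<times> Bs)"] b(1) sub fB by blast
  then show thesis using b that by blast
 qed
 obtain h n where h: "B' = h ` {i. i < (n::nat)}" "inj_on h {i. i < n}" using finite_imp_nat_seg_image_inj_on[OF B'(2)] by blast
 have h': "EX T:A. J T = h l" if "l < n" for l using B'(1) h(1) that by (metis (mono_tags, lifting) image_iff mem_Collect_eq subsetD)
 define b where "b l = (if l < n then (SOME T. T \<in> A & J T = h l) else 0)" for l
 have b: "b l \<in> A" "l < n ==> J (b l) = h l" for l
 proof -
  have "b l \<in> A & J (b l) = h l" if "l < n" using someI_ex[of "%T. T \<in> A & J T = h l"] h'[OF that] that by (simp add: b_def Bex_def)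
  then show "b l \<in> A" "l < n ==> J (b l) = h l" using A(2) by (cases "l < n", simp_all add: b_def)
 qed
 have Js: "J (SUM l:I. T l) = (SUM l:I. J (T l))" for I :: "nat set" and T
  by (induction I rule: infinite_finite_induct) (simp_all only: sum.infinite sum.empty sum.insert Ja not_False_eq_True)
 have "EX m. T = (SUM l<Suc n. op_scale (m l) (b l))" if T: "T \<in> A" for T
 proof -
  have "J T \<in> fun_vs.span B'" using T B'(3) by blast
  then obtain u where u: "J T = (SUM v:B'. fscale (u v) v)" unfolding fun_vs.span_finite[OF B'(2)] by blast
  also have "... = (SUM l:{i. i < n}. fscale (u (h l)) (h l))" unfolding h(1) by (subst sum.reindex[OF h(2)]) simp
  also have "... = (SUM l<n. J (op_scale (u (h l)) (b l)))" unfolding lessThan_def Ja by (intro sum.cong refl) (simp add: b(2))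
  also have "... = J (SUM l<n. op_scale (u (h l)) (b l))" by (rule Js[symmetric])
  finally have "T = (SUM l<n. op_scale (u (h l)) (b l))" by (rule Ji)
  moreover have "op_scale c (b n) = 0" for c by (simp add: b_def op_scale_def fscale_def fun_eq_iff)
  ultimately show ?thesis by (intro exI[of _ "%l. u (h l)"]) simp
 qed
 then show ?thesis using b(1) by (intro exI[of _ "Suc n"] conjI exI[of _ b]) auto
qed

text \<open>E x a and F y b commute and are projections, so their products are projections in the generated algebra, and they
inherit the nonsignalling relations from the completeness of both measures.\<close>
lemma generated_operator_state:
 fixes E :: "'i::finite => 'o::finite => 'u op"
 assumes A: "cstar_algebra H ip A" and B: "cstar_algebra H ip B" and AB: "!!S T. S \<in> A ==> T \<in> B ==> S o T = T o S"
  and E: "!!x. pvm H ip (E x)" "!!x a. E x a \<in> A" and F: "!!y. pvm H ip (F y)" "!!y b. F y b \<in> B"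
  and phi: "state_on H ip (cstar_generated H ip (A \<union> B)) phi"
 shows "operator_state H ip (cstar_generated H ip (A \<union> B)) phi (%(a, b, x, y). E x a o F y b)"
proof -
 let ?A = "cstar_generated H ip (A \<union> B)"
 have ABsub: "A \<union> B <= BO" using A B by (auto simp: cstar_algebra_def)
 have "A \<union> B <= commutant {}"
 proof
  fix T assume T: "T \<in> A \<union> B"
  then have "EX S:BO. is_adjoint H ip S T" using A B unfolding cstar_algebra_def by blast
  then show "T \<in> commutant {}" using T ABsub by (auto simp: commutant_def)
 qed
 then have top: "T \<in> commutant {}" if "T \<in> ?A" for T using that commutant_cstar[of "{}"] by (auto simp: cstar_generated_def)
 have G: "T \<in> ?A" if "T \<in> A \<union> B" for T using that by (auto simp: cstar_generated_def)
 have cl: "T \<in> ?A" if "!!Z. cstar_algebra H ip Z ==> A \<union> B <= Z ==> T \<in> Z" for T using that by (auto simp: cstar_generated_def)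
 have el: "T \<in> Z" if "T \<in> ?A" "cstar_algebra H ip Z" "A \<union> B <= Z" for T Z using that by (auto simp: cstar_generated_def)
 have sumA: "(SUM i:I. T i) \<in> A" if "!!i. T i \<in> A" for I and T :: "'o => 'u op"
  using A that by (induction I rule: infinite_finite_induct) (simp_all add: cstar_algebra_def)
 have id: "op_id H \<in> ?A" using G sumA[of "E undefined" UNIV] E by (simp add: pvm_def)
 have EB: "E x a \<in> BO" "F y b \<in> BO" for x a y b using E F by (simp_all add: pvm_def)
 have Fsum: "(SUM b:UNIV. E x a o F y b) = E x a" for x a y
 proof (rule HOL.ext)
  fix v
  have "(SUM b:UNIV. E x a o F y b) v = (SUM b:UNIV. E x a (F y b v))" by (simp add: sum_fun_apply)
  also have "... = E x a (SUM b:UNIV. F y b v)" by (rule BO_sum[OF EB(1), symmetric]) (simp add: EB)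
  also have "(SUM b:UNIV. F y b v) = (SUM b:UNIV. F y b) v" by (simp add: sum_fun_apply)
  also have "... = op_id H v" using F(1)[of y] by (simp add: pvm_def)
  also have "E x a (op_id H v) = (E x a o op_id H) v" by simp
  finally show "(SUM b:UNIV. E x a o F y b) v = E x a v" by (simp only: comp_id(2)[OF EB(1)])
 qed
 have Esum: "(SUM a:UNIV. E x a o F y b) = F y b" for x b y
 proof (rule HOL.ext)
  fix v
  have "(SUM a:UNIV. E x a o F y b) v = (SUM a:UNIV. E x a) (F y b v)" by (simp add: sum_fun_apply)
  also have "... = (op_id H o F y b) v" using E(1)[of x] by (simp add: pvm_def)
  finally show "(SUM a:UNIV. E x a o F y b) v = F y b v" by (simp only: comp_id(1)[OF EB(2)])
 qed
 have comm: "E x a o F y b = F y b o E x a" for x a y b by (rule AB[OF E(2) F(2)])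
 show ?thesis
 proof (intro operator_state.intro operator_state_axioms.intro hilbert_space_axioms)
  fix S T :: "'u op" and c
  show "T \<in> ?A ==> T \<in> BO" using top by (auto simp: commutant_def)
  show "0 \<in> ?A" by (rule cl) (simp add: cstar_algebra_def)
  show "op_id H \<in> ?A" by (rule id)
  show "S + T \<in> ?A" if "S \<in> ?A" "T \<in> ?A"
  proof (rule cl)
   fix Z assume Z: "cstar_algebra H ip Z" "A \<union> B <= Z"
   show "S + T \<in> Z" using el[OF that(1) Z] el[OF that(2) Z] Z(1) by (simp add: cstar_algebra_def)
  qed
  show "S o T \<in> ?A" if "S \<in> ?A" "T \<in> ?A"
  proof (rule cl)
   fix Z assume Z: "cstar_algebra H ip Z" "A \<union> B <= Z"
   show "S o T \<in> Z" using el[OF that(1) Z] el[OF that(2) Z] Z(1) by (simp add: cstar_algebra_def)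
  qed
  show "op_scale c T \<in> ?A" if "T \<in> ?A"
  proof (rule cl)
   fix Z assume Z: "cstar_algebra H ip Z" "A \<union> B <= Z"
   show "op_scale c T \<in> Z" using el[OF that Z] Z(1) by (simp add: cstar_algebra_def)
  qed
  show "EX S:?A. is_adjoint H ip S T" if T: "T \<in> ?A"
  proof -
   obtain S where S: "S \<in> BO" "is_adjoint H ip S T" using top[OF T] by (auto simp: commutant_def)
   have "S \<in> ?A"
   proof (rule cl)
    fix Z assume Z: "cstar_algebra H ip Z" "A \<union> B <= Z"
    then obtain S' where S': "S' \<in> Z" "is_adjoint H ip S' T" using el[OF T Z] unfolding cstar_algebra_def by blast
    have "S' \<in> BO" using S'(1) Z(1) by (auto simp: cstar_algebra_def)
    then show "S \<in> Z" using adjoint_unique[OF S(1) _ S(2) S'(2)] S'(1) by simp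
   qed
   then show ?thesis using S(2) by blast
  qed
  show "phi (S + T) = phi S + phi T" if "S \<in> ?A" "T \<in> ?A" using phi that by (simp add: state_on_def)
  show "phi (op_scale c T) = c * phi T" if "T \<in> ?A" using phi that by (simp add: state_on_def)
  show "phi (S o T) \<in> Rnn" if "S \<in> ?A" "T \<in> ?A" "is_adjoint H ip S T" using phi that by (simp add: state_on_def)
  show "phi (op_id H) = 1" using phi by (simp add: state_on_def)
 next
  fix q :: "('i, 'o) lab"
  obtain a b x y where q: "q = (a, b, x, y)" by (cases q)
  show "(case q of (a, b, x, y) => E x a o F y b) \<in> ?A" unfolding q prod.case
  proof (rule cl)
   fix Z assume Z: "cstar_algebra H ip Z" "A \<union> B <= Z"
   then have "E x a \<in> Z" "F y b \<in> Z" using E(2)[of x a] F(2)[of y b] by blast+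
   then show "E x a o F y b \<in> Z" using Z(1) by (simp add: cstar_algebra_def)
  qed
  have "(E x a o F y b) o (E x a o F y b) = E x a o ((F y b o E x a) o F y b)" by (simp only: comp_assoc)
  also have "... = (E x a o E x a) o (F y b o F y b)" by (simp only: comm[symmetric] comp_assoc)
  also have "... = E x a o F y b" using E(1)[of x] F(1)[of y] by (simp add: pvm_def)
  finally show "(case q of (a, b, x, y) => E x a o F y b) o (case q of (a, b, x, y) => E x a o F y b) = (case q of (a, b, x, y) => E x a o F y b)"
   unfolding q prod.case .
  have Ea: "is_adjoint H ip (E x a) (E x a)" "is_adjoint H ip (F y b) (F y b)" using E(1)[of x] F(1)[of y] by (simp_all add: pvm_def)
  show "is_adjoint H ip (case q of (a, b, x, y) => E x a o F y b) (case q of (a, b, x, y) => E x a o F y b)" unfolding q prod.case is_adjoint_def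
  proof (intro ballI)
   fix u v assume u: "u \<in> H" and v: "v \<in> H"
   have "ip ((E x a o F y b) u) v = ip u ((F y b o E x a) v)" using u v by (simp add: adj_D[OF Ea(1)] adj_D[OF Ea(2)] EB)
   then show "ip ((E x a o F y b) u) v = ip u ((E x a o F y b) v)" by (simp only: comm)
  qed
 next
  fix a :: 'o and x y z :: 'i
  show "(SUM a:UNIV. SUM b:UNIV. case (a, b, x, y) of (a, b, x, y) => E x a o F y b) = op_id H"
   using E(1)[of x] by (simp only: prod.case Fsum) (simp add: pvm_def)
  show "(SUM b:UNIV. case (a, b, x, y) of (a, b, x, y) => E x a o F y b) = (SUM b:UNIV. case (a, b, x, z) of (a, b, x, y) => E x a o F y b)"
   by (simp only: prod.case Fsum)
  show "(SUM b:UNIV. case (b, a, y, x) of (a, b, x, y) => E x a o F y b) = (SUM b:UNIV. case (b, a, z, x) of (a, b, x, y) => E x a o F y b)"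
   by (simp only: prod.case Esum)
 qed
qed

end

section \<open>Correlations and cones\<close>

lemma C_qc_functional:
 fixes p :: "('i::finite, 'o::finite) corr"
 assumes m: "commuting_model H ip p"
 shows "EX psi. clin psi & psi vunit = 1 & (ALL a b x y. psi (vP a b x y) = p a b x y) & nonneg_on psi (D_qc g) &
  (finite_dim H --> (EX k>=1. nonneg_on psi (D_q g k)))"
proof -
 have hs: "hilbert_space H ip" using m by (simp add: commuting_model_def)
 obtain A B E F phi where M: "cstar_algebra H ip A" "cstar_algebra H ip B" "ALL S:A. ALL T:B. S o T = T o S"
  "ALL x. pvm H ip (E x) & (ALL a. E x a \<in> A)" "ALL y. pvm H ip (F y) & (ALL b. F y b \<in> B)"
  "state_on H ip (cstar_generated H ip (A \<union> B)) phi" "ALL a b x y. p a b x y = phi (E x a o F y b)"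
  using m unfolding commuting_model_def by blast
 interpret hilbert_space H ip by (rule hs)
 let ?A = "cstar_generated H ip (A \<union> B)"
 have "S o T = T o S" if "S \<in> A" "T \<in> B" for S T using M(3) that by blast
 moreover have "pvm H ip (E x)" "E x a \<in> A" "pvm H ip (F x)" "F x a \<in> B" for x a using M(4,5) by blast+
 ultimately interpret S: operator_state H ip ?A phi "%(a, b, x, y). E x a o F y b" by (intro generated_operator_state M(1,2,6))
 let ?psi = "S.Lf (op_id H) (op_id H)"
 have "EX k>=1. nonneg_on ?psi (D_q g k)" if fd: "finite_dim H"
 proof -
  obtain k b where kb: "k >= 1" "!!l :: nat. b l \<in> ?A" "!!T. T \<in> ?A ==> EX m. T = (SUM l<k. op_scale (m l) (b l))"
  proof -
   have "?A <= bounded_ops H ip" using S.A0_BO by blast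
   from operators_finite_span[OF fd this S.A0_zero S.A0_add S.A0_scale] show thesis using that by blast
  qed
  have "nonneg_on ?psi (D_q g k)" unfolding nonneg_on_def by (intro ballI S.D_q_sound[where k = k and b = b and g = g]) (use kb in auto)
  then show ?thesis using kb(1) by blast
 qed
 moreover have "nonneg_on ?psi (D_qc g)" unfolding nonneg_on_def using S.D_qc_sound by blast
 moreover have "clin ?psi" by (rule S.Lf(1)[OF S.A0_id S.A0_id])
 ultimately show ?thesis using S.Lf_id_P M(7) by (intro exI[of _ ?psi]) simp
qed

lemma functional_eq:
 assumes "clin phi" "clin psi" "phi vunit = psi vunit" "!!a b x y. phi (vP a b x y) = psi (vP a b x y)"
 shows "phi = psi"
proof (rule clin_cong[OF assms(1,2)])
 show "phi (gen q) = psi (gen q)" for q using assms(3,4) by (cases q) auto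
qed

lemma C_ns_iff:
 fixes p :: "('i::finite, 'o::finite) corr"
 assumes lin: "clin phi" and u: "phi vunit = 1" and p: "!!a b x y. p a b x y = phi (vP a b x y)"
 shows "p \<in> C_ns \<longleftrightarrow> nonneg_on phi D_ns"
proof
 assume "p \<in> C_ns"
 then have pos: "!!a b x y. p a b x y \<in> Rnn" and sum: "!!x y. (SUM a:UNIV. SUM b:UNIV. p a b x y) = 1" by (auto simp: C_ns_def correlation_def)
 have le: "Re (p a b x y) <= 1" for a b x y
 proof -
  have r: "0 <= Re (p a b x y)" for a b using pos by (simp add: complex_nonneg_Reals_iff)
  have "Re (p a b x y) <= (SUM b:UNIV. Re (p a b x y))" by (rule member_le_sum) (auto simp: r)
  also have "... <= (SUM a:UNIV. SUM b:UNIV. Re (p a b x y))"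
   by (rule member_le_sum[of a UNIV "%a. SUM b:UNIV. Re (p a b x y)"]) (auto intro!: sum_nonneg r)
  also have "... = Re (SUM a:UNIV. SUM b:UNIV. p a b x y)" by simp
  finally show ?thesis unfolding sum by simp
 qed
 show "nonneg_on phi D_ns" unfolding nonneg_on_def D_ns_def
 proof
  fix z :: "('i, 'o) vns" assume z: "z \<in> E_cone"
  have 1: "phi (vP a b x y) \<in> Rnn" for a b x y using pos p by simp
  have 2: "phi (perp (vP a b x y)) \<in> Rnn" for a b x y
   using pos[of a b x y] le[of a b x y] by (simp add: clinD(8)[OF lin] u p[symmetric] complex_nonneg_Reals_iff)
  show "phi z \<in> Rnn" by (rule E_cone_nonneg[OF lin 1 2 _ z]) (simp add: u)
 qed
next
 assume nn: "nonneg_on phi D_ns"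
 have s: "(SUM i:I. phi (h i)) = phi (SUM i:I. h i)" for I :: "'o set" and h by (simp add: clinD(7)[OF lin])
 have pp: "phi (vP a b x y) \<in> Rnn" for a b x y using nn vP_in_E[of a b x y] unfolding nonneg_on_def D_ns_def by blast
 show "p \<in> C_ns" unfolding C_ns_def mem_Collect_eq correlation_def p s vns_relations(1) u
  by (intro conjI allI; rule pp refl arg_cong[OF vns_relations(2)] arg_cong[OF vns_relations(3)])
qed

lemma C_qc_iff:
 fixes p :: "('i::finite, 'o::finite) corr"
 assumes inf: "infinite (UNIV :: 'u set)" and g: "generator_enum g"
  and lin: "clin phi" and u: "phi vunit = 1" and p: "!!a b x y. p a b x y = phi (vP a b x y)"
 shows "p \<in> C_qc TYPE('u) \<longleftrightarrow> nonneg_on phi (D_qc g)"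
proof
 assume "p \<in> C_qc TYPE('u)"
 then obtain H :: "('u => complex) set" and ip where "commuting_model H ip p" by (auto simp: C_qc_def)
 from C_qc_functional[OF this, of g] obtain psi where psi: "clin psi" "psi vunit = 1" "ALL a b x y. psi (vP a b x y) = p a b x y" "nonneg_on psi (D_qc g)"
  by blast
 have "phi = psi" by (rule functional_eq[OF lin psi(1)]) (simp_all add: u psi(2,3) p)
 then show "nonneg_on phi (D_qc g)" using psi(4) by simp
next
 assume "nonneg_on phi (D_qc g)"
 from datum_exists[OF g lin u this] obtain F where F: "datum F" "F 0 0 = phi" by blast
 have "(%a b x y. frmI F (vP a b x y) (evec 0) (evec 0)) \<in> C_qc TYPE('u)" by (rule datum_in_C_qc[OF F(1) inf FS_evec]) (simp add: frmI_evec F(2) u)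
 also have "(%a b x y. frmI F (vP a b x y) (evec 0) (evec 0)) = p" by (simp add: frmI_evec F(2) p fun_eq_iff)
 finally show "p \<in> C_qc TYPE('u)" .
qed

lemma C_q_iff:
 fixes p :: "('i::finite, 'o::finite) corr"
 assumes inf: "infinite (UNIV :: 'u set)" and g: "generator_enum g"
  and lin: "clin phi" and u: "phi vunit = 1" and p: "!!a b x y. p a b x y = phi (vP a b x y)"
 shows "p \<in> C_q TYPE('u) \<longleftrightarrow> (EX k>=1. nonneg_on phi (D_q g k))"
proof
 assume "p \<in> C_q TYPE('u)"
 then obtain H :: "('u => complex) set" and ip where H: "commuting_model H ip p" "finite_dim H" by (auto simp: C_q_def)
 from C_qc_functional[OF H(1), of g] H(2) obtain psi where psi: "clin psi" "psi vunit = 1" "ALL a b x y. psi (vP a b x y) = p a b x y" "EX k>=1. nonneg_on psi (D_q g k)"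
  by blast
 have "phi = psi" by (rule functional_eq[OF lin psi(1)]) (simp_all add: u psi(2,3) p)
 then show "EX k>=1. nonneg_on phi (D_q g k)" using psi(4) by simp
next
 assume "EX k>=1. nonneg_on phi (D_q g k)"
 then obtain k where "k >= 1" "nonneg_on phi (D_q g k)" by blast
 from D_q_nonneg_split[OF g this(1) lin u this(2)] obtain psi where psi: "psi \<in> split_states" "cvec phi = cvec psi" by blast
 have "phi (prj q) = psi (prj q)" for q using arg_cong[OF psi(2), of "%v. vec_nth v q"] by (simp add: cvec_def)
 then have "phi (vP a b x y) = psi (vP a b x y)" for a b x y using gen_simps(2) by metis
 then have "p = (%a b x y. psi (vP a b x y))" by (simp add: p fun_eq_iff)
 then show "p \<in> C_q TYPE('u)" using split_state_C_q[OF psi(1) inf] by simp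
qed

lemma C_qa_iff:
 fixes p :: "('i::finite, 'o::finite) corr"
 assumes inf: "infinite (UNIV :: 'u set)" and g: "generator_enum g"
  and lin: "clin phi" and u: "phi vunit = 1" and p: "!!a b x y. p a b x y = phi (vP a b x y)"
 shows "p \<in> C_qa TYPE('u) \<longleftrightarrow> nonneg_on phi (D_qa g)"
proof
 assume pc: "p \<in> C_qa TYPE('u)"
 define val where "val z p = (SUM q:UNIV. rep_vns z q * (case q of None => 1 | Some (a, b, x, y) => p a b x y))" for z :: "('i, 'o) vns" and p :: "('i, 'o) corr"
 have val: "val z p = psi z" if "clin psi" "psi vunit = 1" "!!a b x y. p a b x y = psi (vP a b x y)" for z p psi
  unfolding clin_expand[OF that(1), of z] val_def by (intro sum.cong refl arg_cong[where f = "(*) _"]) (auto simp: that(2,3) split: option.split)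
 show "nonneg_on phi (D_qa g)" unfolding nonneg_on_def
 proof
  fix z assume z: "z \<in> D_qa g"
  have c: "continuous_on UNIV (%p :: ('i, 'o) corr. case q of None => 1 | Some (a, b, x, y) => p a b x y)" for q
  proof (cases q)
   case (Some t)
   obtain a b x y where t: "t = (a, b, x, y)" by (cases t)
   have "continuous_on UNIV (%p :: ('i, 'o) corr. p)" by (rule continuous_on_id)
   then have "continuous_on UNIV (%p :: ('i, 'o) corr. p a)" by (rule cont_fun1)
   then have "continuous_on UNIV (%p :: ('i, 'o) corr. p a b)" by (rule cont_fun1)
   then have "continuous_on UNIV (%p :: ('i, 'o) corr. p a b x)" by (rule cont_fun1)
   then have "continuous_on UNIV (%p :: ('i, 'o) corr. p a b x y)" by (rule cont_fun1)
   then show ?thesis by (simp add: Some t)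
  qed (simp add: continuous_on_const)
  have "closed {p. val z p \<in> Rnn}" unfolding val_def complex_nonneg_Reals_iff
   by (intro closed_Collect_conj closed_Collect_le closed_Collect_eq continuous_intros c)
  moreover have "C_q TYPE('u) <= {p. val z p \<in> Rnn}"
  proof
   fix p' :: "('i, 'o) corr" assume "p' \<in> C_q TYPE('u)"
   then obtain H :: "('u => complex) set" and ip where H: "commuting_model H ip p'" "finite_dim H" by (auto simp: C_q_def)
   from C_qc_functional[OF H(1), of g] H(2) obtain psi k where psi: "clin psi" "psi vunit = 1" "ALL a b x y. psi (vP a b x y) = p' a b x y"
    "k >= 1" "nonneg_on psi (D_q g k)" by blast
   have "z \<in> D_q g k" using z psi(4) by (auto simp: D_qa_def)
   then have "psi z \<in> Rnn" using psi(5) by (simp add: nonneg_on_def)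
   then show "p' \<in> {p. val z p \<in> Rnn}" using val[OF psi(1,2), of p' z] psi(3) by simp
  qed
  ultimately have "closure (C_q TYPE('u)) <= {p. val z p \<in> Rnn}" by (intro closure_minimal)
  then have "val z p \<in> Rnn" using pc by (auto simp: C_qa_def)
  then show "phi z \<in> Rnn" using val[OF lin u p, of z] by simp
 qed
next
 assume "nonneg_on phi (D_qa g)"
 from D_qa_nonneg_split[OF g lin u this] have cl: "cvec phi \<in> closure (cvec ` split_states)" .
 define \<Phi> where "\<Phi> v = (%a b x y. vec_nth v (a, b, x, y))" for v :: "('i, 'o) cvec"
 have \<Phi>: "\<Phi> (cvec psi) = (%a b x y. psi (vP a b x y))" for psi by (simp add: \<Phi>_def cvec_def)
 have "continuous_on (closure (cvec ` split_states)) \<Phi>" unfolding \<Phi>_def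
  by (intro continuous_on_coordinatewise_then_product continuous_intros)
 moreover have "\<Phi> ` (cvec ` split_states) <= closure (C_q TYPE('u))" using split_state_C_q[OF _ inf] closure_subset by (fastforce simp: \<Phi>)
 ultimately have "\<Phi> ` closure (cvec ` split_states) <= closure (C_q TYPE('u))" by (intro image_closure_subset closed_closure)
 then have "\<Phi> (cvec phi) \<in> closure (C_q TYPE('u))" using cl by blast
 moreover have "\<Phi> (cvec phi) = p" by (simp add: \<Phi> p fun_eq_iff)
 ultimately show "p \<in> C_qa TYPE('u)" by (simp add: C_qa_def)
qed

theorem theorem6p5:
  fixes g :: "nat \<Rightarrow> 'o::finite \<times> 'o \<times> 'i::finite \<times> 'i"
    and \<phi> :: "('i, 'o) vns \<Rightarrow> complex"
    and p :: "('i, 'o) corr"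
  assumes "infinite (UNIV :: 'u set)"
    and "generator_enum g"
    and "Vector_Spaces.linear vscale (*) \<phi>"
    and "\<phi> vunit = 1"
    and "\<And>a b x y. p a b x y = \<phi> (vP a b x y)"
  shows "(p \<in> C_q TYPE('u) \<longleftrightarrow> (\<exists>k\<ge>1. nonneg_on \<phi> (D_q g k))) \<and>
         (p \<in> C_qa TYPE('u) \<longleftrightarrow> nonneg_on \<phi> (D_qa g)) \<and>
         (p \<in> C_qc TYPE('u) \<longleftrightarrow> nonneg_on \<phi> (D_qc g)) \<and>
         (p \<in> C_ns \<longleftrightarrow> nonneg_on \<phi> D_ns)"
proof -
 interpret L: Vector_Spaces.linear vscale "(*)" \<phi> by (rule assms(3))
 have lin: "clin \<phi>" unfolding clin_def using L.add L.scale by blast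
 show ?thesis
  using C_q_iff[OF assms(1,2) lin assms(4,5)] C_qa_iff[OF assms(1,2) lin assms(4,5)]
   C_qc_iff[OF assms(1,2) lin assms(4,5)] C_ns_iff[OF lin assms(4,5)] by blast
qed

end
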